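(* Let $d,n\ge 1$ be integers, $v\in\mathbb{R}^n$, and let $f\in \mathrm{Hyp}_n^d(v)$, i.e., $f\in\mathbb{R}[Z_1,\ldots,Z_n]$ is a homogeneous polynomial of degree $d$ which is Gårding hyperbolic with respect to $v$. Let $x \in DC(\mathbb{R}, \mathbb{R}^n) \cap W^{2,1}_{\mathrm{loc}}(\mathbb{R}, \mathbb{R}^n)$ (this is, for instance, fulfilled if $x \in C^{1,1}(\mathbb{R},\mathbb{R}^n)$). \begin{enumerate} \item[(1)] Any differentiable system $\lambda = (\lambda_1,\ldots,\lambda_d)$ of the roots of $f$ along $x$ is actually of class \[ \lambda \in C^1(\mathbb{R},\mathbb{R}^d) \cap DC(\mathbb{R},\mathbb{R}^d)\cap W^{2,1}_{\mathrm{loc}}(\mathbb{R},\mathbb{R}^d). \] \item[(2)] If $x : \mathbb{R} \to \mathbb{R}^n$ is of class $C^1$, then there exists a differentiable (thus $C^1$) system $\lambda = (\lambda_1,\ldots,\lambda_d)$ of the roots of $f$ along $x$. \item[(3)] The result is uniform in the following sense. Let $I \subseteq \mathbb{R}$ be a bounded open interval, let $k\ge 1$ be an integer, and let $U$ be an open neighborhood of the closure of $I^{1+k}$ in $\mathbb{R}^{1+k}$. Suppose that $x : U \to \mathbb{R}^n$ (now a map on $U$, replacing the curve above) is such that \begin{itemize} \item $x$ is locally $DC$ on $U$, \item $x( \cdot,r) \in C^1(\overline I,\mathbb{R}^n) \cap W^{2,1}(I,\mathbb{R}^n)$ for all $r \in \overline I^k$. \end{itemize} Assume that, for each $r \in \overline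 I^k$, a $C^1$-system $\lambda(\cdot,r)$ of the roots of $f$ along $x(\cdot,r)$ is fixed. Then the family $\lambda(\cdot,r)$, $r \in \overline I^k$, is bounded in $C^1(\overline I, \mathbb{R}^d)$, and there is a non-negative $L^1$-function $m : I^k \to \mathbb{R}_{\ge 0}$ such that \[ \|\lambda(\cdot, r)\|_{W^{2,1}(I,\mathbb{R}^d)} \le m(r) \quad \text{for a.e. } r \in I^k. \] \end{enumerate}
   Context: A homogeneous polynomial $f\in\mathbb{R}[Z_1,\ldots,Z_n]$ of degree $d$ is Gårding hyperbolic with respect to $v\in\mathbb{R}^n$ if $f(v)\neq 0$ and for every $x\in\mathbb{R}^n$ the univariate polynomial $f(x-Tv)\in\mathbb{R}[T]$ has only real roots. $\mathrm{Hyp}_n^d(v)$ is the set of all such $f$. For such $f$ and $x\in\mathbb{R}^n$ let $\lambda_1^\downarrow(x)\ge\cdots\ge\lambda_d^\downarrow(x)$ be the roots of $f(x-Tv)$ in decreasing order, with multiplicity, so that $f(x+Tv)=f(v)\prod_{j=1}^d(T+\lambda_j^\downarrow(x))$; the map $\lambda^\downarrow=(\lambda_1^\downarrow,\ldots,\lambda_d^\downarrow):\mathbb{R}^n\to\mathbb{R}^d$ is the characteristic map of $f$ with respect to $v$. Given a curve $x$ from an interval $J\subseteq\mathbb{R}$ (e.g. $J=\mathbb{R}$ or $J=\overline I$) to $\mathbb{R}^n$, a mapping $\lambda=(\lambda_1,\ldots,\lambda_d):J\to\mathbb{R}^d$ is called a system of the roots of $f$ along $x$ if $\lambda(t)$ and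 $\lambda^\downarrow(x(t))$ coincide as unordered $d$-tuples for all $t\in J$. It is a differentiable (resp. $C^1$-) system if $\lambda$ is differentiable (resp. $C^1$). A real function on a convex set is difference-convex ($DC$) if it is the difference of two continuous convex functions on that set; a function is locally $DC$ if every point of its domain has a convex neighborhood on which it is $DC$. A vector-valued map is (locally) $DC$ if each component is; $DC(\mathbb{R},\mathbb{R}^n)$ is the set of $DC$ maps $\mathbb{R}\to\mathbb{R}^n$. $W^{2,1}$ denotes the Sobolev space of integrable functions with integrable weak derivatives up to order $2$, and $W^{2,1}_{\mathrm{loc}}$ its local version. $C^{1,1}$ denotes $C^1$-functions whose first order derivatives are locally Lipschitz. *)

theory Defs
  imports
    "HOL-Analysis.Analysis"
    "HOL-Computational_Algebra.Fundamental_Theorem_Algebra"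
    "HOL-Library.Poly_Mapping"
begin

section \<open>Hyperbolic polynomials and their characteristic roots\<close>

text \<open>
  The polynomial ring over the reals in the variables \<open>Z\<^sub>i\<close>, for \<open>i\<close> in the finite type \<open>'n\<close>:
  a polynomial is a finitely supported function from monomials (exponent vectors) to coefficients.
\<close>

type_synonym 'n rpoly = "('n \<Rightarrow>\<^sub>0 nat) \<Rightarrow>\<^sub>0 real"

text \<open>
  Substitution of \<open>z i\<close> for \<open>Z\<^sub>i\<close>, where \<open>h\<close> embeds the coefficients into the target ring.
\<close>

definition rpoly_subst ::
  "(real \<Rightarrow> 'a::comm_semiring_1) \<Rightarrow> 'n::finite rpoly \<Rightarrow> ('n \<Rightarrow> 'a) \<Rightarrow> 'a" where
  "rpoly_subst h f z =
     (\<Sum>m\<in>Poly_Mapping.keys f. h (Poly_Mapping.lookup f m) *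
        (\<Prod>i\<in>UNIV. z i ^ Poly_Mapping.lookup m i))"

definition rpoly_eval :: "'n::finite rpoly \<Rightarrow> real ^ 'n \<Rightarrow> real" where
  "rpoly_eval f x = rpoly_subst (\<lambda>c. c) f (\<lambda>i. x $ i)"

text \<open>The univariate polynomial \<open>f (x - T v)\<close> in the variable \<open>T\<close>.\<close>

definition rpoly_line :: "'n::finite rpoly \<Rightarrow> real ^ 'n \<Rightarrow> real ^ 'n \<Rightarrow> real poly" where
  "rpoly_line f v x = rpoly_subst (\<lambda>c. [:c:]) f (\<lambda>i. [:x $ i, - (v $ i):])"

definition homogeneous :: "nat \<Rightarrow> 'n::finite rpoly \<Rightarrow> bool" where
  "homogeneous d f \<longleftrightarrow>
     (\<forall>m\<in>Poly_Mapping.keys f. (\<Sum>i\<in>UNIV. Poly_Mapping.lookup m i) = d)"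

definition real_rooted :: "real poly \<Rightarrow> bool" where
  "real_rooted p \<longleftrightarrow> (\<forall>z::complex. poly (map_poly complex_of_real p) z = 0 \<longrightarrow> z \<in> \<real>)"

definition Hyp :: "nat \<Rightarrow> real ^ 'n \<Rightarrow> 'n::finite rpoly set" where
  "Hyp d v = {f. homogeneous d f \<and> rpoly_eval f v \<noteq> 0 \<and> (\<forall>x. real_rooted (rpoly_line f v x))}"

text \<open>
  The characteristic map: the list of the roots of \<open>f (x - T v)\<close>, with multiplicity, in decreasing
  order.  For \<open>f \<in> Hyp d v\<close> it has length \<open>d\<close>; see \<open>char_map_factorization\<close> below.
\<close>

definition char_map :: "'n::finite rpoly \<Rightarrow> real ^ 'n \<Rightarrow> real ^ 'n \<Rightarrow> real list" where
  "char_map f v x = rev (sorted_list_of_multiset (proots (rpoly_line f v x)))"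

lemma poly_rpoly_line: "poly (rpoly_line f v x) t = rpoly_eval f (x - t *\<^sub>R v)"
  by (simp add: rpoly_line_def rpoly_eval_def rpoly_subst_def poly_sum poly_prod algebra_simps)

lemma coeff_prod_linear_power:
  fixes a b :: "'i \<Rightarrow> real" and m :: "'i \<Rightarrow> nat"
  assumes "finite A"
  shows "degree (\<Prod>i\<in>A. [:a i, b i:] ^ m i) \<le> sum m A \<and>
         coeff (\<Prod>i\<in>A. [:a i, b i:] ^ m i) (sum m A) = (\<Prod>i\<in>A. b i ^ m i)"
  using assms
proof (induction A)
  case (insert i A)
  have *: "degree ([:a i, b i:] ^ k) \<le> k \<and> coeff ([:a i, b i:] ^ k) k = b i ^ k" for k
  proof (induction k)
    case (Suc k)
    have "degree ([:a i, b i:] * [:a i, b i:] ^ k) \<le> 1 + k"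
      using Suc by (intro order.trans[OF degree_mult_le] add_mono) auto
    moreover have "coeff ([:a i, b i:] * [:a i, b i:] ^ k) (1 + k) = b i * b i ^ k"
      using Suc by (simp add: coeff_eq_0)
    ultimately show ?case by simp
  qed simp
  let ?p = "[:a i, b i:] ^ m i" and ?q = "\<Prod>i\<in>A. [:a i, b i:] ^ m i"
  have "degree (?p * ?q) \<le> m i + sum m A"
    using insert * by (intro order.trans[OF degree_mult_le] add_mono) auto
  moreover have "coeff (?p * ?q) (m i + sum m A) = coeff ?p (m i) * coeff ?q (sum m A)"
  proof -
    have "(\<Sum>k\<le>m i + sum m A. coeff ?p k * coeff ?q (m i + sum m A - k)) =
          (\<Sum>k\<in>{m i}. coeff ?p k * coeff ?q (m i + sum m A - k))"
    proof (intro sum.mono_neutral_right ballI)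
      fix k assume "k \<in> {..m i + sum m A} - {m i}"
      then consider "k > m i" | "m i + sum m A - k > sum m A" by atomize_elim auto
      then show "coeff ?p k * coeff ?q (m i + sum m A - k) = 0"
      proof cases
        case 1
        then have "coeff ?p k = 0" using *[of "m i"] by (intro coeff_eq_0) linarith
        then show ?thesis by simp
      next
        case 2
        then have "coeff ?q (m i + sum m A - k) = 0" using insert.IH by (intro coeff_eq_0) linarith
        then show ?thesis by simp
      qed
    qed auto
    then show ?thesis by (simp add: coeff_mult)
  qed
  ultimately show ?case
    using insert.IH *[of "m i"] by (simp only: sum.insert[OF insert.hyps] prod.insert[OF insert.hyps])
qed simp

lemma rpoly_line_degree:
  assumes "homogeneous d f"
  shows "degree (rpoly_line f v x) \<le> d" "coeff (rpoly_line f v x) d = (- 1) ^ d * rpoly_eval f v"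
proof -
  let ?q = "\<lambda>m. \<Prod>i\<in>UNIV. [:x $ i, - (v $ i):] ^ Poly_Mapping.lookup m i"
  have q: "degree (?q m) \<le> d"
    "coeff (?q m) d = (- 1) ^ d * (\<Prod>i\<in>UNIV. (v $ i) ^ Poly_Mapping.lookup m i)"
    if "m \<in> Poly_Mapping.keys f" for m
  proof -
    have d: "sum (Poly_Mapping.lookup m) UNIV = d"
      using assms that by (auto simp: homogeneous_def)
    note * = coeff_prod_linear_power[where a = "\<lambda>i. x $ i" and b = "\<lambda>i. - (v $ i)"
        and m = "Poly_Mapping.lookup m", OF finite_class.finite_UNIV, unfolded d]
    show "degree (?q m) \<le> d" using * by blast
    have "(\<Prod>i\<in>UNIV. (- (v $ i)) ^ Poly_Mapping.lookup m i) =
          (\<Prod>i\<in>UNIV. (- 1) ^ Poly_Mapping.lookup m i * (v $ i) ^ Poly_Mapping.lookup m i)"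
      by (intro prod.cong refl) (metis power_minus)
    then show "coeff (?q m) d = (- 1) ^ d * (\<Prod>i\<in>UNIV. (v $ i) ^ Poly_Mapping.lookup m i)"
      using * by (simp add: prod.distrib power_sum[symmetric] d)
  qed
  show "degree (rpoly_line f v x) \<le> d"
    unfolding rpoly_line_def rpoly_subst_def using q(1)
    by (intro degree_sum_le) (auto intro: order.trans[OF degree_smult_le])
  show "coeff (rpoly_line f v x) d = (- 1) ^ d * rpoly_eval f v"
    unfolding rpoly_line_def rpoly_eval_def rpoly_subst_def
    by (simp add: coeff_sum q(2) sum_distrib_left mult_ac)
qed

lemma map_poly_of_real_mult:
  "map_poly complex_of_real (p * q) = map_poly complex_of_real p * map_poly complex_of_real q"
  by (intro poly_eqI) (simp add: coeff_map_poly coeff_mult)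

lemma poly_map_poly_of_real:
  "poly (map_poly complex_of_real p) (complex_of_real r) = complex_of_real (poly p r)"
  by (induction p) (simp_all add: map_poly_pCons)

lemma degree_prod_mset_linear: "degree (\<Prod>r\<in>#A. [:- r, 1 :: real:]) = size A"
proof (induction A)
  case (add x A)
  have "(\<Prod>r\<in>#A. [:- r, 1:]) \<noteq> 0" by (auto simp: prod_mset_zero_iff)
  then show ?case using add by (simp add: degree_mult_eq del: mult_pCons_left)
qed simp

lemma prod_list_prod_nth_map: "prod_list (map g xs) = (\<Prod>j<length xs. g (xs ! j))"
  by (induction xs) (simp_all add: prod.lessThan_Suc_shift del: prod.lessThan_Suc)

lemma real_rooted_decompose:
  assumes "real_rooted p" "p \<noteq> 0"
  shows "p = smult (lead_coeff p) (\<Prod>r\<in>#proots p. [:- r, 1:])"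
  using assms
proof (induction "degree p" arbitrary: p)
  case 0
  then show ?case by (auto elim!: degree_eq_zeroE)
next
  case (Suc n)
  have "\<not> constant (poly (map_poly complex_of_real p))"
    using Suc.hyps(2) by (subst constant_degree) (simp add: degree_map_poly)
  then obtain z where z: "poly (map_poly complex_of_real p) z = 0"
    using fundamental_theorem_of_algebra by blast
  with Suc.prems obtain r where r: "z = complex_of_real r"
    by (auto simp: real_rooted_def elim: Reals_cases)
  with z have "poly p r = 0" by (simp add: poly_map_poly_of_real)
  then obtain q where q: "p = [:- r, 1:] * q" by (auto simp: poly_eq_0_iff_dvd)
  have "q \<noteq> 0" using q Suc.prems by auto
  have "real_rooted q"
    unfolding real_rooted_def
  proof (intro allI impI)
    fix z assume "poly (map_poly complex_of_real q) z = 0"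
    then have "poly (map_poly complex_of_real p) z = 0"
      unfolding q map_poly_of_real_mult by simp
    then show "z \<in> \<real>" using Suc.prems by (auto simp: real_rooted_def)
  qed
  moreover have "degree p = Suc (degree q)"
    unfolding q using \<open>q \<noteq> 0\<close> by (subst degree_mult_eq) auto
  ultimately have "q = smult (lead_coeff q) (\<Prod>r\<in>#proots q. [:- r, 1:])" (is "_ = smult _ ?P")
    using Suc \<open>q \<noteq> 0\<close> by auto
  then have "p = [:- r, 1:] * smult (lead_coeff q) ?P" using q by metis
  also have "\<dots> = smult (lead_coeff q) ([:- r, 1:] * ?P)" by (rule mult_smult_right)
  also have "lead_coeff q = lead_coeff p" unfolding q by (subst lead_coeff_mult) simp
  also have "[:- r, 1:] * ?P = (\<Prod>r\<in>#proots p. [:- r, 1:])"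
    unfolding q using \<open>q \<noteq> 0\<close> by (subst proots_mult) (auto simp del: mult_pCons_left)
  finally show ?case .
qed

lemma char_map_factorization:
  assumes "f \<in> Hyp d v"
  shows "length (char_map f v x) = d"
    and "sorted_wrt (\<ge>) (char_map f v x)"
    and "rpoly_eval f (x + t *\<^sub>R v) = rpoly_eval f v * (\<Prod>j<d. t + char_map f v x ! j)"
proof -
  let ?p = "rpoly_line f v x"
  have f: "homogeneous d f" "rpoly_eval f v \<noteq> 0" "real_rooted ?p"
    using assms by (auto simp: Hyp_def)
  have c: "coeff ?p d \<noteq> 0" using rpoly_line_degree(2)[OF f(1)] f(2) by simp
  then have deg: "degree ?p = d"
    using rpoly_line_degree(1)[OF f(1), of v x] le_degree[OF c] by simp
  have "?p \<noteq> 0" using c by auto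
  then have dec: "?p = smult (lead_coeff ?p) (\<Prod>r\<in>#proots ?p. [:- r, 1:])"
    using real_rooted_decompose f(3) by blast
  have "degree ?p = degree (\<Prod>r\<in>#proots ?p. [:- r, 1:])"
    using \<open>?p \<noteq> 0\<close> by (subst dec) simp
  also have "\<dots> = size (proots ?p)"
    by (rule degree_prod_mset_linear)
  finally have size: "size (proots ?p) = d" using deg by simp
  have mset: "mset (char_map f v x) = proots ?p" by (simp add: char_map_def)
  then show len: "length (char_map f v x) = d" using size by (metis size_mset)
  show "sorted_wrt (\<ge>) (char_map f v x)" by (simp add: char_map_def sorted_wrt_rev)
  have "rpoly_eval f (x + t *\<^sub>R v) = poly ?p (- t)" by (simp add: poly_rpoly_line)
  also have "\<dots> = (- 1) ^ d * rpoly_eval f v * (\<Prod>r\<in>#proots ?p. - (t + r))"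
  proof -
    have *: "(\<lambda>r. poly [:- r, 1:] (- t)) = (\<lambda>r. - (t + r))" by auto
    show ?thesis
      by (subst dec) (simp only: poly_smult poly_prod_mset * deg rpoly_line_degree(2)[OF f(1)])
  qed
  also have "(\<Prod>r\<in>#proots ?p. - (t + r)) = (\<Prod>j<d. - (t + char_map f v x ! j))"
    unfolding mset[symmetric] len[symmetric] mset_map[symmetric] prod_mset_prod_list
    by (simp add: prod_list_prod_nth_map)
  also have "\<dots> = (- 1) ^ d * (\<Prod>j<d. t + char_map f v x ! j)"
    by (subst prod_uminus) simp
  finally show "rpoly_eval f (x + t *\<^sub>R v) = rpoly_eval f v * (\<Prod>j<d. t + char_map f v x ! j)"
    by (simp add: power_mult_distrib[symmetric])
qed

text \<open>Equality of unordered tuples is equality of multisets of entries.\<close>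

definition root_system ::
  "'n::finite rpoly \<Rightarrow> real ^ 'n \<Rightarrow> real set \<Rightarrow> (real \<Rightarrow> real ^ 'n) \<Rightarrow> (real \<Rightarrow> real ^ 'd::finite) \<Rightarrow> bool"
  where
  "root_system f v J x lam \<longleftrightarrow>
     (\<forall>t\<in>J. image_mset (\<lambda>j. lam t $ j) (mset_set UNIV) = mset (char_map f v (x t)))"


section \<open>Difference-convex functions\<close>

text \<open>\<^const>\<open>convex_on\<close> includes convexity of the domain.\<close>

definition dc_on :: "'a::real_normed_vector set \<Rightarrow> ('a \<Rightarrow> real) \<Rightarrow> bool" where
  "dc_on S h \<longleftrightarrow>
     (\<exists>p q. convex_on S p \<and> continuous_on S p \<and> convex_on S q \<and> continuous_on S q \<and>
            (\<forall>z\<in>S. h z = p z - q z))"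

text \<open>\<open>N\<close> is a convex neighborhood of \<open>a\<close> in \<open>S\<close>.\<close>

definition locally_dc_on :: "'a::real_normed_vector set \<Rightarrow> ('a \<Rightarrow> real) \<Rightarrow> bool" where
  "locally_dc_on S h \<longleftrightarrow>
     (\<forall>a\<in>S. \<exists>W N. open W \<and> a \<in> W \<and> W \<inter> S \<subseteq> N \<and> N \<subseteq> S \<and> convex N \<and> dc_on N h)"

definition DC_on :: "'a::real_normed_vector set \<Rightarrow> ('a \<Rightarrow> real ^ 'm::finite) \<Rightarrow> bool" where
  "DC_on S g \<longleftrightarrow> (\<forall>i. dc_on S (\<lambda>z. g z $ i))"

definition locally_DC_on :: "'a::real_normed_vector set \<Rightarrow> ('a \<Rightarrow> real ^ 'm::finite) \<Rightarrow> bool" where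
  "locally_DC_on S g \<longleftrightarrow> (\<forall>i. locally_dc_on S (\<lambda>z. g z $ i))"


section \<open>Classes of differentiable functions\<close>

text \<open>
  In contrast to \<^const>\<open>C1_differentiable_on\<close>, derivatives are taken within \<open>S\<close>, so that they
  are one-sided at the end points of a closed interval.
\<close>

definition C1_on :: "real set \<Rightarrow> (real \<Rightarrow> 'b::real_normed_vector) \<Rightarrow> bool" where
  "C1_on S g \<longleftrightarrow>
     (\<exists>g'. (\<forall>t\<in>S. (g has_vector_derivative g' t) (at t within S)) \<and> continuous_on S g')"

lemma C1_on_open: "open S \<Longrightarrow> C1_on S g \<longleftrightarrow> g C1_differentiable_on S"
  unfolding C1_on_def C1_differentiable_on_def by (metis at_within_open)

text \<open>For \<open>C\<^sup>1\<close>-functions on a nondegenerate compact interval the suprema are finite.\<close>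

definition C1_norm :: "real set \<Rightarrow> (real \<Rightarrow> 'b::real_normed_vector) \<Rightarrow> real" where
  "C1_norm S g = (SUP t\<in>S. norm (g t)) + (SUP t\<in>S. norm (vector_derivative g (at t within S)))"

definition C11 :: "(real \<Rightarrow> 'b::real_normed_vector) \<Rightarrow> bool" where
  "C11 g \<longleftrightarrow> C1_on UNIV g \<and>
     (\<forall>t. \<exists>e>0. \<exists>L. L-lipschitz_on (ball t e) (\<lambda>s. vector_derivative g (at s)))"


section \<open>Sobolev spaces on open subsets of the line\<close>

definition smooth :: "(real \<Rightarrow> real) \<Rightarrow> bool" where
  "smooth \<phi> \<longleftrightarrow> (\<forall>k t. (deriv ^^ k) \<phi> field_differentiable at t)"

definition test_functions :: "real set \<Rightarrow> (real \<Rightarrow> real) set" where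
  "test_functions \<Omega> =
     {\<phi>. smooth \<phi> \<and> compact (closure {t. \<phi> t \<noteq> 0}) \<and> closure {t. \<phi> t \<noteq> 0} \<subseteq> \<Omega>}"

definition locally_integrable_on :: "real set \<Rightarrow> (real \<Rightarrow> 'b::euclidean_space) \<Rightarrow> bool" where
  "locally_integrable_on \<Omega> u \<longleftrightarrow> (\<forall>K. compact K \<and> K \<subseteq> \<Omega> \<longrightarrow> u absolutely_integrable_on K)"

definition has_weak_deriv ::
  "nat \<Rightarrow> real set \<Rightarrow> (real \<Rightarrow> 'b::euclidean_space) \<Rightarrow> (real \<Rightarrow> 'b) \<Rightarrow> bool" where
  "has_weak_deriv k \<Omega> u g \<longleftrightarrow>
     locally_integrable_on \<Omega> u \<and> locally_integrable_on \<Omega> g \<and>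
     (\<forall>\<phi>\<in>test_functions \<Omega>.
        (LINT t:\<Omega>|lebesgue. (deriv ^^ k) \<phi> t *\<^sub>R u t) =
        (- 1) ^ k *\<^sub>R (LINT t:\<Omega>|lebesgue. \<phi> t *\<^sub>R g t))"

definition W21 :: "real set \<Rightarrow> (real \<Rightarrow> 'b::euclidean_space) \<Rightarrow> bool" where
  "W21 \<Omega> u \<longleftrightarrow> u absolutely_integrable_on \<Omega> \<and>
     (\<forall>k\<in>{1, 2}. \<exists>g. has_weak_deriv k \<Omega> u g \<and> g absolutely_integrable_on \<Omega>)"

definition W21_loc :: "real set \<Rightarrow> (real \<Rightarrow> 'b::euclidean_space) \<Rightarrow> bool" where
  "W21_loc \<Omega> u \<longleftrightarrow>
     (\<forall>V. open V \<and> compact (closure V) \<and> closure V \<subseteq> \<Omega> \<longrightarrow> W21 V u)"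

text \<open>
  Weak derivatives are unique up to null sets, so that the norm does not depend on the choice.
  It is meaningful only for \<open>u\<close> satisfying \<^term>\<open>W21 \<Omega>\<close>.
\<close>

definition weak_deriv ::
  "nat \<Rightarrow> real set \<Rightarrow> (real \<Rightarrow> 'b::euclidean_space) \<Rightarrow> (real \<Rightarrow> 'b)" where
  "weak_deriv k \<Omega> u = (SOME g. has_weak_deriv k \<Omega> u g)"

definition W21_norm :: "real set \<Rightarrow> (real \<Rightarrow> 'b::euclidean_space) \<Rightarrow> real" where
  "W21_norm \<Omega> u =
     (LINT t:\<Omega>|lebesgue. norm (u t)) +
     (LINT t:\<Omega>|lebesgue. norm (weak_deriv 1 \<Omega> u t)) +
     (LINT t:\<Omega>|lebesgue. norm (weak_deriv 2 \<Omega> u t))"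


section \<open>Powers of an interval\<close>

definition cube :: "real set \<Rightarrow> (real ^ 'k::finite) set" where
  "cube S = {r. \<forall>i. r $ i \<in> S}"

end

theory Submission
  imports Defs
begin

text \<open>
  The sum of the \<open>k\<close> smallest roots is superadditive, because the product of all \<open>k\<close>-fold sums of
  roots is again a hyperbolic polynomial, so its hyperbolicity cone is convex.  Hence the sorted
  roots along a difference-convex curve are differences of convex functions \<open>P\<^sub>k\<close>, and the
  derivative of a differentiable selection takes values in the finite set of their one-sided
  derivatives.  By Darboux's theorem it oscillates no more than the slopes of the \<open>P\<^sub>k\<close>, so it is
  continuous and of bounded variation.  Differentiating the polynomial along a root shows that the
  derivative of the root maps null sets to null sets if the curve is \<open>W\<^sup>2\<^sup>,\<^sup>1\<close>; together with bounded
  variation this gives absolute continuity, with an \<open>L\<^sup>1\<close> bound depending only on the slopes of the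
  \<open>P\<^sub>k\<close>.  In particular the bound \<open>m\<close> of the uniform statement can be taken constant.

  For existence, at a point where the curve is differentiable the left and right derivatives of the
  roots agree up to relabelling, so a kink at a single point can be removed.  The kinks sit at
  the jumps of one monotone function, and the relabelled systems have a limit by compactness.
\<close>

section \<open>Symmetric functions of roots\<close>

text \<open>The times at which roots coincide can form a set as irregular as a Cantor set, so a root
  cannot be followed through local factorizations. The sorted roots avoid this: a superadditive,
  positively homogeneous function is concave and Lipschitz, and subtracting it from a large multiple
  of \<open>\<Sum>i. p i + q i\<close>, where \<open>p i - q i\<close> are the components of the
  curve, leaves a convex function of time. A differentiable selection then has finitely many
  possible derivatives at each time. Bounded variation of the derivative does not give a second
  derivative in L^1, as the Cantor function shows; the Sobolev hypothesis supplies the missing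
  condition on null sets, as in the Banach-Zarecki theorem. For existence the obstacle is that kinks
  of the sorted roots may be dense, so they cannot be repaired from left to right. They are repaired
  in arbitrary order: relabelling keeps the multiset of pairs of root and slope, which leaves
  finitely many values at each time, and it only lowers the increments of the dominating function,
  so earlier repairs survive later ones.\<close>

definition esym :: "'i set \<Rightarrow> ('i \<Rightarrow> 'b::comm_ring_1) \<Rightarrow> nat \<Rightarrow> 'b" where
  "esym I X k = (\<Sum>S | S \<subseteq> I \<and> card S = k. \<Prod>i\<in>S. X i)"

lemma esym_0 [simp]: "finite I \<Longrightarrow> esym I X 0 = 1"
proof -
  assume "finite I"
  then have "{S. S \<subseteq> I \<and> card S = 0} = {{}}" by (auto dest: finite_subset)
  then show ?thesis by (simp add: esym_def)
qed

lemma esym_insert_Suc: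
  assumes "finite I" "i \<notin> I"
  shows "esym (insert i I) X (Suc k) = esym I X (Suc k) + X i * esym I X k"
proof -
  let ?A = "{S. S \<subseteq> I \<and> card S = Suc k}" and ?B = "{S. S \<subseteq> I \<and> card S = k}"
  have eq: "{S. S \<subseteq> insert i I \<and> card S = Suc k} = ?A \<union> insert i ` ?B" (is "?L = _")
  proof (intro equalityI subsetI)
    fix S assume S: "S \<in> ?L"
    show "S \<in> ?A \<union> insert i ` ?B"
    proof (cases "i \<in> S")
      case True
      with S assms have "S = insert i (S - {i})" "S - {i} \<subseteq> I" "card (S - {i}) = k"
        by (auto simp: card_Diff_singleton)
      then show ?thesis by blast
    qed (use S in auto)
  next
    fix S assume "S \<in> ?A \<union> insert i ` ?B"
    moreover have "finite T" if "T \<subseteq> I" for T using assms(1) that by (rule rev_finite_subset)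
    ultimately show "S \<in> ?L"
      using assms by (auto simp: card_insert_if)
  qed
  have fin: "finite ?A" "finite ?B" using assms by auto
  have "esym (insert i I) X (Suc k) = (\<Sum>S\<in>?A. \<Prod>i\<in>S. X i) + (\<Sum>S\<in>insert i ` ?B. \<Prod>i\<in>S. X i)"
    unfolding esym_def eq using fin assms by (intro sum.union_disjoint) auto
  also have "(\<Sum>S\<in>insert i ` ?B. \<Prod>i\<in>S. X i) = (\<Sum>S\<in>?B. X i * (\<Prod>i\<in>S. X i))"
  proof (subst sum.reindex)
    show "inj_on (insert i) ?B" using assms(2) by (auto simp: inj_on_def)
    show "sum ((\<lambda>S. \<Prod>i\<in>S. X i) \<circ> insert i) ?B = (\<Sum>S\<in>?B. X i * (\<Prod>i\<in>S. X i))"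
    proof (intro sum.cong refl)
      fix S assume "S \<in> ?B"
      then have "finite S" "i \<notin> S" using assms by (auto intro: rev_finite_subset)
      then show "((\<lambda>S. \<Prod>i\<in>S. X i) \<circ> insert i) S = X i * (\<Prod>i\<in>S. X i)" by simp
    qed
  qed
  finally show ?thesis by (simp add: esym_def sum_distrib_left)
qed

lemma esym_eq_0:
  assumes "finite I" "card I < k"
  shows "esym I X k = 0"
proof -
  have "{S. S \<subseteq> I \<and> card S = k} = {}"
    using assms card_mono leD by blast
  then show ?thesis unfolding esym_def by (metis sum.empty)
qed

text \<open>Vieta's formulas: taking \<open>X i\<close> from \<open>k\<close> factors and the
  variable from the others leaves the power \<open>card I - k\<close>. No signs appear because the
  factors are \<open>X i + T\<close>.\<close>

lemma coeff_prod_linear_esym: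
  assumes "finite I" "k \<le> card I"
  shows "coeff (\<Prod>i\<in>I. [:X i, 1:]) (card I - k) = esym I X k"
  using assms
proof (induction arbitrary: k)
  case empty
  then show ?case by simp
next
  case (insert i I)
  let ?P = "\<Prod>i\<in>I. [:X i, 1:]"
  have deg: "degree ?P \<le> card I"
    using degree_prod_sum_le[OF insert.hyps(1), of "\<lambda>i. [:X i, 1:]"] by simp
  have prod: "(\<Prod>i\<in>insert i I. [:X i, 1:]) = [:X i, 1:] * ?P"
    using insert.hyps by (rule prod.insert)
  have coeff: "coeff ([:X i, 1:] * ?P) (Suc n) = X i * coeff ?P (Suc n) + coeff ?P n" for n
    by simp
  have card: "card (insert i I) = Suc (card I)" using insert.hyps by simp
  show ?case
  proof (cases k)
    case 0
    have "coeff ?P (Suc (card I)) = 0" using deg by (intro coeff_eq_0) simp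
    moreover have "coeff ?P (card I) = 1" using insert.IH[of 0] insert.hyps(1) by simp
    ultimately show ?thesis
      unfolding prod card 0 diff_zero coeff using insert.hyps(1) by simp
  next
    case (Suc l)
    show ?thesis
    proof (cases "l = card I")
      case True
      have "coeff ?P 0 = esym I X l" using insert.IH[of l] True by simp
      moreover have "esym I X (Suc l) = 0" using True insert.hyps(1) by (intro esym_eq_0) auto
      moreover have "coeff ([:X i, 1:] * ?P) 0 = X i * coeff ?P 0" by simp
      ultimately show ?thesis
        unfolding prod card Suc True esym_insert_Suc[OF insert.hyps] by simp
    next
      case False
      then have le: "Suc l \<le> card I" using insert.prems insert.hyps Suc by simp
      then have m: "Suc (card I) - Suc l = Suc (card I - Suc l)" "Suc (card I - Suc l) = card I - l"
        by auto
      have "coeff ?P (Suc (card I - Suc l)) = esym I X l"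
        unfolding m using le by (intro insert.IH) simp
      moreover have "coeff ?P (card I - Suc l) = esym I X (Suc l)"
        using le by (rule insert.IH)
      ultimately show ?thesis
        unfolding prod card Suc m(1) coeff esym_insert_Suc[OF insert.hyps] by simp
    qed
  qed
qed

text \<open>Adding an element with value \<open>c\<close> multiplies the product of the
  \<open>1 - X i T\<close> by \<open>1 - c T\<close>, so the signed coefficient \<open>e j\<close>
  turns into \<open>e j - c * e (j - 1)\<close>. In the convolution with the new power sums all
  powers of \<open>c\<close> cancel except \<open>c * e k\<close>, and the induction hypothesis for
  \<open>k\<close> and for \<open>k - 1\<close> evaluates the rest.\<close>

lemma newton_identity:
  fixes X :: "'i \<Rightarrow> 'b::comm_ring_1"
  assumes "finite I"
  shows "of_nat (Suc k) * ((-1) ^ Suc k * esym I X (Suc k)) =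
    - (\<Sum>j\<le>k. (-1) ^ j * esym I X j * (\<Sum>i\<in>I. X i ^ (Suc k - j)))"
  using assms
proof (induction arbitrary: k)
  case empty
  have *: "{S. S \<subseteq> {} \<and> card S = Suc k} = {}" by auto
  have "esym {} X (Suc k) = 0" unfolding esym_def * by simp
  then show ?case by simp
next
  case (insert x I)
  define e where "e j = (-1) ^ j * esym I X j" for j
  define p where "p m = (\<Sum>i\<in>I. X i ^ m)" for m
  define c where "c = X x"
  have e': "(-1) ^ j * esym (insert x I) X j = (if j = 0 then 1 else e j - c * e (j - 1))" for j
    using insert.hyps by (cases j) (simp_all add: e_def c_def esym_insert_Suc algebra_simps)
  have e0: "e 0 = 1" using insert.hyps by (simp add: e_def)
  have IH: "of_nat (Suc k) * e (Suc k) = - (\<Sum>j\<le>k. e j * p (Suc k - j))" for k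
    using insert.IH by (simp add: e_def p_def)
  have "(\<Sum>j\<le>k. (if j = 0 then 1 else e j - c * e (j - 1)) * (p (Suc k - j) + c ^ (Suc k - j))) =
        (\<Sum>j\<le>k. e j * p (Suc k - j)) + (\<Sum>j\<le>k. e j * c ^ (Suc k - j))
        - (\<Sum>j<k. c * e j * (p (k - j) + c ^ (k - j)))"
  proof -
    have "(\<Sum>j\<le>k. (if j = 0 then 1 else e j - c * e (j - 1)) * (p (Suc k - j) + c ^ (Suc k - j))) =
      (\<Sum>j\<le>k. e j * (p (Suc k - j) + c ^ (Suc k - j)) -
         (if j = 0 then 0 else c * e (j - 1) * (p (Suc k - j) + c ^ (Suc k - j))))"
      by (intro sum.cong refl) (auto simp: e0 algebra_simps)
    also have "\<dots> = (\<Sum>j\<le>k. e j * (p (Suc k - j) + c ^ (Suc k - j))) -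
       (\<Sum>j\<le>k. if j = 0 then 0 else c * e (j - 1) * (p (Suc k - j) + c ^ (Suc k - j)))"
      by (rule sum_subtractf)
    also have "(\<Sum>j\<le>k. if j = 0 then 0 else c * e (j - 1) * (p (Suc k - j) + c ^ (Suc k - j))) =
       (\<Sum>j<k. c * e j * (p (k - j) + c ^ (k - j)))"
      by (cases k) (simp_all add: sum.atMost_Suc_shift lessThan_Suc_atMost del: sum.atMost_Suc sum.lessThan_Suc)
    finally show ?thesis by (simp add: distrib_left sum.distrib)
  qed
  also have "(\<Sum>j<k. c * e j * (p (k - j) + c ^ (k - j))) =
     c * (\<Sum>j<k. e j * p (k - j)) + (\<Sum>j<k. e j * c ^ (Suc k - j))"
    by (simp add: distrib_left sum.distrib sum_distrib_left mult_ac Suc_diff_le)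
  also have "(\<Sum>j\<le>k. e j * c ^ (Suc k - j)) = (\<Sum>j<k. e j * c ^ (Suc k - j)) + e k * c"
    by (simp flip: lessThan_Suc_atMost)
  also have "(\<Sum>j<k. e j * p (k - j)) = - (of_nat k * e k)"
  proof (cases k)
    case (Suc l)
    then show ?thesis using IH[of l] by (simp flip: lessThan_Suc_atMost)
  qed simp
  also have "(\<Sum>j\<le>k. e j * p (Suc k - j)) = - (of_nat (Suc k) * e (Suc k))"
    using IH[of k] by simp
  finally have *: "(\<Sum>j\<le>k. (if j = 0 then 1 else e j - c * e (j - 1)) * (p (Suc k - j) + c ^ (Suc k - j)))
     = - (of_nat (Suc k) * (e (Suc k) - c * e k))"
    by (simp add: algebra_simps)
  have p': "(\<Sum>i\<in>insert x I. X i ^ m) = p m + c ^ m" for m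
    using insert.hyps by (simp add: p_def c_def add.commute)
  show ?case unfolding e' p' * by simp
qed

text \<open>
  Closure under division by positive integers is what Newton's identities need.
\<close>

definition function_ring :: "('a \<Rightarrow> 'b::comm_ring_1) set \<Rightarrow> bool" where
  "function_ring R \<longleftrightarrow> (\<lambda>_. 1) \<in> R \<and> (\<forall>f\<in>R. (\<lambda>a. - f a) \<in> R) \<and>
     (\<forall>f\<in>R. \<forall>g\<in>R. (\<lambda>a. f a + g a) \<in> R \<and> (\<lambda>a. f a * g a) \<in> R) \<and>
     (\<forall>n f. (\<lambda>a. of_nat (Suc n) * f a) \<in> R \<longrightarrow> f \<in> R)"

lemma function_ringD:
  assumes "function_ring R"
  shows "(\<lambda>_. 1) \<in> R" "(\<lambda>_. 0) \<in> R" "f \<in> R \<Longrightarrow> (\<lambda>a. - f a) \<in> R"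
    "f \<in> R \<Longrightarrow> g \<in> R \<Longrightarrow> (\<lambda>a. f a + g a) \<in> R"
    "f \<in> R \<Longrightarrow> g \<in> R \<Longrightarrow> (\<lambda>a. f a * g a) \<in> R"
    "(\<lambda>a. of_nat (Suc n) * f a) \<in> R \<Longrightarrow> f \<in> R"
    "f \<in> R \<Longrightarrow> (\<lambda>a. of_nat n * f a) \<in> R"
    "f \<in> R \<Longrightarrow> (\<lambda>a. (-1) ^ n * f a) \<in> R"
proof -
  note * = assms[unfolded function_ring_def]
  show 1: "(\<lambda>_. 1) \<in> R" using * by blast
  show neg: "(\<lambda>a. - f a) \<in> R" if "f \<in> R" for f using * that by blast
  show add: "(\<lambda>a. f a + g a) \<in> R" if "f \<in> R" "g \<in> R" for f g using * that by blast
  show "(\<lambda>a. f a * g a) \<in> R" if "f \<in> R" "g \<in> R" using * that by blast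
  show "(\<lambda>a. of_nat (Suc n) * f a) \<in> R \<Longrightarrow> f \<in> R" using * by blast
  show 0: "(\<lambda>_. 0) \<in> R" using add[OF 1 neg[OF 1]] by simp
  show "(\<lambda>a. of_nat n * f a) \<in> R" if "f \<in> R"
  proof (induction n)
    case (Suc n)
    then show ?case using add[OF that Suc] by (simp add: algebra_simps)
  qed (simp add: 0)
  show "(\<lambda>a. (-1) ^ n * f a) \<in> R" if "f \<in> R"
  proof (induction n)
    case (Suc n)
    then show ?case using neg[OF Suc] by simp
  qed (simp add: that)
qed

lemma function_ring_sum:
  assumes "function_ring R" "\<And>i. i \<in> A \<Longrightarrow> (\<lambda>a. f a i) \<in> R"
  shows "(\<lambda>a. \<Sum>i\<in>A. f a i) \<in> R"
  using assms(2)
proof (induction A rule: infinite_finite_induct)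
  case (insert x F)
  then have "(\<lambda>a. f a x + (\<Sum>i\<in>F. f a i)) \<in> R"
    by (intro function_ringD(4)[OF assms(1)]) simp_all
  with insert.hyps show ?case by simp
qed (simp_all add: function_ringD(1,2)[OF assms(1)])

lemma function_ring_prod:
  assumes "function_ring R" "\<And>i. i \<in> A \<Longrightarrow> (\<lambda>a. f a i) \<in> R"
  shows "(\<lambda>a. \<Prod>i\<in>A. f a i) \<in> R"
  using assms(2)
proof (induction A rule: infinite_finite_induct)
  case (insert x F)
  then have "(\<lambda>a. f a x * (\<Prod>i\<in>F. f a i)) \<in> R"
    by (intro function_ringD(5)[OF assms(1)]) simp_all
  with insert.hyps show ?case by simp
qed (simp_all add: function_ringD(1,2)[OF assms(1)])

lemma function_ring_power:
  assumes "function_ring R" "f \<in> R"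
  shows "(\<lambda>a. f a ^ n) \<in> R"
proof (induction n)
  case (Suc n)
  then have "(\<lambda>a. f a * f a ^ n) \<in> R" by (intro function_ringD(5)[OF assms(1)] assms(2))
  then show ?case by simp
qed (simp add: function_ringD(1)[OF assms(1)])

text \<open>The term \<open>j = 0\<close> of Newton's identity is the power sum of order
  \<open>Suc k\<close> itself, with coefficient 1; the other terms contain lower power sums.\<close>

lemma power_sum_in_function_ring:
  assumes "finite I" "function_ring R" "\<And>k. (\<lambda>a. esym I (X a) k) \<in> R"
  shows "(\<lambda>a. \<Sum>i\<in>I. X a i ^ m) \<in> R"
proof (induction m rule: less_induct)
  case (less m)
  show ?case
  proof (cases m)
    case 0
    have "(\<lambda>a. of_nat (card I) * (\<lambda>_. 1) a) \<in> R"
      by (intro function_ringD(1,7)[OF assms(2)])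
    then show ?thesis using 0 by simp
  next
    case (Suc k)
    have "(\<Sum>i\<in>I. X a i ^ m) =
      - (of_nat (Suc k) * ((-1) ^ Suc k * esym I (X a) (Suc k)) +
        (\<Sum>j\<in>{1..k}. (-1) ^ j * esym I (X a) j * (\<Sum>i\<in>I. X a i ^ (Suc k - j))))" for a
    proof -
      have "{..k} = insert 0 {1..k}" by auto
      then have "(\<Sum>j\<le>k. (-1) ^ j * esym I (X a) j * (\<Sum>i\<in>I. X a i ^ (Suc k - j))) =
         (\<Sum>i\<in>I. X a i ^ m) +
         (\<Sum>j\<in>{1..k}. (-1) ^ j * esym I (X a) j * (\<Sum>i\<in>I. X a i ^ (Suc k - j)))"
        using assms(1) Suc by simp
      then show ?thesis using newton_identity[OF assms(1), of k "X a"] by simp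
    qed
    moreover have "(\<lambda>a. - (of_nat (Suc k) * ((-1) ^ Suc k * esym I (X a) (Suc k)) +
        (\<Sum>j\<in>{1..k}. (-1) ^ j * esym I (X a) j * (\<Sum>i\<in>I. X a i ^ (Suc k - j))))) \<in> R"
      using Suc
      by (intro function_ringD(3,4,7,8)[OF assms(2)] function_ring_sum[OF assms(2)]
          function_ringD(5)[OF assms(2) function_ringD(8)[OF assms(2)]] assms(3) less) auto
    ultimately show ?thesis by simp
  qed
qed

text \<open>Newton's identity read in the other direction. It yields \<open>Suc l\<close> times the
  elementary symmetric function, so this is where division by positive integers enters.\<close>

lemma esym_in_function_ring:
  assumes "finite I" "function_ring R" "\<And>m. (\<lambda>a. \<Sum>i\<in>I. X a i ^ m) \<in> R"
  shows "(\<lambda>a. esym I (X a) k) \<in> R"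
proof (induction k rule: less_induct)
  case (less k)
  show ?case
  proof (cases k)
    case 0
    then show ?thesis using assms function_ringD(1)[OF assms(2)] by simp
  next
    case (Suc l)
    have "(\<lambda>a. - (\<Sum>j\<le>l. (-1) ^ j * esym I (X a) j * (\<Sum>i\<in>I. X a i ^ (Suc l - j)))) \<in> R"
      using Suc
      by (intro function_ringD(3)[OF assms(2)] function_ring_sum[OF assms(2)]
          function_ringD(5)[OF assms(2) function_ringD(8)[OF assms(2)]] assms(3) less) auto
    then have "(\<lambda>a. of_nat (Suc l) * ((-1) ^ Suc l * esym I (X a) (Suc l))) \<in> R"
      by (simp only: newton_identity[OF assms(1)])
    then have "(\<lambda>a. (-1) ^ Suc l * esym I (X a) (Suc l)) \<in> R"
      by (rule function_ringD(6)[OF assms(2)])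
    then have "(\<lambda>a. (-1) ^ Suc l * ((-1) ^ Suc l * esym I (X a) (Suc l))) \<in> R"
      by (rule function_ringD(8)[OF assms(2)])
    moreover have "(-1) ^ Suc l * ((-1) ^ Suc l * y) = y" for y :: 'c
      by (simp flip: mult.assoc power_add mult_2)
    ultimately show ?thesis using Suc by simp
  qed
qed

text \<open>
  The product of all \<open>k\<close>-fold subset sums of the roots is a symmetric function.  The power sums
  of the subset sums are the coefficients of the elementary symmetric functions of the formal power
  series \<open>exp (X i T)\<close>.
\<close>

lemma prod_subset_sums_in_function_ring:
  fixes X :: "'a \<Rightarrow> 'i \<Rightarrow> 'b::field_char_0"
  assumes "finite I" "function_ring R" "\<And>c. (\<lambda>_. c) \<in> R" "\<And>j. (\<lambda>a. esym I (X a) j) \<in> R"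
  shows "(\<lambda>a. \<Prod>S | S \<subseteq> I \<and> card S = k. \<Sum>i\<in>S. X a i) \<in> R"
proof -
  let ?I = "{S. S \<subseteq> I \<and> card S = k}"
  \<comment> \<open>Families of power series with all coefficients in \<open>R\<close>. Newton's
    identities can then be applied to the elements \<open>fps_exp (X a i)\<close>.\<close>
  define R' :: "('a \<Rightarrow> 'b fps) set" where "R' = {F. \<forall>n. (\<lambda>a. fps_nth (F a) n) \<in> R}"
  have R': "function_ring R'"
    unfolding function_ring_def
  proof (intro conjI ballI allI impI)
    show "(\<lambda>_. 1) \<in> R'" using assms(3) by (simp add: R'_def)
    show "(\<lambda>a. - f a) \<in> R'" if "f \<in> R'" for f
      using that unfolding R'_def mem_Collect_eq fps_add_nth fps_neg_nth
      by (intro allI function_ringD(3,4)[OF assms(2)]) simp_all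
    show "(\<lambda>a. f a + g a) \<in> R'" if "f \<in> R'" "g \<in> R'" for f g
      using that unfolding R'_def mem_Collect_eq fps_add_nth fps_neg_nth
      by (intro allI function_ringD(3,4)[OF assms(2)]) simp_all
    show "(\<lambda>a. f a * g a) \<in> R'" if "f \<in> R'" "g \<in> R'" for f g
      using that unfolding R'_def mem_Collect_eq fps_mult_nth
      by (intro allI function_ring_sum[OF assms(2)] function_ringD(5)[OF assms(2)]) simp_all
    show "f \<in> R'" if "(\<lambda>a. of_nat (Suc n) * f a) \<in> R'" for f n
    proof -
      have "(\<lambda>a. of_nat (Suc n) * fps_nth (f a) m) \<in> R" for m
        using that by (simp add: R'_def fps_mult_of_nat_nth del: of_nat_Suc)
      then have "\<And>m. (\<lambda>a. fps_nth (f a) m) \<in> R" by (rule function_ringD(6)[OF assms(2)])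
      then show ?thesis unfolding R'_def by blast
    qed
  qed
  have p: "(\<lambda>a. \<Sum>i\<in>I. X a i ^ m) \<in> R" for m
    by (rule power_sum_in_function_ring) fact+
  \<comment> \<open>The \<open>m\<close>-th power of \<open>fps_exp c\<close> is the exponential
    series of \<open>m c\<close>, so each coefficient of this power sum is a constant times an
    ordinary power sum of the \<open>X a i\<close>.\<close>
  have "(\<lambda>a. \<Sum>i\<in>I. fps_exp (X a i) ^ m) \<in> R'" for m
    unfolding R'_def
  proof (intro CollectI allI)
    fix n
    have "fps_nth (\<Sum>i\<in>I. fps_exp (X a i) ^ m) n = of_nat m ^ n / fact n * (\<Sum>i\<in>I. X a i ^ n)" for a
      by (simp add: fps_sum_nth fps_exp_power_mult power_mult_distrib sum_distrib_left)
    then show "(\<lambda>a. fps_nth (\<Sum>i\<in>I. fps_exp (X a i) ^ m) n) \<in> R"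
      by (simp only:) (intro function_ringD(5)[OF assms(2)] assms(3) p)
  qed
  then have e: "(\<lambda>a. esym I (\<lambda>i. fps_exp (X a i)) k) \<in> R'"
    by (rule esym_in_function_ring[OF assms(1) R'])
  have ex: "(\<Prod>i\<in>S. fps_exp (X a i)) = fps_exp (\<Sum>i\<in>S. X a i)" for S a
    by (induction S rule: infinite_finite_induct) (simp_all add: fps_exp_add_mult)
  have P: "(\<lambda>a. \<Sum>S\<in>?I. (\<Sum>i\<in>S. X a i) ^ m) \<in> R" for m
  proof -
    have "(\<lambda>a. fact m * fps_nth (esym I (\<lambda>i. fps_exp (X a i)) k) m) \<in> R"
      using e by (intro function_ringD(5)[OF assms(2)] assms(3)) (simp add: R'_def)
    then show ?thesis
      unfolding esym_def ex by (simp add: fps_sum_nth flip: sum_divide_distrib)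
  qed
  have fin: "finite ?I" using assms(1) by simp
  \<comment> \<open>The product over all subsets is the elementary symmetric function of top
    order.\<close>
  have "(\<lambda>a. esym ?I (\<lambda>S. \<Sum>i\<in>S. X a i) (card ?I)) \<in> R"
    by (rule esym_in_function_ring[OF fin assms(2) P])
  moreover have "{T. T \<subseteq> ?I \<and> card T = card ?I} = {?I}"
    using fin card_subset_eq by blast
  ultimately show ?thesis by (simp add: esym_def)
qed

text \<open>On a two-point index set the functions with equal values at both points form a
  \<open>function_ring\<close>. Membership of the product in this ring is exactly its equality for
  \<open>X\<close> and \<open>Y\<close>, so the general lemma yields well-definedness without
  exhibiting a polynomial.\<close>

lemma prod_subset_sums_cong:
  fixes X Y :: "'i \<Rightarrow> 'b::field_char_0"
  assumes "finite I" "(\<Prod>i\<in>I. [:X i, 1:]) = (\<Prod>i\<in>I. [:Y i, 1:])"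
  shows "(\<Prod>S | S \<subseteq> I \<and> card S = k. \<Sum>i\<in>S. X i) = (\<Prod>S | S \<subseteq> I \<and> card S = k. \<Sum>i\<in>S. Y i)"
proof -
  let ?R = "{h :: bool \<Rightarrow> 'b. h True = h False}" and ?Z = "\<lambda>a. if a then X else Y"
  have e: "esym I X j = esym I Y j" for j
  proof (cases "j \<le> card I")
    case True
    then show ?thesis using coeff_prod_linear_esym[OF assms(1)] assms(2) by metis
  next
    case False
    then show ?thesis using esym_eq_0[OF assms(1), of j X] esym_eq_0[OF assms(1), of j Y] by simp
  qed
  have "(\<lambda>a. \<Prod>S | S \<subseteq> I \<and> card S = k. \<Sum>i\<in>S. ?Z a i) \<in> ?R"
  proof (rule prod_subset_sums_in_function_ring[OF assms(1)])
    show "function_ring ?R" by (auto simp: function_ring_def simp del: of_nat_Suc)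
    show "(\<lambda>a. esym I (?Z a) j) \<in> ?R" for j using e by simp
  qed auto
  then show ?thesis by simp
qed

section \<open>Hyperbolicity cones\<close>

definition cvec :: "real ^ 'n \<Rightarrow> complex ^ 'n" where
  "cvec x = (\<chi> i. complex_of_real (x $ i))"

lemma cvec_simps:
  "cvec (x + y) = cvec x + cvec y" "cvec (c *\<^sub>R x) = complex_of_real c *s cvec x" "cvec 0 = 0"
  by (simp_all add: cvec_def vec_eq_iff)

lemma continuous_on_vector_scalar_mult [continuous_intros]:
  fixes f :: "'a::topological_space \<Rightarrow> complex" and g :: "'a \<Rightarrow> complex ^ 'n"
  assumes "continuous_on S f" "continuous_on S g"
  shows "continuous_on S (\<lambda>t. f t *s g t)"
  unfolding vector_scalar_mult_def using assms by (intro continuous_intros)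

lemma norm_vector_scalar_mult: "norm (c *s w) = cmod c * norm w" for w :: "complex ^ 'n"
  by (simp add: norm_vec_def norm_mult L2_set_right_distrib)

text \<open>An interface for homogeneous polynomials on complex vectors that mentions no
  coefficients. The polynomial of the subset sums will be defined through a choice of roots, so only
  its behaviour on complex lines is accessible; the coefficient of order \<open>N\<close> along
  \<open>e\<close> is \<open>Q e\<close>, which makes the direction \<open>e\<close> responsible for
  the number of zeros.\<close>

definition homogeneous_poly_fun :: "nat \<Rightarrow> (complex ^ 'n \<Rightarrow> complex) \<Rightarrow> bool" where
  "homogeneous_poly_fun N Q \<longleftrightarrow> continuous_on UNIV Q \<and> (\<forall>c w. Q (c *s w) = c ^ N * Q w) \<and>
     (\<forall>w e. \<exists>p. degree p \<le> N \<and> coeff p N = Q e \<and> (\<forall>z. poly p z = Q (w + z *s e)))"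

lemma homogeneous_poly_funD:
  assumes "homogeneous_poly_fun N Q"
  shows "continuous_on UNIV Q" "Q (c *s w) = c ^ N * Q w"
    "\<exists>p. degree p \<le> N \<and> coeff p N = Q e \<and> (\<forall>z. poly p z = Q (w + z *s e))"
  using assms unfolding homogeneous_poly_fun_def by blast+

lemma homogeneous_poly_fun_tendsto:
  assumes "homogeneous_poly_fun N Q" "(g \<longlongrightarrow> l) F"
  shows "((\<lambda>a. Q (g a)) \<longlongrightarrow> Q l) F"
  by (rule continuous_on_tendsto_compose[OF homogeneous_poly_funD(1)[OF assms(1)] assms(2)]) simp_all

lemma norm_prod_mset_ge:
  assumes "0 \<le> \<delta>" "\<And>r. r \<in># A \<Longrightarrow> \<delta> \<le> cmod (g r)"
  shows "\<delta> ^ size A \<le> cmod (\<Prod>r\<in>#A. g r)"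
  using assms(2)
proof (induction A)
  case (add x A)
  have "\<delta> * \<delta> ^ size A \<le> cmod (g x) * cmod (\<Prod>r\<in>#A. g r)"
    using add assms(1) by (intro mult_mono) auto
  then show ?case by (simp add: norm_mult)
qed simp

text \<open>Along the line the polynomial is \<open>Q e\<close> times \<open>N\<close> linear
  factors, each of modulus at least \<open>\<delta>\<close>. Being an inequality between values, the
  bound survives limits and replaces the continuity of zeros.\<close>

lemma homogeneous_poly_fun_lower_bound:
  assumes Q: "homogeneous_poly_fun N Q" "Q e \<noteq> 0" and "0 \<le> \<delta>"
    and far: "\<And>r. Q (w + r *s e) = 0 \<Longrightarrow> \<delta> \<le> cmod (z - r)"
  shows "cmod (Q e) * \<delta> ^ N \<le> cmod (Q (w + z *s e))"
proof -
  obtain p where p: "degree p \<le> N" "coeff p N = Q e" "\<And>z. poly p z = Q (w + z *s e)"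
    using homogeneous_poly_funD(3)[OF Q(1)] by metis
  have deg: "degree p = N" using p(1,2) Q(2) le_degree[of p N] by simp
  then have "p \<noteq> 0" using p Q(2) by auto
  then obtain A where A: "size A = degree p" "p = smult (lead_coeff p) (\<Prod>x\<in>#A. [:-x, 1:])"
    using alg_closed_imp_factorization by blast
  have ev: "poly p u = Q e * (\<Prod>x\<in>#A. u - x)" for u
  proof -
    have *: "(\<lambda>x. poly [:-x, 1:] u) = (\<lambda>x. u - x)" by auto
    show ?thesis by (subst A(2)) (simp only: poly_smult poly_prod_mset * deg p(2))
  qed
  have "\<delta> \<le> cmod (z - r)" if "r \<in># A" for r
  proof -
    have "poly p r = 0" using that unfolding ev by force
    then show ?thesis using far p(3) by simp
  qed
  then have "\<delta> ^ size A \<le> cmod (\<Prod>x\<in>#A. z - x)"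
    using \<open>0 \<le> \<delta>\<close> by (intro norm_prod_mset_ge)
  then have "cmod (Q e) * \<delta> ^ N \<le> cmod (Q e) * cmod (\<Prod>x\<in>#A. z - x)"
    using A(1) deg by (intro mult_left_mono) auto
  also have "\<dots> = cmod (Q (w + z *s e))"
    unfolding p(3)[symmetric] ev norm_mult ..
  finally show ?thesis .
qed

text \<open>Connectedness of the parameter interval. The parameters with all zeros in the open half
  plane, and those with some zero in the opposite one, are both closed because no zero lies on the
  boundary. The constant \<open>c\<close> rotates the half plane.\<close>

lemma zeros_stay_in_half_plane:
  fixes w :: "real \<Rightarrow> complex ^ 'n"
  assumes Q: "homogeneous_poly_fun N Q" "Q e \<noteq> 0" and w: "continuous_on {0..1} w"
    and no: "\<And>\<theta> z. \<theta> \<in> {0..1} \<Longrightarrow> Q (w \<theta> + z *s e) = 0 \<Longrightarrow> Re (c * z) \<noteq> 0"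
    and start: "\<And>z. Q (w 0 + z *s e) = 0 \<Longrightarrow> Re (c * z) < 0"
    and z: "Q (w \<theta> + z *s e) = 0" and \<theta>: "\<theta> \<in> {0..1}"
  shows "Re (c * z) < 0"
proof (rule ccontr)
  assume neg: "\<not> Re (c * z) < 0"
  then have c: "c \<noteq> 0" using no[OF \<theta> z] by auto
  have contQ: "continuous_on S (\<lambda>a. Q (g a))" if "continuous_on S g" for S :: "'b::topological_space set" and g
    using continuous_on_compose2[OF homogeneous_poly_funD(1)[OF Q(1)] that] by simp
  define A where "A = {\<theta>\<in>{0..1}. \<forall>z. Q (w \<theta> + z *s e) = 0 \<longrightarrow> Re (c * z) < 0}"
  define B where "B = {\<theta>\<in>{0..1}. \<exists>z. Q (w \<theta> + z *s e) = 0 \<and> Re (c * z) > 0}"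
  \<comment> \<open>A zero \<open>z\<close> on the wrong side in the limit has distance at least
    \<open>Re (c * z) / cmod c\<close> from all zeros along the sequence, so the lower bound keeps
    the values at \<open>z\<close> away from 0.\<close>
  have "closed A"
    unfolding closed_sequential_limits
  proof (intro allI impI)
    fix f l assume fl: "(\<forall>n. f n \<in> A) \<and> f \<longlonglongrightarrow> l"
    then have l: "l \<in> {0..1}"
      using closed_sequentially[of "{0..1::real}" f l] by (auto simp: A_def)
    have "Re (c * z) < 0" if z: "Q (w l + z *s e) = 0" for z
    proof (rule ccontr)
      assume "\<not> Re (c * z) < 0"
      then have pos: "Re (c * z) > 0" using no[OF l z] by simp
      let ?\<delta> = "Re (c * z) / cmod c"
      have "cmod (Q e) * ?\<delta> ^ N \<le> cmod (Q (w (f n) + z *s e))" for n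
      proof (rule homogeneous_poly_fun_lower_bound[OF Q])
        show "0 \<le> ?\<delta>" using pos by simp
        fix r assume "Q (w (f n) + r *s e) = 0"
        then have "Re (c * r) < 0" using fl by (auto simp: A_def)
        then have "Re (c * z) \<le> Re (c * (z - r))" by (simp add: algebra_simps)
        also have "\<dots> \<le> cmod c * cmod (z - r)" by (metis complex_Re_le_cmod norm_mult)
        finally show "?\<delta> \<le> cmod (z - r)" using c by (simp add: field_simps)
      qed
      moreover have "(\<lambda>n. cmod (Q (w (f n) + z *s e))) \<longlonglongrightarrow> cmod (Q (w l + z *s e))"
      proof (intro tendsto_norm homogeneous_poly_fun_tendsto[OF Q(1)] tendsto_add tendsto_const)
        show "(\<lambda>n. w (f n)) \<longlonglongrightarrow> w l"
          using w fl l by (intro continuous_on_tendsto_compose[OF w]) (auto simp: A_def)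
      qed
      ultimately have "cmod (Q e) * ?\<delta> ^ N \<le> cmod (Q (w l + z *s e))"
        by (intro LIMSEQ_le_const) auto
      then show False using z Q(2) pos c
        by (smt (verit) divide_pos_pos norm_zero zero_less_mult_iff zero_less_norm_iff zero_less_power)
    qed
    with l show "l \<in> A" by (auto simp: A_def)
  qed
  \<comment> \<open>\<open>B\<close> is the projection of a compact set of pairs of parameter and
    zero.\<close>
  have "closed B"
  proof -
    \<comment> \<open>By homogeneity a zero \<open>z\<close> gives a zero of \<open>Q\<close> at
      \<open>e\<close> plus \<open>w \<theta>\<close> divided by \<open>z\<close>. Since
      \<open>Q\<close> does not vanish near \<open>e\<close>, this bounds \<open>z\<close> by
      \<open>W / \<delta>\<close>.\<close>
    obtain \<delta> where \<delta>: "\<delta> > 0" "\<And>u. norm u < \<delta> \<Longrightarrow> Q (u + e) \<noteq> 0"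
    proof -
      have "continuous_on UNIV (\<lambda>u. Q (u + e))" by (intro contQ continuous_intros)
      then have "open ((\<lambda>u. Q (u + e)) -` (- {0}))" by (intro open_vimage) auto
      moreover have "0 \<in> (\<lambda>u. Q (u + e)) -` (- {0})" using Q(2) by simp
      ultimately obtain d where "d > 0" "ball 0 d \<subseteq> (\<lambda>u. Q (u + e)) -` (- {0})"
        by (meson openE)
      show ?thesis
      proof (rule that[OF \<open>d > 0\<close>])
        fix u :: "complex ^ 'n" assume "norm u < d"
        then have "u \<in> ball 0 d" by simp
        then show "Q (u + e) \<noteq> 0" using \<open>ball 0 d \<subseteq> _\<close> by blast
      qed
    qed
    have "bounded (w ` {0..1})"
      using w by (intro compact_imp_bounded compact_continuous_image) auto
    then obtain W where W: "\<And>\<theta>. \<theta> \<in> {0..1} \<Longrightarrow> norm (w \<theta>) \<le> W"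
      unfolding bounded_iff by (metis imageI)
    have "W \<ge> 0" using W[of 0] norm_ge_zero[of "w 0"] by (simp del: norm_ge_zero)
    have bd: "cmod z \<le> W / \<delta>" if "\<theta> \<in> {0..1}" "Q (w \<theta> + z *s e) = 0" for \<theta> z
    proof (cases "z = 0")
      case False
      have "w \<theta> + z *s e = z *s ((1 / z) *s w \<theta> + e)"
        using False by (simp add: vec_eq_iff field_simps)
      then have "Q ((1 / z) *s w \<theta> + e) = 0"
        using that(2) False homogeneous_poly_funD(2)[OF Q(1)] by (metis mult_eq_0_iff power_not_zero)
      then have "\<delta> \<le> norm ((1 / z) *s w \<theta>)" using \<delta>(2) by (meson not_le)
      also have "\<dots> \<le> W / cmod z"
        using W[OF that(1)] by (simp add: norm_vector_scalar_mult norm_divide divide_right_mono)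
      finally show ?thesis using \<delta>(1) False by (simp add: field_simps)
    qed (use \<open>W \<ge> 0\<close> \<delta> in simp)
    define K where "K = {a \<in> {0..1} \<times> cball 0 (W / \<delta>). Q (w (fst a) + snd a *s e) = 0 \<and> 0 \<le> Re (c * snd a)}"
    have cont: "continuous_on ({0..1} \<times> cball 0 (W / \<delta>)) (\<lambda>a::real \<times> complex. Q (w (fst a) + snd a *s e))"
      by (intro contQ continuous_intros continuous_on_compose2[OF w]) auto
    have "K = ({0..1} \<times> cball 0 (W / \<delta>)) \<inter> (\<lambda>a. Q (w (fst a) + snd a *s e)) -` {0} \<inter>
        {a. 0 \<le> Re (c * snd a)}"
      by (auto simp: K_def)
    moreover have "closed (({0..1} \<times> cball 0 (W / \<delta>)) \<inter> (\<lambda>a. Q (w (fst a) + snd a *s e)) -` {0})"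
      by (intro continuous_closed_preimage cont closed_Times) auto
    moreover have "closed {a::real \<times> complex. 0 \<le> Re (c * snd a)}"
      by (intro closed_Collect_le continuous_intros)
    ultimately have "closed K" by auto
    moreover have "bounded K"
      by (rule bounded_subset[of "{0..1} \<times> cball 0 (W / \<delta>)"]) (auto simp: K_def intro: bounded_Times)
    ultimately have "compact K" by (simp add: compact_eq_bounded_closed)
    moreover have "B = fst ` K"
    proof (intro equalityI subsetI)
      fix \<theta> assume "\<theta> \<in> B"
      then obtain z where "\<theta> \<in> {0..1}" "Q (w \<theta> + z *s e) = 0" "Re (c * z) > 0"
        by (auto simp: B_def)
      then have "(\<theta>, z) \<in> K" using bd by (auto simp: K_def)
      then show "\<theta> \<in> fst ` K" by force
    next
      fix \<theta> assume "\<theta> \<in> fst ` K"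
      then obtain z where "\<theta> \<in> {0..1}" "Q (w \<theta> + z *s e) = 0" "Re (c * z) \<ge> 0"
        by (auto simp: K_def)
      then show "\<theta> \<in> B" using no[of \<theta> z] unfolding B_def by force
    qed
    ultimately show ?thesis
      by (simp add: compact_continuous_image compact_imp_closed continuous_on_fst)
  qed
  moreover have "{0..1} \<subseteq> A \<union> B" using no unfolding A_def B_def by force
  moreover have "A \<inter> B \<inter> {0..1} = {}" unfolding A_def B_def by force
  moreover have "A \<inter> {0..1} \<noteq> {}"
  proof -
    have "0 \<in> A" using start by (simp add: A_def)
    then show ?thesis by auto
  qed
  moreover have "B \<inter> {0..1} \<noteq> {}"
  proof -
    have "\<theta> \<in> B" using neg z \<theta> no[OF \<theta> z] by (auto simp: B_def)
    then show ?thesis using \<theta> by blast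
  qed
  ultimately show False
    using \<open>closed A\<close> connected_closed[of "{0..1::real}"] connected_Icc by blast
qed

definition hyperbolic_fun :: "(complex ^ 'n \<Rightarrow> complex) \<Rightarrow> real ^ 'n \<Rightarrow> bool" where
  "hyperbolic_fun Q v \<longleftrightarrow> Q (cvec v) \<noteq> 0 \<and> (\<forall>x t. t \<notin> \<real> \<longrightarrow> Q (cvec x + t *s cvec v) \<noteq> 0)"

text \<open>Garding's cone in algebraic form. For a hyperbolic \<open>Q\<close> the zeros in
  \<open>t\<close> are the negatives of the characteristic roots, so the condition says that all of
  these roots are positive.\<close>

definition hyperbolicity_cone :: "(complex ^ 'n \<Rightarrow> complex) \<Rightarrow> real ^ 'n \<Rightarrow> (real ^ 'n) set" where
  "hyperbolicity_cone Q v = {x. \<forall>t\<ge>0. Q (cvec (x + t *\<^sub>R v)) \<noteq> 0}"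

text \<open>Garding's argument that \<open>Q\<close> is hyperbolic in every direction of its cone.
  Push \<open>w\<close> off the real space by a small imaginary multiple of \<open>v\<close>: a real
  zero in direction \<open>y\<close> would then give a nonreal zero in direction \<open>v\<close>.
  So the imaginary parts of the zeros keep their sign while \<open>w\<close> is scaled down to 0,
  where the sign can be read off. Letting the push tend to 0 excludes zeros on the other
  side.\<close>

lemma hyperbolic_fun_cone_direction:
  assumes Q: "homogeneous_poly_fun N Q" and hyp: "hyperbolic_fun Q v"
    and y: "y \<in> hyperbolicity_cone Q v" and zero: "Q (cvec w + \<mu> *s cvec y) = 0"
  shows "\<mu> \<in> \<real>"
proof (rule ccontr)
  assume "\<mu> \<notin> \<real>"
  then have im: "Im \<mu> \<noteq> 0" by (simp add: complex_is_Real_iff)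
  have v: "Q (cvec v) \<noteq> 0" "\<And>x t. Q (cvec x + t *s cvec v) = 0 \<Longrightarrow> t \<in> \<real>"
    using hyp by (auto simp: hyperbolic_fun_def)
  have Qy: "Q (cvec y) \<noteq> 0" using y by (auto simp: hyperbolicity_cone_def dest!: spec[of _ 0])
  \<comment> \<open>With this sign and \<open>c = - \<i> * s\<close>, the half plane is
    \<open>s * Im z < 0\<close>, the one that does not contain \<open>\<mu>\<close>.\<close>
  define s where "s = sgn (Im \<mu>)"
  have s: "s \<noteq> 0" "s * Im \<mu> = \<bar>Im \<mu>\<bar>" using im by (auto simp: s_def sgn_if)
  have roots: "Re ((- \<i> * of_real s) * z) < 0"
    if \<epsilon>: "\<epsilon> > 0" and z: "Q ((cvec w + (\<i> * of_real (s * \<epsilon>)) *s cvec v) + z *s cvec y) = 0" for \<epsilon> z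
  proof (rule zeros_stay_in_half_plane[where Q = Q and w = "\<lambda>\<theta>. complex_of_real \<theta> *s cvec w + (\<i> * of_real (s * \<epsilon>)) *s cvec v"
          and \<theta> = 1 and e = "cvec y", OF Q Qy])
    show "continuous_on {0..1} (\<lambda>\<theta>. complex_of_real \<theta> *s cvec w + (\<i> * of_real (s * \<epsilon>)) *s cvec v)"
      by (intro continuous_intros)
    have nonreal: "\<i> * of_real (s * \<epsilon>) \<notin> \<real>" using s \<epsilon> by (simp add: complex_is_Real_iff)
    fix z
    { fix \<theta> :: real
      assume z: "Q (complex_of_real \<theta> *s cvec w + (\<i> * of_real (s * \<epsilon>)) *s cvec v + z *s cvec y) = 0"
      show "Re ((- \<i> * of_real s) * z) \<noteq> 0"
      proof
        assume "Re ((- \<i> * of_real s) * z) = 0"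
        then have "z = of_real (Re z)" using s by (simp add: complex_eq_iff)
        then have "complex_of_real \<theta> *s cvec w + (\<i> * of_real (s * \<epsilon>)) *s cvec v + z *s cvec y =
           cvec (\<theta> *\<^sub>R w + Re z *\<^sub>R y) + (\<i> * of_real (s * \<epsilon>)) *s cvec v"
          by (metis (no_types, lifting) add.commute add.left_commute cvec_simps(1,2))
        then show False using z v(2) nonreal by metis
      qed }
    assume "Q (complex_of_real 0 *s cvec w + (\<i> * of_real (s * \<epsilon>)) *s cvec v + z *s cvec y) = 0"
    then have z: "Q ((\<i> * of_real (s * \<epsilon>)) *s cvec v + z *s cvec y) = 0" by simp
    have "z \<noteq> 0"
    proof
      assume "z = 0"
      then have "(\<i> * of_real (s * \<epsilon>)) ^ N * Q (cvec v) = 0"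
        using z by (simp flip: homogeneous_poly_funD(2)[OF Q])
      then show False using v(1) s \<epsilon> by auto
    qed
    \<comment> \<open>Dividing by \<open>z\<close> turns a zero for \<open>\<theta> = 0\<close> into
      a zero of the line through \<open>y\<close> in direction \<open>v\<close>. It is real and, as
      \<open>y\<close> lies in the cone, negative, which determines the sign of the purely imaginary
      \<open>z\<close>.\<close>
    define \<tau> where "\<tau> = \<i> * of_real (s * \<epsilon>) / z"
    have "(\<i> * of_real (s * \<epsilon>)) *s cvec v + z *s cvec y = z *s (cvec y + \<tau> *s cvec v)"
      using \<open>z \<noteq> 0\<close> by (simp add: \<tau>_def vec_eq_iff field_simps)
    then have \<tau>0: "Q (cvec y + \<tau> *s cvec v) = 0"
      using z \<open>z \<noteq> 0\<close> homogeneous_poly_funD(2)[OF Q] by (metis mult_eq_0_iff power_not_zero)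
    then obtain t where t: "\<tau> = of_real t" using v(2) by (metis Reals_cases)
    have "t < 0"
    proof (rule ccontr)
      assume "\<not> t < 0"
      then show False using y \<tau>0 t by (auto simp: hyperbolicity_cone_def cvec_simps)
    qed
    moreover have "z = \<i> * of_real (s * \<epsilon> / t)"
      using \<open>z \<noteq> 0\<close> t \<open>t < 0\<close> by (simp add: \<tau>_def field_simps)
    then have "Re ((- \<i> * of_real s) * z) = s * s * \<epsilon> / t" by simp
    ultimately show "Re ((- \<i> * of_real s) * z) < 0"
      using s(1) \<epsilon> by (metis divide_pos_neg mult_pos_pos not_real_square_gt_zero)
  qed (use z in auto)
  have le: "cmod (Q (cvec y)) * \<bar>Im \<mu>\<bar> ^ N \<le>
      cmod (Q ((cvec w + (\<i> * of_real (s * inverse (of_nat (Suc n)))) *s cvec v) + \<mu> *s cvec y))" for n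
  proof (rule homogeneous_poly_fun_lower_bound[OF Q Qy])
    fix r assume "Q ((cvec w + (\<i> * of_real (s * inverse (of_nat (Suc n)))) *s cvec v) + r *s cvec y) = 0"
    then have "s * Im r < 0" using roots[of "inverse (of_nat (Suc n))" r] by simp
    then have "\<bar>Im \<mu>\<bar> \<le> \<bar>Im (\<mu> - r)\<bar>"
      using im unfolding s_def by (auto simp: sgn_if split: if_splits)
    also have "\<dots> \<le> cmod (\<mu> - r)" by (rule abs_Im_le_cmod)
    finally show "\<bar>Im \<mu>\<bar> \<le> cmod (\<mu> - r)" .
  qed simp
  have "(\<lambda>n. cmod (Q ((cvec w + (\<i> * of_real (s * inverse (of_nat (Suc n)))) *s cvec v) + \<mu> *s cvec y)))
     \<longlonglongrightarrow> cmod (Q ((cvec w + (\<i> * of_real (s * 0)) *s cvec v) + \<mu> *s cvec y))"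
    unfolding vector_scalar_mult_def
    by (intro tendsto_norm homogeneous_poly_fun_tendsto[OF Q] tendsto_intros tendsto_vec_lambda LIMSEQ_inverse_real_of_nat)
  then have "cmod (Q (cvec y)) * \<bar>Im \<mu>\<bar> ^ N \<le> 0"
    using le zero by (intro LIMSEQ_le_const) auto
  moreover have "0 < cmod (Q (cvec y)) * \<bar>Im \<mu>\<bar> ^ N" using Qy im by simp
  ultimately show False by simp
qed

text \<open>A zero at \<open>x + y + t0 v\<close> means that 1 is a zero in direction
  \<open>y\<close> of the line through \<open>x + t0 v\<close>. Joining this point to
  \<open>v\<close> inside the cone, the zeros in direction \<open>y\<close> are real and never 0,
  and at \<open>v\<close> they are negative; hence they cannot include 1.\<close>

theorem hyperbolicity_cone_add:
  assumes Q: "homogeneous_poly_fun N Q" and hyp: "hyperbolic_fun Q v"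
    and x: "x \<in> hyperbolicity_cone Q v" and y: "y \<in> hyperbolicity_cone Q v"
  shows "x + y \<in> hyperbolicity_cone Q v"
  unfolding hyperbolicity_cone_def
proof (intro CollectI allI impI notI)
  fix t0 :: real assume "0 \<le> t0" and zero: "Q (cvec (x + y + t0 *\<^sub>R v)) = 0"
  have Qy: "Q (cvec y) \<noteq> 0" using y by (auto simp: hyperbolicity_cone_def dest!: spec[of _ 0])
  have Qv: "Q (cvec v) \<noteq> 0" using hyp by (simp add: hyperbolic_fun_def)
  let ?s = "\<lambda>\<theta>. (1 - \<theta>) + \<theta> * t0"
  have "Re (1 * 1) < 0"
  proof (rule zeros_stay_in_half_plane[where w = "\<lambda>\<theta>. cvec (\<theta> *\<^sub>R x + ?s \<theta> *\<^sub>R v)" and \<theta> = 1, OF Q Qy])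
    show "continuous_on {0..1} (\<lambda>\<theta>. cvec (\<theta> *\<^sub>R x + ?s \<theta> *\<^sub>R v))"
      unfolding cvec_simps by (intro continuous_intros)
    fix z
    { fix \<theta> :: real
      assume \<theta>: "\<theta> \<in> {0..1}" and z: "Q (cvec (\<theta> *\<^sub>R x + ?s \<theta> *\<^sub>R v) + z *s cvec y) = 0"
      then have "z \<in> \<real>" using hyperbolic_fun_cone_direction[OF Q hyp y] by blast
      show "Re (1 * z) \<noteq> 0"
      proof
        assume "Re (1 * z) = 0"
        with \<open>z \<in> \<real>\<close> have "z = 0" by (simp add: complex_is_Real_iff complex_eq_iff)
        with z have 0: "Q (cvec (\<theta> *\<^sub>R x + ?s \<theta> *\<^sub>R v)) = 0" by simp
        show False
        proof (cases "\<theta> = 0")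
          case True
          then show ?thesis using 0 Qv by simp
        next
          case False
          have "\<theta> *\<^sub>R x + ?s \<theta> *\<^sub>R v = \<theta> *\<^sub>R (x + (?s \<theta> / \<theta>) *\<^sub>R v)"
            using False by (simp add: scaleR_add_right)
          then have "Q (cvec (x + (?s \<theta> / \<theta>) *\<^sub>R v)) = 0"
            using 0 False homogeneous_poly_funD(2)[OF Q] cvec_simps(2)
            by (metis mult_eq_0_iff of_real_eq_0_iff power_not_zero)
          moreover have "0 \<le> ?s \<theta> / \<theta>" using \<theta> \<open>0 \<le> t0\<close> by simp
          ultimately show False using x by (auto simp: hyperbolicity_cone_def)
        qed
      qed }
    assume z: "Q (cvec (0 *\<^sub>R x + ?s 0 *\<^sub>R v) + z *s cvec y) = 0"
    then have "z \<in> \<real>" using hyperbolic_fun_cone_direction[OF Q hyp y] by blast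
    then obtain t where t: "z = of_real t" by (metis Reals_cases)
    have z': "Q (cvec v + z *s cvec y) = 0" using z by simp
    have "z \<noteq> 0" using z' Qv by auto
    have "cvec v + z *s cvec y = z *s cvec (y + (1 / t) *\<^sub>R v)"
      using t \<open>z \<noteq> 0\<close> by (simp add: cvec_simps vec_eq_iff field_simps)
    then have "Q (cvec (y + (1 / t) *\<^sub>R v)) = 0"
      using z' \<open>z \<noteq> 0\<close> homogeneous_poly_funD(2)[OF Q] by (metis mult_eq_0_iff power_not_zero)
    then have "\<not> 0 \<le> 1 / t" using y by (auto simp: hyperbolicity_cone_def)
    then show "Re (1 * z) < 0" using t by (simp add: not_le)
  qed (use zero \<open>0 \<le> t0\<close> in \<open>simp_all add: cvec_simps algebra_simps\<close>)
  then show False by simp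
qed

text \<open>Degree bound and leading coefficient follow from homogeneity: writing
  \<open>w + z e\<close> as \<open>z\<close> times \<open>e + w / z\<close> compares the polynomial
  of the line with the reversed polynomial of the line with base and direction exchanged.\<close>

lemma homogeneous_poly_funI:
  assumes cont: "continuous_on UNIV Q" and hom: "\<And>c w. Q (c *s w) = c ^ N * Q w"
    and poly: "\<And>w e. \<exists>p. \<forall>z. poly p z = Q (w + z *s e)"
  shows "homogeneous_poly_fun N Q"
  unfolding homogeneous_poly_fun_def
proof (intro conjI allI)
  fix w e
  obtain p where p: "\<And>z. poly p z = Q (w + z *s e)" using poly by metis
  obtain r where r: "\<And>z. poly r z = Q (e + z *s w)" using poly by metis
  let ?m = "degree r"
  \<comment> \<open>The extra factor \<open>[:0, 1:]\<close> makes both sides vanish at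
    \<open>z = 0\<close>, where the substitution is impossible.\<close>
  have "[:0, 1:] * (monom 1 ?m * p) = [:0, 1:] * (monom 1 N * reflect_poly r)" (is "?l = ?r")
  proof (rule poly_eq_poly_eq_iff[THEN iffD1], rule ext)
    fix z
    show "poly ?l z = poly ?r z"
    proof (cases "z = 0")
      case False
      then have "w + z *s e = z *s (e + inverse z *s w)"
        by (simp add: vec_eq_iff field_simps)
      then have "poly p z = z ^ N * poly r (inverse z)" by (simp only: p r hom)
      then show ?thesis
        using False by (simp add: poly_monom poly_reflect_poly_nz)
    qed simp
  qed
  then have eq: "monom 1 ?m * p = monom 1 N * reflect_poly r" by simp
  have "degree p \<le> N"
  proof (cases "p = 0")
    case False
    then have "degree (monom 1 ?m * p) = ?m + degree p"
      by (simp add: degree_mult_eq degree_monom_eq)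
    moreover have "degree (monom 1 N * reflect_poly r) \<le> N + ?m"
      by (intro order.trans[OF degree_mult_le] add_mono) (simp_all add: degree_monom_eq degree_reflect_poly_le)
    ultimately show ?thesis using eq by simp
  qed simp
  moreover have "coeff p N = Q e"
  proof -
    have "coeff (monom 1 ?m * p) (N + ?m) = coeff (monom 1 N * reflect_poly r) (N + ?m)"
      using eq by simp
    then have "coeff p N = coeff r 0"
      by (simp add: coeff_monom_mult coeff_reflect_poly)
    then show ?thesis using r[of 0] by (simp add: poly_0_coeff_0)
  qed
  ultimately show "\<exists>p. degree p \<le> N \<and> coeff p N = Q e \<and> (\<forall>z. poly p z = Q (w + z *s e))"
    using p by blast
qed (use cont hom in auto)

section \<open>Function rings used for the polynomial of the subset sums\<close>

lemma function_ring_polys: "function_ring {h :: complex \<Rightarrow> complex. \<exists>p. \<forall>z. h z = poly p z}" (is "function_ring ?R")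
  unfolding function_ring_def
proof (intro conjI ballI allI impI)
  show "(\<lambda>_. 1) \<in> ?R" by (auto intro!: exI[of _ 1])
  show "(\<lambda>a. - f a) \<in> ?R" if f: "f \<in> ?R" for f
  proof -
    obtain p where "\<forall>z. f z = poly p z" using f by blast
    then show ?thesis by (auto intro!: exI[of _ "- p"])
  qed
  show "(\<lambda>a. f a + g a) \<in> ?R" "(\<lambda>a. f a * g a) \<in> ?R" if fg: "f \<in> ?R" "g \<in> ?R" for f g
  proof -
    obtain p q where "\<forall>z. f z = poly p z" "\<forall>z. g z = poly q z" using fg by blast
    then have "\<forall>z. f z + g z = poly (p + q) z" "\<forall>z. f z * g z = poly (p * q) z" by simp_all
    then show "(\<lambda>a. f a + g a) \<in> ?R" "(\<lambda>a. f a * g a) \<in> ?R" by blast+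
  qed
  show "f \<in> ?R" if f: "(\<lambda>a. of_nat (Suc n) * f a) \<in> ?R" for n f
  proof -
    obtain p where p: "\<And>z. of_nat (Suc n) * f z = poly p z" using f by auto
    have "f z = poly (smult (inverse (of_nat (Suc n))) p) z" for z
      by (simp only: poly_smult flip: p) (simp add: field_simps del: of_nat_Suc)
    then show ?thesis by blast
  qed
qed

lemma function_ring_continuous:
  "function_ring {h :: 'a::topological_space \<Rightarrow> complex. continuous_on UNIV h}" (is "function_ring ?R")
  unfolding function_ring_def
proof (intro conjI ballI allI impI)
  show "f \<in> ?R" if "(\<lambda>a. of_nat (Suc n) * f a) \<in> ?R" for n f
  proof -
    have "continuous_on UNIV (\<lambda>a. inverse (of_nat (Suc n)) * (of_nat (Suc n) * f a))"
      using that unfolding mem_Collect_eq by (rule continuous_on_mult[OF continuous_on_const])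
    moreover have *: "inverse (of_nat (Suc n)) * (of_nat (Suc n) * x) = x" for x :: complex
      by (simp add: field_simps del: of_nat_Suc)
    ultimately show ?thesis unfolding mem_Collect_eq * by simp
  qed
qed (auto intro!: continuous_intros)

text \<open>Lets a substitution into \<open>f\<close> with polynomial arguments be treated
  coefficient by coefficient: once with complex entries for the symmetric functions of roots, once
  along a real curve.\<close>

lemma function_ring_coeffs:
  fixes R :: "('a \<Rightarrow> 'b::field_char_0) set"
  assumes R: "function_ring R"
  shows "function_ring {F. \<forall>j. (\<lambda>a. coeff (F a) j) \<in> R}" (is "function_ring ?R")
  unfolding function_ring_def
proof (intro conjI ballI allI impI)
  show "(\<lambda>_. 1) \<in> ?R"
    using function_ringD(1,2)[OF R] by (auto simp: coeff_1)
  show "(\<lambda>a. - f a) \<in> ?R" if "f \<in> ?R" for f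
    using that unfolding mem_Collect_eq coeff_minus by (intro allI function_ringD(3)[OF R]) simp
  show "(\<lambda>a. f a + g a) \<in> ?R" if "f \<in> ?R" "g \<in> ?R" for f g
    using that unfolding mem_Collect_eq coeff_add by (intro allI function_ringD(4)[OF R]) simp_all
  show "(\<lambda>a. f a * g a) \<in> ?R" if "f \<in> ?R" "g \<in> ?R" for f g
    using that unfolding mem_Collect_eq coeff_mult
    by (intro allI function_ring_sum[OF R] function_ringD(5)[OF R]) simp_all
  show "f \<in> ?R" if "(\<lambda>a. of_nat (Suc n) * f a) \<in> ?R" for n f
  proof -
    have "(\<lambda>a. of_nat (Suc n) * coeff (f a) j) \<in> R" for j
    proof -
      have "(\<lambda>a. coeff (of_nat (Suc n) * f a) j) \<in> R" using that by blast
      moreover have "coeff (of_nat (Suc n) * p) j = of_nat (Suc n) * coeff p j" for p :: "'b poly"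
        by (subst of_nat_poly) simp
      ultimately show ?thesis by (simp only:)
    qed
    then have "\<And>j. (\<lambda>a. coeff (f a) j) \<in> R" by (rule function_ringD(6)[OF R])
    then show ?thesis by blast
  qed
qed

lemma rpoly_subst_in_function_ring:
  fixes f :: "'n::finite rpoly"
  assumes R: "function_ring R" and c: "\<And>c. (\<lambda>_. h c) \<in> R" and z: "\<And>i. (\<lambda>a. z a i) \<in> R"
  shows "(\<lambda>a. rpoly_subst h f (z a)) \<in> R"
  unfolding rpoly_subst_def
  by (intro function_ring_sum[OF R] function_ringD(5)[OF R] c function_ring_prod[OF R]
      function_ring_power[OF R] z)

definition complex_eval :: "'n::finite rpoly \<Rightarrow> complex ^ 'n \<Rightarrow> complex" where
  "complex_eval f w = rpoly_subst complex_of_real f (\<lambda>i. w $ i)"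

lemma complex_eval_cvec: "complex_eval f (cvec x) = complex_of_real (rpoly_eval f x)"
  by (simp add: complex_eval_def rpoly_eval_def rpoly_subst_def cvec_def)

lemma complex_eval_scale:
  assumes "homogeneous d f"
  shows "complex_eval f (c *s w) = c ^ d * complex_eval f w"
proof -
  have "(\<Prod>i\<in>UNIV. (c * w $ i) ^ Poly_Mapping.lookup m i) =
     c ^ d * (\<Prod>i\<in>UNIV. (w $ i) ^ Poly_Mapping.lookup m i)" if "m \<in> Poly_Mapping.keys f" for m
  proof -
    have "(\<Sum>i\<in>UNIV. Poly_Mapping.lookup m i) = d" using assms that by (simp add: homogeneous_def)
    then show ?thesis by (simp add: power_mult_distrib prod.distrib flip: power_sum)
  qed
  then show ?thesis
    unfolding complex_eval_def rpoly_subst_def sum_distrib_left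
    by (intro sum.cong refl) (simp add: mult_ac)
qed

lemma homogeneous_poly_fun_complex_eval:
  assumes "homogeneous d f"
  shows "homogeneous_poly_fun d (complex_eval f)"
proof (rule homogeneous_poly_funI)
  have "(\<lambda>w. complex_eval f w) \<in> {h. continuous_on UNIV h}"
    unfolding complex_eval_def
    by (rule rpoly_subst_in_function_ring[OF function_ring_continuous]) (auto intro!: continuous_intros)
  then show "continuous_on UNIV (complex_eval f)" by simp
  fix w e :: "complex ^ 'a"
  have "(\<lambda>z. complex_eval f (w + z *s e)) \<in> {h. \<exists>p. \<forall>z. h z = poly p z}"
    unfolding complex_eval_def
  proof (rule rpoly_subst_in_function_ring[OF function_ring_polys])
    show "(\<lambda>_. complex_of_real c) \<in> {h. \<exists>p. \<forall>z. h z = poly p z}" for c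
      by (auto intro!: exI[of _ "[:complex_of_real c:]"])
    show "(\<lambda>a. (w + a *s e) $ i) \<in> {h. \<exists>p. \<forall>z. h z = poly p z}" for i
      by (auto intro!: exI[of _ "[:w $ i, e $ i:]"])
  qed
  then show "\<exists>p. \<forall>z. poly p z = complex_eval f (w + z *s e)" by force
qed (rule complex_eval_scale[OF assms])

text \<open>Negated zeros of \<open>f\<close> along a complex line, in an arbitrary order without
  any continuity, and arbitrary beyond index \<open>d\<close>. Every later use is through symmetric
  functions of the first \<open>d\<close> values.\<close>

definition complex_roots :: "'n::finite rpoly \<Rightarrow> real ^ 'n \<Rightarrow> nat \<Rightarrow> complex ^ 'n \<Rightarrow> nat \<Rightarrow> complex" where
  "complex_roots f v d w =
     (SOME r. \<forall>t. complex_eval f (w + t *s cvec v) = complex_eval f (cvec v) * (\<Prod>i<d. t + r i))"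

lemma linear_factors_eq_iff:
  fixes X Y :: "nat \<Rightarrow> 'a::field_char_0"
  assumes "\<And>t. t \<in> T \<Longrightarrow> (\<Prod>i<d. t + X i) = (\<Prod>i<d. t + Y i)" "infinite T"
  shows "(\<Prod>i<d. [:X i, 1:]) = (\<Prod>i<d. [:Y i, 1:])"
proof (rule ccontr)
  assume "(\<Prod>i<d. [:X i, 1:]) \<noteq> (\<Prod>i<d. [:Y i, 1:])"
  then have "finite {t. poly ((\<Prod>i<d. [:X i, 1:]) - (\<Prod>i<d. [:Y i, 1:])) t = 0}"
    by (intro poly_roots_finite) simp
  moreover have "T \<subseteq> {t. poly ((\<Prod>i<d. [:X i, 1:]) - (\<Prod>i<d. [:Y i, 1:])) t = 0}"
    using assms(1) by (auto simp: poly_prod add.commute)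
  ultimately show False using assms(2) finite_subset by blast
qed

context
  fixes f :: "'n::finite rpoly" and v :: "real ^ 'n" and d :: nat
  assumes hom: "homogeneous d f" and fv: "rpoly_eval f v \<noteq> 0"
begin

lemma complex_roots_factorization:
  "complex_eval f (w + t *s cvec v) = complex_eval f (cvec v) * (\<Prod>i<d. t + complex_roots f v d w i)"
proof -
  note Q = homogeneous_poly_fun_complex_eval[OF hom]
  have Qv: "complex_eval f (cvec v) \<noteq> 0" using fv by (simp add: complex_eval_cvec)
  obtain p where p: "degree p \<le> d" "coeff p d = complex_eval f (cvec v)"
     "\<And>z. poly p z = complex_eval f (w + z *s cvec v)"
    using homogeneous_poly_funD(3)[OF Q] by metis
  have deg: "degree p = d" using p(1,2) Qv le_degree[of p d] by simp
  then have "p \<noteq> 0" using p Qv by auto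
  then obtain A where A: "size A = degree p" "p = smult (lead_coeff p) (\<Prod>x\<in>#A. [:-x, 1:])"
    using alg_closed_imp_factorization by blast
  obtain xs where xs: "A = mset xs" by (metis ex_mset)
  have len: "length xs = d" using A(1) deg xs by simp
  have ev: "poly p u = complex_eval f (cvec v) * (\<Prod>i<d. u + (- (xs ! i)))" for u
  proof -
    have *: "(\<lambda>x. poly [:-x, 1:] u) = (\<lambda>x. u + - x)" by auto
    have "poly p u = complex_eval f (cvec v) * (\<Prod>x\<in>#A. u + - x)"
      by (subst A(2)) (simp only: poly_smult poly_prod_mset * deg p(2))
    also have "(\<Prod>x\<in>#A. u + - x) = (\<Prod>i<d. u + (- (xs ! i)))"
      unfolding xs by (simp only: mset_map[symmetric] prod_mset_prod_list)
        (simp add: prod_list_prod_nth_map len)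
    finally show ?thesis .
  qed
  then have "\<exists>r. \<forall>t. complex_eval f (w + t *s cvec v) = complex_eval f (cvec v) * (\<Prod>i<d. t + r i)"
    unfolding p(3) by (intro exI[of _ "\<lambda>i. - (xs ! i)"]) blast
  from someI_ex[OF this] show ?thesis unfolding complex_roots_def by blast
qed

lemma complex_roots_eqI:
  assumes "\<And>t. t \<in> T \<Longrightarrow> complex_eval f (w + t *s cvec v) = complex_eval f (cvec v) * (\<Prod>i<d. t + r i)" "infinite T"
  shows "(\<Prod>i<d. [:complex_roots f v d w i, 1:]) = (\<Prod>i<d. [:r i, 1:])"
proof (rule linear_factors_eq_iff[OF _ assms(2)])
  fix t assume "t \<in> T"
  then show "(\<Prod>i<d. t + complex_roots f v d w i) = (\<Prod>i<d. t + r i)"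
    using assms(1) complex_roots_factorization fv by (simp add: complex_eval_cvec)
qed

text \<open>Up to the factor \<open>f(v)\<close> these are coefficients of
  \<open>f(w + T v)\<close>, hence polynomial in the entries of \<open>w\<close>. This removes the
  arbitrariness of the chosen roots.\<close>

lemma esym_complex_roots_in_function_ring:
  fixes R :: "('a \<Rightarrow> complex) set"
  assumes R: "function_ring R" "\<And>c. (\<lambda>_. c) \<in> R" and w: "\<And>i. (\<lambda>a. w a $ i) \<in> R"
  shows "(\<lambda>a. esym {..<d} (complex_roots f v d (w a)) k) \<in> R"
proof (cases "k \<le> d")
  case False
  then have "esym {..<d} X k = 0" for X :: "nat \<Rightarrow> complex" by (intro esym_eq_0) auto
  then show ?thesis using function_ringD(2)[OF R(1)] by simp
next
  case True
  define P where "P w = rpoly_subst (\<lambda>c. [:complex_of_real c:]) f (\<lambda>i. [:w $ i, complex_of_real (v $ i):])" for w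
  have "(\<lambda>a. P (w a)) \<in> {F. \<forall>j. (\<lambda>a. coeff (F a) j) \<in> R}"
    unfolding P_def
  proof (rule rpoly_subst_in_function_ring[OF function_ring_coeffs[OF R(1)]])
    show "(\<lambda>_. [:complex_of_real c:]) \<in> {F. \<forall>j. (\<lambda>a. coeff (F a) j) \<in> R}" for c
      using R(2) by simp
    have "(\<lambda>a. coeff [:w a $ i, complex_of_real (v $ i):] j) \<in> R" for i j
      using R(2) w[of i] by (cases j) (simp_all)
    then show "(\<lambda>a. [:w a $ i, complex_of_real (v $ i):]) \<in> {F. \<forall>j. (\<lambda>a. coeff (F a) j) \<in> R}" for i
      by blast
  qed
  then have "(\<lambda>a. coeff (P (w a)) (d - k)) \<in> R" by blast
  then have "(\<lambda>a. inverse (complex_eval f (cvec v)) * coeff (P (w a)) (d - k)) \<in> R"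
    by (intro function_ringD(5)[OF R(1)] R(2))
  moreover have "inverse (complex_eval f (cvec v)) * coeff (P w) (d - k) = esym {..<d} (complex_roots f v d w) k" for w
  proof -
    have "P w = smult (complex_eval f (cvec v)) (\<Prod>i<d. [:complex_roots f v d w i, 1:])"
    proof (rule poly_eq_poly_eq_iff[THEN iffD1], rule ext)
      fix t
      have "poly (P w) t = complex_eval f (w + t *s cvec v)"
        by (simp add: P_def complex_eval_def rpoly_subst_def poly_sum poly_prod cvec_def)
      then show "poly (P w) t = poly (smult (complex_eval f (cvec v)) (\<Prod>i<d. [:complex_roots f v d w i, 1:])) t"
        by (simp add: complex_roots_factorization poly_prod add.commute)
    qed
    moreover have "coeff (\<Prod>i<d. [:complex_roots f v d w i, 1:]) (d - k) = esym {..<d} (complex_roots f v d w) k"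
      using coeff_prod_linear_esym[of "{..<d}" k] True by simp
    ultimately show ?thesis using fv by (simp add: complex_eval_cvec)
  qed
  ultimately show ?thesis by simp
qed

definition subset_sum_poly :: "nat \<Rightarrow> complex ^ 'n \<Rightarrow> complex" where
  "subset_sum_poly k w = (\<Prod>S | S \<subseteq> {..<d} \<and> card S = k. \<Sum>i\<in>S. complex_roots f v d w i)"

text \<open>Two monic polynomials agreeing on an infinite set are equal, so a factorization known on
  the real line only, such as that by characteristic roots, may replace the chosen one.\<close>

lemma subset_sum_poly_eq:
  assumes "\<And>t. t \<in> T \<Longrightarrow> complex_eval f (w + t *s cvec v) = complex_eval f (cvec v) * (\<Prod>i<d. t + r i)" "infinite T"
  shows "subset_sum_poly k w = (\<Prod>S | S \<subseteq> {..<d} \<and> card S = k. \<Sum>i\<in>S. r i)"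
  unfolding subset_sum_poly_def
  by (rule prod_subset_sums_cong[OF finite_lessThan complex_roots_eqI[OF assms]])

lemma subset_sum_poly_in_function_ring:
  fixes R :: "('a \<Rightarrow> complex) set"
  assumes R: "function_ring R" "\<And>c. (\<lambda>_. c) \<in> R" and w: "\<And>i. (\<lambda>a. w a $ i) \<in> R"
  shows "(\<lambda>a. subset_sum_poly k (w a)) \<in> R"
  unfolding subset_sum_poly_def
  by (rule prod_subset_sums_in_function_ring[OF finite_lessThan R])
    (rule esym_complex_roots_in_function_ring[OF R w])

text \<open>Scaling \<open>w\<close> scales the multiset of roots, hence each of the
  \<open>d choose k\<close> factors.\<close>

lemma homogeneous_poly_fun_subset_sum_poly:
  "homogeneous_poly_fun (d choose k) (subset_sum_poly k)"
proof (rule homogeneous_poly_funI)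
  have "(\<lambda>w. subset_sum_poly k w) \<in> {h. continuous_on UNIV h}"
    by (rule subset_sum_poly_in_function_ring[OF function_ring_continuous]) (auto intro!: continuous_intros)
  then show "continuous_on UNIV (subset_sum_poly k)" by simp
  fix w e :: "complex ^ 'n"
  have "(\<lambda>z. subset_sum_poly k (w + z *s e)) \<in> {h. \<exists>p. \<forall>z. h z = poly p z}"
  proof (rule subset_sum_poly_in_function_ring[OF function_ring_polys])
    show "(\<lambda>_. c) \<in> {h. \<exists>p. \<forall>z. h z = poly p z}" for c
      by (auto intro!: exI[of _ "[:c:]"])
    show "(\<lambda>a. (w + a *s e) $ i) \<in> {h. \<exists>p. \<forall>z. h z = poly p z}" for i
      by (auto intro!: exI[of _ "[:w $ i, e $ i:]"])
  qed
  then show "\<exists>p. \<forall>z. poly p z = subset_sum_poly k (w + z *s e)" by force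
next
  fix c :: complex and w :: "complex ^ 'n"
  let ?r = "complex_roots f v d w"
  have "complex_eval f (c *s w + t *s cvec v) = complex_eval f (cvec v) * (\<Prod>i<d. t + c * ?r i)" for t
  proof (cases "c = 0")
    case True
    then show ?thesis by (simp add: complex_eval_scale[OF hom])
  next
    case False
    then have "c *s w + t *s cvec v = c *s (w + (t / c) *s cvec v)"
      by (simp add: vec_eq_iff field_simps)
    then have "complex_eval f (c *s w + t *s cvec v) = complex_eval f (cvec v) * (c ^ d * (\<Prod>i<d. t / c + ?r i))"
      by (simp only: complex_eval_scale[OF hom] complex_roots_factorization) simp
    also have "c ^ d * (\<Prod>i<d. t / c + ?r i) = (\<Prod>i<d. c * (t / c + ?r i))"
      by (simp add: prod.distrib)
    also have "\<dots> = (\<Prod>i<d. t + c * ?r i)" using False by (simp add: distrib_left)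
    finally show ?thesis .
  qed
  then have "subset_sum_poly k (c *s w) = (\<Prod>S | S \<subseteq> {..<d} \<and> card S = k. \<Sum>i\<in>S. c * ?r i)"
    by (intro subset_sum_poly_eq[where T = UNIV]) (auto simp: infinite_UNIV_char_0)
  also have "\<dots> = c ^ (d choose k) * subset_sum_poly k w"
    unfolding subset_sum_poly_def
    by (simp add: prod.distrib n_subsets flip: sum_distrib_left)
  finally show "subset_sum_poly k (c *s w) = c ^ (d choose k) * subset_sum_poly k w" .
qed

end

section \<open>Sums of the smallest characteristic roots\<close>

lemma Hyp_D:
  assumes "f \<in> Hyp d v"
  shows "homogeneous d f" "rpoly_eval f v \<noteq> 0"
  using assms by (auto simp: Hyp_def)

lemma linear_factors_unique:
  fixes a b :: "real list"
  assumes "length a = d" "length b = d" "sorted_wrt (\<ge>) a" "sorted_wrt (\<ge>) b"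
    and eq: "\<And>t. (\<Prod>i<d. t + a ! i) = (\<Prod>i<d. t + b ! i)"
  shows "a = b"
proof -
  have poly: "(\<Prod>i<d. [:c ! i, 1:]) = (\<Prod>x\<in>#mset c. [:x, 1:])" if "length c = d" for c :: "real list"
    by (simp only: mset_map[symmetric] prod_mset_prod_list prod_list_prod_nth_map that)
  have "(\<Prod>i<d. [:a ! i, 1:]) = (\<Prod>i<d. [:b ! i, 1:])"
    using linear_factors_eq_iff[where T = UNIV and d = d and X = "\<lambda>i. a ! i" and Y = "\<lambda>i. b ! i"] eq infinite_UNIV_char_0 by blast
  then have ab: "(\<Prod>x\<in>#mset a. [:x, 1:]) = (\<Prod>x\<in>#mset b. [:x, 1:])"
    unfolding poly[OF assms(1)] poly[OF assms(2)] .
  have pr: "proots (\<Prod>x\<in>#A. [:x, 1:]) = image_mset uminus A" for A :: "real multiset"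
  proof (induction A)
    case (add x A)
    have "(\<Prod>x\<in>#A. [:x, 1:]) \<noteq> 0" by (auto simp: prod_mset_zero_iff)
    then have "proots ([:x, 1:] * (\<Prod>x\<in>#A. [:x, 1:])) = proots [:x, 1:] + proots (\<Prod>x\<in>#A. [:x, 1:])"
      by (intro proots_mult) auto
    then show ?case using add by (simp del: mult_pCons_left)
  qed simp
  have "image_mset uminus (mset a) = image_mset uminus (mset b)"
    by (rule trans[OF pr[symmetric] trans[OF _ pr]]) (simp only: ab)
  then have "image_mset uminus (image_mset uminus (mset a)) = image_mset uminus (image_mset uminus (mset b))" by simp
  then have "mset a = mset b" by (simp add: multiset.map_comp comp_def)
  then have "mset (rev a) = mset (rev b)" by simp
  moreover have "sorted (rev a)" "sorted (rev b)" using assms(3,4) by (simp_all add: sorted_wrt_rev)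
  ultimately have "rev a = rev b" using sorted_sort_id sorted_list_of_multiset_mset by (metis (no_types))
  then show ?thesis by simp
qed

lemma char_map_eqI:
  assumes f: "f \<in> Hyp d v" and l: "length l = d" "sorted_wrt (\<ge>) l"
    and "\<And>t. rpoly_eval f (x + t *\<^sub>R v) = rpoly_eval f v * (\<Prod>j<d. t + l ! j)"
  shows "char_map f v x = l"
  using char_map_factorization[OF f, of x] assms(4) Hyp_D(2)[OF f]
  by (intro linear_factors_unique[OF _ l(1) _ l(2)]) simp_all

lemma rpoly_eval_scale: "homogeneous d f \<Longrightarrow> rpoly_eval f (c *\<^sub>R x) = c ^ d * rpoly_eval f x"
proof -
  assume "homogeneous d f"
  then have "complex_of_real (rpoly_eval f (c *\<^sub>R x)) = complex_of_real (c ^ d * rpoly_eval f x)"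
    by (simp add: cvec_simps complex_eval_scale flip: complex_eval_cvec)
  then show ?thesis using of_real_eq_iff by blast
qed

lemma char_map_scale:
  assumes f: "f \<in> Hyp d v" and c: "0 \<le> c" and j: "j < d"
  shows "char_map f v (c *\<^sub>R x) ! j = c * char_map f v x ! j"
proof -
  let ?l = "map ((*) c) (char_map f v x)"
  note F = char_map_factorization[OF f]
  have "char_map f v (c *\<^sub>R x) = ?l"
  proof (rule char_map_eqI[OF f])
    show "length ?l = d" by (simp add: F)
    have "sorted_wrt (\<lambda>a b. c * a \<ge> c * b) (char_map f v x)"
      using F(2)[of x] by (rule sorted_wrt_mono_rel[rotated]) (use c in \<open>auto intro: mult_left_mono\<close>)
    then show "sorted_wrt (\<ge>) ?l" by (simp add: sorted_wrt_map)
    fix t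
    have l: "?l ! j = c * char_map f v x ! j" if "j < d" for j using that F(1) by simp
    show "rpoly_eval f (c *\<^sub>R x + t *\<^sub>R v) = rpoly_eval f v * (\<Prod>j<d. t + ?l ! j)"
    proof (cases "c = 0")
      case True
      have "(\<Prod>j<d. t + ?l ! j) = (\<Prod>j<d. t)" by (intro prod.cong refl) (simp only: l lessThan_iff, simp add: True)
      then have "(\<Prod>j<d. t + ?l ! j) = t ^ d" by (simp only: prod_constant card_lessThan)
      then show ?thesis using True by (simp add: rpoly_eval_scale[OF Hyp_D(1)[OF f]])
    next
      case False
      then have "c *\<^sub>R x + t *\<^sub>R v = c *\<^sub>R (x + (t / c) *\<^sub>R v)" by (simp add: scaleR_add_right)
      then have "rpoly_eval f (c *\<^sub>R x + t *\<^sub>R v) = rpoly_eval f v * (c ^ d * (\<Prod>j<d. t / c + char_map f v x ! j))"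
        by (simp only: rpoly_eval_scale[OF Hyp_D(1)[OF f]] F(3)) simp
      also have "c ^ d * (\<Prod>j<d. t / c + char_map f v x ! j) = (\<Prod>j<d. c * (t / c + char_map f v x ! j))"
        by (simp add: prod.distrib)
      also have "\<dots> = (\<Prod>j<d. t + ?l ! j)"
        using False by (intro prod.cong refl) (simp add: l distrib_left)
      finally show ?thesis .
    qed
  qed
  then show ?thesis using j F(1) by simp
qed

text \<open>At real base points the chosen roots are the characteristic roots up to order, and
  moving by \<open>t\<close> along \<open>v\<close> adds \<open>t\<close> to each of the
  \<open>k\<close> summands. In particular all zeros in \<open>t\<close> are real.\<close>

lemma subset_sum_poly_real:
  assumes f: "f \<in> Hyp d v"
  shows "subset_sum_poly f v d k (cvec x + t *s cvec v) =
    (\<Prod>S | S \<subseteq> {..<d} \<and> card S = k. of_nat k * t + of_real (\<Sum>i\<in>S. char_map f v x ! i))"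
proof -
  note F = char_map_factorization[OF f]
  note H = Hyp_D[OF f]
  let ?r = "\<lambda>i. t + of_real (char_map f v x ! i)"
  have poly: "(\<Prod>i<d. [:complex_roots f v d (cvec x) i, 1:]) = (\<Prod>i<d. [:of_real (char_map f v x ! i), 1:])"
  proof (rule complex_roots_eqI[OF H])
    show "infinite (complex_of_real ` UNIV)"
      by (simp add: finite_image_iff inj_of_real infinite_UNIV_char_0)
    fix s :: complex assume "s \<in> range complex_of_real"
    then obtain u where u: "s = of_real u" by auto
    have "complex_eval f (cvec (x + u *\<^sub>R v)) = complex_eval f (cvec v) * (\<Prod>i<d. of_real u + of_real (char_map f v x ! i))"
      unfolding complex_eval_cvec F(3) by simp
    then show "complex_eval f (cvec x + s *s cvec v) = complex_eval f (cvec v) * (\<Prod>i<d. s + of_real (char_map f v x ! i))"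
      by (simp add: u cvec_simps)
  qed
  have "subset_sum_poly f v d k (cvec x + t *s cvec v) = (\<Prod>S | S \<subseteq> {..<d} \<and> card S = k. \<Sum>i\<in>S. ?r i)"
  proof (rule subset_sum_poly_eq[OF H])
    show "infinite (UNIV :: complex set)" by (simp add: infinite_UNIV_char_0)
    fix s :: complex
    have "(\<Prod>i<d. (s + t) + complex_roots f v d (cvec x) i) = poly (\<Prod>i<d. [:complex_roots f v d (cvec x) i, 1:]) (s + t)"
      by (simp add: poly_prod add_ac)
    also have "\<dots> = (\<Prod>i<d. s + ?r i)" unfolding poly by (simp add: poly_prod add_ac)
    finally have "complex_eval f (cvec x + (s + t) *s cvec v) = complex_eval f (cvec v) * (\<Prod>i<d. s + ?r i)"
      using complex_roots_factorization[OF H, of "cvec x" "s + t"] by simp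
    then show "complex_eval f (cvec x + t *s cvec v + s *s cvec v) = complex_eval f (cvec v) * (\<Prod>i<d. s + ?r i)"
      by (simp add: vec_eq_iff algebra_simps)
  qed
  also have "\<dots> = (\<Prod>S | S \<subseteq> {..<d} \<and> card S = k. of_nat k * t + of_real (\<Sum>i\<in>S. char_map f v x ! i))"
    by (intro prod.cong refl) (simp add: sum.distrib)
  finally show ?thesis .
qed

text \<open>The minimum over all \<open>k\<close>-subsets is the form in which the quantity is seen
  by the zeros of \<open>subset_sum_poly\<close>.\<close>

definition bottom_sum :: "'n::finite rpoly \<Rightarrow> real ^ 'n \<Rightarrow> nat \<Rightarrow> nat \<Rightarrow> real ^ 'n \<Rightarrow> real" where
  "bottom_sum f v d k x = Min ((\<lambda>S. \<Sum>i\<in>S. char_map f v x ! i) ` {S. S \<subseteq> {..<d} \<and> card S = k})"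

lemma card_subsets_ex: "k \<le> d \<Longrightarrow> {S. S \<subseteq> {..<d} \<and> card S = k} \<noteq> {}"
  using obtain_subset_with_card_n[of k "{..<d}"] by auto

lemma bottom_sum_less_iff:
  assumes "k \<le> d"
  shows "a < bottom_sum f v d k x \<longleftrightarrow> (\<forall>S. S \<subseteq> {..<d} \<and> card S = k \<longrightarrow> a < (\<Sum>i\<in>S. char_map f v x ! i))"
  unfolding bottom_sum_def using card_subsets_ex[OF assms] by (subst Min_gr_iff) auto

text \<open>Exchange argument: \<open>T\<close> and \<open>S\<close> have the same size, so
  \<open>T - S\<close> can be matched with \<open>S - T\<close>; each index in \<open>S - T\<close>
  lies below \<open>d - k\<close> and carries a root at least as large.\<close>

lemma bottom_sum_eq:
  assumes f: "f \<in> Hyp d v" and k: "k \<le> d"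
  shows "bottom_sum f v d k x = (\<Sum>i\<in>{d-k..<d}. char_map f v x ! i)"
proof -
  note F = char_map_factorization[OF f]
  let ?r = "\<lambda>i. char_map f v x ! i"
  have anti: "?r j \<le> ?r i" if "i \<le> j" "j < d" for i j
    using F(1,2)[of x] that by (cases "i = j") (auto simp: sorted_wrt_iff_nth_less)
  have le: "(\<Sum>i\<in>{d-k..<d}. ?r i) \<le> (\<Sum>i\<in>S. ?r i)" if S: "S \<subseteq> {..<d}" "card S = k" for S
  proof -
    define T where "T = {d-k..<d}"
    have T: "finite T" "card T = k" using k by (simp_all add: T_def)
    have fin: "finite S" using S finite_subset by blast
    have "card (T \<inter> S) + card (T - S) = card (S \<inter> T) + card (S - T)"
      using card_Int_Diff[OF T(1), of S] card_Int_Diff[OF fin, of T] T(2) S(2) by linarith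
    then have card: "card (T - S) = card (S - T)"
      by (simp add: Int_commute)
    then obtain h where h: "bij_betw h (T - S) (S - T)"
      using finite_same_card_bij[OF _ _ card] fin T(1) by auto
    have "(\<Sum>i\<in>T - S. ?r i) \<le> (\<Sum>i\<in>T - S. ?r (h i))"
    proof (rule sum_mono)
      fix i assume i: "i \<in> T - S"
      then have "h i \<in> S - T" using bij_betwE[OF h] by auto
      then show "?r i \<le> ?r (h i)" using S i by (intro anti) (auto simp: T_def)
    qed
    also have "\<dots> = (\<Sum>i\<in>S - T. ?r i)" by (rule sum.reindex_bij_betw[OF h])
    finally have "(\<Sum>i\<in>T - S. ?r i) + (\<Sum>i\<in>T \<inter> S. ?r i) \<le> (\<Sum>i\<in>S - T. ?r i) + (\<Sum>i\<in>T \<inter> S. ?r i)" by simp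
    moreover have "(\<Sum>i\<in>T. ?r i) = (\<Sum>i\<in>T - S. ?r i) + (\<Sum>i\<in>T \<inter> S. ?r i)"
      using sum.Int_Diff[OF T(1), of ?r S] by simp
    moreover have "(\<Sum>i\<in>S. ?r i) = (\<Sum>i\<in>S - T. ?r i) + (\<Sum>i\<in>T \<inter> S. ?r i)"
      using sum.Int_Diff[OF fin, of ?r T] by (simp add: Int_commute)
    ultimately show ?thesis by (simp add: T_def)
  qed
  show ?thesis
    unfolding bottom_sum_def
  proof (rule Min_eqI)
    show "(\<Sum>i\<in>{d-k..<d}. ?r i) \<in> (\<lambda>S. \<Sum>i\<in>S. ?r i) ` {S. S \<subseteq> {..<d} \<and> card S = k}"
      using k by (intro imageI) auto
  qed (use le in auto)
qed

lemma char_map_nth_eq_diff: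
  assumes f: "f \<in> Hyp d v" and "j < d"
  shows "char_map f v x ! j = bottom_sum f v d (d - j) x - bottom_sum f v d (d - Suc j) x"
proof -
  have "{j..<d} = insert j {Suc j..<d}" using assms(2) by auto
  then show ?thesis using assms(2) by (simp add: bottom_sum_eq[OF f])
qed

text \<open>The zeros in \<open>t\<close> are the subset sums divided by \<open>- k\<close>. None is
  nonnegative exactly if the smallest subset sum is positive.\<close>

lemma bottom_sum_pos_iff:
  assumes f: "f \<in> Hyp d v" and k: "0 < k" "k \<le> d"
  shows "x \<in> hyperbolicity_cone (subset_sum_poly f v d k) v \<longleftrightarrow> 0 < bottom_sum f v d k x"
proof -
  have *: "subset_sum_poly f v d k (cvec (x + t *\<^sub>R v)) = 0 \<longleftrightarrow>
    (\<exists>S. S \<subseteq> {..<d} \<and> card S = k \<and> of_nat k * t + (\<Sum>i\<in>S. char_map f v x ! i) = 0)" for t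
  proof -
    have "subset_sum_poly f v d k (cvec (x + t *\<^sub>R v)) =
       (\<Prod>S | S \<subseteq> {..<d} \<and> card S = k. of_nat k * of_real t + of_real (\<Sum>i\<in>S. char_map f v x ! i))"
      by (simp only: cvec_simps subset_sum_poly_real[OF f])
    also have "\<dots> = of_real (\<Prod>S | S \<subseteq> {..<d} \<and> card S = k. of_nat k * t + (\<Sum>i\<in>S. char_map f v x ! i))"
      by simp
    finally show ?thesis by (simp only: of_real_eq_0_iff) simp
  qed
  show ?thesis
  proof
    assume x: "x \<in> hyperbolicity_cone (subset_sum_poly f v d k) v"
    show "0 < bottom_sum f v d k x"
      unfolding bottom_sum_less_iff[OF k(2)]
    proof (intro allI impI)
      fix S assume S: "S \<subseteq> {..<d} \<and> card S = k"
      show "0 < (\<Sum>i\<in>S. char_map f v x ! i)"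
      proof (rule ccontr)
        assume neg: "\<not> 0 < (\<Sum>i\<in>S. char_map f v x ! i)"
        let ?t = "- (\<Sum>i\<in>S. char_map f v x ! i) / of_nat k"
        have "subset_sum_poly f v d k (cvec (x + ?t *\<^sub>R v)) = 0"
          unfolding * using S k by auto
        moreover have "?t \<ge> 0" using neg by (intro divide_nonneg_nonneg) auto
        ultimately show False using x unfolding hyperbolicity_cone_def by blast
      qed
    qed
  next
    assume "0 < bottom_sum f v d k x"
    then have pos: "0 < (\<Sum>i\<in>S. char_map f v x ! i)" if "S \<subseteq> {..<d}" "card S = k" for S
      using that unfolding bottom_sum_less_iff[OF k(2)] by blast
    then show "x \<in> hyperbolicity_cone (subset_sum_poly f v d k) v"
      unfolding hyperbolicity_cone_def mem_Collect_eq *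
      by (metis add_nonneg_pos less_irrefl mult_nonneg_nonneg of_nat_0_le_iff)
  qed
qed

lemma bottom_sum_shift:
  assumes f: "f \<in> Hyp d v" and k: "k \<le> d"
  shows "bottom_sum f v d k (x + t *\<^sub>R v) = bottom_sum f v d k x + of_nat k * t"
proof -
  note F = char_map_factorization[OF f]
  let ?l = "map ((+) t) (char_map f v x)"
  have "char_map f v (x + t *\<^sub>R v) = ?l"
  proof (rule char_map_eqI[OF f])
    show "length ?l = d" by (simp add: F)
    show "sorted_wrt (\<ge>) ?l" using F(2)[of x] by (simp add: sorted_wrt_map)
    fix s
    have "rpoly_eval f (x + t *\<^sub>R v + s *\<^sub>R v) = rpoly_eval f (x + (s + t) *\<^sub>R v)"
      by (simp add: algebra_simps)
    also have "\<dots> = rpoly_eval f v * (\<Prod>j<d. s + ?l ! j)"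
      unfolding F(3) using F(1)[of x] by (simp add: add_ac)
    finally show "rpoly_eval f (x + t *\<^sub>R v + s *\<^sub>R v) = rpoly_eval f v * (\<Prod>j<d. s + ?l ! j)" .
  qed
  then have "(\<Sum>i\<in>{d-k..<d}. char_map f v (x + t *\<^sub>R v) ! i) = (\<Sum>i\<in>{d-k..<d}. t + char_map f v x ! i)"
    using F(1)[of x] by (intro sum.cong) auto
  then show ?thesis using k by (simp add: bottom_sum_eq[OF f k] sum.distrib)
qed

text \<open>Closure of the cone under addition says that positivity at \<open>x\<close> and
  \<open>y\<close> gives positivity at \<open>x + y\<close>. Translation along \<open>v\<close>
  changes the bottom sum by a known amount and upgrades this to an inequality between
  values.\<close>

theorem bottom_sum_superadditive:
  assumes f: "f \<in> Hyp d v" and k: "k \<le> d"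
  shows "bottom_sum f v d k x + bottom_sum f v d k y \<le> bottom_sum f v d k (x + y)"
proof (cases "k = 0")
  case True
  then show ?thesis by (simp add: bottom_sum_eq[OF f])
next
  case False
  let ?Q = "subset_sum_poly f v d k" and ?b = "bottom_sum f v d k"
  have k0: "0 < k" using False by simp
  note Q = homogeneous_poly_fun_subset_sum_poly[OF Hyp_D[OF f], of k]
  have nz: "?Q (cvec x + t *s cvec v) \<noteq> 0" if "t \<notin> \<real>" for x t
  proof -
    have "of_nat k * t + of_real a \<noteq> 0" for a
    proof -
      have "Im (of_nat k * t + of_real a) \<noteq> 0" using that False by (simp add: complex_is_Real_iff)
      then show ?thesis by force
    qed
    then show ?thesis unfolding subset_sum_poly_real[OF f] by (auto simp del: of_real_sum)
  qed
  have b0: "?b 0 = 0"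
    using char_map_scale[OF f, of 0 _ 0] by (simp add: bottom_sum_eq[OF f k])
  have "v \<in> hyperbolicity_cone ?Q v"
    using bottom_sum_shift[OF f k, of 0 1] b0 k0 bottom_sum_pos_iff[OF f k0 k] by simp
  then have "?Q (cvec v) \<noteq> 0" by (auto simp: hyperbolicity_cone_def dest!: spec[of _ 0])
  then have hyp: "hyperbolic_fun ?Q v" using nz by (simp add: hyperbolic_fun_def)
  have add: "0 < ?b (x + y)" if "0 < ?b x" "0 < ?b y" for x y
    using that hyperbolicity_cone_add[OF Q hyp] by (simp add: bottom_sum_pos_iff[OF f k0 k])
  show ?thesis
  proof (rule field_le_epsilon)
    fix e :: real assume e: "0 < e"
    \<comment> \<open>Shifts that bring the bottom sums of both points to
      \<open>e / 2\<close>.\<close>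
    let ?s = "(e / 2 - ?b x) / of_nat k" and ?t = "(e / 2 - ?b y) / of_nat k"
    have "0 < ?b (x + ?s *\<^sub>R v)" "0 < ?b (y + ?t *\<^sub>R v)"
      using k0 e by (simp_all add: bottom_sum_shift[OF f k])
    from add[OF this] have "0 < ?b ((x + y) + (?s + ?t) *\<^sub>R v)" by (simp add: algebra_simps)
    then have "0 < ?b (x + y) + of_nat k * (?s + ?t)" by (simp only: bottom_sum_shift[OF f k])
    moreover have "of_nat k * (?s + ?t) = e - ?b x - ?b y" using k0 by (simp add: field_simps)
    ultimately show "?b x + ?b y \<le> ?b (x + y) + e" by simp
  qed
qed

lemma bottom_sum_scale:
  assumes f: "f \<in> Hyp d v" and k: "k \<le> d" and "0 \<le> c"
  shows "bottom_sum f v d k (c *\<^sub>R x) = c * bottom_sum f v d k x"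
  unfolding bottom_sum_eq[OF f k] sum_distrib_left
  by (intro sum.cong refl) (use char_map_scale[OF f \<open>0 \<le> c\<close>] in auto)

text \<open>Superadditivity bounds the value at \<open>x\<close> below by the values at its
  coordinate vectors. Homogeneity holds for nonnegative factors, so both signs of each unit vector
  enter; summing over \<open>k\<close> makes \<open>L\<close> common to all
  \<open>k\<close>.\<close>

lemma bottom_sum_lower_bound:
  assumes f: "f \<in> Hyp d v"
  obtains L where "0 \<le> L" "\<And>k x. k \<le> d \<Longrightarrow> - (L * (\<Sum>i\<in>UNIV. \<bar>x $ i\<bar>)) \<le> bottom_sum f v d k x"
proof -
  define L where "L = (\<Sum>k\<le>d. \<Sum>i\<in>UNIV. \<bar>bottom_sum f v d k (axis i 1)\<bar> + \<bar>bottom_sum f v d k (axis i (-1))\<bar>)"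
  have "- (L * (\<Sum>i\<in>UNIV. \<bar>x $ i\<bar>)) \<le> bottom_sum f v d k x" if k: "k \<le> d" for k x
  proof -
    let ?b = "bottom_sum f v d k"
    have L: "\<bar>?b (axis i 1)\<bar> + \<bar>?b (axis i (-1))\<bar> \<le> L" for i
    proof -
      have "\<bar>?b (axis i 1)\<bar> + \<bar>?b (axis i (-1))\<bar> \<le> (\<Sum>i\<in>UNIV. \<bar>?b (axis i 1)\<bar> + \<bar>?b (axis i (-1))\<bar>)"
        by (rule member_le_sum) auto
      also have "\<dots> \<le> L" unfolding L_def
        using k by (intro member_le_sum[of k "{..d}" "\<lambda>k. \<Sum>i\<in>UNIV. \<bar>bottom_sum f v d k (axis i 1)\<bar> + \<bar>bottom_sum f v d k (axis i (-1))\<bar>"]) (auto intro: sum_nonneg)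
      finally show ?thesis .
    qed
    have ax: "- (L * \<bar>c\<bar>) \<le> ?b (axis i c)" for i c
    proof -
      have eq: "axis i c = \<bar>c\<bar> *\<^sub>R (axis i (sgn c) :: real ^ 'a)"
        by (auto simp: axis_def vec_eq_iff sgn_if)
      have "- L \<le> ?b (axis i 1)" "- L \<le> ?b (axis i (-1))" using L[of i] by linarith+
      then have "- L \<le> ?b (axis i (sgn c))" if "c \<noteq> 0"
        using that by (auto simp: sgn_if)
      then have "\<bar>c\<bar> * (- L) \<le> \<bar>c\<bar> * ?b (axis i (sgn c))"
        by (cases "c = 0") (simp, intro mult_left_mono, simp_all)
      then show ?thesis
        by (subst eq) (simp add: bottom_sum_scale[OF f k] mult.commute)
    qed
    have sum: "(\<Sum>i\<in>A. ?b (g i)) \<le> ?b (\<Sum>i\<in>A. g i)" if "finite A" for A and g :: "'a \<Rightarrow> real ^ 'a"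
      using that
    proof (induction A)
      case empty
      show ?case using bottom_sum_scale[OF f k, of 0 0] by simp
    next
      case (insert a A)
      then show ?case
        using bottom_sum_superadditive[OF f k, of "g a" "sum g A"] by simp
    qed
    have x: "(\<Sum>i\<in>UNIV. axis i (x $ i)) = x"
      by (simp add: vec_eq_iff axis_def)
    have "- (L * (\<Sum>i\<in>UNIV. \<bar>x $ i\<bar>)) = (\<Sum>i\<in>UNIV. - (L * \<bar>x $ i\<bar>))"
      by (simp add: sum_distrib_left sum_negf)
    also have "\<dots> \<le> (\<Sum>i\<in>UNIV. ?b (axis i (x $ i)))" by (intro sum_mono ax)
    also have "\<dots> \<le> ?b x" using sum[of UNIV "\<lambda>i. axis i (x $ i)"] by (simp add: x)
    finally show ?thesis .
  qed
  moreover have "0 \<le> L" unfolding L_def by (intro sum_nonneg) auto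
  ultimately show ?thesis using that by blast
qed

text \<open>Superadditivity for \<open>x = y + (x - y)\<close>. The l1 norm fits because it splits
  into the absolute values of the components, which are what convex functions control.\<close>

lemma bottom_sum_convex_aux:
  assumes f: "f \<in> Hyp d v" and k: "k \<le> d"
    and L: "\<And>x. - (L * (\<Sum>i\<in>UNIV. \<bar>x $ i\<bar>)) \<le> bottom_sum f v d k x"
  shows "bottom_sum f v d k y - L * (\<Sum>i\<in>UNIV. \<bar>x $ i - y $ i\<bar>) \<le> bottom_sum f v d k x"
  using bottom_sum_superadditive[OF f k, of y "x - y"] L[of "x - y"] by simp

section \<open>Composition with difference-convex curves\<close>

text \<open>On a segment, each component of \<open>x\<close> deviates from its affine interpolation
  by at most the convexity deficit of \<open>p i + q i\<close>. As \<open>bottom_sum\<close> is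
  concave and \<open>L\<close>-Lipschitz, \<open>L\<close> times the total deficit outweighs the
  error made by interpolating inside \<open>bottom_sum\<close>.\<close>

lemma convex_on_majorant_minus_bottom_sum:
  fixes x :: "'a::real_normed_vector \<Rightarrow> real ^ 'n::finite"
  assumes f: "f \<in> Hyp d v" and k: "k \<le> d" and "0 \<le> L"
    and L: "\<And>x. - (L * (\<Sum>i\<in>UNIV. \<bar>x $ i\<bar>)) \<le> bottom_sum f v d k x"
    and pq: "\<And>i. convex_on N (p i)" "\<And>i. convex_on N (q i)"
    and x: "\<And>i z. z \<in> N \<Longrightarrow> x z $ i = p i z - q i z"
  shows "convex_on N (\<lambda>z. L * (\<Sum>i\<in>UNIV. p i z + q i z) - bottom_sum f v d k (x z))"
proof (rule convex_onI)
  have N: "convex N" using pq(1) by (auto simp: convex_on_def)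
  show "convex N" by (rule N)
  fix t :: real and y z assume t: "0 < t" "t < 1" and yz: "y \<in> N" "z \<in> N"
  let ?u = "(1 - t) *\<^sub>R y + t *\<^sub>R z"
  let ?b = "bottom_sum f v d k" and ?X = "(1 - t) *\<^sub>R x y + t *\<^sub>R x z"
  have u: "?u \<in> N" using N yz t by (intro convexD) auto
  have "\<bar>x ?u $ i - ?X $ i\<bar> \<le> ((1 - t) * (p i y + q i y) + t * (p i z + q i z)) - (p i ?u + q i ?u)" for i
  proof -
    have "p i ?u \<le> (1 - t) * p i y + t * p i z" "q i ?u \<le> (1 - t) * q i y + t * q i z"
      using convex_onD[OF pq(1)] convex_onD[OF pq(2)] t yz by auto
    moreover have "?X $ i = (1 - t) * (p i y - q i y) + t * (p i z - q i z)"
      using yz by (simp add: x)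
    ultimately show ?thesis unfolding x[OF u] by (simp add: algebra_simps abs_le_iff)
  qed
  then have "(\<Sum>i\<in>UNIV. \<bar>x ?u $ i - ?X $ i\<bar>) \<le>
     (\<Sum>i\<in>UNIV. ((1 - t) * (p i y + q i y) + t * (p i z + q i z)) - (p i ?u + q i ?u))"
    by (rule sum_mono)
  moreover define c where "c w = (\<Sum>i\<in>UNIV. p i w + q i w)" for w
  have "(\<Sum>i\<in>UNIV. ((1 - t) * (p i y + q i y) + t * (p i z + q i z)) - (p i ?u + q i ?u)) =
     (1 - t) * c y + t * c z - c ?u"
    unfolding c_def sum_subtractf sum.distrib[of "\<lambda>i. (1 - t) * (p i y + q i y)"] sum_distrib_left[symmetric] ..
  ultimately have "L * (\<Sum>i\<in>UNIV. \<bar>x ?u $ i - ?X $ i\<bar>) \<le> L * ((1 - t) * c y + t * c z - c ?u)"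
    using \<open>0 \<le> L\<close> by (intro mult_left_mono) simp_all
  also have "\<dots> = (1 - t) * (L * c y) + t * (L * c z) - L * c ?u"
    by (simp add: algebra_simps)
  finally have 1: "L * (\<Sum>i\<in>UNIV. \<bar>x ?u $ i - ?X $ i\<bar>) \<le> (1 - t) * (L * c y) + t * (L * c z) - L * c ?u" .
  have 2: "?b ?X - L * (\<Sum>i\<in>UNIV. \<bar>x ?u $ i - ?X $ i\<bar>) \<le> ?b (x ?u)"
    by (rule bottom_sum_convex_aux[OF f k L])
  have 3: "(1 - t) * ?b (x y) + t * ?b (x z) \<le> ?b ?X"
    using bottom_sum_superadditive[OF f k, of "(1 - t) *\<^sub>R x y" "t *\<^sub>R x z"] t
    by (simp add: bottom_sum_scale[OF f k])
  have "L * c ?u - ?b (x ?u) \<le> (1 - t) * (L * c y) + t * (L * c z) - ((1 - t) * ?b (x y) + t * ?b (x z))"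
    using 1 2 3 by linarith
  also have "\<dots> = (1 - t) * (L * c y - ?b (x y)) + t * (L * c z - ?b (x z))"
    by (simp only: right_diff_distrib)
  finally show "L * (\<Sum>i\<in>UNIV. p i ?u + q i ?u) - ?b (x ?u) \<le>
     (1 - t) * (L * (\<Sum>i\<in>UNIV. p i y + q i y) - ?b (x y)) + t * (L * (\<Sum>i\<in>UNIV. p i z + q i z) - ?b (x z))"
    unfolding c_def .
qed

section \<open>One-sided derivatives of convex functions on the line\<close>

lemma convex_on_subgradientI:
  fixes h D :: "real \<Rightarrow> real"
  assumes "convex S" and sub: "\<And>s t. s \<in> S \<Longrightarrow> t \<in> S \<Longrightarrow> h s + D s * (t - s) \<le> h t"
  shows "convex_on S h"
proof (rule convex_onI[OF _ \<open>convex S\<close>])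
  fix t x y :: real assume t: "0 < t" "t < 1" and xy: "x \<in> S" "y \<in> S"
  let ?u = "(1 - t) *\<^sub>R x + t *\<^sub>R y"
  have u: "?u \<in> S" using \<open>convex S\<close> xy t by (intro convexD) auto
  have "(1 - t) * (h ?u + D ?u * (x - ?u)) + t * (h ?u + D ?u * (y - ?u)) \<le> (1 - t) * h x + t * h y"
    using t by (intro add_mono mult_left_mono sub u xy) auto
  moreover have "(1 - t) * (h ?u + D ?u * (x - ?u)) + t * (h ?u + D ?u * (y - ?u)) = h ?u"
    by (simp add: algebra_simps)
  ultimately show "h ?u \<le> (1 - t) * h x + t * h y" by simp
qed

text \<open>The right derivative of a convex function, as an infimum so that no limit has to be
  shown to exist. The quotients carry both signs reversed to match
  \<open>convex_le_Inf_differential\<close>.\<close>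

definition right_slope :: "real set \<Rightarrow> (real \<Rightarrow> real) \<Rightarrow> real \<Rightarrow> real" where
  "right_slope J P t = Inf ((\<lambda>u. (P t - P u) / (t - u)) ` ({t<..} \<inter> J))"

context
  fixes J :: "real set" and P :: "real \<Rightarrow> real"
  assumes J: "open J" and P: "convex_on J P"
begin

lemma right_slope_subgradient:
  assumes "s \<in> J" "t \<in> J"
  shows "P s + right_slope J P s * (t - s) \<le> P t"
  using convex_le_Inf_differential[OF P, of s t] assms J by (simp add: right_slope_def interior_open)

text \<open>All four claims come from the subgradient inequality taken at \<open>s\<close> and at
  \<open>t\<close>. The last one, bounding the first-order error by length times slope increment, is
  the model for \<open>dominated\<close>.\<close>

lemma right_slope_increment:
  assumes "s \<in> J" "t \<in> J" "s \<le> t"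
  shows "right_slope J P s * (t - s) \<le> P t - P s" "P t - P s \<le> right_slope J P t * (t - s)"
    "right_slope J P s \<le> right_slope J P t"
    "\<bar>P t - P s - right_slope J P s * (t - s)\<bar> \<le> (t - s) * (right_slope J P t - right_slope J P s)"
proof -
  show 1: "right_slope J P s * (t - s) \<le> P t - P s"
    using right_slope_subgradient[of s t] assms by simp
  show 2: "P t - P s \<le> right_slope J P t * (t - s)"
    using right_slope_subgradient[of t s] assms by (simp add: algebra_simps)
  show "right_slope J P s \<le> right_slope J P t"
    using 1 2 assms by (cases "s = t") (auto dest: order_trans)
  show "\<bar>P t - P s - right_slope J P s * (t - s)\<bar> \<le> (t - s) * (right_slope J P t - right_slope J P s)"
    using 1 2 by (simp add: algebra_simps)
qed

lemma right_slope_le: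
  assumes "t \<in> J" "u \<in> J" "t < u"
  shows "right_slope J P t \<le> (P u - P t) / (u - t)"
  using right_slope_increment(1)[of t u] assms by (simp add: field_simps)

lemma right_slope_approx:
  assumes "t \<in> J" "0 < e"
  obtains u where "u \<in> J" "t < u" "(P u - P t) / (u - t) < right_slope J P t + e"
proof -
  let ?F = "(\<lambda>u. (P t - P u) / (t - u)) ` ({t<..} \<inter> J)"
  obtain r where "r > 0" "cball t r \<subseteq> J" using J assms(1) open_contains_cball by blast
  have "t + r \<in> cball t r" using \<open>r > 0\<close> by (simp add: dist_real_def)
  then have "t + r \<in> {t<..} \<inter> J" using \<open>r > 0\<close> \<open>cball t r \<subseteq> J\<close> by auto
  then have "?F \<noteq> {}" by blast
  moreover have "Inf ?F < right_slope J P t + e" using assms(2) by (simp add: right_slope_def)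
  ultimately obtain y where y: "y \<in> ?F" "y < right_slope J P t + e"
    using cInf_lessD[of ?F "right_slope J P t + e"] by metis
  then obtain u where u: "u \<in> J" "t < u" "(P t - P u) / (t - u) < right_slope J P t + e"
    by (metis (no_types, lifting) IntE greaterThan_iff imageE)
  moreover have "(P t - P u) / (t - u) = (P u - P t) / (u - t)"
    using minus_divide_divide[of "P u - P t" "u - t"] by simp
  ultimately show ?thesis using that[of u] by simp
qed

text \<open>Monotonicity gives the lower bound. For the upper one, fix a point \<open>u\<close>
  nearly attaining the infimum at \<open>t\<close>: its quotient varies continuously with the base
  point and bounds the slopes near \<open>t\<close>.\<close>

lemma right_slope_right_continuous:
  assumes t: "t \<in> J"
  shows "(right_slope J P \<longlongrightarrow> right_slope J P t) (at_right t)"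
proof (rule order_tendstoI)
  have evJ: "\<forall>\<^sub>F s in at_right t. s \<in> J"
    using J t by (metis at_le eventually_at_topological filter_leD subset_UNIV)
  fix a assume "a < right_slope J P t"
  show "\<forall>\<^sub>F s in at_right t. a < right_slope J P s"
    using evJ eventually_at_right_less[of t]
    by eventually_elim (use right_slope_increment(3)[OF t] \<open>a < _\<close> in force)
next
  have evJ: "\<forall>\<^sub>F s in at_right t. s \<in> J"
    using J t by (metis at_le eventually_at_topological filter_leD subset_UNIV)
  fix a assume a: "right_slope J P t < a"
  then obtain u where u: "u \<in> J" "t < u" "(P u - P t) / (u - t) < a"
    using right_slope_approx[OF t, of "a - right_slope J P t"] by auto
  have "continuous_on J P" using convex_on_continuous[OF J P] .
  then have "(P \<longlongrightarrow> P t) (at_right t)"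
    using J t by (metis at_le continuous_on_eq_continuous_at continuous_within subset_UNIV tendsto_mono)
  then have "((\<lambda>s. (P u - P s) / (u - s)) \<longlongrightarrow> (P u - P t) / (u - t)) (at_right t)"
    using u by (intro tendsto_intros) auto
  then have "\<forall>\<^sub>F s in at_right t. (P u - P s) / (u - s) < a"
    using u(3) by (rule order_tendstoD)
  moreover have "\<forall>\<^sub>F s in at_right t. s < u"
    using u(2) by (rule eventually_at_right_real[THEN eventually_mono]) auto
  ultimately show "\<forall>\<^sub>F s in at_right t. right_slope J P s < a"
    using evJ by eventually_elim (use right_slope_le[OF _ u(1)] in force)
qed

lemma right_slope_has_derivative:
  assumes t: "t \<in> J"
  shows "((\<lambda>u. (P u - P t) / (u - t)) \<longlongrightarrow> right_slope J P t) (at_right t)"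
proof (rule tendsto_sandwich[OF _ _ tendsto_const right_slope_right_continuous[OF t]])
  have evJ: "\<forall>\<^sub>F s in at_right t. s \<in> J"
    using J t by (metis at_le eventually_at_topological filter_leD subset_UNIV)
  then show "\<forall>\<^sub>F u in at_right t. right_slope J P t \<le> (P u - P t) / (u - t)"
    using eventually_at_right_less[of t] by eventually_elim (use right_slope_le[OF t] in force)
  show "\<forall>\<^sub>F u in at_right t. (P u - P t) / (u - t) \<le> right_slope J P u"
    using evJ eventually_at_right_less[of t]
    by eventually_elim (use right_slope_increment(2)[OF t] in \<open>force simp: field_simps\<close>)
qed

end

section \<open>Differentiable selections\<close>

text \<open>Darboux's theorem. After subtracting a linear function the derivative changes sign from
  negative to positive, which forces the minimum over the interval into the interior.\<close>

lemma derivative_intermediate_value: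
  fixes g g' :: "real \<Rightarrow> real"
  assumes "s \<le> t" and g: "\<And>r. r \<in> {s..t} \<Longrightarrow> (g has_real_derivative g' r) (at r)"
    and y: "(g' s \<le> y \<and> y \<le> g' t) \<or> (g' t \<le> y \<and> y \<le> g' s)"
  shows "\<exists>r\<in>{s..t}. g' r = y"
proof -
  have *: "\<exists>r\<in>{s..t}. h' r = 0"
    if h: "\<And>r. r \<in> {s..t} \<Longrightarrow> (h has_real_derivative h' r) (at r)" and sg: "h' s < 0" "0 < h' t" for h h' :: "real \<Rightarrow> real"
  proof -
    have "continuous_on {s..t} h" by (meson DERIV_continuous_on h has_field_derivative_at_within)
    then obtain r where r: "r \<in> {s..t}" "\<And>u. u \<in> {s..t} \<Longrightarrow> h r \<le> h u"
      using continuous_attains_inf[of "{s..t}" h] \<open>s \<le> t\<close> by auto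
    have "s < t" using sg \<open>s \<le> t\<close> by (cases "s = t") auto
    have "r \<noteq> s"
    proof
      assume "r = s"
      obtain d where d: "d > 0" "\<And>u. 0 < u \<Longrightarrow> u < d \<Longrightarrow> h (s + u) < h s"
        using DERIV_neg_dec_right[OF h sg(1)] \<open>s \<le> t\<close> by auto
      have "h (s + min (d / 2) (t - s)) < h s" using d(1) \<open>s < t\<close> by (intro d(2)) (auto simp: min_def)
      moreover have "s + min (d / 2) (t - s) \<in> {s..t}" using d(1) \<open>s < t\<close> by (auto simp: min_def)
      ultimately show False using r(2) \<open>r = s\<close> leD by blast
    qed
    moreover have "r \<noteq> t"
    proof
      assume "r = t"
      obtain d where d: "d > 0" "\<And>u. 0 < u \<Longrightarrow> u < d \<Longrightarrow> h (t - u) < h t"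
        using DERIV_pos_inc_left[OF h sg(2)] \<open>s \<le> t\<close> by auto
      have "h (t - min (d / 2) (t - s)) < h t" using d(1) \<open>s < t\<close> by (intro d(2)) (auto simp: min_def)
      moreover have "t - min (d / 2) (t - s) \<in> {s..t}" using d(1) \<open>s < t\<close> by (auto simp: min_def)
      ultimately show False using r(2) \<open>r = t\<close> leD by blast
    qed
    ultimately have "0 < min (r - s) (t - r)" using r(1) by auto
    moreover have "\<forall>u. \<bar>r - u\<bar> < min (r - s) (t - r) \<longrightarrow> h r \<le> h u"
      using r(2) by (auto simp: abs_less_iff)
    ultimately have "h' r = 0" using DERIV_local_min[OF h[OF r(1)]] by blast
    then show ?thesis using r(1) by blast
  qed
  consider "g' s = y" | "g' t = y" | "g' s < y" "y < g' t" | "g' t < y" "y < g' s" using y by linarith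
  then show ?thesis
  proof cases
    case 3
    have "((\<lambda>r. g r - y * r) has_real_derivative g' r - y) (at r)" if "r \<in> {s..t}" for r
      using g[OF that] by (auto intro!: derivative_eq_intros)
    then obtain r where "r \<in> {s..t}" "g' r - y = 0"
      using *[of "\<lambda>r. g r - y * r" "\<lambda>r. g' r - y"] 3 by auto
    then show ?thesis by auto
  next
    case 4
    have "((\<lambda>r. y * r - g r) has_real_derivative y - g' r) (at r)" if "r \<in> {s..t}" for r
      using g[OF that] by (auto intro!: derivative_eq_intros)
    then obtain r where "r \<in> {s..t}" "y - g' r = 0"
      using *[of "\<lambda>r. y * r - g r" "\<lambda>r. y - g' r"] 4 by auto
    then show ?thesis by auto
  qed (use \<open>s \<le> t\<close> in auto)
qed

lemma interval_length_le_cover: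
  fixes a b :: real
  assumes "finite A" "{a..b} \<subseteq> (\<Union>l\<in>A. {c l..e l})" "\<And>l. l \<in> A \<Longrightarrow> c l \<le> e l"
  shows "b - a \<le> (\<Sum>l\<in>A. e l - c l)"
proof (cases "a \<le> b")
  case True
  have "measure lborel {a..b} \<le> measure lborel (\<Union>l\<in>A. {c l..e l})"
  proof (rule measure_mono_fmeasurable[OF assms(2)])
    show "(\<Union>l\<in>A. {c l..e l}) \<in> fmeasurable lborel"
      using assms(1) by (intro fmeasurable.finite_UN fmeasurableI) (auto simp: emeasure_lborel_Icc_eq)
  qed simp
  also have "\<dots> \<le> (\<Sum>l\<in>A. measure lborel {c l..e l})"
    using assms(1) by (intro measure_UNION_le) auto
  also have "\<dots> = (\<Sum>l\<in>A. e l - c l)" using assms(3) by (intro sum.cong) auto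
  finally show ?thesis using True by simp
next
  case False
  have "0 \<le> (\<Sum>l\<in>A. e l - c l)" using assms(3) by (intro sum_nonneg) auto
  then show ?thesis using False by linarith
qed

text \<open>Otherwise every \<open>l\<close> is excluded on a right neighbourhood of
  \<open>t\<close>: either the values at \<open>t\<close> differ, or the difference quotients have
  different limits. Finitely many exclusions hold simultaneously and contradict the
  selection.\<close>

lemma selection_right_derivative:
  fixes g :: "real \<Rightarrow> real" and m D :: "'l \<Rightarrow> real \<Rightarrow> real"
  assumes g: "((\<lambda>u. (g u - g t) / (u - t)) \<longlongrightarrow> g') (at_right t)" "(g \<longlongrightarrow> g t) (at_right t)" and A: "finite A"
    and m: "\<And>l. l \<in> A \<Longrightarrow> ((\<lambda>u. (m l u - m l t) / (u - t)) \<longlongrightarrow> D l t) (at_right t)"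
      "\<And>l. l \<in> A \<Longrightarrow> (m l \<longlongrightarrow> m l t) (at_right t)"
    and sel: "\<forall>\<^sub>F u in at_right t. \<exists>l\<in>A. g u = m l u"
  shows "\<exists>l\<in>A. g' = D l t"
proof (rule ccontr)
  assume neg: "\<not> ?thesis"
  have "\<forall>\<^sub>F u in at_right t. g u \<noteq> m l u" if l: "l \<in> A" for l
  proof (cases "g t = m l t")
    case False
    have "((\<lambda>u. g u - m l u) \<longlongrightarrow> g t - m l t) (at_right t)" by (intro tendsto_diff g m l)
    then have "\<forall>\<^sub>F u in at_right t. g u - m l u \<noteq> 0"
      by (rule tendsto_imp_eventually_ne) (use False in auto)
    then show ?thesis by eventually_elim auto
  next
    case True
    have "((\<lambda>u. (g u - g t) / (u - t) - (m l u - m l t) / (u - t)) \<longlongrightarrow> g' - D l t) (at_right t)"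
      by (intro tendsto_diff g m l)
    then have "\<forall>\<^sub>F u in at_right t. (g u - g t) / (u - t) - (m l u - m l t) / (u - t) \<noteq> 0"
      by (rule tendsto_imp_eventually_ne) (use neg l in auto)
    then show ?thesis by eventually_elim (use True in auto)
  qed
  then have "\<forall>\<^sub>F u in at_right t. \<forall>l\<in>A. g u \<noteq> m l u"
    using A by (simp add: eventually_ball_finite)
  with sel have "\<forall>\<^sub>F u in at_right t. False" by eventually_elim auto
  then show False by simp
qed

text \<open>By Darboux all values between \<open>g' s\<close> and \<open>g' t\<close> occur as
  derivatives. They are covered by the finitely many intervals in which the functions
  \<open>\<alpha> l - \<beta> l\<close> move, and comparing lengths gives the bound.\<close>

lemma selection_derivative_increment:
  fixes g g' :: "real \<Rightarrow> real" and \<alpha> \<beta> :: "'l \<Rightarrow> real \<Rightarrow> real"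
  assumes "s \<le> t" and g: "\<And>r. r \<in> {s..t} \<Longrightarrow> (g has_real_derivative g' r) (at r)" and A: "finite A"
    and sel: "\<And>r. r \<in> {s..t} \<Longrightarrow> \<exists>l\<in>A. g' r = \<alpha> l r - \<beta> l r"
    and mono: "\<And>l. l \<in> A \<Longrightarrow> mono_on {s..t} (\<alpha> l)" "\<And>l. l \<in> A \<Longrightarrow> mono_on {s..t} (\<beta> l)"
  shows "\<bar>g' t - g' s\<bar> \<le> (\<Sum>l\<in>A. (\<alpha> l t - \<alpha> l s) + (\<beta> l t - \<beta> l s))"
proof -
  have m: "\<alpha> l s \<le> \<alpha> l r" "\<alpha> l r \<le> \<alpha> l t" "\<beta> l s \<le> \<beta> l r" "\<beta> l r \<le> \<beta> l t"
    if "l \<in> A" "r \<in> {s..t}" for l r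
    using mono[OF that(1)] that(2) by (auto simp: mono_on_def)
  have "max (g' s) (g' t) - min (g' s) (g' t) \<le> (\<Sum>l\<in>A. (\<alpha> l t - \<beta> l s) - (\<alpha> l s - \<beta> l t))"
  proof (rule interval_length_le_cover[OF A])
    show "{min (g' s) (g' t)..max (g' s) (g' t)} \<subseteq> (\<Union>l\<in>A. {\<alpha> l s - \<beta> l t..\<alpha> l t - \<beta> l s})"
    proof
      fix y assume "y \<in> {min (g' s) (g' t)..max (g' s) (g' t)}"
      then have "(g' s \<le> y \<and> y \<le> g' t) \<or> (g' t \<le> y \<and> y \<le> g' s)" by (auto simp: min_def max_def split: if_splits)
      then obtain r where r: "r \<in> {s..t}" "g' r = y"
        using derivative_intermediate_value[OF \<open>s \<le> t\<close> g] by blast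
      then obtain l where l: "l \<in> A" "y = \<alpha> l r - \<beta> l r" using sel by blast
      then have "y \<in> {\<alpha> l s - \<beta> l t..\<alpha> l t - \<beta> l s}" using m[OF l(1) r(1)] by auto
      then show "y \<in> (\<Union>l\<in>A. {\<alpha> l s - \<beta> l t..\<alpha> l t - \<beta> l s})" using l(1) by blast
    qed
    show "\<alpha> l s - \<beta> l t \<le> \<alpha> l t - \<beta> l s" if "l \<in> A" for l using m[OF that, of t] \<open>s \<le> t\<close> by auto
  qed
  moreover have "(\<Sum>l\<in>A. (\<alpha> l t - \<beta> l s) - (\<alpha> l s - \<beta> l t)) = (\<Sum>l\<in>A. (\<alpha> l t - \<alpha> l s) + (\<beta> l t - \<beta> l s))"
    by (intro sum.cong refl) simp
  ultimately show ?thesis by (simp add: max_def min_def split: if_splits)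
qed

text \<open>\<open>\<Phi>\<close> may jump at \<open>t0\<close>, so the domination says nothing
  about \<open>g' t0\<close> itself. It makes the oscillation of \<open>g'\<close> small on a right
  neighbourhood without \<open>t0\<close>; the mean value theorem ties difference quotients at
  \<open>t0\<close> to values of \<open>g'\<close> there.\<close>

lemma dominated_derivative_right_continuous:
  fixes g g' \<Phi> :: "real \<Rightarrow> real"
  assumes J: "open J" "t0 \<in> J" and g: "\<And>r. r \<in> J \<Longrightarrow> (g has_real_derivative g' r) (at r)"
    and J': "convex J"
    and dom: "\<And>s t. s \<in> J \<Longrightarrow> t \<in> J \<Longrightarrow> s \<le> t \<Longrightarrow> \<bar>g' t - g' s\<bar> \<le> \<Phi> t - \<Phi> s"
  shows "(g' \<longlongrightarrow> g' t0) (at_right t0)"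
proof (rule tendstoI)
  fix e :: real assume "0 < e"
  obtain r where r: "r > 0" "cball t0 r \<subseteq> J" using J open_contains_cball by blast
  have rJ: "t \<in> J" if "t0 \<le> t" "t \<le> t0 + r" for t using r that by (auto simp: dist_real_def subset_iff)
  have mono: "\<Phi> s \<le> \<Phi> t" if "s \<in> J" "t \<in> J" "s \<le> t" for s t using dom[OF that] by linarith
  let ?F = "\<Phi> ` {t0<..t0 + r}"
  have bdd: "bdd_below ?F" using mono[of t0] rJ r(1) by (intro bdd_belowI2[of _ "\<Phi> t0"]) auto
  have "?F \<noteq> {}" using r(1) by auto
  then obtain y where "y \<in> ?F" "y < Inf ?F + e / 2" using \<open>0 < e\<close> cInf_lessD[of ?F "Inf ?F + e / 2"] by auto
  then obtain u where u: "t0 < u" "u \<le> t0 + r" "\<Phi> u < Inf ?F + e / 2" by auto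
  have osc: "\<bar>g' t - g' s\<bar> < e / 2" if "t0 < s" "s \<le> t" "t \<le> u" for s t
  proof -
    have "Inf ?F \<le> \<Phi> s" using that u by (intro cInf_lower bdd) auto
    moreover have "\<Phi> t \<le> \<Phi> u" using that u by (intro mono rJ) auto
    moreover have "\<bar>g' t - g' s\<bar> \<le> \<Phi> t - \<Phi> s" using that u by (intro dom rJ) auto
    ultimately show ?thesis using u(3) by linarith
  qed
  have "((\<lambda>s. (g s - g t0) / (s - t0)) \<longlongrightarrow> g' t0) (at t0)"
    using g[OF J(2)] by (simp add: has_field_derivative_iff)
  then have "((\<lambda>s. (g s - g t0) / (s - t0)) \<longlongrightarrow> g' t0) (at_right t0)"
    by (rule tendsto_mono[OF at_le[OF subset_UNIV]])
  then have "\<forall>\<^sub>F s in at_right t0. \<bar>(g s - g t0) / (s - t0) - g' t0\<bar> < e / 2"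
    using tendstoD[of _ "g' t0" _ "e / 2"] \<open>0 < e\<close> by (simp add: dist_real_def)
  then obtain b where b: "b > t0" "\<And>s. t0 < s \<Longrightarrow> s < b \<Longrightarrow> \<bar>(g s - g t0) / (s - t0) - g' t0\<bar> < e / 2"
    by (auto simp: eventually_at_right[of t0 "t0 + 1"])
  have "dist (g' t) (g' t0) < e" if t: "t0 < t" "t \<le> u" for t
  proof -
    define s where "s = (t0 + min b t) / 2"
    have s: "t0 < s" "s < b" "s < t" using b(1) t by (auto simp: s_def min_def field_simps)
    obtain \<xi> where \<xi>: "t0 < \<xi>" "\<xi> < s" "g s - g t0 = (s - t0) * g' \<xi>"
      using MVT2[of t0 s g g'] s t u g rJ by auto
    then have "(g s - g t0) / (s - t0) = g' \<xi>" using s by simp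
    then have "\<bar>g' \<xi> - g' t0\<bar> < e / 2" using b(2)[OF s(1,2)] by simp
    moreover have "\<bar>g' t - g' \<xi>\<bar> < e / 2" using \<xi> s t by (intro osc) auto
    ultimately show ?thesis unfolding dist_real_def by linarith
  qed
  then show "\<forall>\<^sub>F t in at_right t0. dist (g' t) (g' t0) < e"
    using u(1) by (auto simp: eventually_at_right[OF u(1)] intro!: exI[of _ u])
qed

text \<open>Left continuity is right continuity of the reflected function; \<open>\<Phi>\<close> is
  reflected and negated to stay increasing.\<close>

lemma dominated_derivative_continuous_on:
  fixes g g' \<Phi> :: "real \<Rightarrow> real"
  assumes J: "open J" "convex J" and g: "\<And>r. r \<in> J \<Longrightarrow> (g has_real_derivative g' r) (at r)"
    and dom: "\<And>s t. s \<in> J \<Longrightarrow> t \<in> J \<Longrightarrow> s \<le> t \<Longrightarrow> \<bar>g' t - g' s\<bar> \<le> \<Phi> t - \<Phi> s"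
  shows "continuous_on J g'"
proof -
  have "isCont g' t" if t: "t \<in> J" for t
  proof -
    have "(g' \<longlongrightarrow> g' t) (at_right t)"
      by (rule dominated_derivative_right_continuous[OF J(1) t g J(2) dom])
    moreover have "((\<lambda>r. g' (- r)) \<longlongrightarrow> g' (- (- t))) (at_right (- t))"
    proof (rule dominated_derivative_right_continuous[where J = "uminus ` J" and g = "\<lambda>r. - g (- r)" and \<Phi> = "\<lambda>r. - \<Phi> (- r)"])
      show "open (uminus ` J)" using J(1) by (rule open_negations)
      show "- t \<in> uminus ` J" using t by blast
      show "convex (uminus ` J)" using J(2) by (rule convex_negations)
      show "((\<lambda>r. - g (- r)) has_real_derivative g' (- r)) (at r)" if "r \<in> uminus ` J" for r
      proof -
        have "(g has_real_derivative g' (- r)) (at (- r))" using that g by auto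
        then have "((\<lambda>x. g (- x)) has_real_derivative - g' (- r)) (at r)"
          by (simp add: DERIV_mirror)
        then show ?thesis using DERIV_minus by fastforce
      qed
      show "\<bar>g' (- b) - g' (- a)\<bar> \<le> - \<Phi> (- b) - - \<Phi> (- a)" if "a \<in> uminus ` J" "b \<in> uminus ` J" "a \<le> b" for a b
        using dom[of "- b" "- a"] that by (auto simp: abs_minus_commute)
    qed
    then have "(g' \<longlongrightarrow> g' t) (at_left t)"
      by (simp add: filterlim_at_left_to_right)
    ultimately show ?thesis by (simp add: continuous_at filterlim_split_at)
  qed
  then show ?thesis by (simp add: continuous_at_imp_continuous_on)
qed

section \<open>Functions of bounded variation mapping null sets to null sets\<close>

text \<open>Finitely many components are padded with empty sets.\<close>

lemma open_real_components_sequence: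
  fixes W :: "real set"
  assumes "open W"
  obtains C :: "nat \<Rightarrow> real set" where "disjoint_family C" "\<And>n. open (C n)" "\<And>n. connected (C n)" "W = (\<Union>n. C n)"
proof -
  have cnt: "countable (components W)"
  proof (rule countable_disjoint_open_subsets)
    show "\<And>S. S \<in> components W \<Longrightarrow> open S" using assms open_components by blast
    show "pairwise disjnt (components W)"
      using pairwise_disjoint_components[of W] by (simp add: disjnt_def pairwise_def)
  qed
  define F where "F = to_nat_on (components W)"
  define C where "C n = \<Union>{D \<in> components W. F D = n}" for n
  have inj: "inj_on F (components W)" unfolding F_def using cnt by (rule inj_on_to_nat_on)
  have C: "C n = {} \<or> C n \<in> components W" for n
  proof (cases "\<exists>D\<in>components W. F D = n")
    case True
    then obtain D where D: "D \<in> components W" "F D = n" by blast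
    then have "{D \<in> components W. F D = n} = {D}" using inj by (auto simp: inj_on_def)
    then show ?thesis using D by (simp add: C_def)
  next
    case False
    then have "{D \<in> components W. F D = n} = {}" by blast
    then show ?thesis by (intro disjI1) (simp only: C_def Union_empty)
  qed
  show ?thesis
  proof (rule that)
    show "disjoint_family C"
      unfolding disjoint_family_on_def
    proof (intro ballI impI)
      fix m n :: nat assume "m \<noteq> n"
      have "D \<inter> E = {}" if "D \<in> components W" "E \<in> components W" "F D = m" "F E = n" for D E
        using that \<open>m \<noteq> n\<close> components_nonoverlap by metis
      then show "C m \<inter> C n = {}" unfolding C_def by blast
    qed
    show "open (C n)" for n using C[of n] assms open_components by (metis open_empty)
    show "connected (C n)" for n using C[of n] in_components_connected by (metis connected_empty)
    have "(\<Union>n. C n) = \<Union>(components W)" unfolding C_def by blast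
    then show "W = (\<Union>n. C n)" using Union_components by metis
  qed
qed

text \<open>Outer regularity encloses \<open>B\<close> in an open set of nearly the same measure. On
  each component \<open>G\<close> oscillates by at most the measure of the component, so its image
  lies in a ball of that radius around any of its values; the diameter explains the factor
  2.\<close>

lemma emeasure_image_cover:
  fixes G :: "real \<Rightarrow> real" and M :: "real measure"
  assumes M: "sets M = sets borel" "emeasure M (space M) \<noteq> \<infinity>"
    and G: "\<And>s t. s \<le> t \<Longrightarrow> \<bar>G t - G s\<bar> \<le> measure M {s<..t}"
    and B: "B \<in> sets borel" and e: "0 < (e::real)"
  obtains V where "V \<in> sets borel" "G ` B \<subseteq> V" "emeasure lborel V \<le> 2 * emeasure M B + e"
proof -
  interpret finite_measure M using M(2) by (rule finite_measureI)
  have sp: "space M = UNIV" using M(1) by (metis sets_eq_imp_space_eq space_borel)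
  have meas: "A \<in> sets M" if "open A" for A using that M(1) by (simp add: borel_open)
  have "emeasure M B < emeasure M B + ennreal (e / 2)"
    using e by (simp add: emeasure_eq_measure ennreal_less_iff flip: ennreal_plus)
  then have "(INF U\<in>{U. B \<subseteq> U \<and> open U}. emeasure M U) < emeasure M B + ennreal (e / 2)"
    by (subst outer_regular[OF M B, symmetric])
  then obtain W where W: "open W" "B \<subseteq> W" "emeasure M W < emeasure M B + ennreal (e / 2)"
    unfolding INF_less_iff by blast
  obtain C :: "nat \<Rightarrow> real set" where C: "disjoint_family C" "\<And>n. open (C n)" "\<And>n. connected (C n)" "W = (\<Union>n. C n)"
    by (rule open_real_components_sequence[OF W(1)]) (rule that)
  define V where "V n = (if C n = {} then {} else cball (G (SOME x. x \<in> C n)) (measure M (C n)))" for n :: nat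
  have "G ` W \<subseteq> (\<Union>n. V n)"
  proof
    fix y assume "y \<in> G ` W"
    then obtain n x where x: "x \<in> C n" "y = G x" using C(4) by blast
    define z where "z = (SOME x. x \<in> C n)"
    have z: "z \<in> C n" unfolding z_def using x(1) by (rule someI)
    have "\<bar>G b - G a\<bar> \<le> measure M (C n)" if ab: "a \<in> C n" "b \<in> C n" "a \<le> b" for a b
    proof -
      have "x \<in> C n" if "x \<in> {a<..b}" for x
        using connectedD_interval[OF C(3)[of n] ab(1,2), of x] that by simp
      then have "{a<..b} \<subseteq> C n" by (rule subsetI)
      then have "measure M {a<..b} \<le> measure M (C n)"
        using C(2) by (intro finite_measure_mono meas)
      then show ?thesis using G[OF ab(3)] by linarith
    qed
    from this[OF x(1) z] this[OF z x(1)] have "dist (G z) (G x) \<le> measure M (C n)"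
      by (cases "x \<le> z") (auto simp: dist_real_def abs_minus_commute)
    then have "y \<in> V n" using x z unfolding V_def z_def by auto
    then show "y \<in> (\<Union>n. V n)" by (rule UN_I[OF UNIV_I])
  qed
  then have cover: "G ` B \<subseteq> (\<Union>n. V n)" using W(2) by blast
  have "emeasure lborel (V n) \<le> 2 * emeasure M (C n)" for n
  proof (cases "C n = {}")
    case False
    have "emeasure lborel (V n) = ennreal (2 * measure M (C n))"
      using False by (simp add: V_def cball_eq_atLeastAtMost emeasure_lborel_Icc_eq)
    then show ?thesis by (simp add: emeasure_eq_measure ennreal_mult)
  qed (simp add: V_def)
  then have "suminf (\<lambda>n. emeasure lborel (V n)) \<le> suminf (\<lambda>n. 2 * emeasure M (C n))"
    by (intro suminf_le) auto
  also have "\<dots> = 2 * suminf (\<lambda>n. emeasure M (C n))" by simp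
  also have "suminf (\<lambda>n. emeasure M (C n)) = emeasure M W"
    unfolding C(4) using C(1,2) meas by (intro suminf_emeasure) auto
  finally have le: "suminf (\<lambda>n. emeasure lborel (V n)) \<le> 2 * emeasure M W" .
  have V: "V n \<in> sets lborel" for n by (simp add: V_def)
  have "emeasure lborel (\<Union>n. V n) \<le> suminf (\<lambda>n. emeasure lborel (V n))"
    using V by (intro emeasure_subadditive_countably) auto
  also note le
  also have "2 * emeasure M W \<le> 2 * (emeasure M B + ennreal (e / 2))"
    using W(3) by (intro mult_left_mono) auto
  also have "\<dots> = 2 * emeasure M B + ennreal e"
    using e by (simp add: distrib_left flip: ennreal_mult' ennreal_numeral)
  finally have "emeasure lborel (\<Union>n. V n) \<le> 2 * emeasure M B + ennreal e" .
  moreover have "(\<Union>n. V n) \<in> sets borel" using V by auto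
  ultimately show ?thesis using that cover by blast
qed

lemma negligible_image_dominated:
  fixes G :: "real \<Rightarrow> real" and M :: "real measure"
  assumes M: "sets M = sets borel" "emeasure M (space M) \<noteq> \<infinity>" "absolutely_continuous lborel M"
    and G: "\<And>s t. s \<le> t \<Longrightarrow> \<bar>G t - G s\<bar> \<le> measure M {s<..t}"
    and N: "negligible N"
  shows "negligible (G ` N)"
  unfolding negligible_outer_le
proof (intro allI impI)
  fix e :: real assume e: "0 < e"
  obtain N' where N': "N \<subseteq> N'" "N' \<in> null_sets lborel"
    using N by (auto simp: negligible_iff_null_sets null_sets_completion_iff2)
  then have "emeasure M N' = 0"
    using M(3) by (auto simp: absolutely_continuous_def)
  moreover have B: "N' \<in> sets borel" using N' by auto
  ultimately obtain V where V: "V \<in> sets borel" "G ` N' \<subseteq> V" "emeasure lborel V \<le> ennreal e"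
    using emeasure_image_cover[OF M(1,2) G B e] by (metis add.left_neutral mult_zero_right)
  have "emeasure lebesgue V \<le> ennreal e" using V by (simp add: emeasure_completion)
  then have "V \<in> lmeasurable" "measure lebesgue V \<le> e"
    using V(1) e by (auto intro!: fmeasurableI simp: measure_def enn2real_leI order_le_less_trans[OF _ ennreal_less_top])
  then show "\<exists>T. G ` N \<subseteq> T \<and> T \<in> lmeasurable \<and> measure lebesgue T \<le> e"
    using V(2) N'(1) by blast
qed

text \<open>
  The singular part of \<open>M\<close> lives on a null set \<open>E\<close> of maximal measure, whose image under \<open>G\<close> is
  negligible.  So the increments of \<open>G\<close> only see the absolutely continuous part of \<open>M\<close>.
\<close>

lemma absolutely_continuous_part:
  fixes M :: "real measure"
  assumes M: "sets M = sets borel" "emeasure M (space M) \<noteq> \<infinity>"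
  obtains E f where "E \<in> null_sets lborel" "f \<in> borel_measurable lborel"
    "\<And>A. A \<in> sets borel \<Longrightarrow> emeasure M (A - E) = (\<integral>\<^sup>+x\<in>A. f x \<partial>lborel)"
proof -
  interpret finite_measure M using M(2) by (rule finite_measureI)
  have sp: "space M = UNIV" using M(1) by (metis sets_eq_imp_space_eq space_borel)
  let ?S = "emeasure M ` null_sets lborel"
  have "?S \<noteq> {}" by blast
  \<comment> \<open>The union of a maximizing sequence of null sets is again null, so the supremum
    is attained by \<open>E\<close>.\<close>
  then obtain g :: "nat \<Rightarrow> ennreal" where g: "range g \<subseteq> ?S" "Sup ?S = (SUP i. g i)"
    using ennreal_Sup_countable_SUP[of ?S] by metis
  then have "\<forall>i. \<exists>N. N \<in> null_sets lborel \<and> g i = emeasure M N" by blast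
  then obtain N where N: "\<And>i. N i \<in> null_sets lborel" "\<And>i. g i = emeasure M (N i)" by metis
  define E where "E = (\<Union>i. N i)"
  have E: "E \<in> null_sets lborel" unfolding E_def using N(1) by (intro null_sets_UN) auto
  have inM: "A \<in> sets M" if "A \<in> null_sets lborel" for A
    using null_setsD2[OF that] M(1) by simp
  have sup: "Sup ?S \<le> emeasure M E"
    unfolding g(2) N(2) using inM N(1) E by (intro SUP_least emeasure_mono) (auto simp: E_def)
  define M' where "M' = density M (indicator (- E))"
  have Ein: "E \<in> sets M" using inM E by blast
  have M': "emeasure M' A = emeasure M (A - E)" if "A \<in> sets borel" for A
  proof -
    have "emeasure M' A = emeasure M (A \<inter> - E)"
      unfolding M'_def using that M(1) Ein sp
      by (subst emeasure_restricted) (auto simp: Int_commute)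
    then show ?thesis by (simp only: Diff_eq)
  qed
  have sets': "sets M' = sets lborel" by (simp add: M'_def M)
  have "absolutely_continuous lborel M'"
    unfolding absolutely_continuous_def
  proof
    fix A :: "real set" assume A: "A \<in> null_sets lborel"
    \<comment> \<open>If \<open>A - E\<close> had positive measure, the null set
      \<open>E \<union> A\<close> would exceed the supremum.\<close>
    then have "E \<union> A \<in> null_sets lborel" using E by auto
    then have "emeasure M (E \<union> A) \<le> Sup ?S" by (intro Sup_upper) blast
    also note sup
    finally have le: "emeasure M (E \<union> A) \<le> emeasure M E" .
    have "emeasure M (E \<union> A) = emeasure M E + emeasure M (A - E)"
      using plus_emeasure[OF Ein, of "A - E"] inM[OF A] Ein by (simp add: Un_Diff_cancel)
    then have "emeasure M (A - E) = 0"
      using le emeasure_finite[of E] ennreal_add_left_cancel_le[of "emeasure M E" "emeasure M (A - E)" 0] by simp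
    then show "A \<in> null_sets M'" using A M' sets' by (auto simp: null_sets_def)
  qed
  then obtain f where f: "f \<in> borel_measurable lborel" "density lborel f = M'"
    using sigma_finite_measure.Radon_Nikodym[OF sigma_finite_lborel] sets' by blast
  have "emeasure M (A - E) = (\<integral>\<^sup>+x\<in>A. f x \<partial>lborel)" if "A \<in> sets borel" for A
    using M'[OF that] emeasure_density[OF f(1), of A] that unfolding f(2) by simp
  then show ?thesis using that E f(1) by blast
qed

section \<open>Stieltjes measures and indefinite integrals\<close>

lemma real_density:
  fixes f :: "real \<Rightarrow> ennreal"
  assumes f: "f \<in> borel_measurable lborel" and fin: "(\<integral>\<^sup>+x. f x \<partial>lborel) \<noteq> \<infinity>"
  shows "integrable lborel (\<lambda>x. enn2real (f x))"
    "\<And>A. A \<in> sets borel \<Longrightarrow> (\<integral>\<^sup>+x\<in>A. f x \<partial>lborel) = ennreal (LINT x:A|lborel. enn2real (f x))"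
proof -
  have "AE x in lborel. f x \<noteq> \<infinity>" by (rule nn_integral_PInf_AE[OF f fin])
  then have ae: "AE x in lborel. ennreal (enn2real (f x)) = f x"
    by eventually_elim (simp add: less_top)
  have "(\<integral>\<^sup>+x. ennreal (enn2real (f x)) \<partial>lborel) = (\<integral>\<^sup>+x. f x \<partial>lborel)"
    by (rule nn_integral_cong_AE[OF ae])
  then show int: "integrable lborel (\<lambda>x. enn2real (f x))"
    using fin f by (intro integrableI_nonneg) (auto simp: less_top)
  fix A :: "real set" assume A: "A \<in> sets borel"
  have "set_integrable lborel A (\<lambda>x. enn2real (f x))"
    unfolding set_integrable_def using A int by (intro integrable_mult_indicator) auto
  then have "ennreal (LINT x:A|lborel. enn2real (f x)) = (\<integral>\<^sup>+x. ennreal (indicator A x *\<^sub>R enn2real (f x)) \<partial>lborel)"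
    unfolding set_lebesgue_integral_def set_integrable_def
    by (intro nn_integral_eq_integral[symmetric]) auto
  also have "\<dots> = (\<integral>\<^sup>+x\<in>A. f x \<partial>lborel)"
  proof (intro nn_integral_cong_AE)
    show "AE x in lborel. ennreal (indicator A x *\<^sub>R enn2real (f x)) = f x * indicator A x"
      using ae by eventually_elim (auto split: split_indicator)
  qed
  finally show "(\<integral>\<^sup>+x\<in>A. f x \<partial>lborel) = ennreal (LINT x:A|lborel. enn2real (f x))" ..
qed

lemma emeasure_interval_measure_UNIV:
  fixes F :: "real \<Rightarrow> real"
  assumes mono: "\<And>x y. x \<le> y \<Longrightarrow> F x \<le> F y" and cont: "\<And>a. continuous (at_right a) F"
    and "a \<le> b" and const: "\<And>t. b \<le> t \<Longrightarrow> F t = F b" "\<And>t. t \<le> a \<Longrightarrow> F t = F a"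
  shows "emeasure (interval_measure F) UNIV = ennreal (F b - F a)"
proof -
  let ?M = "interval_measure F"
  have L: "{a - real n<..a} \<in> null_sets ?M" "{b<..b + real n} \<in> null_sets ?M" for n :: nat
    using emeasure_interval_measure_Ioc[of "a - real n" a F, OF _ mono cont]
      emeasure_interval_measure_Ioc[of b "b + real n" F, OF _ mono cont]
      const(2)[of "a - real n"] const(1)[of "b + real n"]
    by (auto simp: null_sets_def)
  then have null: "(\<Union>n::nat. {a - real n<..a}) \<union> (\<Union>n::nat. {b<..b + real n}) \<in> null_sets ?M" (is "?N \<in> _")
    by (intro null_sets.Un null_sets_UN)
  have "x \<in> {a<..b} \<union> ?N" for x
  proof -
    obtain n where n: "\<bar>x\<bar> + \<bar>a\<bar> + \<bar>b\<bar> < real n" using reals_Archimedean2 by blast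
    consider "x \<le> a" | "x \<in> {a<..b}" | "b < x" by force
    then show ?thesis
    proof cases
      case 1
      then have "x \<in> {a - real n<..a}" using n by auto
      then show ?thesis by blast
    next
      case 3
      then have "x \<in> {b<..b + real n}" using n by auto
      then show ?thesis by blast
    qed blast
  qed
  then have "UNIV = {a<..b} \<union> ?N" by blast
  then have "emeasure ?M UNIV = emeasure ?M {a<..b}"
    using emeasure_Un_null_set[OF _ null, of "{a<..b}"] by simp
  then show ?thesis using emeasure_interval_measure_Ioc[OF \<open>a \<le> b\<close> mono cont] by simp
qed

lemma dominated_right_continuous:
  fixes G :: "real \<Rightarrow> real"
  assumes M: "sets M = sets borel" "finite_measure M"
    and G: "\<And>s t. s \<le> t \<Longrightarrow> \<bar>G t - G s\<bar> \<le> measure M {s<..t}"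
  shows "continuous (at_right a) G"
proof -
  interpret finite_measure M by (rule M(2))
  have "((\<lambda>t. G t - G a) \<longlongrightarrow> 0) (at_right a)"
  proof (rule tendsto_at_right_sequentially[of a "a + 1"])
    fix S :: "nat \<Rightarrow> real" assume S: "\<And>n. a < S n" "\<And>n. S n < a + 1" "decseq S" "S \<longlonglongrightarrow> a"
    have "(\<lambda>n. measure M {a<..S n}) \<longlonglongrightarrow> measure M (\<Inter>n. {a<..S n})"
    proof (rule finite_Lim_measure_decseq)
      show "range (\<lambda>n. {a<..S n}) \<subseteq> sets M" by (auto simp: M)
      show "decseq (\<lambda>n. {a<..S n})"
        using S(3) unfolding decseq_def by (force intro: order_trans)
    qed
    moreover have "(\<Inter>n. {a<..S n}) = {}"
    proof -
      have False if "x \<in> (\<Inter>n. {a<..S n})" for x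
      proof -
        have "x \<le> S n" for n using that by auto
        then have "x \<le> a" using S(4) by (intro LIMSEQ_le_const) auto
        then show False using that by auto
      qed
      then show ?thesis by blast
    qed
    ultimately have "(\<lambda>n. measure M {a<..S n}) \<longlonglongrightarrow> 0" by simp
    then show "(\<lambda>n. G (S n) - G a) \<longlonglongrightarrow> 0"
    proof (rule Lim_null_comparison[rotated])
      show "\<forall>\<^sub>F n in sequentially. norm (G (S n) - G a) \<le> measure M {a<..S n}"
        using G[OF less_imp_le[OF S(1)]] by simp
    qed
  qed simp
  then have "(G \<longlongrightarrow> G a) (at_right a)" by (simp add: LIM_zero_iff)
  then show ?thesis by (simp add: continuous_within)
qed

text \<open>The core of the Banach-Zarecki theorem: split \<open>[s, t]\<close> along the null set
  \<open>E\<close> that carries the singular part. Values on \<open>E\<close> are negligible by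
  \<open>null\<close>; those off \<open>E\<close> are covered using the density alone. The factor 2
  is inherited from the covering lemma.\<close>

lemma lusin_increments:
  fixes F G :: "real \<Rightarrow> real"
  assumes mono: "\<And>x y. x \<le> y \<Longrightarrow> F x \<le> F y" and cont: "\<And>a. continuous (at_right a) F"
    and "a \<le> b" and const: "\<And>t. b \<le> t \<Longrightarrow> F t = F b" "\<And>t. t \<le> a \<Longrightarrow> F t = F a"
    and G: "continuous_on UNIV G" "\<And>s t. s \<le> t \<Longrightarrow> \<bar>G t - G s\<bar> \<le> F t - F s"
    and null: "\<And>N. negligible N \<Longrightarrow> negligible (G ` N)"
  obtains h where "\<And>x. 0 \<le> h x" "integrable lborel h" "(LINT x|lborel. h x) \<le> F b - F a"
    "\<And>s t. s \<le> t \<Longrightarrow> \<bar>G t - G s\<bar> \<le> 2 * (LINT x:{s..t}|lborel. h x)"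
proof -
  let ?M = "interval_measure F"
  have UN: "emeasure ?M UNIV = ennreal (F b - F a)"
    by (rule emeasure_interval_measure_UNIV[OF mono cont \<open>a \<le> b\<close> const])
  have M: "sets ?M = sets borel" "emeasure ?M (space ?M) \<noteq> \<infinity>" using UN by auto
  have dom: "\<bar>G t - G s\<bar> \<le> measure ?M {s<..t}" if "s \<le> t" for s t
    using G(2)[OF that] measure_interval_measure_Ioc[OF that mono cont] by simp
  obtain E f where E: "E \<in> null_sets lborel" and f: "f \<in> borel_measurable lborel"
    and Ef: "\<And>A. A \<in> sets borel \<Longrightarrow> emeasure ?M (A - E) = (\<integral>\<^sup>+x\<in>A. f x \<partial>lborel)"
    using absolutely_continuous_part[OF M] by metis
  have "(\<integral>\<^sup>+x. f x \<partial>lborel) = emeasure ?M (UNIV - E)" using Ef[of UNIV] by simp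
  also have "\<dots> \<le> emeasure ?M UNIV" by (intro emeasure_mono) auto
  finally have le: "(\<integral>\<^sup>+x. f x \<partial>lborel) \<le> ennreal (F b - F a)" unfolding UN .
  then have fin: "(\<integral>\<^sup>+x. f x \<partial>lborel) \<noteq> \<infinity>" by (auto simp: top_unique)
  note h = real_density[OF f fin]
  show ?thesis
  proof (rule that[of "\<lambda>x. enn2real (f x)"])
    have "ennreal (LINT x|lborel. enn2real (f x)) \<le> ennreal (F b - F a)"
      using h(2)[of UNIV] le by (simp add: set_lebesgue_integral_def)
    then show "(LINT x|lborel. enn2real (f x)) \<le> F b - F a"
      using mono[OF \<open>a \<le> b\<close>] by simp
    fix s t :: real assume st: "s \<le> t"
    show "\<bar>G t - G s\<bar> \<le> 2 * (LINT x:{s..t}|lborel. enn2real (f x))" (is "_ \<le> 2 * ?I")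
    proof (rule field_le_epsilon)
      fix e :: real assume "0 < e"
      have I0: "0 \<le> ?I" unfolding set_lebesgue_integral_def by (intro integral_nonneg_AE) auto
      have B: "{s..t} - E \<in> sets borel" using E by auto
      obtain V where V: "V \<in> sets borel" "G ` ({s..t} - E) \<subseteq> V"
         "emeasure lborel V \<le> 2 * emeasure ?M ({s..t} - E) + e"
        by (rule emeasure_image_cover[OF M dom B \<open>0 < e\<close>])
      have "emeasure lborel V \<le> ennreal (2 * ?I + e)"
        using V(3) Ef[of "{s..t}"] h(2)[of "{s..t}"] I0 \<open>0 < e\<close>
        by (simp add: ennreal_mult ennreal_plus flip: ennreal_numeral)
      then have le: "emeasure lebesgue V \<le> ennreal (2 * ?I + e)"
        using V(1) by (simp add: emeasure_completion)
      then have Vm: "V \<in> lmeasurable" "measure lebesgue V \<le> 2 * ?I + e"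
        using V(1) I0 \<open>0 < e\<close> order_le_less_trans[OF le ennreal_less_top]
        by (auto intro!: fmeasurableI enn2real_leI simp: measure_def)
      have "negligible E" using E by (simp add: negligible_iff_null_sets null_sets_completionI)
      then have nE: "negligible (G ` E)" by (rule null)
      note Gm = negligible_imp_measurable[OF nE]
      \<comment> \<open>Intermediate values: each number between \<open>G s\<close> and
        \<open>G t\<close> is taken on or off \<open>E\<close>. Comparing measures bounds the
        increment.\<close>
      have sub: "{min (G s) (G t)..max (G s) (G t)} \<subseteq> V \<union> G ` E"
      proof
        fix y assume "y \<in> {min (G s) (G t)..max (G s) (G t)}"
        then have "(G s \<le> y \<and> y \<le> G t) \<or> (G t \<le> y \<and> y \<le> G s)" by (auto simp: min_def max_def split: if_splits)
        then obtain x where x: "x \<in> {s..t}" "G x = y"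
          using IVT'[of G s y t] IVT2'[of G t y s] st continuous_on_subset[OF G(1)] by auto
        then show "y \<in> V \<union> G ` E" using V(2) by (cases "x \<in> E") auto
      qed
      have "measure lebesgue {min (G s) (G t)..max (G s) (G t)} \<le> measure lebesgue (V \<union> G ` E)"
        using Vm(1) Gm by (intro measure_mono_fmeasurable[OF sub] fmeasurable.Un) auto
      also have "\<dots> \<le> measure lebesgue V + measure lebesgue (G ` E)"
        using Vm(1) Gm by (intro measure_Un_le fmeasurableD)
      also have "\<dots> \<le> 2 * ?I + e" using Vm(2) negligible_imp_measure0[OF nE] by simp
      finally show "\<bar>G t - G s\<bar> \<le> 2 * ?I + e" by (simp add: max_def min_def split: if_splits)
    qed
  qed (use h(1) in auto)
qed

lemma set_integral_eq_diff_measure: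
  assumes M: "finite_measure M" "sets M = sets borel" and "s \<le> t"
  shows "measure M {s<..t} = measure M {..t} - measure M {..s::real}"
proof -
  interpret finite_measure M by (rule M(1))
  have "{..t} = {..s} \<union> {s<..t}" using \<open>s \<le> t\<close> by auto
  then show ?thesis using finite_measure_Union[of "{..s}" "{s<..t}"] M(2) by (auto simp: Int_def)
qed

text \<open>With \<open>H\<close> the distribution function of the measure with density
  \<open>h\<close>, both \<open>H + G\<close> and \<open>H - G\<close> are increasing and their
  Stieltjes measures add up to twice that measure. Hence they are absolutely continuous, and
  \<open>g\<close> is the density of \<open>H + G\<close> minus \<open>h\<close>. The constant 3 is
  2 for this density plus 1 for \<open>h\<close>.\<close>

lemma dominated_increments_integral:
  fixes G h :: "real \<Rightarrow> real"
  assumes h: "\<And>x. 0 \<le> h x" "integrable lborel h"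
    and G: "\<And>s t. s \<le> t \<Longrightarrow> \<bar>G t - G s\<bar> \<le> (LINT x:{s..t}|lborel. h x)"
  obtains g where "integrable lborel g" "(LINT x|lborel. \<bar>g x\<bar>) \<le> 3 * (LINT x|lborel. h x)"
    "\<And>s t. s \<le> t \<Longrightarrow> G t - G s = (LINT x:{s..t}|lborel. g x)"
proof -
  have hm: "h \<in> borel_measurable lborel" using h(2) by auto
  define M where "M = density lborel (\<lambda>x. ennreal (h x))"
  have setsM: "sets M = sets borel" by (simp add: M_def)
  have setint: "set_integrable lborel A k" if "A \<in> sets borel" "integrable lborel k" for A and k :: "real \<Rightarrow> real"
    unfolding set_integrable_def using that by (intro integrable_mult_indicator) auto
  have eM: "emeasure M A = ennreal (LINT x:A|lborel. h x)" if "A \<in> sets borel" for A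
  proof -
    have "emeasure M A = (\<integral>\<^sup>+x. ennreal (indicator A x *\<^sub>R h x) \<partial>lborel)"
      using that hm unfolding M_def
      by (subst emeasure_density) (auto intro!: nn_integral_cong split: split_indicator)
    also have "\<dots> = ennreal (LINT x:A|lborel. h x)"
      using setint[OF that h(2)] h(1) unfolding set_lebesgue_integral_def set_integrable_def
      by (intro nn_integral_eq_integral) auto
    finally show ?thesis .
  qed
  have sp: "space M = UNIV" by (simp add: M_def)
  have finM: "finite_measure M" using eM[of UNIV] sp by (intro finite_measureI) simp
  interpret M: finite_measure M by (rule finM)
  have nn: "0 \<le> (LINT x:A|lborel. h x)" for A
    unfolding set_lebesgue_integral_def using h(1) by (intro integral_nonneg_AE) auto
  have mM: "measure M A = (LINT x:A|lborel. h x)" if "A \<in> sets borel" for A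
    using eM[OF that] nn by (simp add: measure_def)
  have Ioc: "(LINT x:{s..t}|lborel. k x) = (LINT x:{s<..t}|lborel. k x)" 
    if k: "k \<in> borel_measurable lborel" for s t and k :: "real \<Rightarrow> real"
  proof -
    have "AE x in lborel. x \<noteq> s" by (rule AE_lborel_singleton)
    then show ?thesis unfolding set_lebesgue_integral_def
    proof (intro integral_cong_AE)
      show "AE x in lborel. indicat_real {s..t} x *\<^sub>R k x = indicat_real {s<..t} x *\<^sub>R k x"
        using \<open>AE x in lborel. x \<noteq> s\<close> by eventually_elim (auto split: split_indicator)
    qed (use k in auto)
  qed
  define H where "H t = measure M {..t}" for t
  have Hd: "H t - H s = measure M {s<..t}" if "s \<le> t" for s t
    unfolding H_def using set_integral_eq_diff_measure[OF finM setsM that] by simp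
  have Gd: "\<bar>G t - G s\<bar> \<le> measure M {s<..t}" if "s \<le> t" for s t
    using G[OF that] mM[of "{s<..t}"] Ioc[OF hm, of s t] by simp
  have contH: "continuous (at_right a) H" for a
    by (rule dominated_right_continuous[OF setsM finM]) (simp add: Hd)
  have contG: "continuous (at_right a) G" for a
    by (rule dominated_right_continuous[OF setsM finM Gd])
  define K where "K = (\<lambda>t. H t + G t)"
  define K' where "K' = (\<lambda>t. H t - G t)"
  have mono: "K x \<le> K y" "K' x \<le> K' y" if "x \<le> y" for x y
    using Hd[OF that] Gd[OF that] by (auto simp: K_def K'_def)
  have cont: "continuous (at_right a) K" "continuous (at_right a) K'" for a
    unfolding K_def K'_def by (intro continuous_intros contH contG)+
  let ?N = "interval_measure K" and ?N' = "interval_measure K'"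
  have N: "emeasure ?N {s<..t} = ennreal (K t - K s)" "emeasure ?N' {s<..t} = ennreal (K' t - K' s)" if "s \<le> t" for s t
    using emeasure_interval_measure_Ioc[OF that mono(1) cont(1)]
      emeasure_interval_measure_Ioc[OF that mono(2) cont(2)] by auto
  have m: "measure ?N {s<..t} + measure ?N' {s<..t} = 2 * measure M {s<..t}" for s t
  proof (cases "s \<le> t")
    case True
    then have "measure ?N {s<..t} + measure ?N' {s<..t} = 2 * (H t - H s)"
      using N[OF True] mono[OF True] by (simp add: measure_def) (simp add: K_def K'_def)
    then show ?thesis using Hd[OF True] by simp
  qed simp
  \<comment> \<open>The identity is known on half-open intervals and extends to Borel sets by
    Dynkin's argument. Intersecting with a bounded interval keeps both Stieltjes measures finite, as
    complements require.\<close>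
  have P: "measure ?N (A \<inter> {c<..d}) + measure ?N' (A \<inter> {c<..d}) = 2 * measure M (A \<inter> {c<..d})"
    if cd: "c \<le> d" and A: "A \<in> sets borel" for A c d
  proof -
    have fin: "emeasure ?N (A \<inter> {c<..d}) \<noteq> \<infinity>" "emeasure ?N' (A \<inter> {c<..d}) \<noteq> \<infinity>" for A
      using emeasure_mono[of "A \<inter> {c<..d}" "{c<..d}" ?N] emeasure_mono[of "A \<inter> {c<..d}" "{c<..d}" ?N'] N[OF cd]
      by (auto simp: top_unique)
    have finD: "emeasure ?N {c<..d} \<noteq> \<infinity>" "emeasure ?N' {c<..d} \<noteq> \<infinity>" using N[OF cd] by auto
    let ?G = "range (\<lambda>(a, b). {a<..b::real})"
    have borel: "sets borel = sigma_sets UNIV ?G"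
      by (subst borel_sigma_sets_Ioc) (rule sets_measure_of, simp)
    have "Int_stable ?G"
      unfolding Int_stable_def
    proof (intro ballI)
      fix x y assume "x \<in> ?G" "y \<in> ?G"
      then obtain a b a' b' where "x = {a<..b}" "y = {a'<..b'}" by auto
      then have "x \<inter> y = (\<lambda>(a, b). {a<..b}) (max a a', min b b')" by auto
      then show "x \<inter> y \<in> ?G" by blast
    qed
    moreover have "?G \<subseteq> Pow UNIV" by simp
    moreover have "A \<in> sigma_sets UNIV ?G" using A borel by simp
    ultimately show ?thesis
    proof (induction rule: sigma_sets_induct_disjoint)
      case (basic A)
      then obtain a b where "A = {a<..b}" by auto
      then have "A \<inter> {c<..d} = {max a c<..min b d}" by auto
      then show ?case using m by simp
    next
      case (compl A)
      then have A: "A \<in> sets borel" using borel by simp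
      have eq: "(UNIV - A) \<inter> {c<..d} = {c<..d} - A \<inter> {c<..d}" by auto
      show ?case
        unfolding eq using compl.IH m[of c d] A finD
        by (subst measure_Diff, auto simp: setsM)+
    next
      case (union A)
      have A: "range (\<lambda>i. A i \<inter> {c<..d}) \<subseteq> sets borel" 
      proof safe
        fix i
        have "A i \<in> sets borel" using union(2) unfolding borel by blast
        then show "A i \<inter> {c<..d} \<in> sets borel" by simp
      qed
      have dis: "disjoint_family (\<lambda>i. A i \<inter> {c<..d})"
        using union(1) by (auto simp: disjoint_family_on_def)
      have eq: "(\<Union>i. A i) \<inter> {c<..d} = (\<Union>i. A i \<inter> {c<..d})" by auto
      have "(\<lambda>i. measure ?N (A i \<inter> {c<..d}) + measure ?N' (A i \<inter> {c<..d})) sums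
         (measure ?N (\<Union>i. A i \<inter> {c<..d}) + measure ?N' (\<Union>i. A i \<inter> {c<..d}))"
        using A dis fin[of "\<Union>i. A i"] unfolding eq by (intro sums_add measure_UNION) auto
      moreover have "(\<lambda>i. 2 * measure M (A i \<inter> {c<..d})) sums (2 * measure M (\<Union>i. A i \<inter> {c<..d}))"
        using A dis setsM by (intro sums_mult M.finite_measure_UNION) auto
      ultimately show ?case unfolding eq union(3) by (rule sums_unique2)
    qed simp
  qed
  have ac: "absolutely_continuous lborel ?N"
    unfolding absolutely_continuous_def
  proof
    fix A :: "real set" assume A: "A \<in> null_sets lborel"
    then have Ab: "A \<in> sets borel" by auto
    have "A \<inter> {- real n<..real n} \<in> null_sets ?N" for n :: nat
    proof -
      have nn: "- real n \<le> real n" by simp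
      have B: "A \<inter> {- real n<..real n} \<in> null_sets lborel" using A by (intro null_set_Int2) auto
      have "AE x in lborel. x \<notin> A \<inter> {- real n<..real n}" by (rule AE_not_in[OF B])
      then have "measure M (A \<inter> {- real n<..real n}) = 0"
        unfolding mM[OF null_setsD2[OF B, simplified]] set_lebesgue_integral_def
      proof (intro integral_eq_zero_AE)
        show "AE x in lborel. indicat_real (A \<inter> {- real n<..real n}) x *\<^sub>R h x = 0"
          using \<open>AE x in lborel. x \<notin> A \<inter> {- real n<..real n}\<close> by eventually_elim (auto split: split_indicator)
      qed
      then have "measure ?N (A \<inter> {- real n<..real n}) = 0"
        using P[OF nn Ab] measure_nonneg[of ?N "A \<inter> {- real n<..real n}"]
          measure_nonneg[of ?N' "A \<inter> {- real n<..real n}"] by linarith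
      moreover have "emeasure ?N (A \<inter> {- real n<..real n}) < top"
        using emeasure_mono[of "A \<inter> {- real n<..real n}" "{- real n<..real n}" ?N] N(1)[OF nn]
        by (simp add: order_le_less_trans)
      ultimately have "emeasure ?N (A \<inter> {- real n<..real n}) = 0"
        by (metis emeasure_eq_ennreal_measure ennreal_0 less_irrefl)
      then show ?thesis using Ab by (auto simp: null_sets_def)
    qed
    then have "(\<Union>n::nat. A \<inter> {- real n<..real n}) \<in> null_sets ?N" by (rule null_sets_UN)
    moreover have "A = (\<Union>n::nat. A \<inter> {- real n<..real n})"
    proof -
      have "x \<in> (\<Union>n::nat. {- real n<..real n})" for x
      proof -
        obtain n where "\<bar>x\<bar> < real n" using reals_Archimedean2 by blast
        then have "x \<in> {- real n<..real n}" by auto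
        then show ?thesis by blast
      qed
      then show ?thesis by blast
    qed
    ultimately show "A \<in> null_sets ?N" by simp
  qed
  then obtain f where f: "f \<in> borel_measurable lborel" "density lborel f = ?N"
    using sigma_finite_measure.Radon_Nikodym[OF sigma_finite_lborel, of ?N] by auto
  have ef: "(\<integral>\<^sup>+x\<in>A. f x \<partial>lborel) = emeasure ?N A" if "A \<in> sets borel" for A
    using emeasure_density[OF f(1), of A] that unfolding f(2) by simp
  have tot: "emeasure ?N UNIV \<le> ennreal (2 * measure M UNIV)"
  proof -
    have "(\<Union>n::nat. {- real n<..real n}) = UNIV"
    proof -
      have "x \<in> (\<Union>n::nat. {- real n<..real n})" for x
      proof -
        obtain n where "\<bar>x\<bar> < real n" using reals_Archimedean2 by blast
        then have "x \<in> {- real n<..real n}" by auto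
        then show ?thesis by blast
      qed
      then show ?thesis by blast
    qed
    moreover have "incseq (\<lambda>n::nat. {- real n<..real n})" by (auto simp: incseq_def)
    ultimately have "emeasure ?N UNIV = (SUP n::nat. emeasure ?N {- real n<..real n})"
      using SUP_emeasure_incseq[of "\<lambda>n::nat. {- real n<..real n}" ?N] by (simp add: image_subset_iff)
    also have "\<dots> \<le> ennreal (2 * measure M UNIV)"
    proof (rule SUP_least)
      fix n :: nat
      have nn: "- real n \<le> real n" by simp
      have "K (real n) - K (- real n) \<le> 2 * measure M {- real n<..real n}"
        using Hd[OF nn] Gd[OF nn] by (simp add: K_def)
      also have "\<dots> \<le> 2 * measure M UNIV" using M.finite_measure_mono[of _ UNIV] setsM by simp
      finally show "emeasure ?N {- real n<..real n} \<le> ennreal (2 * measure M UNIV)"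
        unfolding N(1)[OF nn] by (rule ennreal_leI)
    qed
    finally show ?thesis .
  qed
  have fin: "(\<integral>\<^sup>+x. f x \<partial>lborel) \<noteq> \<infinity>" using ef[of UNIV] tot by (auto simp: top_unique)
  note rd = real_density[OF f(1) fin]
  define g where "g x = enn2real (f x) - h x" for x
  have gm: "g \<in> borel_measurable lborel" unfolding g_def using f(1) hm by measurable
  show ?thesis
  proof (rule that[of g])
    show gi: "integrable lborel g" unfolding g_def by (intro Bochner_Integration.integrable_diff rd(1) h(2))
    have mU: "measure M UNIV = (LINT x|lborel. h x)" using mM[of UNIV] by (simp add: set_lebesgue_integral_def)
    have "ennreal (LINT x|lborel. enn2real (f x)) \<le> ennreal (2 * measure M UNIV)"
      using rd(2)[of UNIV] ef[of UNIV] tot by (simp add: set_lebesgue_integral_def)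
    then have le: "(LINT x|lborel. enn2real (f x)) \<le> 2 * (LINT x|lborel. h x)"
      unfolding mU[symmetric] by (subst (asm) ennreal_le_iff) auto
    have "(LINT x|lborel. \<bar>g x\<bar>) \<le> (LINT x|lborel. enn2real (f x) + h x)"
      using gi rd(1) h by (intro integral_mono) (auto simp: g_def abs_le_iff)
    also have "\<dots> = (LINT x|lborel. enn2real (f x)) + (LINT x|lborel. h x)"
      by (rule Bochner_Integration.integral_add[OF rd(1) h(2)])
    finally show "(LINT x|lborel. \<bar>g x\<bar>) \<le> 3 * (LINT x|lborel. h x)" using le by simp
    fix s t :: real assume st: "s \<le> t"
    have A: "{s<..t} \<in> sets borel" by simp
    have "ennreal (LINT x:{s<..t}|lborel. enn2real (f x)) = ennreal (K t - K s)"
      using rd(2)[OF A] ef[OF A] N(1)[OF st] by simp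
    moreover have "0 \<le> (LINT x:{s<..t}|lborel. enn2real (f x))"
      unfolding set_lebesgue_integral_def by (intro integral_nonneg_AE) auto
    ultimately have "(LINT x:{s<..t}|lborel. enn2real (f x)) = K t - K s"
      using mono(1)[OF st] by simp
    moreover have "(LINT x:{s<..t}|lborel. h x) = H t - H s" using mM[OF A] Hd[OF st] by simp
    moreover have "(LINT x:{s<..t}|lborel. g x) = (LINT x:{s<..t}|lborel. enn2real (f x)) - (LINT x:{s<..t}|lborel. h x)"
      unfolding g_def by (rule set_integral_diff) (intro setint A rd(1) h(2))+
    ultimately show "G t - G s = (LINT x:{s..t}|lborel. g x)"
      unfolding Ioc[OF gm] by (simp add: K_def)
  qed
qed

text \<open>Reduction to the global lemmas: \<open>G\<close> and \<open>\<Phi>\<close> are extended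
  by constants through the clamping map \<open>c\<close>, and the extension of \<open>\<Phi>\<close>
  is made right continuous. The constant 6 is 2 from \<open>lusin_increments\<close> times 3 from
  \<open>dominated_increments_integral\<close>.\<close>

theorem lusin_imp_indefinite_integral:
  fixes G \<Phi> :: "real \<Rightarrow> real"
  assumes ab: "a \<le> b" and cont: "continuous_on {a..b} G"
    and dom: "\<And>s t. a \<le> s \<Longrightarrow> s \<le> t \<Longrightarrow> t \<le> b \<Longrightarrow> \<bar>G t - G s\<bar> \<le> \<Phi> t - \<Phi> s"
    and null: "\<And>N. N \<subseteq> {a..b} \<Longrightarrow> negligible N \<Longrightarrow> negligible (G ` N)"
  obtains g where "g absolutely_integrable_on {a..b}"
    "\<And>s t. a \<le> s \<Longrightarrow> s \<le> t \<Longrightarrow> t \<le> b \<Longrightarrow> (g has_integral (G t - G s)) {s..t}"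
    "integral {a..b} (\<lambda>x. \<bar>g x\<bar>) \<le> 6 * (\<Phi> b - \<Phi> a)"
proof -
  define c where "c u = max a (min b u)" for u
  have c: "c u \<in> {a..b}" "u \<in> {a..b} \<Longrightarrow> c u = u" for u using ab by (auto simp: c_def)
  have cmono: "c u \<le> c w" if "u \<le> w" for u w using that by (auto simp: c_def)
  define G' where "G' u = G (c u)" for u
  define P where "P u = \<Phi> (c u)" for u
  have contG: "continuous_on UNIV G'"
    unfolding G'_def c_def
    by (rule continuous_on_compose2[OF cont]) (use ab in \<open>auto intro!: continuous_intros\<close>)
  have domP: "\<bar>G' t - G' s\<bar> \<le> P t - P s" if "s \<le> t" for s t
    unfolding G'_def P_def using dom c(1) cmono[OF that] by auto
  have monoP: "P s \<le> P t" if "s \<le> t" for s t using domP[OF that] by linarith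
  \<comment> \<open>The right limit of \<open>P\<close>, since \<open>interval_measure\<close> needs
    a right-continuous function. Continuity of \<open>G\<close> preserves the domination.\<close>
  define F where "F u = Inf (P ` {u<..})" for u
  have bdd: "bdd_below (P ` {u<..})" for u
    using monoP[of u] by (intro bdd_belowI2[of _ "P u"]) auto
  have ne: "P ` {u<..} \<noteq> {}" for u :: real using gt_ex[of u] by auto
  have FP: "F u \<le> P w" if "u < w" for u w unfolding F_def using that by (intro cInf_lower bdd) auto
  have PF: "P u \<le> F u" for u unfolding F_def using monoP[of u] by (intro cInf_greatest ne) auto
  have ex: "\<exists>w>u. P w < F u + e" if "0 < e" for u e
    using cInf_lessD[OF ne, of u "F u + e"] that by (auto simp: F_def)
  have monoF: "F x \<le> F y" if "x \<le> y" for x y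
    using FP[of x y] PF[of y] that by (cases "x = y") auto
  have contF: "continuous (at_right u) F" for u
  proof -
    have "(F \<longlongrightarrow> F u) (at_right u)"
    proof (rule tendstoI)
      fix e :: real assume "0 < e"
      then obtain w where w: "u < w" "P w < F u + e" using ex by blast
      have "dist (F x) (F u) < e" if "u < x" "x < w" for x
        using monoF[of u x] FP[of x w] that w by (simp add: dist_real_def)
      then show "\<forall>\<^sub>F x in at_right u. dist (F x) (F u) < e"
        using w(1) by (auto simp: eventually_at_right[OF w(1)])
    qed
    then show ?thesis by (simp add: continuous_within)
  qed
  have Fb: "F t = \<Phi> b" if "b \<le> t" for t
  proof -
    have "P w = \<Phi> b" if "w > t" for w using that \<open>b \<le> t\<close> ab by (simp add: P_def c_def)
    then have "P ` {t<..} = (\<lambda>_. \<Phi> b) ` {t<..}" by (intro image_cong) auto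
    then show ?thesis using gt_ex[of t] by (simp add: F_def)
  qed
  \<comment> \<open>The right limit at \<open>a\<close> may exceed \<open>\<Phi> a\<close>. Starting
    at \<open>a - 1\<close> includes this jump, so that the total mass is
    \<open>\<Phi> b - \<Phi> a\<close>.\<close>
  have Fa: "F t = \<Phi> a" if "t \<le> a - 1" for t
  proof (rule antisym)
    show "F t \<le> \<Phi> a" using FP[of t a] that ab by (simp add: P_def c_def)
    show "\<Phi> a \<le> F t" using PF[of t] that ab by (simp add: P_def c_def)
  qed
  have domF: "\<bar>G' t - G' s\<bar> \<le> F t - F s" if "s \<le> t" for s t
  proof (cases "s = t")
    case False
    then have "s < t" using that by simp
    have le: "\<bar>G' t - G' v\<bar> \<le> F t - F s" if v: "s < v" "v < t" for v
    proof (rule field_le_epsilon)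
      fix e :: real assume "0 < e"
      then obtain w where w: "t < w" "P w < F t + e" using ex by blast
      have "\<bar>G' t - G' v\<bar> \<le> P t - P v" using v by (intro domP) simp
      also have "\<dots> \<le> P w - P v" using w by (simp add: monoP)
      also have "\<dots> \<le> F t + e - F s" using w(2) FP[OF v(1)] by linarith
      finally show "\<bar>G' t - G' v\<bar> \<le> F t - F s + e" by simp
    qed
    have "(G' \<longlongrightarrow> G' s) (at_right s)"
      using contG by (metis UNIV_I at_le continuous_on_eq_continuous_within continuous_within subset_UNIV tendsto_mono)
    then have "((\<lambda>v. \<bar>G' t - G' v\<bar>) \<longlongrightarrow> \<bar>G' t - G' s\<bar>) (at_right s)"
      by (intro tendsto_intros)
    moreover have "\<forall>\<^sub>F v in at_right s. \<bar>G' t - G' v\<bar> \<le> F t - F s"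
      using le \<open>s < t\<close> by (auto simp: eventually_at_right[OF \<open>s < t\<close>])
    ultimately show ?thesis by (intro tendsto_upperbound) auto
  qed simp
  have nullG: "negligible (G' ` N)" if N: "negligible N" for N
  proof -
    have "G' ` N \<subseteq> G ` (N \<inter> {a..b}) \<union> {G a, G b}"
      by (auto simp: G'_def c_def max_def min_def)
    moreover have "negligible (G ` (N \<inter> {a..b}))" using N by (intro null) (auto intro: negligible_Int)
    ultimately show ?thesis by (meson negligible_Un negligible_finite finite.emptyI finite.insertI negligible_subset)
  qed
  obtain h where h: "\<And>x. 0 \<le> h x" "integrable lborel h" "(LINT x|lborel. h x) \<le> F b - F (a - 1)"
    "\<And>s t. s \<le> t \<Longrightarrow> \<bar>G' t - G' s\<bar> \<le> 2 * (LINT x:{s..t}|lborel. h x)"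
  proof (rule lusin_increments[OF monoF contF _ _ _ contG domF nullG, of "a - 1" b])
    show "a - 1 \<le> b" using ab by simp
    show "F t = F b" if "b \<le> t" for t using Fb that by simp
    show "F t = F (a - 1)" if "t \<le> a - 1" for t using Fa that by simp
  qed (assumption | rule that)+
  have h2: "\<bar>G' t - G' s\<bar> \<le> (LINT x:{s..t}|lborel. 2 * h x)" if "s \<le> t" for s t
    using h(4)[OF that] by simp
  obtain g where g: "integrable lborel g" "(LINT x|lborel. \<bar>g x\<bar>) \<le> 3 * (LINT x|lborel. 2 * h x)"
    "\<And>s t. s \<le> t \<Longrightarrow> G' t - G' s = (LINT x:{s..t}|lborel. g x)"
  proof (rule dominated_increments_integral[of "\<lambda>x. 2 * h x" G'])
    show "0 \<le> 2 * h x" for x using h(1) by simp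
    show "integrable lborel (\<lambda>x. 2 * h x)" using h(2) by simp
  qed (use h2 that in auto)
  have si: "set_integrable lborel {s..t} g" for s t
    unfolding set_integrable_def using g(1) by (intro integrable_mult_indicator) auto
  show ?thesis
  proof (rule that[of g])
    show ai: "g absolutely_integrable_on {a..b}"
    proof -
      have "integrable lborel (\<lambda>x. indicat_real {a..b} x *\<^sub>R g x)"
        using si[of a b] by (simp only: set_integrable_def)
      then show ?thesis
        unfolding set_integrable_def
        by (subst integrable_completion) (auto intro: borel_measurable_integrable)
    qed
    show "(g has_integral (G t - G s)) {s..t}" if "a \<le> s" "s \<le> t" "t \<le> b" for s t
    proof -
      have "integral {s..t} g = G' t - G' s"
        using set_borel_integral_eq_integral(2)[OF si] g(3)[OF that(2)] by simp
      moreover have "G' t = G t" "G' s = G s" using that c(2) by (auto simp: G'_def)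
      ultimately show ?thesis
        using set_borel_integral_eq_integral(1)[OF si, of s t] by (metis integrable_integral)
    qed
    have gi: "integrable lborel (\<lambda>x. \<bar>g x\<bar>)" using g(1) by simp
    have "integral {a..b} (\<lambda>x. \<bar>g x\<bar>) = (LINT x:{a..b}|lborel. \<bar>g x\<bar>)"
      using set_borel_integral_eq_integral(2)[of "{a..b}" "\<lambda>x. \<bar>g x\<bar>"] set_integrable_abs[OF si] by simp
    also have "\<dots> \<le> (LINT x|lborel. \<bar>g x\<bar>)"
      unfolding set_lebesgue_integral_def using gi
      by (intro integral_mono integrable_mult_indicator) (auto split: split_indicator)
    also have "\<dots> \<le> 6 * (LINT x|lborel. h x)" using g(2) by simp
    also have "\<dots> \<le> 6 * (\<Phi> b - \<Phi> a)" using h(3) Fa[of "a - 1"] Fb[of b] by simp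
    finally show "integral {a..b} (\<lambda>x. \<bar>g x\<bar>) \<le> 6 * (\<Phi> b - \<Phi> a)" .
  qed
qed

section \<open>Test functions\<close>

text \<open>Coinduction in disguise: it suffices to find a class of differentiable functions that
  contains the given one and is closed under \<open>deriv\<close>.\<close>

lemma smoothI:
  assumes "\<phi> \<in> S" and S: "\<And>f t. f \<in> S \<Longrightarrow> f field_differentiable at t" "\<And>f. f \<in> S \<Longrightarrow> deriv f \<in> S"
  shows "smooth \<phi>"
proof -
  have "(deriv ^^ k) \<phi> \<in> S" for k by (induction k) (simp_all add: assms)
  then show ?thesis unfolding smooth_def using S(1) by blast
qed

lemma smooth_deriv:
  assumes "smooth f"
  shows "smooth (deriv f)" "(f has_real_derivative deriv f t) (at t)"
proof -
  have *: "(deriv ^^ Suc k) f field_differentiable at t" for k t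
    using assms unfolding smooth_def by blast
  show "smooth (deriv f)" unfolding smooth_def using *[unfolded funpow_Suc_right o_def] by blast
  have "(deriv ^^ 0) f field_differentiable at t" using assms unfolding smooth_def by blast
  then show "(f has_real_derivative deriv f t) (at t)"
    by (simp add: field_differentiable_derivI)
qed

lemma smooth_isCont: "smooth f \<Longrightarrow> isCont f t"
  using smooth_deriv(2) DERIV_isCont by blast

lemma smooth_continuous_on: "smooth f \<Longrightarrow> continuous_on S f"
  by (simp add: smooth_isCont continuous_at_imp_continuous_on)

lemma smooth_antiderivative:
  assumes N: "\<And>x. (N has_real_derivative f x) (at x)" and f: "smooth f"
  shows "smooth N"
proof (rule smoothI[where S = "insert N {g. smooth g}"])
  show "N \<in> insert N {g. smooth g}" by simp
  fix g assume g: "g \<in> insert N {g. smooth g}"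
  show "g field_differentiable at t" for t
    using g N smooth_deriv(2) unfolding field_differentiable_def by blast
  have "deriv N = f" using N by (auto intro: DERIV_imp_deriv)
  then show "deriv g \<in> insert N {g. smooth g}" using g f smooth_deriv(1) by auto
qed

lemma smooth_affine:
  assumes "smooth f"
  shows "smooth (\<lambda>x. c * f (m * x + p))"
proof (rule smoothI[where S = "{\<lambda>x. c * g (m * x + p) | c g. smooth g}"])
  show "(\<lambda>x. c * f (m * x + p)) \<in> {\<lambda>x. c * g (m * x + p) | c g. smooth g}" using assms by blast
  fix h assume "h \<in> {\<lambda>x. c * g (m * x + p) | c g. smooth g}"
  then obtain c g where h: "h = (\<lambda>x. c * g (m * x + p))" "smooth g" by blast
  have D: "(h has_real_derivative (c * m) * deriv g (m * t + p)) (at t)" for t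
    unfolding h(1) by (rule derivative_eq_intros DERIV_chain2[OF smooth_deriv(2)[OF h(2)]] refl)+ simp
  then show "h field_differentiable at t" for t unfolding field_differentiable_def by blast
  have "deriv h = (\<lambda>t. (c * m) * deriv g (m * t + p))" using D by (auto intro: DERIV_imp_deriv)
  then show "deriv h \<in> {\<lambda>x. c * g (m * x + p) | c g. smooth g}" using smooth_deriv(1)[OF h(2)] by blast
qed

lemma smooth_add:
  assumes "smooth f" "smooth g"
  shows "smooth (\<lambda>x. f x + g x)"
proof (rule smoothI[where S = "{\<lambda>x. f x + g x | f g. smooth f \<and> smooth g}"])
  show "(\<lambda>x. f x + g x) \<in> {\<lambda>x. f x + g x | f g. smooth f \<and> smooth g}" using assms by blast
  fix h assume "h \<in> {\<lambda>x. f x + g x | f g. smooth f \<and> smooth g}"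
  then obtain f g where h: "h = (\<lambda>x. f x + g x)" "smooth f" "smooth g" by blast
  have D: "(h has_real_derivative deriv f t + deriv g t) (at t)" for t
    unfolding h(1) by (intro DERIV_add smooth_deriv(2) h)
  then show "h field_differentiable at t" for t unfolding field_differentiable_def by blast
  have "deriv h = (\<lambda>t. deriv f t + deriv g t)" using D by (auto intro: DERIV_imp_deriv)
  then show "deriv h \<in> {\<lambda>x. f x + g x | f g. smooth f \<and> smooth g}"
    using smooth_deriv(1)[OF h(2)] smooth_deriv(1)[OF h(3)] by blast
qed

text \<open>Products of smooth functions are not closed under \<open>deriv\<close>, but their sums
  are, by the Leibniz rule.\<close>

inductive_set product_sums :: "(real \<Rightarrow> real) set" where
  mult: "smooth f \<Longrightarrow> smooth g \<Longrightarrow> (\<lambda>x. f x * g x) \<in> product_sums"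
| add: "u \<in> product_sums \<Longrightarrow> w \<in> product_sums \<Longrightarrow> (\<lambda>x. u x + w x) \<in> product_sums"

lemma product_sums_deriv:
  assumes "h \<in> product_sums"
  shows "\<exists>h'\<in>product_sums. \<forall>t. (h has_real_derivative h' t) (at t)"
  using assms
proof induction
  case (mult f g)
  have "(\<lambda>t. deriv f t * g t + f t * deriv g t) \<in> product_sums"
    by (intro product_sums.intros smooth_deriv mult)
  moreover have "((\<lambda>x. f x * g x) has_real_derivative deriv f t * g t + f t * deriv g t) (at t)" for t
    using DERIV_mult[OF smooth_deriv(2)[OF mult(1)] smooth_deriv(2)[OF mult(2)], of t]
    by (simp add: add.commute mult.commute)
  ultimately show ?case by (intro bexI[rotated] allI)
next
  case (add u w)
  then obtain u' w' where "u' \<in> product_sums" "\<And>t. (u has_real_derivative u' t) (at t)"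
    "w' \<in> product_sums" "\<And>t. (w has_real_derivative w' t) (at t)" by blast
  then have "(\<lambda>t. u' t + w' t) \<in> product_sums" "\<And>t. ((\<lambda>x. u x + w x) has_real_derivative u' t + w' t) (at t)"
    by (auto intro: product_sums.add DERIV_add)
  then show ?case by (intro bexI[rotated] allI)
qed

lemma smooth_mult:
  assumes "smooth f" "smooth g"
  shows "smooth (\<lambda>x. f x * g x)"
proof (rule smoothI[where S = product_sums])
  show "(\<lambda>x. f x * g x) \<in> product_sums" by (rule product_sums.mult[OF assms])
  fix h assume h: "h \<in> product_sums"
  obtain h' where h': "h' \<in> product_sums" "\<And>t. (h has_real_derivative h' t) (at t)"
    using product_sums_deriv[OF h] by blast
  then show "h field_differentiable at t" for t unfolding field_differentiable_def by blast
  have "deriv h = h'" using h'(2) by (auto intro: DERIV_imp_deriv)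
  then show "deriv h \<in> product_sums" using h'(1) by simp
qed

text \<open>The classical flat function \<open>exp (- (1 / t))\<close>. The polynomial in
  \<open>1 / t\<close> closes the family under differentiation.\<close>

definition exp_step :: "real poly \<Rightarrow> real \<Rightarrow> real" where
  "exp_step p t = (if 0 < t then poly p (1 / t) * exp (- (1 / t)) else 0)"

lemma poly_times_exp_minus_tendsto_0: "((\<lambda>y. poly p y * exp (- y)) \<longlongrightarrow> (0::real)) at_top"
proof -
  have eq: "poly p y * exp (- y) = (\<Sum>i\<le>degree p. coeff p i * (y ^ i / exp y))" for y
    unfolding poly_altdef sum_distrib_right by (intro sum.cong refl) (simp add: exp_minus field_simps)
  have "((\<lambda>y. \<Sum>i\<le>degree p. coeff p i * (y ^ i / exp y)) \<longlongrightarrow> (\<Sum>i\<le>degree p. coeff p i * 0)) at_top"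
    by (intro tendsto_sum tendsto_mult tendsto_const tendsto_power_div_exp_0)
  then show ?thesis unfolding eq by simp
qed

text \<open>With \<open>s = 1 / t\<close>, the derivative in \<open>t\<close> is
  \<open>- s^2\<close> times the derivative in \<open>s\<close>, which explains the factor
  \<open>[:0, 0, 1:]\<close> and the sign of \<open>p - pderiv p\<close>. At 0 the quotient vanishes
  in the limit because the exponential beats every polynomial.\<close>

lemma exp_step_has_derivative:
  "(exp_step p has_real_derivative exp_step ([:0, 0, 1:] * (p - pderiv p)) t) (at t)"
proof -
  consider "0 < t" | "t < 0" | "t = 0" by linarith
  then show ?thesis
  proof cases
    case 1
    have "((\<lambda>t. poly p (1 / t) * exp (- (1 / t))) has_real_derivative
      exp_step ([:0, 0, 1:] * (p - pderiv p)) t) (at t)"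
      using 1 by (auto intro!: derivative_eq_intros DERIV_chain2[OF poly_DERIV]
          simp: exp_step_def field_simps power2_eq_square)
    moreover have "\<forall>\<^sub>F u in nhds t. 0 < u"
      using eventually_nhds_in_open[of "{0<..}" t] 1 by simp
    then have "\<forall>\<^sub>F u in nhds t. exp_step p u = poly p (1 / u) * exp (- (1 / u))"
      by eventually_elim (simp add: exp_step_def)
    ultimately show ?thesis by (subst DERIV_cong_ev[OF refl _ refl])
  next
    case 2
    have "\<forall>\<^sub>F u in nhds t. u < 0"
      using eventually_nhds_in_open[of "{..<0}" t] 2 by simp
    then have "\<forall>\<^sub>F u in nhds t. exp_step p u = 0"
      by eventually_elim (simp add: exp_step_def)
    moreover have "((\<lambda>_. 0) has_real_derivative exp_step ([:0, 0, 1:] * (p - pderiv p)) t) (at t)"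
      using 2 by (simp add: exp_step_def)
    ultimately show ?thesis by (subst DERIV_cong_ev[OF refl _ refl])
  next
    case 3
    have "((\<lambda>h. exp_step p h / h) \<longlongrightarrow> 0) (at 0)"
    proof (rule filterlim_split_at)
      have "\<forall>\<^sub>F h in at_left (0::real). h < 0" by (simp add: eventually_at_filter)
      then have "\<forall>\<^sub>F h in at_left 0. 0 = exp_step p h / h"
        by eventually_elim (simp add: exp_step_def)
      then show "((\<lambda>h. exp_step p h / h) \<longlongrightarrow> 0) (at_left 0)"
        by (rule Lim_transform_eventually[OF tendsto_const])
      have "((\<lambda>y. poly ([:0, 1:] * p) y * exp (- y)) \<longlongrightarrow> 0) at_top"
        by (rule poly_times_exp_minus_tendsto_0)
      then have lim: "((\<lambda>h. poly ([:0, 1:] * p) (inverse h) * exp (- inverse h)) \<longlongrightarrow> 0) (at_right 0)"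
        by (rule filterlim_compose[OF _ filterlim_inverse_at_top_right])
      have "\<forall>\<^sub>F h in at_right (0::real). 0 < h" by (simp add: eventually_at_filter)
      then have "\<forall>\<^sub>F h in at_right 0. poly ([:0, 1:] * p) (inverse h) * exp (- inverse h) = exp_step p h / h"
        by eventually_elim (simp add: exp_step_def field_simps)
      then show "((\<lambda>h. exp_step p h / h) \<longlongrightarrow> 0) (at_right 0)"
        by (rule Lim_transform_eventually[OF lim])
    qed
    moreover have "exp_step q 0 = 0" for q by (simp add: exp_step_def)
    ultimately show ?thesis unfolding 3 by (simp add: has_field_derivative_iff)
  qed
qed

lemma smooth_exp_step: "smooth (exp_step p)"
proof (rule smoothI[where S = "range exp_step"])
  show "exp_step p \<in> range exp_step" by simp
  fix h assume "h \<in> range exp_step"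
  then obtain q where q: "h = exp_step q" by blast
  show "h field_differentiable at t" for t
    using exp_step_has_derivative unfolding q field_differentiable_def by blast
  have "deriv h = exp_step ([:0, 0, 1:] * (q - pderiv q))"
    unfolding q using exp_step_has_derivative by (intro ext DERIV_imp_deriv)
  then show "deriv h \<in> range exp_step" by simp
qed

text \<open>The parameter \<open>m\<close> steepens both edges: for \<open>m\<close> tending to
  infinity the bumps approach the indicator of the open interval while keeping their
  support.\<close>

definition smooth_bump :: "real \<Rightarrow> real \<Rightarrow> real \<Rightarrow> real \<Rightarrow> real" where
  "smooth_bump m s t r = exp_step 1 (m * (r - s)) * exp_step 1 (m * (t - r))"

lemma smooth_smooth_bump: "smooth (smooth_bump m s t)"
proof -
  have "smooth (\<lambda>r. (1 * exp_step 1 (m * r + (- m * s))) * (1 * exp_step 1 ((- m) * r + m * t)))"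
    by (intro smooth_mult smooth_affine smooth_exp_step)
  then show ?thesis by (simp add: smooth_bump_def[abs_def] algebra_simps)
qed

lemma smooth_bump_simps:
  assumes "0 < m"
  shows "0 \<le> smooth_bump m s t r" "smooth_bump m s t r \<le> 1"
    "0 < smooth_bump m s t r \<longleftrightarrow> s < r \<and> r < t" "r \<notin> {s<..<t} \<Longrightarrow> smooth_bump m s t r = 0"
proof -
  have e: "0 \<le> exp_step 1 x" "exp_step 1 x \<le> 1" "0 < exp_step 1 x \<longleftrightarrow> 0 < x" for x
    by (auto simp: exp_step_def)
  show "0 \<le> smooth_bump m s t r" "smooth_bump m s t r \<le> 1"
    unfolding smooth_bump_def using e by (auto intro: mult_le_one)
  show "0 < smooth_bump m s t r \<longleftrightarrow> s < r \<and> r < t"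
    unfolding smooth_bump_def using e assms
    by (auto simp: zero_less_mult_iff order.strict_iff_order[of 0 "exp_step 1 _"] dest: leD)
  then show "r \<notin> {s<..<t} \<Longrightarrow> smooth_bump m s t r = 0"
    using \<open>0 \<le> smooth_bump m s t r\<close> by auto
qed

lemma smooth_bump_tendsto_1:
  assumes "s < r" "r < t"
  shows "(\<lambda>n. smooth_bump (real (Suc n)) s t r) \<longlonglongrightarrow> 1"
proof -
  have e: "(\<lambda>n. exp_step 1 (real (Suc n) * x)) \<longlonglongrightarrow> 1" if "0 < x" for x
  proof -
    have "(\<lambda>n. exp (- (inverse x * inverse (real (Suc n))))) \<longlonglongrightarrow> exp (- (inverse x * 0))"
      by (intro tendsto_intros LIMSEQ_inverse_real_of_nat)
    moreover have "exp (- (inverse x * inverse (real (Suc n)))) = exp_step 1 (real (Suc n) * x)" for n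
      using mult_pos_pos[of "real (Suc n)" x] that unfolding exp_step_def by (simp add: field_simps)
    ultimately show ?thesis by simp
  qed
  have "(\<lambda>n. smooth_bump (real (Suc n)) s t r) \<longlonglongrightarrow> 1 * 1"
    unfolding smooth_bump_def using assms by (intro tendsto_mult e) auto
  then show ?thesis by simp
qed

lemma test_functionsI:
  assumes "smooth \<phi>" "\<And>r. r \<notin> {c..d} \<Longrightarrow> \<phi> r = 0" "{c..d} \<subseteq> \<Omega>"
  shows "\<phi> \<in> test_functions \<Omega>"
proof -
  have "{t. \<phi> t \<noteq> 0} \<subseteq> {c..d}" using assms(2) by blast
  then have sub: "closure {t. \<phi> t \<noteq> 0} \<subseteq> {c..d}" by (intro closure_minimal) auto
  then have "bounded (closure {t. \<phi> t \<noteq> 0})" using bounded_closed_interval bounded_subset by blast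
  then have "compact (closure {t. \<phi> t \<noteq> 0})" by (simp add: compact_eq_bounded_closed)
  then show ?thesis using assms sub by (auto simp: test_functions_def)
qed

lemma test_functions_support:
  assumes "\<phi> \<in> test_functions \<Omega>"
  shows "smooth \<phi>" "r \<notin> closure {t. \<phi> t \<noteq> 0} \<Longrightarrow> (deriv ^^ k) \<phi> r = 0"
proof -
  show "smooth \<phi>" using assms by (simp add: test_functions_def)
  let ?S = "closure {t. \<phi> t \<noteq> 0}"
  have "r \<notin> ?S \<Longrightarrow> (deriv ^^ k) \<phi> r = 0" for r
  proof (induction k arbitrary: r)
    case 0
    then show ?case using closure_subset by force
  next
    case (Suc k)
    have "\<forall>\<^sub>F u in nhds r. u \<in> - ?S" using Suc.prems by (intro eventually_nhds_in_open) auto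
    then have ev: "\<forall>\<^sub>F u in nhds r. (deriv ^^ k) \<phi> u = 0"
      by eventually_elim (use Suc.IH in auto)
    have "((deriv ^^ k) \<phi> has_real_derivative 0) (at r)"
      by (subst DERIV_cong_ev[OF refl ev refl]) simp
    then show ?case by (simp add: DERIV_imp_deriv)
  qed
  then show "r \<notin> ?S \<Longrightarrow> (deriv ^^ k) \<phi> r = 0" .
qed

lemma antiderivative_from_left:
  fixes f :: "real \<Rightarrow> real"
  assumes f: "continuous_on UNIV f" "\<And>x. x \<le> l \<Longrightarrow> f x = 0"
  obtains N where "\<And>x. (N has_real_derivative f x) (at x)" "\<And>x. x \<le> l \<Longrightarrow> N x = 0"
proof -
  \<comment> \<open>Starting at \<open>l - 1\<close> makes every point from \<open>l\<close> on
    interior to the range of integration, so its derivative there is two-sided.\<close>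
  define N where "N x = integral {l - 1..x} f" for x
  have N0: "N x = 0" if "x \<le> l" for x
  proof -
    have "N x = integral {l - 1..x} (\<lambda>_. 0)" unfolding N_def
      by (rule integral_cong) (use that f(2) in auto)
    then show ?thesis by simp
  qed
  have "(N has_real_derivative f x) (at x)" for x
  proof (cases "x < l")
    case True
    have "\<forall>\<^sub>F u in nhds x. u \<in> {..<l}" using True by (intro eventually_nhds_in_open) auto
    then have ev: "\<forall>\<^sub>F u in nhds x. N u = 0" by eventually_elim (use N0 in auto)
    show ?thesis using True f(2) by (subst DERIV_cong_ev[OF refl ev refl]) simp
  next
    case False
    have "(N has_real_derivative f x) (at x within {l - 1..x + 1})"
      unfolding N_def using False
      by (intro integral_has_real_derivative continuous_on_subset[OF f(1)]) auto
    then show ?thesis using False by (simp add: at_within_Icc_at)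
  qed
  then show ?thesis using that N0 by blast
qed

section \<open>Integration by parts against indefinite integrals\<close>

text \<open>Bisection: the estimate with a fixed \<open>e\<close> is additive over adjacent
  intervals and holds for all short intervals around each point, hence for \<open>[a, b]\<close>;
  then \<open>e\<close> is arbitrary.\<close>

lemma interval_additive_eq_0:
  fixes D :: "real \<Rightarrow> real \<Rightarrow> 'b::real_normed_vector"
  assumes "a \<le> b" and add: "\<And>s t u. a \<le> s \<Longrightarrow> s \<le> t \<Longrightarrow> t \<le> u \<Longrightarrow> u \<le> b \<Longrightarrow> D s u = D s t + D t u"
    and loc: "\<And>e x. 0 < e \<Longrightarrow> x \<in> {a..b} \<Longrightarrow>
      \<exists>d>0. \<forall>s t. a \<le> s \<and> s \<le> x \<and> x \<le> t \<and> t \<le> b \<and> t - s < d \<longrightarrow> norm (D s t) \<le> e * (Q t - Q s)"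
  shows "D a b = 0"
proof (rule ccontr)
  assume nz: "D a b \<noteq> 0"
  have le: "norm (D a b) \<le> e * (Q b - Q a)" if e: "0 < e" for e :: real
  proof -
    have "a \<le> a \<and> b \<le> b \<longrightarrow> norm (D a b) \<le> e * (Q b - Q a)"
    proof (rule Bolzano[OF \<open>a \<le> b\<close>, where P = "\<lambda>s t. a \<le> s \<and> t \<le> b \<longrightarrow> norm (D s t) \<le> e * (Q t - Q s)"])
      fix s t u
      assume *: "a \<le> s \<and> t \<le> b \<longrightarrow> norm (D s t) \<le> e * (Q t - Q s)"
        "a \<le> t \<and> u \<le> b \<longrightarrow> norm (D t u) \<le> e * (Q u - Q t)" "s \<le> t" "t \<le> u"
      show "a \<le> s \<and> u \<le> b \<longrightarrow> norm (D s u) \<le> e * (Q u - Q s)"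
      proof
        assume **: "a \<le> s \<and> u \<le> b"
        then have "norm (D s u) \<le> norm (D s t) + norm (D t u)"
          using add[of s t u] * norm_triangle_ineq by auto
        also have "\<dots> \<le> e * (Q t - Q s) + e * (Q u - Q t)" using * ** by (intro add_mono) auto
        finally show "norm (D s u) \<le> e * (Q u - Q s)" by (simp add: algebra_simps)
      qed
    next
      fix x assume x: "a \<le> x" "x \<le> b"
      obtain d where d: "d > 0"
        "\<And>s t. a \<le> s \<Longrightarrow> s \<le> x \<Longrightarrow> x \<le> t \<Longrightarrow> t \<le> b \<Longrightarrow> t - s < d \<Longrightarrow> norm (D s t) \<le> e * (Q t - Q s)"
        using loc[OF e, of x] x by auto
      show "\<exists>d>0. \<forall>s t. s \<le> x \<and> x \<le> t \<and> t - s < d \<longrightarrow> a \<le> s \<and> t \<le> b \<longrightarrow> norm (D s t) \<le> e * (Q t - Q s)"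
        using d by (intro exI[of _ d]) auto
    qed
    then show ?thesis by simp
  qed
  \<comment> \<open>Chosen to give the contradiction that the norm is at most half of itself; adding
    1 keeps the denominator positive.\<close>
  let ?e = "norm (D a b) / (2 * (\<bar>Q b - Q a\<bar> + 1))"
  have pos: "0 < ?e" using nz abs_ge_zero[of "Q b - Q a"] by (intro divide_pos_pos mult_pos_pos) (simp_all add: add_nonneg_pos)
  have "norm (D a b) \<le> ?e * (Q b - Q a)" by (rule le[OF pos])
  also have "\<dots> \<le> ?e * (\<bar>Q b - Q a\<bar> + 1)" using pos by (intro mult_left_mono) auto
  also have "\<dots> = norm (D a b) / 2" by (simp add: field_simps add_nonneg_eq_0_iff)
  finally show False using nz by simp
qed

lemma indefinite_integral_continuous_on:
  fixes U g :: "real \<Rightarrow> 'b::euclidean_space"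
  assumes g: "g integrable_on {a..b}" and U: "\<And>s t. a \<le> s \<Longrightarrow> s \<le> t \<Longrightarrow> t \<le> b \<Longrightarrow> (g has_integral (U t - U s)) {s..t}"
  shows "continuous_on {a..b} U"
proof -
  have eq: "U a + integral {a..t} g = U t" if "t \<in> {a..b}" for t
    using integral_unique[OF U[of a t]] that by simp
  have "continuous_on {a..b} (\<lambda>t. U a + integral {a..t} g)"
    by (intro continuous_intros indefinite_integral_continuous_1 g)
  then show ?thesis using eq by (rule continuous_on_eq)
qed

lemma absolutely_integrable_continuous_scaleR:
  fixes \<phi> :: "real \<Rightarrow> real" and g :: "real \<Rightarrow> 'b::euclidean_space"
  assumes "continuous_on {a..b} \<phi>" "g absolutely_integrable_on {a..b}"
  shows "(\<lambda>t. \<phi> t *\<^sub>R g t) absolutely_integrable_on {a..b}"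
proof (rule absolutely_integrable_bounded_measurable_product[where h = "\<lambda>c x. c *\<^sub>R x", OF _ _ _ _ assms(2)])
  show "bilinear (\<lambda>c x. c *\<^sub>R x :: 'b)"
    unfolding bilinear_def by (auto intro!: linearI simp: scaleR_add_left scaleR_add_right)
  show "\<phi> \<in> borel_measurable (lebesgue_on {a..b})"
    by (rule continuous_imp_measurable_on_sets_lebesgue[OF assms(1)]) auto
  show "bounded (\<phi> ` {a..b})"
    using assms(1) by (intro compact_imp_bounded compact_continuous_image) auto
qed auto

text \<open>\<open>U\<close> is a primitive in the integral sense and may lack a derivative at many
  points. So the defect of the product rule is treated as an additive interval function: on a short
  interval it is bounded by the oscillations of \<open>U\<close> and \<open>\<phi>\<close> times the
  mass of \<open>C + norm (g r)\<close>.\<close>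

lemma product_rule_indefinite_integral:
  fixes \<phi> \<phi>' :: "real \<Rightarrow> real" and U g :: "real \<Rightarrow> 'b::euclidean_space"
  assumes "a \<le> b" and \<phi>: "\<And>t. (\<phi> has_real_derivative \<phi>' t) (at t)" and \<phi>': "continuous_on UNIV \<phi>'"
    and g: "g absolutely_integrable_on {a..b}"
    and U: "\<And>s t. a \<le> s \<Longrightarrow> s \<le> t \<Longrightarrow> t \<le> b \<Longrightarrow> (g has_integral (U t - U s)) {s..t}"
  shows "((\<lambda>t. \<phi>' t *\<^sub>R U t + \<phi> t *\<^sub>R g t) has_integral (\<phi> b *\<^sub>R U b - \<phi> a *\<^sub>R U a)) {a..b}"
proof -
  let ?F = "\<lambda>t. \<phi>' t *\<^sub>R U t + \<phi> t *\<^sub>R g t"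
  have gi: "g integrable_on {a..b}" using g by (rule set_lebesgue_integral_eq_integral(1))
  have ngi: "(\<lambda>t. norm (g t)) integrable_on {a..b}"
    using g by (simp add: absolutely_integrable_on_def)
  note cU = indefinite_integral_continuous_on[OF gi U]
  have c\<phi>: "continuous_on S \<phi>" for S
    using \<phi> by (meson DERIV_continuous_on has_field_derivative_at_within)
  have c\<phi>': "continuous_on S \<phi>'" for S using \<phi>' continuous_on_subset by blast
  have F: "?F integrable_on {a..b}"
    by (intro integrable_add integrable_continuous_interval continuous_intros c\<phi>' cU
        set_lebesgue_integral_eq_integral(1) absolutely_integrable_continuous_scaleR c\<phi> g)
  have sub: "h integrable_on {s..t}" if "h integrable_on {a..b}" "a \<le> s" "t \<le> b" for h :: "real \<Rightarrow> 'c::euclidean_space" and s t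
    using integrable_subinterval_real[OF that(1), of s t] that by auto
  define D where "D s t = (\<phi> t *\<^sub>R U t - \<phi> s *\<^sub>R U s) - integral {s..t} ?F" for s t
  obtain C where C: "\<And>t. t \<in> {a..b} \<Longrightarrow> \<bar>\<phi>' t\<bar> \<le> C"
  proof -
    have "bounded (\<phi>' ` {a..b})" using c\<phi>' by (intro compact_imp_bounded compact_continuous_image) auto
    then show ?thesis using that unfolding bounded_iff by (metis imageI real_norm_def)
  qed
  \<comment> \<open>A primitive of the mass density against which the defect is small.\<close>
  define Q where "Q t = C * t + integral {a..t} (\<lambda>r. norm (g r))" for t
  have "D a b = 0"
  proof (rule interval_additive_eq_0[OF \<open>a \<le> b\<close>, of D "\<lambda>t. 2 * Q t"])
    fix s t u assume stu: "a \<le> s" "s \<le> t" "t \<le> u" "u \<le> b"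
    have "integral {s..t} ?F + integral {t..u} ?F = integral {s..u} ?F"
      using stu sub[OF F, of s u] by (intro Henstock_Kurzweil_Integration.integral_combine) auto
    then show "D s u = D s t + D t u" by (simp add: D_def algebra_simps)
  next
    fix e x :: real assume e: "0 < e" and x: "x \<in> {a..b}"
    obtain d1 where d1: "d1 > 0" "\<And>r. r \<in> {a..b} \<Longrightarrow> dist r x < d1 \<Longrightarrow> dist (U r) (U x) < e"
      using cU x e unfolding continuous_on_iff by metis
    obtain d2 where d2: "d2 > 0" "\<And>r. r \<in> {a..b} \<Longrightarrow> dist r x < d2 \<Longrightarrow> dist (\<phi> r) (\<phi> x) < e"
      using c\<phi>[of "{a..b}"] x e unfolding continuous_on_iff by metis
    have "norm (D s t) \<le> e * (2 * Q t - 2 * Q s)"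
      if st: "a \<le> s" "s \<le> x" "x \<le> t" "t \<le> b" "t - s < min d1 d2" for s t
    proof -
      have osc: "norm (U t - U r) \<le> 2 * e" "\<bar>\<phi> s - \<phi> r\<bar> \<le> 2 * e" if r: "r \<in> {s..t}" for r
      proof -
        have "dist r x < d1" "dist t x < d1" "dist s x < d2" "dist r x < d2"
          using r st by (auto simp: dist_real_def)
        moreover have "r \<in> {a..b}" "s \<in> {a..b}" "t \<in> {a..b}" using r st by auto
        ultimately have "dist (U r) (U x) < e" "dist (U t) (U x) < e" "dist (\<phi> s) (\<phi> x) < e" "dist (\<phi> r) (\<phi> x) < e"
          using d1(2) d2(2) by auto
        then show "norm (U t - U r) \<le> 2 * e" "\<bar>\<phi> s - \<phi> r\<bar> \<le> 2 * e"
          using dist_triangle_less_add[of "U t" "U x" e "U r" e] dist_triangle_less_add[of "\<phi> s" "\<phi> x" e "\<phi> r" e]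
          by (auto simp: dist_norm dist_commute norm_minus_commute)
      qed
      have "(\<phi>' has_integral (\<phi> t - \<phi> s)) {s..t}"
        using st \<phi> by (intro fundamental_theorem_of_calculus)
          (auto simp: has_real_derivative_iff_has_vector_derivative[symmetric] intro: has_field_derivative_at_within)
      then have 1: "((\<lambda>r. \<phi>' r *\<^sub>R U t) has_integral (\<phi> t - \<phi> s) *\<^sub>R U t) {s..t}"
        by (rule has_integral_scaleR_left)
      have 2: "((\<lambda>r. \<phi> s *\<^sub>R g r) has_integral \<phi> s *\<^sub>R (U t - U s)) {s..t}"
        using st by (intro has_integral_cmul U) auto
      have 3: "(?F has_integral (integral {s..t} ?F)) {s..t}" using sub[OF F] st by (intro integrable_integral) auto
      have D: "((\<lambda>r. (\<phi>' r *\<^sub>R U t + \<phi> s *\<^sub>R g r) - ?F r) has_integral D s t) {s..t}"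
        using has_integral_diff[OF has_integral_add[OF 1 2] 3]
        by (simp add: D_def algebra_simps)
      have "norm (D s t) \<le> integral {s..t} (\<lambda>r. 2 * e * (C + norm (g r)))"
        unfolding integral_unique[OF D, symmetric]
      proof (rule integral_norm_bound_integral)
        show "(\<lambda>r. (\<phi>' r *\<^sub>R U t + \<phi> s *\<^sub>R g r) - ?F r) integrable_on {s..t}" using D by blast
        show "(\<lambda>r. 2 * e * (C + norm (g r))) integrable_on {s..t}"
          using sub[OF ngi] st by (intro integrable_on_mult_right integrable_add) auto
        fix r assume r: "r \<in> {s..t}"
        have "(\<phi>' r *\<^sub>R U t + \<phi> s *\<^sub>R g r) - ?F r = \<phi>' r *\<^sub>R (U t - U r) + (\<phi> s - \<phi> r) *\<^sub>R g r"
          by (simp add: algebra_simps)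
        also have "norm \<dots> \<le> \<bar>\<phi>' r\<bar> * norm (U t - U r) + \<bar>\<phi> s - \<phi> r\<bar> * norm (g r)"
          by (rule order_trans[OF norm_triangle_ineq]) simp
        also have "\<dots> \<le> C * (2 * e) + (2 * e) * norm (g r)"
          using osc[OF r] C[of r] r st by (intro add_mono mult_mono) auto
        finally show "norm ((\<phi>' r *\<^sub>R U t + \<phi> s *\<^sub>R g r) - ?F r) \<le> 2 * e * (C + norm (g r))"
          by (simp add: algebra_simps)
      qed
      also have "\<dots> = 2 * e * (C * (t - s) + integral {s..t} (\<lambda>r. norm (g r)))"
        using sub[OF ngi, of s t] st by (subst integral_mult_right, subst Henstock_Kurzweil_Integration.integral_add) (auto simp: mult.commute)
      also have "integral {s..t} (\<lambda>r. norm (g r)) = integral {a..t} (\<lambda>r. norm (g r)) - integral {a..s} (\<lambda>r. norm (g r))"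
        using Henstock_Kurzweil_Integration.integral_combine[of a s t "\<lambda>r. norm (g r)"] sub[OF ngi, of a t] st by simp
      also have "2 * e * (C * (t - s) + (integral {a..t} (\<lambda>r. norm (g r)) - integral {a..s} (\<lambda>r. norm (g r)))) = e * (2 * Q t - 2 * Q s)"
        by (simp add: Q_def algebra_simps)
      finally show ?thesis .
    qed
    then show "\<exists>d>0. \<forall>s t. a \<le> s \<and> s \<le> x \<and> x \<le> t \<and> t \<le> b \<and> t - s < d \<longrightarrow> norm (D s t) \<le> e * (2 * Q t - 2 * Q s)"
      using d1(1) d2(1) by (intro exI[of _ "min d1 d2"]) auto
  qed
  then show ?thesis using integrable_integral[OF F] by (simp add: D_def)
qed

section \<open>Weak derivatives\<close>

lemma test_function_support_interval:
  assumes "\<phi> \<in> test_functions {a<..<b}" "a < (b::real)"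
  obtains c d where "a < c" "c \<le> d" "d < b" "\<And>k r. r \<notin> {c..d} \<Longrightarrow> (deriv ^^ k) \<phi> r = 0"
proof (cases "closure {t. \<phi> t \<noteq> 0} = {}")
  case True
  let ?m = "(a + b) / 2"
  show ?thesis
    by (rule that[of ?m ?m]) (use assms(2) test_functions_support(2)[OF assms(1)] True in auto)
next
  case False
  let ?S = "closure {t. \<phi> t \<noteq> 0}"
  have S: "compact ?S" "?S \<subseteq> {a<..<b}" using assms by (auto simp: test_functions_def)
  obtain c where c: "c \<in> ?S" "\<And>t. t \<in> ?S \<Longrightarrow> c \<le> t" using compact_attains_inf[OF S(1) False] by blast
  obtain d where d: "d \<in> ?S" "\<And>t. t \<in> ?S \<Longrightarrow> t \<le> d" using compact_attains_sup[OF S(1) False] by blast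
  show ?thesis
  proof (rule that[of c d])
    show "a < c" "d < b" "c \<le> d" using c d S(2) by auto
    fix k r assume "r \<notin> {c..d}"
    then have "r \<notin> ?S" using c(2) d(2) by auto
    then show "(deriv ^^ k) \<phi> r = 0" by (rule test_functions_support(2)[OF assms(1)])
  qed
qed

lemma LINT_supported:
  fixes u :: "real \<Rightarrow> 'b::euclidean_space"
  assumes "A \<subseteq> B" "\<And>r. r \<in> B - A \<Longrightarrow> \<theta> r = 0"
  shows "(LINT t:B|lebesgue. \<theta> t *\<^sub>R u t) = (LINT t:A|lebesgue. \<theta> t *\<^sub>R u t)"
  unfolding set_lebesgue_integral_def using assms
  by (intro Bochner_Integration.integral_cong refl) (auto split: split_indicator)

lemma LINT_open_interval:
  fixes h :: "real \<Rightarrow> 'b::euclidean_space"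
  assumes "h absolutely_integrable_on {a..b}"
  shows "(LINT t:{a<..<b}|lebesgue. h t) = integral {a..b} h"
proof -
  have "h absolutely_integrable_on {a<..<b}"
    using assms by (rule set_integrable_subset) auto
  then have "(LINT t:{a<..<b}|lebesgue. h t) = integral {a<..<b} h"
    by (rule set_lebesgue_integral_eq_integral(2))
  also have "\<dots> = integral {a..b} h"
    using integral_open_interval[of a b h] by simp
  finally show ?thesis .
qed

lemma smooth_funpow_deriv: "smooth \<phi> \<Longrightarrow> smooth ((deriv ^^ k) \<phi>)"
  by (induction k) (simp_all add: smooth_deriv(1))

lemma locally_integrable_onI:
  assumes "u absolutely_integrable_on \<Omega>"
  shows "locally_integrable_on \<Omega> u"
  unfolding locally_integrable_on_def
proof (intro allI impI)
  fix K :: "real set" assume "compact K \<and> K \<subseteq> \<Omega>"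
  then show "u absolutely_integrable_on K"
    by (intro set_integrable_subset[OF assms]) (auto intro: lmeasurable_compact fmeasurableD)
qed

context
  fixes a b :: real and u u' g :: "real \<Rightarrow> 'b::euclidean_space"
  assumes ab: "a < b" and g: "g absolutely_integrable_on {a..b}"
    and u: "\<And>s t. a \<le> s \<Longrightarrow> s \<le> t \<Longrightarrow> t \<le> b \<Longrightarrow> (u' has_integral (u t - u s)) {s..t}"
    and u': "\<And>s t. a \<le> s \<Longrightarrow> s \<le> t \<Longrightarrow> t \<le> b \<Longrightarrow> (g has_integral (u' t - u' s)) {s..t}"
begin

lemma indefinite_integrals_absolutely_integrable:
  "u' absolutely_integrable_on {a..b}" "u absolutely_integrable_on {a..b}"
proof -
  have "continuous_on {a..b} u'"
    by (rule indefinite_integral_continuous_on[OF set_lebesgue_integral_eq_integral(1)[OF g] u'])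
  then show 1: "u' absolutely_integrable_on {a..b}" by (rule absolutely_integrable_continuous_real)
  have "continuous_on {a..b} u"
    by (rule indefinite_integral_continuous_on[OF set_lebesgue_integral_eq_integral(1)[OF 1] u])
  then show "u absolutely_integrable_on {a..b}" by (rule absolutely_integrable_continuous_real)
qed

lemma LINT_by_parts:
  fixes V h :: "real \<Rightarrow> 'b"
  assumes \<phi>: "smooth \<phi>" "\<phi> a = 0" "\<phi> b = 0" and h: "h absolutely_integrable_on {a..b}"
    and V: "\<And>s t. a \<le> s \<Longrightarrow> s \<le> t \<Longrightarrow> t \<le> b \<Longrightarrow> (h has_integral (V t - V s)) {s..t}"
  shows "(LINT t:{a<..<b}|lebesgue. deriv \<phi> t *\<^sub>R V t) = - (LINT t:{a<..<b}|lebesgue. \<phi> t *\<^sub>R h t)"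
proof -
  note hi = set_lebesgue_integral_eq_integral(1)[OF h]
  have cV: "continuous_on {a..b} V" by (rule indefinite_integral_continuous_on[OF hi V])
  have 1: "(\<lambda>t. deriv \<phi> t *\<^sub>R V t) absolutely_integrable_on {a..b}"
    by (intro absolutely_integrable_continuous_real continuous_intros cV smooth_continuous_on smooth_deriv(1) \<phi>)
  have 2: "(\<lambda>t. \<phi> t *\<^sub>R h t) absolutely_integrable_on {a..b}"
    by (intro absolutely_integrable_continuous_scaleR smooth_continuous_on \<phi> h)
  have "((\<lambda>t. deriv \<phi> t *\<^sub>R V t + \<phi> t *\<^sub>R h t) has_integral (\<phi> b *\<^sub>R V b - \<phi> a *\<^sub>R V a)) {a..b}"
    by (rule product_rule_indefinite_integral[OF less_imp_le[OF ab] smooth_deriv(2)[OF \<phi>(1)]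
          smooth_continuous_on[OF smooth_deriv(1)[OF \<phi>(1)]] h V])
  then have "integral {a..b} (\<lambda>t. deriv \<phi> t *\<^sub>R V t + \<phi> t *\<^sub>R h t) = 0"
    using \<phi>(2,3) by (simp add: integral_unique)
  then have "integral {a..b} (\<lambda>t. deriv \<phi> t *\<^sub>R V t) + integral {a..b} (\<lambda>t. \<phi> t *\<^sub>R h t) = 0"
    using 1 2 by (subst (asm) Henstock_Kurzweil_Integration.integral_add) (auto intro: set_lebesgue_integral_eq_integral(1))
  then show ?thesis
    unfolding LINT_open_interval[OF 1] LINT_open_interval[OF 2] by (simp add: eq_neg_iff_add_eq_0)
qed

lemma has_weak_deriv_indefinite_integrals:
  "has_weak_deriv 1 {a<..<b} u u'" "has_weak_deriv 2 {a<..<b} u g"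
proof -
  note ai = indefinite_integrals_absolutely_integrable
  have li: "locally_integrable_on {a<..<b} h" if "h absolutely_integrable_on {a..b}" for h :: "real \<Rightarrow> 'b"
    by (intro locally_integrable_onI set_integrable_subset[OF that]) auto
  have zero: "smooth \<phi>" "(deriv ^^ k) \<phi> a = 0" "(deriv ^^ k) \<phi> b = 0" if \<phi>: "\<phi> \<in> test_functions {a<..<b}" for \<phi> k
  proof -
    show "smooth \<phi>" using \<phi> by (rule test_functions_support(1))
    obtain c d where "a < c" "d < b" "\<And>k r. r \<notin> {c..d} \<Longrightarrow> (deriv ^^ k) \<phi> r = 0"
      by (rule test_function_support_interval[OF \<phi> ab]) (rule that)
    then show "(deriv ^^ k) \<phi> a = 0" "(deriv ^^ k) \<phi> b = 0" by auto
  qed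
  show "has_weak_deriv 1 {a<..<b} u u'"
    unfolding has_weak_deriv_def
  proof (intro conjI ballI li ai)
    fix \<phi> assume \<phi>: "\<phi> \<in> test_functions {a<..<b}"
    show "(LINT t:{a<..<b}|lebesgue. (deriv ^^ 1) \<phi> t *\<^sub>R u t) = (- 1) ^ 1 *\<^sub>R (LINT t:{a<..<b}|lebesgue. \<phi> t *\<^sub>R u' t)"
      using LINT_by_parts[OF zero(1)[OF \<phi>] _ _ ai(1) u] zero(2,3)[OF \<phi>, of 0] by simp
  qed
  show "has_weak_deriv 2 {a<..<b} u g"
    unfolding has_weak_deriv_def
  proof (intro conjI ballI li ai g)
    fix \<phi> assume \<phi>: "\<phi> \<in> test_functions {a<..<b}"
    have "(LINT t:{a<..<b}|lebesgue. deriv (deriv \<phi>) t *\<^sub>R u t) = - (LINT t:{a<..<b}|lebesgue. deriv \<phi> t *\<^sub>R u' t)"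
      using LINT_by_parts[OF smooth_deriv(1)[OF zero(1)[OF \<phi>]] _ _ ai(1) u] zero(2,3)[OF \<phi>, of 1] by simp
    also have "(LINT t:{a<..<b}|lebesgue. deriv \<phi> t *\<^sub>R u' t) = - (LINT t:{a<..<b}|lebesgue. \<phi> t *\<^sub>R g t)"
      using LINT_by_parts[OF zero(1)[OF \<phi>] _ _ g u'] zero(2,3)[OF \<phi>, of 0] by simp
    finally show "(LINT t:{a<..<b}|lebesgue. (deriv ^^ 2) \<phi> t *\<^sub>R u t) = (- 1) ^ 2 *\<^sub>R (LINT t:{a<..<b}|lebesgue. \<phi> t *\<^sub>R g t)"
      by (simp add: numeral_2_eq_2)
  qed
qed

end

lemma has_weak_deriv_subset:
  assumes "has_weak_deriv k \<Omega> u g" "V \<subseteq> \<Omega>"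
  shows "has_weak_deriv k V u g"
proof -
  have supp: "(LINT t:\<Omega>|lebesgue. (deriv ^^ j) \<phi> t *\<^sub>R w t) = (LINT t:V|lebesgue. (deriv ^^ j) \<phi> t *\<^sub>R w t)"
    if \<phi>: "\<phi> \<in> test_functions V" for \<phi> j and w :: "real \<Rightarrow> 'a"
  proof (rule LINT_supported[OF assms(2)])
    fix r assume "r \<in> \<Omega> - V"
    then have "r \<notin> closure {t. \<phi> t \<noteq> 0}" using \<phi> by (auto simp: test_functions_def)
    then show "(deriv ^^ j) \<phi> r = 0" by (rule test_functions_support(2)[OF \<phi>])
  qed
  have sub: "test_functions V \<subseteq> test_functions \<Omega>" using assms(2) by (auto simp: test_functions_def)
  show ?thesis
    unfolding has_weak_deriv_def
  proof (intro conjI ballI)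
    show "locally_integrable_on V u" "locally_integrable_on V g"
      using assms unfolding has_weak_deriv_def locally_integrable_on_def by blast+
    fix \<phi> assume \<phi>: "\<phi> \<in> test_functions V"
    then have "(LINT t:\<Omega>|lebesgue. (deriv ^^ k) \<phi> t *\<^sub>R u t) = (- 1) ^ k *\<^sub>R (LINT t:\<Omega>|lebesgue. (deriv ^^ 0) \<phi> t *\<^sub>R g t)"
      using assms(1) sub by (auto simp: has_weak_deriv_def)
    then show "(LINT t:V|lebesgue. (deriv ^^ k) \<phi> t *\<^sub>R u t) = (- 1) ^ k *\<^sub>R (LINT t:V|lebesgue. \<phi> t *\<^sub>R g t)"
      unfolding supp[OF \<phi>] by simp
  qed
qed

section \<open>Functions whose weak derivatives vanish\<close>

lemma integral_intervals_zero_imp_AE_zero: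
  fixes g :: "real \<Rightarrow> real"
  assumes g: "integrable lborel g" and zero: "\<And>s t. s \<le> t \<Longrightarrow> (LINT x:{s<..t}|lborel. g x) = 0"
  shows "AE x in lborel. g x = 0"
proof -
  have si: "set_integrable lborel A g" if "A \<in> sets borel" for A
    unfolding set_integrable_def using that g by (intro integrable_mult_indicator) auto
  let ?G = "range (\<lambda>(a, b). {a<..b::real})"
  have borel: "sets borel = sigma_sets UNIV ?G"
    by (subst borel_sigma_sets_Ioc) (rule sets_measure_of, simp)
  have Z: "(LINT x:A|lborel. g x) = 0" if A: "A \<in> sets borel" for A
  proof -
    have tends: "(\<lambda>n::nat. LINT x:{- real n<..real n}|lborel. g x) \<longlonglongrightarrow> (LINT x:UNIV|lborel. g x)"
    proof -
      have U: "(\<Union>n::nat. {- real n<..real n}) = UNIV"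
      proof -
        have "x \<in> (\<Union>n::nat. {- real n<..real n})" for x
        proof -
          obtain n where "\<bar>x\<bar> < real n" using reals_Archimedean2 by blast
          then have "x \<in> {- real n<..real n}" by auto
          then show ?thesis by (rule UN_I[OF UNIV_I])
        qed
        then show ?thesis by blast
      qed
      have "(\<lambda>n::nat. LINT x:{- real n<..real n}|lborel. g x) \<longlonglongrightarrow> (LINT x:(\<Union>n::nat. {- real n<..real n})|lborel. g x)"
        by (rule set_integral_cont_up) (auto simp: incseq_def U intro: si)
      then show ?thesis unfolding U .
    qed
    have "(\<lambda>n::nat. LINT x:{- real n<..real n}|lborel. g x) \<longlonglongrightarrow> 0"
      using zero by simp
    then have U0: "(LINT x:UNIV|lborel. g x) = 0" using tends LIMSEQ_unique by blast
    have "Int_stable ?G"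
      unfolding Int_stable_def
    proof (intro ballI)
      fix x y assume "x \<in> ?G" "y \<in> ?G"
      then obtain a b a' b' where "x = {a<..b}" "y = {a'<..b'}" by auto
      then have "x \<inter> y = (\<lambda>(a, b). {a<..b}) (max a a', min b b')" by auto
      then show "x \<inter> y \<in> ?G" by blast
    qed
    moreover have "?G \<subseteq> Pow UNIV" by simp
    moreover have "A \<in> sigma_sets UNIV ?G" using A borel by simp
    ultimately show ?thesis
    proof (induction rule: sigma_sets_induct_disjoint)
      case (basic A)
      then obtain a b where "A = {a<..b}" by auto
      then show ?case using zero[of a b] by (cases "a \<le> b") (auto simp: set_lebesgue_integral_def)
    next
      case empty
      then show ?case by (simp add: set_lebesgue_integral_def)
    next
      case (compl A)
      then have A: "A \<in> sets borel" using borel by simp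
      then have "(LINT x:(A \<union> (UNIV - A))|lborel. g x) = (LINT x:A|lborel. g x) + (LINT x:(UNIV - A)|lborel. g x)"
        by (intro set_integral_Un si) auto
      then show ?case using compl.IH U0 by simp
    next
      case (union A)
      have A: "A i \<in> sets borel" for i using union(2) unfolding borel by blast
      have "(LINT x:(\<Union>i. A i)|lborel. g x) = suminf (\<lambda>i. LINT x:(A i)|lborel. g x)"
        using union(1) A by (intro lebesgue_integral_countable_add si) (auto simp: disjoint_family_on_def)
      then show ?case using union(3) by simp
    qed
  qed
  have "AE x in lborel. g x = (\<lambda>_. 0) x"
  proof (rule density_unique_real[OF g])
    show "integrable lborel (\<lambda>_::real. 0::real)" by simp
    show "(LINT x:A|lborel. g x) = (LINT x:A|lborel. 0)" if "A \<in> sets lborel" for A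
      using Z[of A] that by (simp add: set_lebesgue_integral_def)
  qed
  then show ?thesis by simp
qed

text \<open>Bumps tend to the indicator of a subinterval and are bounded by it, so by dominated
  convergence the integral of \<open>g\<close> over every subinterval is 0.\<close>

lemma weak_zero_imp_AE_zero:
  fixes g :: "real \<Rightarrow> real"
  assumes ab: "a < b" and g: "g absolutely_integrable_on {a<..<b}"
    and zero: "\<And>\<phi>. \<phi> \<in> test_functions {a<..<b} \<Longrightarrow> (LINT t:{a<..<b}|lebesgue. \<phi> t * g t) = 0"
  shows "AE t in lebesgue. t \<in> {a<..<b} \<longrightarrow> g t = 0"
proof -
  have int0: "(LINT t:{s<..<t}|lebesgue. g t) = 0" if st: "a < s" "s < t" "t < b" for s t
  proof -
    let ?\<phi> = "\<lambda>n. smooth_bump (real (Suc n)) s t"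
    have supp: "?\<phi> n r = 0" if "r \<notin> {s<..<t}" for n r
      by (rule smooth_bump_simps(4)[OF _ that]) simp
    have gst: "set_integrable lebesgue {s<..<t} g" using st by (intro set_integrable_subset[OF g]) auto
    have eq: "(LINT r:{s<..<t}|lebesgue. ?\<phi> n r * g r) = 0" for n
    proof -
      have "?\<phi> n \<in> test_functions {a<..<b}"
      proof (rule test_functionsI[where c = s and d = t])
        show "smooth (?\<phi> n)" by (rule smooth_smooth_bump)
        show "?\<phi> n r = 0" if "r \<notin> {s..t}" for r using supp[of r n] that by auto
      qed (use st in auto)
      then have "(LINT r:{a<..<b}|lebesgue. ?\<phi> n r *\<^sub>R g r) = 0" using zero by simp
      moreover have "(LINT r:{a<..<b}|lebesgue. ?\<phi> n r *\<^sub>R g r) = (LINT r:{s<..<t}|lebesgue. ?\<phi> n r *\<^sub>R g r)"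
        by (rule LINT_supported) (use st supp in auto)
      ultimately show ?thesis by simp
    qed
    have "(\<lambda>n. LINT r|lebesgue. indicator {s<..<t} r *\<^sub>R (?\<phi> n r * g r)) \<longlonglongrightarrow> (LINT r|lebesgue. indicator {s<..<t} r *\<^sub>R g r)"
    proof (rule integral_dominated_convergence[where w = "\<lambda>r. \<bar>indicator {s<..<t} r *\<^sub>R g r\<bar>"])
      have gm: "(\<lambda>r. indicator {s<..<t} r *\<^sub>R g r) \<in> borel_measurable lebesgue"
        using gst unfolding set_integrable_def by (rule borel_measurable_integrable)
      then show "(\<lambda>r. indicator {s<..<t} r *\<^sub>R g r) \<in> borel_measurable lebesgue" .
      have "?\<phi> n \<in> borel_measurable borel" for n
        by (intro borel_measurable_continuous_onI smooth_continuous_on smooth_smooth_bump)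
      then have "?\<phi> n \<in> borel_measurable lebesgue" for n by (simp add: measurable_completion)
      then have "(\<lambda>r. ?\<phi> n r * (indicator {s<..<t} r *\<^sub>R g r)) \<in> borel_measurable lebesgue" for n
        using gm by (intro borel_measurable_times)
      then show "(\<lambda>r. indicator {s<..<t} r *\<^sub>R (?\<phi> n r * g r)) \<in> borel_measurable lebesgue" for n
        by (simp add: mult_ac)
      show "integrable lebesgue (\<lambda>r. \<bar>indicator {s<..<t} r *\<^sub>R g r\<bar>)"
        using gst unfolding set_integrable_def by (rule integrable_abs)
      show "AE r in lebesgue. (\<lambda>n. indicator {s<..<t} r *\<^sub>R (?\<phi> n r * g r)) \<longlonglongrightarrow> indicator {s<..<t} r *\<^sub>R g r"
      proof (rule AE_I2)
        fix r
        show "(\<lambda>n. indicator {s<..<t} r *\<^sub>R (?\<phi> n r * g r)) \<longlonglongrightarrow> indicator {s<..<t} r *\<^sub>R g r"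
        proof (cases "r \<in> {s<..<t}")
          case True
          then have "(\<lambda>n. ?\<phi> n r * g r) \<longlonglongrightarrow> 1 * g r"
            by (intro tendsto_mult smooth_bump_tendsto_1 tendsto_const) auto
          then show ?thesis using True by simp
        qed simp
      qed
      show "AE r in lebesgue. norm (indicator {s<..<t} r *\<^sub>R (?\<phi> n r * g r)) \<le> \<bar>indicator {s<..<t} r *\<^sub>R g r\<bar>" for n
      proof (rule AE_I2)
        fix r
        have "\<bar>?\<phi> n r\<bar> \<le> 1" using smooth_bump_simps(1,2)[of "real (Suc n)" s t r] by simp
        then have "\<bar>?\<phi> n r\<bar> * \<bar>g r\<bar> \<le> 1 * \<bar>g r\<bar>" by (intro mult_right_mono) auto
        then show "norm (indicator {s<..<t} r *\<^sub>R (?\<phi> n r * g r)) \<le> \<bar>indicator {s<..<t} r *\<^sub>R g r\<bar>"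
          by (simp add: abs_mult split: split_indicator)
      qed
    qed
    then have "(\<lambda>n. 0::real) \<longlonglongrightarrow> (LINT r:{s<..<t}|lebesgue. g r)"
      using eq unfolding set_lebesgue_integral_def by simp
    then show ?thesis using LIMSEQ_unique tendsto_const by blast
  qed
  have "(\<lambda>r. indicator {a<..<b} r *\<^sub>R g r) \<in> borel_measurable lebesgue"
    using g unfolding set_integrable_def by (rule borel_measurable_integrable)
  \<comment> \<open>A Borel representative, because
    \<open>integral_intervals_zero_imp_AE_zero\<close> works on \<open>lborel\<close>.\<close>
  then obtain h where h: "h \<in> borel_measurable lborel" "AE r in lborel. indicator {a<..<b} r *\<^sub>R g r = h r"
    using completion_ex_borel_measurable_real by blast
  have h': "AE r in lebesgue. indicator {a<..<b} r *\<^sub>R g r = h r" using h(2) by (rule AE_completion)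
  have hi: "integrable lborel h"
  proof -
    have "integrable lebesgue h"
      using g h(1) h' unfolding set_integrable_def
      by (subst integrable_cong_AE[symmetric, OF _ _ h']) (auto intro: borel_measurable_integrable measurable_completion)
    then show ?thesis using h(1) by (simp add: integrable_completion)
  qed
  have hst: "(LINT r:A|lborel. h r) = (LINT r:A \<inter> {a<..<b}|lebesgue. g r)" if "A \<in> sets borel" for A
  proof -
    have "(LINT r:A|lborel. h r) = (LINT r|lebesgue. indicator A r *\<^sub>R h r)"
      unfolding set_lebesgue_integral_def using h(1) that by (intro integral_completion[symmetric]) auto
    also have "\<dots> = (LINT r|lebesgue. indicator (A \<inter> {a<..<b}) r *\<^sub>R g r)"
    proof (rule integral_cong_AE)
      have A: "A \<in> sets lebesgue" using that by simp
      show "(\<lambda>r. indicator A r *\<^sub>R h r) \<in> borel_measurable lebesgue"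
        using h(1) A by (intro borel_measurable_scaleR borel_measurable_indicator) (auto intro: measurable_completion)
      have "set_integrable lebesgue (A \<inter> {a<..<b}) g" using A by (intro set_integrable_subset[OF g]) auto
      then show "(\<lambda>r. indicator (A \<inter> {a<..<b}) r *\<^sub>R g r) \<in> borel_measurable lebesgue"
        unfolding set_integrable_def by (rule borel_measurable_integrable)
      show "AE r in lebesgue. indicator A r *\<^sub>R h r = indicator (A \<inter> {a<..<b}) r *\<^sub>R g r"
        using h' by eventually_elim (auto split: split_indicator)
    qed
    finally show ?thesis unfolding set_lebesgue_integral_def .
  qed
  have "AE x in lborel. h x = 0"
  proof (rule integral_intervals_zero_imp_AE_zero[OF hi])
    fix s t :: real
    \<comment> \<open>Intervals reaching the end points are exhausted from inside, since test
      functions must be supported away from \<open>a\<close> and \<open>b\<close>.\<close>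
    have zero_cont: "(LINT r:{p<..<q}|lebesgue. g r) = 0" if pq: "a \<le> p" "q \<le> b" for p q
    proof (cases "p < q")
      case True
      let ?p = "\<lambda>n. p + (q - p) / 2 * inverse (real (Suc n))" and ?q = "\<lambda>n. q - (q - p) / 2 * inverse (real (Suc n))"
      let ?A = "\<lambda>n. {?p n<..<?q n}"
      have pn: "p < ?p n" "?q n < q" for n using True by auto
      have U: "(\<Union>n. ?A n) = {p<..<q}"
      proof (intro equalityI subsetI)
        fix r assume r: "r \<in> {p<..<q}"
        have "(\<lambda>n. ?p n) \<longlonglongrightarrow> p + (q - p) / 2 * 0" "(\<lambda>n. ?q n) \<longlonglongrightarrow> q - (q - p) / 2 * 0"
          by (intro tendsto_intros LIMSEQ_inverse_real_of_nat)+
        then have "\<forall>\<^sub>F n in sequentially. ?p n < r" "\<forall>\<^sub>F n in sequentially. r < ?q n"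
          using r by (auto intro: order_tendstoD)
        then have "\<forall>\<^sub>F n in sequentially. r \<in> ?A n" by eventually_elim auto
        then obtain n where "r \<in> ?A n" using eventually_happens by force
        then show "r \<in> (\<Union>n. ?A n)" by (rule UN_I[OF UNIV_I])
      next
        fix r assume "r \<in> (\<Union>n. ?A n)"
        then obtain n where "r \<in> ?A n" by blast
        then show "r \<in> {p<..<q}" using pn[of n] by auto
      qed
      have inc: "incseq ?A"
      proof (rule incseq_SucI)
        fix n
        have "inverse (real (Suc (Suc n))) \<le> inverse (real (Suc n))" by (intro le_imp_inverse_le) auto
        then have "(q - p) / 2 * inverse (real (Suc (Suc n))) \<le> (q - p) / 2 * inverse (real (Suc n))"
          using True by (intro mult_left_mono) auto
        then show "?A n \<subseteq> ?A (Suc n)" by auto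
      qed
      have "(\<lambda>n. LINT r:?A n|lebesgue. g r) \<longlonglongrightarrow> (LINT r:(\<Union>n. ?A n)|lebesgue. g r)"
        by (rule set_integral_cont_up[OF _ inc]) (use U pq in \<open>auto intro!: set_integrable_subset[OF g]\<close>)
      moreover have "(LINT r:?A n|lebesgue. g r) = 0" for n
      proof (cases "?p n < ?q n")
        case True
        have "a < ?p n" "?q n < b" using pn[of n] pq by linarith+
        then show ?thesis using True by (intro int0)
      next
        case False
        then have "?A n = {}" by auto
        then show ?thesis by (simp only: set_lebesgue_integral_def) simp
      qed
      ultimately have "(\<lambda>n. 0::real) \<longlonglongrightarrow> (LINT r:{p<..<q}|lebesgue. g r)" unfolding U by simp
      then show ?thesis using LIMSEQ_unique tendsto_const by blast
    next
      case False
      then have "{p<..<q} = {}" by auto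
      then show ?thesis by (simp add: set_lebesgue_integral_def)
    qed
    have "(LINT r:{s<..t}|lborel. h r) = (LINT r:{s<..<t}|lborel. h r)"
      unfolding set_lebesgue_integral_def
    proof (rule integral_cong_AE)
      show "AE x in lborel. indicat_real {s<..t} x *\<^sub>R h x = indicat_real {s<..<t} x *\<^sub>R h x"
        using AE_lborel_singleton[of t] by eventually_elim (auto split: split_indicator)
    qed (use h(1) in auto)
    also have "\<dots> = (LINT r:{max s a<..<min t b}|lebesgue. g r)"
    proof -
      have "{s<..<t} \<inter> {a<..<b} = {max s a<..<min t b}" by auto
      then show ?thesis using hst[of "{s<..<t}"] by simp
    qed
    also have "\<dots> = 0" by (rule zero_cont) auto
    finally show "(LINT r:{s<..t}|lborel. h r) = 0" .
  qed
  then have "AE r in lebesgue. h r = 0" by (rule AE_completion)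
  with h' show ?thesis by eventually_elim (auto split: split_indicator_asm)
qed

text \<open>The second divided difference of \<open>w\<close> is what remains of the hypothesis when
  the second derivative of the test function approximates a combination of point masses at the three
  points. The test function is the same combination of shifted second primitives of a narrow
  bump.\<close>

lemma weak_second_deriv_three_points:
  fixes w :: "real \<Rightarrow> real"
  assumes w: "continuous_on {a<..<b} w" and t: "a < t1" "t1 < t2" "t2 < t3" "t3 < b"
    and zero: "\<And>\<phi>. \<phi> \<in> test_functions {a<..<b} \<Longrightarrow> (LINT s:{a<..<b}|lebesgue. deriv (deriv \<phi>) s * w s) = 0"
  shows "(t3 - t2) * w t1 - (t3 - t1) * w t2 + (t2 - t1) * w t3 = 0"
proof (rule ccontr)
  define T where "T = {t1, t2, t3}"
  \<comment> \<open>The weights of the second divided difference: they annihilate all affine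
    functions.\<close>
  define \<alpha> where "\<alpha> x = (if x = t1 then t3 - t2 else if x = t2 then - (t3 - t1) else t2 - t1)" for x
  have ne: "t1 \<noteq> t2" "t1 \<noteq> t3" "t2 \<noteq> t3" "t2 \<noteq> t1" "t3 \<noteq> t1" "t3 \<noteq> t2" using t by auto
  have sumT: "(\<Sum>x\<in>T. \<alpha> x * g x) = (t3 - t2) * g t1 - (t3 - t1) * g t2 + (t2 - t1) * g t3" for g :: "real \<Rightarrow> real"
  proof -
    have "(\<Sum>x\<in>T. \<alpha> x * g x) = \<alpha> t1 * g t1 + (\<alpha> t2 * g t2 + \<alpha> t3 * g t3)"
      unfolding T_def using ne by simp
    also have "\<dots> = (t3 - t2) * g t1 - (t3 - t1) * g t2 + (t2 - t1) * g t3"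
      using ne by (simp add: \<alpha>_def algebra_simps)
    finally show ?thesis .
  qed
  have T: "finite T" "T \<subseteq> {t1..t3}" "T \<subseteq> {a<..<b}" using t by (auto simp: T_def)
  let ?S = "\<Sum>x\<in>T. \<alpha> x * w x"
  assume "(t3 - t2) * w t1 - (t3 - t1) * w t2 + (t2 - t1) * w t3 \<noteq> 0"
  then have S: "?S \<noteq> 0" by (simp add: sumT)
  define A where "A = (\<Sum>x\<in>T. \<bar>\<alpha> x\<bar>)"
  have "0 \<le> A" unfolding A_def by (intro sum_nonneg) auto
  then have A: "0 < A + 1" by simp
  \<comment> \<open>With this oscillation of \<open>w\<close> near the three points the total error
    stays below half of \<open>\<bar>?S\<bar>\<close>.\<close>
  define e where "e = \<bar>?S\<bar> / 2 / (A + 1)"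
  have e: "0 < e" unfolding e_def using S A by simp
  have eA: "e * (A + 1) = \<bar>?S\<bar> / 2" unfolding e_def using A by (metis less_irrefl nonzero_eq_divide_eq)
  have "\<exists>d>0. \<forall>s. \<bar>s - x\<bar> < d \<longrightarrow> \<bar>w s - w x\<bar> < e" if "x \<in> T" for x
  proof -
    have "isCont w x" using w that T(3) by (simp add: continuous_on_eq_continuous_at subset_iff)
    then show ?thesis using e unfolding continuous_at_eps_delta dist_real_def by metis
  qed
  then obtain \<delta> where \<delta>: "\<And>x. x \<in> T \<Longrightarrow> 0 < \<delta> x" "\<And>x s. x \<in> T \<Longrightarrow> \<bar>s - x\<bar> < \<delta> x \<Longrightarrow> \<bar>w s - w x\<bar> < e" by metis
  \<comment> \<open>Half-width of the bumps: small enough for the oscillation bound and for all of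
    them to stay inside \<open>(a, b)\<close>.\<close>
  define \<epsilon> where "\<epsilon> = Min (insert ((t1 - a) / 2) (insert ((b - t3) / 2) (\<delta> ` T)))"
  let ?E = "insert ((t1 - a) / 2) (insert ((b - t3) / 2) (\<delta> ` T))"
  have E: "finite ?E" using T(1) by simp
  have \<epsilon>le: "\<epsilon> \<le> (t1 - a) / 2" "\<epsilon> \<le> (b - t3) / 2" "\<And>x. x \<in> T \<Longrightarrow> \<epsilon> \<le> \<delta> x"
    unfolding \<epsilon>_def by (intro Min_le E, blast)+
  have "0 < \<epsilon>" unfolding \<epsilon>_def using E \<delta>(1) t by (subst Min_gr_iff) auto
  note \<epsilon> = this \<epsilon>le
  define \<eta> where "\<eta> = smooth_bump 1 (- \<epsilon>) \<epsilon>"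
  have \<eta>: "smooth \<eta>" "\<And>r. 0 \<le> \<eta> r" "\<And>r. 0 < \<eta> r \<longleftrightarrow> - \<epsilon> < r \<and> r < \<epsilon>" "\<And>r. \<epsilon> \<le> \<bar>r\<bar> \<Longrightarrow> \<eta> r = 0"
    unfolding \<eta>_def using smooth_bump_simps(1,3)[of 1 "- \<epsilon>" \<epsilon>]
    by (auto simp: smooth_smooth_bump intro!: smooth_bump_simps(4))
  have c\<eta>: "continuous_on A \<eta>" for A by (rule smooth_continuous_on[OF \<eta>(1)])
  obtain N where N: "\<And>x. (N has_real_derivative \<eta> x) (at x)" "\<And>x. x \<le> - \<epsilon> \<Longrightarrow> N x = 0"
    using antiderivative_from_left[OF c\<eta>, of "- \<epsilon>"] \<eta>(4) by auto
  have cN: "continuous_on A N" for A using N(1) by (meson DERIV_continuous_on has_field_derivative_at_within)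
  obtain N2 where N2: "\<And>x. (N2 has_real_derivative N x) (at x)" "\<And>x. x \<le> - \<epsilon> \<Longrightarrow> N2 x = 0"
    using antiderivative_from_left[OF cN N(2), of "- \<epsilon>"] by auto
  define M where "M = N \<epsilon>"
  have NM: "N x = M" if "\<epsilon> \<le> x" for x
  proof (cases "\<epsilon> = x")
    case False
    then have "\<epsilon> < x" using that by simp
    moreover have "(N has_real_derivative 0) (at y)" if "\<epsilon> < y" for y
      using N(1)[of y] \<eta>(4)[of y] that by simp
    ultimately show ?thesis unfolding M_def by (intro DERIV_isconst_end[OF _ cN]) auto
  qed (simp add: M_def)
  have M: "0 < M"
  proof -
    have "N (- \<epsilon>) < N \<epsilon>"
      using \<epsilon>(1) \<eta>(3) N(1) by (intro DERIV_pos_imp_increasing_open[OF _ _ cN]) auto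
    then show ?thesis using N(2) by (simp add: M_def)
  qed
  define q where "q = N2 \<epsilon> - M * \<epsilon>"
  have N2M: "N2 x = M * x + q" if "\<epsilon> \<le> x" for x
  proof (cases "\<epsilon> = x")
    case False
    then have "\<epsilon> < x" using that by simp
    moreover have "((\<lambda>x. N2 x - M * x) has_real_derivative 0) (at y)" if "\<epsilon> < y" for y
      using N2(1)[of y] NM[of y] that by (auto intro!: derivative_eq_intros)
    moreover have "continuous_on {\<epsilon>..x} (\<lambda>x. N2 x - M * x)"
      using N2(1) by (intro continuous_intros) (meson DERIV_continuous_on has_field_derivative_at_within)
    ultimately have "N2 x - M * x = N2 \<epsilon> - M * \<epsilon>" by (intro DERIV_isconst_end) auto
    then show ?thesis by (simp add: q_def)
  qed (simp add: q_def)
  have sN: "smooth N2" by (rule smooth_antiderivative[OF N2(1) smooth_antiderivative[OF N(1) \<eta>(1)]])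
  define \<phi> where "\<phi> s = (\<Sum>x\<in>T. \<alpha> x * N2 (s - x))" for s
  have \<phi>_eq: "\<phi> = (\<lambda>s. (\<alpha> t1 * N2 (1 * s + (- t1)) + \<alpha> t2 * N2 (1 * s + (- t2))) + \<alpha> t3 * N2 (1 * s + (- t3)))"
  proof
    fix s
    have "\<phi> s = \<alpha> t1 * N2 (s - t1) + (\<alpha> t2 * N2 (s - t2) + \<alpha> t3 * N2 (s - t3))"
      unfolding \<phi>_def T_def using ne by simp
    then show "\<phi> s = (\<alpha> t1 * N2 (1 * s + (- t1)) + \<alpha> t2 * N2 (1 * s + (- t2))) + \<alpha> t3 * N2 (1 * s + (- t3))"
      by simp
  qed
  have s\<phi>: "smooth \<phi>" unfolding \<phi>_eq by (intro smooth_add smooth_affine sN)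
  have "(\<phi> has_real_derivative (\<Sum>x\<in>T. \<alpha> x * N (s - x))) (at s)" for s
    unfolding \<phi>_def[abs_def]
    by (rule derivative_eq_intros DERIV_chain2[OF N2(1)] refl)+ (simp add: mult.commute)
  then have d1: "deriv \<phi> = (\<lambda>s. \<Sum>x\<in>T. \<alpha> x * N (s - x))" by (auto intro: DERIV_imp_deriv)
  have "((\<lambda>s. \<Sum>x\<in>T. \<alpha> x * N (s - x)) has_real_derivative (\<Sum>x\<in>T. \<alpha> x * \<eta> (s - x))) (at s)" for s
    by (rule derivative_eq_intros DERIV_chain2[OF N(1)] refl)+ (simp add: mult.commute)
  then have d2: "deriv (deriv \<phi>) = (\<lambda>s. \<Sum>x\<in>T. \<alpha> x * \<eta> (s - x))" unfolding d1 by (auto intro: DERIV_imp_deriv)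
  let ?c = "t1 - \<epsilon>" and ?d = "t3 + \<epsilon>"
  have cd: "a < ?c" "?d < b" "?c \<le> ?d" using \<epsilon> t by (auto simp: field_simps)
  \<comment> \<open>To the right of all bumps the second primitives are affine with common slope, so
    the weights cancel them. This is what gives the test function compact support.\<close>
  have out: "\<phi> s = 0" if "s \<notin> {?c..?d}" for s
  proof (cases "s < ?c")
    case True
    then have "N2 (s - x) = 0" if "x \<in> T" for x using that T(2) by (intro N2(2)) auto
    then show ?thesis by (simp add: \<phi>_def)
  next
    case False
    then have "N2 (s - x) = M * (s - x) + q" if "x \<in> T" for x using that T(2) \<open>s \<notin> _\<close> by (intro N2M) auto
    then have "\<phi> s = (\<Sum>x\<in>T. \<alpha> x * (M * (s - x) + q))" by (simp add: \<phi>_def)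
    also have "\<dots> = 0" unfolding sumT by (simp add: algebra_simps)
    finally show ?thesis .
  qed
  have test: "\<phi> \<in> test_functions {a<..<b}"
    by (rule test_functionsI[OF s\<phi> out]) (use cd in auto)
  have \<eta>out: "\<eta> (s - x) = 0" if "x \<in> T" "s \<notin> {?c..?d}" for s x
  proof (rule \<eta>(4))
    have "t1 \<le> x" "x \<le> t3" using that(1) T(2) by auto
    then show "\<epsilon> \<le> \<bar>s - x\<bar>" using that(2) by (auto simp: abs_if)
  qed
  have cw: "continuous_on {?c..?d} w" using w by (rule continuous_on_subset) (use cd in auto)
  have cshift: "continuous_on A (\<lambda>s. \<eta> (s - x))" for A x
    by (rule continuous_on_compose2[OF c\<eta>[of UNIV]]) (auto intro!: continuous_intros)
  have int0: "integral {?c..?d} (\<lambda>s. \<Sum>x\<in>T. \<alpha> x * (\<eta> (s - x) * w s)) = 0"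
  proof -
    let ?f = "\<lambda>s. deriv (deriv \<phi>) s *\<^sub>R w s"
    have "(LINT s:{a<..<b}|lebesgue. ?f s) = (LINT s:{?c..?d}|lebesgue. ?f s)"
      by (rule LINT_supported) (use cd \<eta>out in \<open>auto simp: d2\<close>)
    moreover have "?f absolutely_integrable_on {?c..?d}"
      by (intro absolutely_integrable_continuous_real continuous_intros cw smooth_continuous_on smooth_deriv(1) s\<phi>)
    then have "(LINT s:{?c..?d}|lebesgue. ?f s) = integral {?c..?d} ?f"
      by (rule set_lebesgue_integral_eq_integral(2))
    moreover have "?f = (\<lambda>s. \<Sum>x\<in>T. \<alpha> x * (\<eta> (s - x) * w s))"
      by (simp add: d2 sum_distrib_right mult.assoc)
    ultimately show ?thesis using zero[OF test] by simp
  qed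
  have intM: "((\<lambda>s. \<eta> (s - x)) has_integral M) {?c..?d}" if x: "x \<in> T" for x
  proof -
    have "((\<lambda>s. \<eta> (s - x)) has_integral (N (?d - x) - N (?c - x))) {?c..?d}"
    proof (rule fundamental_theorem_of_calculus[OF cd(3)])
      fix s
      have "((\<lambda>s. N (s - x)) has_real_derivative \<eta> (s - x)) (at s)"
      proof -
        have "((\<lambda>s. s - x) has_real_derivative 1) (at s)" by (auto intro!: derivative_eq_intros)
        from DERIV_chain2[OF N(1) this] show ?thesis by simp
      qed
      then show "((\<lambda>s. N (s - x)) has_vector_derivative \<eta> (s - x)) (at s within {?c..?d})"
        by (simp add: has_real_derivative_iff_has_vector_derivative[symmetric] has_field_derivative_at_within)
    qed
    moreover have "N (?d - x) = M" "N (?c - x) = 0" using x T(2) by (auto intro!: NM N(2))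
    ultimately show ?thesis by simp
  qed
  have r: "\<bar>integral {?c..?d} (\<lambda>s. \<eta> (s - x) * w s) - M * w x\<bar> \<le> e * M" if x: "x \<in> T" for x
  proof -
    have 1: "((\<lambda>s. \<eta> (s - x) * w s) has_integral integral {?c..?d} (\<lambda>s. \<eta> (s - x) * w s)) {?c..?d}"
      by (intro integrable_integral integrable_continuous_interval continuous_intros cw cshift)
    have 2: "((\<lambda>s. \<eta> (s - x) * w x) has_integral M * w x) {?c..?d}"
      by (intro has_integral_mult_left intM x)
    note d = has_integral_diff[OF 1 2]
    have "norm (integral {?c..?d} (\<lambda>s. \<eta> (s - x) * w s - \<eta> (s - x) * w x)) \<le> integral {?c..?d} (\<lambda>s. e * \<eta> (s - x))"
    proof (rule integral_norm_bound_integral)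
      show "(\<lambda>s. \<eta> (s - x) * w s - \<eta> (s - x) * w x) integrable_on {?c..?d}" using d by blast
      show "(\<lambda>s. e * \<eta> (s - x)) integrable_on {?c..?d}"
        by (intro integrable_on_mult_right) (use intM[OF x] in blast)
      fix s assume "s \<in> {?c..?d}"
      have "\<bar>\<eta> (s - x) * (w s - w x)\<bar> \<le> \<eta> (s - x) * e"
      proof (cases "\<epsilon> \<le> \<bar>s - x\<bar>")
        case True
        then show ?thesis using \<eta>(4) by simp
      next
        case False
        then have "\<bar>w s - w x\<bar> < e" using \<epsilon>(4)[OF x] by (intro \<delta>(2)[OF x]) simp
        then show ?thesis using \<eta>(2)[of "s - x"] by (simp add: abs_mult mult_left_mono)
      qed
      then show "norm (\<eta> (s - x) * w s - \<eta> (s - x) * w x) \<le> e * \<eta> (s - x)"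
        by (simp add: algebra_simps)
    qed
    then show ?thesis
      using integral_unique[OF d] integral_unique[OF intM[OF x]] by simp
  qed
  have "(\<Sum>x\<in>T. \<alpha> x * integral {?c..?d} (\<lambda>s. \<eta> (s - x) * w s)) = 0"
  proof -
    have "integral {?c..?d} (\<lambda>s. \<Sum>x\<in>T. \<alpha> x * (\<eta> (s - x) * w s)) = (\<Sum>x\<in>T. integral {?c..?d} (\<lambda>s. \<alpha> x * (\<eta> (s - x) * w s)))"
      using T(1) by (intro Henstock_Kurzweil_Integration.integral_sum integrable_continuous_interval continuous_intros cw cshift)
    then show ?thesis using int0 by (simp add: integral_mult_right)
  qed
  then have "M * ?S = (\<Sum>x\<in>T. \<alpha> x * (M * w x - integral {?c..?d} (\<lambda>s. \<eta> (s - x) * w s)))"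
    by (simp add: right_diff_distrib sum_subtractf sum_distrib_left mult_ac)
  also have "\<bar>\<dots>\<bar> \<le> (\<Sum>x\<in>T. \<bar>\<alpha> x\<bar> * (e * M))"
    using r by (intro order_trans[OF sum_abs] sum_mono) (auto simp: abs_mult abs_minus_commute intro!: mult_left_mono)
  also have "\<dots> = M * (e * A)" by (simp add: A_def sum_distrib_left sum_distrib_right mult_ac)
  finally have "M * \<bar>?S\<bar> \<le> M * (e * A)" using M by (simp add: abs_mult)
  then have "\<bar>?S\<bar> \<le> e * A" using M by simp
  also have "\<dots> \<le> e * (A + 1)" using e by simp
  also note eA
  finally show False using S by simp
qed

text \<open>Two interior reference points determine the affine function; the three-point relation
  with \<open>t\<close> as third point places \<open>w t\<close> on it.\<close>

lemma weak_second_deriv_zero_affine: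
  fixes w :: "real \<Rightarrow> real"
  assumes ab: "a < b" and w: "continuous_on {a<..<b} w"
    and zero: "\<And>\<phi>. \<phi> \<in> test_functions {a<..<b} \<Longrightarrow> (LINT s:{a<..<b}|lebesgue. deriv (deriv \<phi>) s * w s) = 0"
  obtains A B where "\<And>t. t \<in> {a<..<b} \<Longrightarrow> w t = A + B * t"
proof -
  define p where "p = (2 * a + b) / 3"
  define q where "q = (a + 2 * b) / 3"
  have pq: "a < p" "p < q" "q < b" using ab by (auto simp: p_def q_def)
  note tp = weak_second_deriv_three_points[OF w _ _ _ _ zero]
  define B where "B = (w q - w p) / (q - p)"
  have B: "B * (q - p) = w q - w p" using pq by (simp add: B_def)
  have "w t = (w p - B * p) + B * t" if t: "t \<in> {a<..<b}" for t
  proof -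
    have "(q - p) * (w t - ((w p - B * p) + B * t)) = 0"
    proof -
      consider "t < p" | "t = p" | "p < t" "t < q" | "t = q" | "q < t" by linarith
      then have "(q - p) * w t = (q - t) * w p + (t - p) * w q"
      proof cases
        case 1
        then show ?thesis using tp[of t p q] t pq by (simp add: algebra_simps)
      next
        case 3
        then show ?thesis using tp[of p t q] t pq by (simp add: algebra_simps)
      next
        case 5
        then show ?thesis using tp[of p q t] t pq by (simp add: algebra_simps)
      qed (simp_all add: algebra_simps)
      moreover have "(q - p) * ((w p - B * p) + B * t) = (q - p) * w p + (t - p) * (B * (q - p))"
        by (simp add: algebra_simps)
      ultimately show ?thesis unfolding B by (simp add: algebra_simps)
    qed
    then show ?thesis using pq by simp
  qed
  then show ?thesis using that by blast
qed

lemma absolutely_integrable_on_closed_interval: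
  fixes g :: "real \<Rightarrow> 'b::euclidean_space"
  assumes "g absolutely_integrable_on {a<..<b}"
  shows "g absolutely_integrable_on {a..b}"
  using assms integrable_on_open_interval[of g a b] integrable_on_open_interval[of "\<lambda>x. norm (g x)" a b]
  by (simp add: absolutely_integrable_on_def)

lemma test_function_scaleR_integrable:
  fixes u :: "real \<Rightarrow> 'b::euclidean_space"
  assumes \<phi>: "\<phi> \<in> test_functions {a<..<b}" and ab: "a < b" and u: "locally_integrable_on {a<..<b} u"
  shows "(\<lambda>t. (deriv ^^ k) \<phi> t *\<^sub>R u t) absolutely_integrable_on {a<..<b}"
proof -
  obtain c d where cd: "a < c" "d < b" "\<And>k r. r \<notin> {c..d} \<Longrightarrow> (deriv ^^ k) \<phi> r = 0"
    by (rule test_function_support_interval[OF \<phi> ab]) (rule that)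
  have "u absolutely_integrable_on {c..d}"
  proof -
    have "{c..d} \<subseteq> {a<..<b}" using cd(1,2) by (auto simp: subset_iff)
    then show ?thesis using u by (simp add: locally_integrable_on_def)
  qed
  then have "(\<lambda>t. (deriv ^^ k) \<phi> t *\<^sub>R u t) absolutely_integrable_on {c..d}"
    by (intro absolutely_integrable_continuous_scaleR smooth_continuous_on smooth_funpow_deriv test_functions_support(1)[OF \<phi>])
  moreover have "(\<lambda>t. indicat_real {a<..<b} t *\<^sub>R ((deriv ^^ k) \<phi> t *\<^sub>R u t)) = (\<lambda>t. indicat_real {c..d} t *\<^sub>R ((deriv ^^ k) \<phi> t *\<^sub>R u t))"
    using cd by (intro ext) (auto split: split_indicator)
  ultimately show ?thesis unfolding set_integrable_def by (simp only:)
qed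

text \<open>Subtract the double primitive of \<open>g\<close>, which has the same second weak
  derivative. The continuous remainder is affine everywhere and not just almost everywhere, so
  \<open>u\<close> itself is differentiable.\<close>

lemma weak_second_deriv_imp_C1:
  fixes u g :: "real \<Rightarrow> real"
  assumes ab: "a < b" and u: "continuous_on {a<..<b} u" and g: "g absolutely_integrable_on {a<..<b}"
    and wd: "has_weak_deriv 2 {a<..<b} u g"
  obtains u' where "\<And>t. t \<in> {a<..<b} \<Longrightarrow> (u has_real_derivative u' t) (at t)"
    "\<And>s t. a < s \<Longrightarrow> s \<le> t \<Longrightarrow> t < b \<Longrightarrow> (g has_integral (u' t - u' s)) {s..t}"
proof -
  have g': "g absolutely_integrable_on {a..b}" by (rule absolutely_integrable_on_closed_interval[OF g])
  then have gi: "g integrable_on {a..b}" by (rule set_lebesgue_integral_eq_integral(1))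
  have prim: "(h has_integral (integral {a..t} h - integral {a..s} h)) {s..t}"
    if "h integrable_on {a..b}" "a \<le> s" "s \<le> t" "t \<le> b" for h :: "real \<Rightarrow> real" and s t
  proof -
    have "h integrable_on {a..t}" "h integrable_on {s..t}"
      using integrable_subinterval_real[OF that(1), of a t] integrable_subinterval_real[OF that(1), of s t] that by auto
    then have "integral {a..s} h + integral {s..t} h = integral {a..t} h"
      using that \<open>h integrable_on {a..t}\<close> by (intro Henstock_Kurzweil_Integration.integral_combine) auto
    then have "integral {a..t} h - integral {a..s} h = integral {s..t} h" by simp
    then show ?thesis using integrable_integral[OF \<open>h integrable_on {s..t}\<close>] by simp
  qed
  define h1 where "h1 t = integral {a..t} g" for t
  have h1: "(g has_integral (h1 t - h1 s)) {s..t}" if "a \<le> s" "s \<le> t" "t \<le> b" for s t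
    unfolding h1_def by (rule prim[OF gi that])
  have ch1: "continuous_on {a..b} h1" unfolding h1_def by (rule indefinite_integral_continuous_1[OF gi])
  define h0 where "h0 t = integral {a..t} h1" for t
  have h0: "(h1 has_integral (h0 t - h0 s)) {s..t}" if "a \<le> s" "s \<le> t" "t \<le> b" for s t
    unfolding h0_def by (rule prim[OF integrable_continuous_interval[OF ch1] that])
  have ch0: "continuous_on {a..b} h0" unfolding h0_def
    by (rule indefinite_integral_continuous_1[OF integrable_continuous_interval[OF ch1]])
  have wh0: "has_weak_deriv 2 {a<..<b} h0 g"
    by (rule has_weak_deriv_indefinite_integrals(2)[OF ab g' h0 h1])
  have cw: "continuous_on {a<..<b} (\<lambda>t. u t - h0 t)"
    by (intro continuous_intros u continuous_on_subset[OF ch0]) auto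
  obtain A B where AB: "\<And>t. t \<in> {a<..<b} \<Longrightarrow> u t - h0 t = A + B * t"
  proof (rule weak_second_deriv_zero_affine[OF ab cw])
    fix \<phi> assume \<phi>: "\<phi> \<in> test_functions {a<..<b}"
    have ai: "(\<lambda>t. (deriv ^^ 2) \<phi> t *\<^sub>R v t) absolutely_integrable_on {a<..<b}"
      if "has_weak_deriv 2 {a<..<b} v g" for v
      using that unfolding has_weak_deriv_def by (intro test_function_scaleR_integrable[OF \<phi> ab]) blast
    have weak: "(LINT t:{a<..<b}|lebesgue. (deriv ^^ 2) \<phi> t *\<^sub>R v t) = (- 1)\<^sup>2 *\<^sub>R (LINT t:{a<..<b}|lebesgue. \<phi> t *\<^sub>R g t)"
      if "has_weak_deriv 2 {a<..<b} v g" for v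
      using that \<phi> unfolding has_weak_deriv_def by blast
    have "(LINT t:{a<..<b}|lebesgue. (deriv ^^ 2) \<phi> t *\<^sub>R u t) = (LINT t:{a<..<b}|lebesgue. (deriv ^^ 2) \<phi> t *\<^sub>R h0 t)"
      by (rule trans[OF weak[OF wd] weak[OF wh0, symmetric]])
    then have "(LINT t:{a<..<b}|lebesgue. (deriv ^^ 2) \<phi> t *\<^sub>R u t - (deriv ^^ 2) \<phi> t *\<^sub>R h0 t) = 0"
      by (subst set_integral_diff(2)[OF ai[OF wd] ai[OF wh0]]) simp
    then show "(LINT s:{a<..<b}|lebesgue. deriv (deriv \<phi>) s * (u s - h0 s)) = 0"
      by (simp add: numeral_2_eq_2 right_diff_distrib)
  qed (rule that)
  show ?thesis
  proof (rule that[of "\<lambda>t. h1 t + B"])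
    fix t assume t: "t \<in> {a<..<b}"
    have "(h0 has_real_derivative h1 t) (at t within {a..b})"
      unfolding h0_def using t by (intro integral_has_real_derivative ch1) auto
    then have "(h0 has_real_derivative h1 t) (at t)" using t by (simp add: at_within_Icc_at)
    then have "((\<lambda>t. h0 t + (A + B * t)) has_real_derivative h1 t + B) (at t)"
      by (auto intro!: derivative_eq_intros)
    moreover have "\<forall>\<^sub>F s in nhds t. s \<in> {a<..<b}" using t by (intro eventually_nhds_in_open) auto
    then have "\<forall>\<^sub>F s in nhds t. u s = h0 s + (A + B * s)" by eventually_elim (use AB in force)
    ultimately show "(u has_real_derivative h1 t + B) (at t)" by (subst DERIV_cong_ev[OF refl _ refl])
  next
    fix s t assume "a < s" "s \<le> t" "t < b"
    then show "(g has_integral (h1 t + B - (h1 s + B))) {s..t}" using h1[of s t] by simp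
  qed
qed

section \<open>Weak derivatives of vector-valued functions\<close>

lemma locally_integrable_on_component:
  fixes u :: "real \<Rightarrow> real ^ 'n"
  assumes "locally_integrable_on \<Omega> u"
  shows "locally_integrable_on \<Omega> (\<lambda>t. u t $ i)"
  unfolding locally_integrable_on_def
proof (intro allI impI)
  fix K :: "real set" assume "compact K \<and> K \<subseteq> \<Omega>"
  then have "integrable lebesgue (\<lambda>t. indicat_real K t *\<^sub>R u t)"
    using assms by (simp add: locally_integrable_on_def set_integrable_def)
  then have "integrable lebesgue (\<lambda>t. (indicat_real K t *\<^sub>R u t) $ i)"
    by (rule integrable_bounded_linear[OF bounded_linear_vec_nth])
  then show "(\<lambda>t. u t $ i) absolutely_integrable_on K" by (simp add: set_integrable_def)
qed

lemma has_weak_deriv_component: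
  fixes u g :: "real \<Rightarrow> real ^ 'n"
  assumes wd: "has_weak_deriv k {a<..<b} u g" and ab: "a < b"
  shows "has_weak_deriv k {a<..<b} (\<lambda>t. u t $ i) (\<lambda>t. g t $ i)"
proof -
  have li: "locally_integrable_on {a<..<b} u" "locally_integrable_on {a<..<b} g"
    using wd by (auto simp: has_weak_deriv_def)
  have comp: "(LINT t:{a<..<b}|lebesgue. (deriv ^^ j) \<phi> t *\<^sub>R (v t $ i)) = (LINT t:{a<..<b}|lebesgue. (deriv ^^ j) \<phi> t *\<^sub>R v t) $ i"
    if \<phi>: "\<phi> \<in> test_functions {a<..<b}" and v: "locally_integrable_on {a<..<b} v" for \<phi> j and v :: "real \<Rightarrow> real ^ 'n"
  proof -
    have "integrable lebesgue (\<lambda>t. indicat_real {a<..<b} t *\<^sub>R ((deriv ^^ j) \<phi> t *\<^sub>R v t))"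
      using test_function_scaleR_integrable[OF \<phi> ab v, of j] by (simp add: set_integrable_def)
    from integral_bounded_linear[OF bounded_linear_vec_nth this, of i]
    show ?thesis by (simp only: set_lebesgue_integral_def vector_scaleR_component)
  qed
  show ?thesis
    unfolding has_weak_deriv_def
  proof (intro conjI ballI locally_integrable_on_component li)
    fix \<phi> assume \<phi>: "\<phi> \<in> test_functions {a<..<b}"
    have "(LINT t:{a<..<b}|lebesgue. (deriv ^^ k) \<phi> t *\<^sub>R u t) = (- 1) ^ k *\<^sub>R (LINT t:{a<..<b}|lebesgue. (deriv ^^ 0) \<phi> t *\<^sub>R g t)"
      using wd \<phi> by (simp add: has_weak_deriv_def)
    then have "(LINT t:{a<..<b}|lebesgue. (deriv ^^ k) \<phi> t *\<^sub>R u t) $ i = (- 1) ^ k *\<^sub>R (LINT t:{a<..<b}|lebesgue. (deriv ^^ 0) \<phi> t *\<^sub>R g t) $ i"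
      by simp
    then show "(LINT t:{a<..<b}|lebesgue. (deriv ^^ k) \<phi> t *\<^sub>R u t $ i) = (- 1) ^ k *\<^sub>R (LINT t:{a<..<b}|lebesgue. \<phi> t *\<^sub>R g t $ i)"
      using comp[OF \<phi> li(1), of k] comp[OF \<phi> li(2), of 0] by simp
  qed
qed

text \<open>Weak derivatives are integrable on compact subintervals, so the components are compared
  there and the open interval is exhausted by countably many of them.\<close>

lemma has_weak_deriv_unique:
  fixes u g1 g2 :: "real \<Rightarrow> real ^ 'n"
  assumes ab: "a < b" and g: "has_weak_deriv k {a<..<b} u g1" "has_weak_deriv k {a<..<b} u g2"
  shows "AE t in lebesgue. t \<in> {a<..<b} \<longrightarrow> g1 t = g2 t"
proof -
  have sub: "AE t in lebesgue. t \<in> {c<..<d} \<longrightarrow> g1 t $ i = g2 t $ i" if cd: "a < c" "c < d" "d < b" for c d i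
  proof -
    have li: "locally_integrable_on {a<..<b} g1" "locally_integrable_on {a<..<b} g2"
      using g by (auto simp: has_weak_deriv_def)
    then have li': "locally_integrable_on {a<..<b} (\<lambda>t. g1 t $ i)" "locally_integrable_on {a<..<b} (\<lambda>t. g2 t $ i)"
      by (auto intro: locally_integrable_on_component)
    have ai: "v absolutely_integrable_on {c<..<d}" if "locally_integrable_on {a<..<b} v" for v :: "real \<Rightarrow> real"
    proof -
      have "v absolutely_integrable_on {c..d}" using that cd by (simp add: locally_integrable_on_def subset_iff)
      then show ?thesis by (rule set_integrable_subset) auto
    qed
    have "AE t in lebesgue. t \<in> {c<..<d} \<longrightarrow> g1 t $ i - g2 t $ i = 0"
    proof (rule weak_zero_imp_AE_zero[OF cd(2)])
      show "(\<lambda>t. g1 t $ i - g2 t $ i) absolutely_integrable_on {c<..<d}" by (intro set_integral_diff(1) ai li')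
      fix \<phi> assume \<phi>: "\<phi> \<in> test_functions {c<..<d}"
      have w: "has_weak_deriv k {c<..<d} (\<lambda>t. u t $ i) (\<lambda>t. g1 t $ i)" "has_weak_deriv k {c<..<d} (\<lambda>t. u t $ i) (\<lambda>t. g2 t $ i)"
        by (rule has_weak_deriv_subset[OF has_weak_deriv_component[OF g(1) ab]], use cd in auto)
          (rule has_weak_deriv_subset[OF has_weak_deriv_component[OF g(2) ab]], use cd in auto)
      have weak: "(LINT t:{c<..<d}|lebesgue. (deriv ^^ k) \<phi> t *\<^sub>R (u t $ i)) = (- 1) ^ k *\<^sub>R (LINT t:{c<..<d}|lebesgue. \<phi> t *\<^sub>R (v t $ i))"
        if "has_weak_deriv k {c<..<d} (\<lambda>t. u t $ i) (\<lambda>t. v t $ i)" for v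
        using that \<phi> unfolding has_weak_deriv_def by blast
      have "(- 1) ^ k *\<^sub>R (LINT t:{c<..<d}|lebesgue. \<phi> t *\<^sub>R (g1 t $ i)) = (- 1) ^ k *\<^sub>R (LINT t:{c<..<d}|lebesgue. \<phi> t *\<^sub>R (g2 t $ i))"
        by (rule trans[OF weak[OF w(1), symmetric] weak[OF w(2)]])
      then have "(LINT t:{c<..<d}|lebesgue. \<phi> t *\<^sub>R (g1 t $ i)) = (LINT t:{c<..<d}|lebesgue. \<phi> t *\<^sub>R (g2 t $ i))"
        by simp
      moreover have "(\<lambda>t. \<phi> t *\<^sub>R (v t $ i)) absolutely_integrable_on {c<..<d}"
        if "has_weak_deriv k {c<..<d} (\<lambda>t. u t $ i) (\<lambda>t. v t $ i)" for v
        using test_function_scaleR_integrable[OF \<phi> cd(2), of "\<lambda>t. v t $ i" 0] that by (simp add: has_weak_deriv_def)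
      note set_integral_diff(2)[OF this[OF w(1)] this[OF w(2)]]
      ultimately show "(LINT t:{c<..<d}|lebesgue. \<phi> t * (g1 t $ i - g2 t $ i)) = 0"
        by (simp add: right_diff_distrib)
    qed
    then show ?thesis by eventually_elim auto
  qed
  let ?c = "\<lambda>n. a + (b - a) / 4 * inverse (real (Suc n))" and ?d = "\<lambda>n. b - (b - a) / 4 * inverse (real (Suc n))"
  have cd: "a < ?c n" "?c n < ?d n" "?d n < b" for n
  proof -
    have "inverse (real (Suc n)) \<le> 1" "0 < inverse (real (Suc n))" by (auto simp: inverse_le_1_iff)
    then have "0 < (b - a) / 4 * inverse (real (Suc n))" "(b - a) / 4 * inverse (real (Suc n)) \<le> (b - a) / 4 * 1"
      using ab by (intro mult_pos_pos mult_left_mono; simp)+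
    moreover have "e < (b - a) / 2" if "e \<le> (b - a) / 4 * 1" for e using that ab by (simp add: field_simps)
    ultimately have *: "0 < (b - a) / 4 * inverse (real (Suc n))" "(b - a) / 4 * inverse (real (Suc n)) < (b - a) / 2" by blast+
    have "a < a + e" "a + e < b - e" "b - e < b" if "0 < e" "e < (b - a) / 2" for e
      using that by (simp_all add: field_simps)
    from this[OF *] show "a < ?c n" "?c n < ?d n" "?d n < b" .
  qed
  have "AE t in lebesgue. \<forall>n. \<forall>i. t \<in> {?c n<..<?d n} \<longrightarrow> g1 t $ i = g2 t $ i"
    unfolding AE_all_countable using sub[OF cd] by (intro allI AE_finite_allI) auto
  then show ?thesis
  proof eventually_elim
    case (elim t)
    show ?case
    proof
      assume t: "t \<in> {a<..<b}"
      have "(\<lambda>n. ?c n) \<longlonglongrightarrow> a + (b - a) / 4 * 0" "(\<lambda>n. ?d n) \<longlonglongrightarrow> b - (b - a) / 4 * 0"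
        by (intro tendsto_intros LIMSEQ_inverse_real_of_nat)+
      then have "\<forall>\<^sub>F n in sequentially. ?c n < t" "\<forall>\<^sub>F n in sequentially. t < ?d n"
        using t by (auto intro: order_tendstoD)
      then have "\<forall>\<^sub>F n in sequentially. t \<in> {?c n<..<?d n}" by eventually_elim auto
      then obtain n where "t \<in> {?c n<..<?d n}" using eventually_happens by force
      then have "g1 t $ i = g2 t $ i" for i using elim by blast
      then show "g1 t = g2 t" by (simp add: vec_eq_iff)
    qed
  qed
qed

text \<open>\<open>W21_norm\<close> refers to weak derivatives picked by choice; uniqueness up to
  null sets replaces them by the explicit \<open>u'\<close> and \<open>g\<close>.\<close>

lemma W21_indefinite_integrals:
  fixes u u' g :: "real \<Rightarrow> real ^ 'n"
  assumes ab: "a < b" and g: "g absolutely_integrable_on {a..b}"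
    and u: "\<And>s t. a \<le> s \<Longrightarrow> s \<le> t \<Longrightarrow> t \<le> b \<Longrightarrow> (u' has_integral (u t - u s)) {s..t}"
    and u': "\<And>s t. a \<le> s \<Longrightarrow> s \<le> t \<Longrightarrow> t \<le> b \<Longrightarrow> (g has_integral (u' t - u' s)) {s..t}"
  shows "open V \<Longrightarrow> V \<subseteq> {a<..<b} \<Longrightarrow> W21 V u"
    and "W21_norm {a<..<b} u = (LINT t:{a<..<b}|lebesgue. norm (u t)) +
      (LINT t:{a<..<b}|lebesgue. norm (u' t)) + (LINT t:{a<..<b}|lebesgue. norm (g t))"
proof -
  note wd = has_weak_deriv_indefinite_integrals[OF ab g u u']
  note ai = indefinite_integrals_absolutely_integrable[OF ab g u u'] g
  show "W21 V u" if V: "open V" "V \<subseteq> {a<..<b}"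
  proof -
    have sub: "h absolutely_integrable_on V" if "h absolutely_integrable_on {a..b}" for h :: "real \<Rightarrow> real ^ 'n"
      by (rule set_integrable_subset[OF that]) (use V in auto)
    have "has_weak_deriv 1 V u u'" "has_weak_deriv 2 V u g"
      using has_weak_deriv_subset[OF wd(1) V(2)] has_weak_deriv_subset[OF wd(2) V(2)] by auto
    then show ?thesis using sub[OF ai(1)] sub[OF ai(2)] sub[OF ai(3)] unfolding W21_def by blast
  qed
  have eq: "(LINT t:{a<..<b}|lebesgue. norm (weak_deriv k {a<..<b} u t)) = (LINT t:{a<..<b}|lebesgue. norm (h t))"
    if h: "has_weak_deriv k {a<..<b} u h" "h absolutely_integrable_on {a..b}" for k h
  proof -
    have "has_weak_deriv k {a<..<b} u (weak_deriv k {a<..<b} u)"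
      unfolding weak_deriv_def by (rule someI[of "has_weak_deriv k {a<..<b} u", OF h(1)])
    then have "AE t in lebesgue. t \<in> {a<..<b} \<longrightarrow> h t = weak_deriv k {a<..<b} u t"
      by (rule has_weak_deriv_unique[OF ab h(1)])
    then have ae: "AE t in lebesgue. indicat_real {a<..<b} t *\<^sub>R h t = indicat_real {a<..<b} t *\<^sub>R weak_deriv k {a<..<b} u t"
      by eventually_elim (auto split: split_indicator)
    have "h absolutely_integrable_on {a<..<b}" by (rule set_integrable_subset[OF h(2)]) auto
    then have m: "(\<lambda>t. indicat_real {a<..<b} t *\<^sub>R h t) \<in> borel_measurable lebesgue"
      unfolding set_integrable_def by (rule borel_measurable_integrable)
    have nm: "(\<lambda>t. norm (w t)) \<in> borel_measurable lebesgue" if "w \<in> borel_measurable lebesgue" for w :: "real \<Rightarrow> real ^ 'n"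
      by (rule measurable_compose[OF that borel_measurable_norm])
    have n: "indicat_real {a<..<b} t *\<^sub>R norm (w t) = norm (indicat_real {a<..<b} t *\<^sub>R w t)" for t and w :: "real \<Rightarrow> real ^ 'n"
      by simp
    show ?thesis
      unfolding set_lebesgue_integral_def n
    proof (rule integral_cong_AE[symmetric])
      show "AE t in lebesgue. norm (indicat_real {a<..<b} t *\<^sub>R h t) = norm (indicat_real {a<..<b} t *\<^sub>R weak_deriv k {a<..<b} u t)"
        using ae by eventually_elim (simp only:)
    qed (rule nm[OF m], rule nm[OF borel_measurable_AE[OF m ae]])
  qed
  show "W21_norm {a<..<b} u = (LINT t:{a<..<b}|lebesgue. norm (u t)) +
      (LINT t:{a<..<b}|lebesgue. norm (u' t)) + (LINT t:{a<..<b}|lebesgue. norm (g t))"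
    unfolding W21_norm_def using eq[OF wd(1) ai(1)] eq[OF wd(2) ai(3)] by simp
qed

lemma W21_imp_derivative:
  fixes x :: "real \<Rightarrow> real ^ 'n"
  assumes ab: "a < b" and x: "continuous_on {a<..<b} x" and W: "W21 {a<..<b} x"
  obtains x' g where "\<And>t. t \<in> {a<..<b} \<Longrightarrow> ((\<lambda>t. x t $ i) has_real_derivative x' t) (at t)"
    "g absolutely_integrable_on {a..b}"
    "\<And>s t. a < s \<Longrightarrow> s \<le> t \<Longrightarrow> t < b \<Longrightarrow> (g has_integral (x' t - x' s)) {s..t}"
proof -
  obtain h where h: "has_weak_deriv 2 {a<..<b} x h" "h absolutely_integrable_on {a<..<b}"
    using W unfolding W21_def by blast
  have "integrable lebesgue (\<lambda>t. (indicat_real {a<..<b} t *\<^sub>R h t) $ i)"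
    using h(2) unfolding set_integrable_def by (rule integrable_bounded_linear[OF bounded_linear_vec_nth])
  then have hi: "(\<lambda>t. h t $ i) absolutely_integrable_on {a<..<b}" by (simp add: set_integrable_def)
  have c: "continuous_on {a<..<b} (\<lambda>t. x t $ i)" by (intro continuous_intros x)
  show ?thesis
    by (rule weak_second_deriv_imp_C1[OF ab c hi has_weak_deriv_component[OF h(1) ab]])
      (rule that[OF _ absolutely_integrable_on_closed_interval[OF hi]])
qed

section \<open>Absolutely continuous functions\<close>

text \<open>Absolute continuity through an integrable majorant of the increments. This form passes
  directly to sums, products and inverses and yields a measure dominating the increments, without
  reference to derivatives.\<close>

definition ac_on :: "real \<Rightarrow> real \<Rightarrow> (real \<Rightarrow> real) \<Rightarrow> bool" where
  "ac_on a b u \<longleftrightarrow> (\<exists>\<rho>. \<rho> integrable_on {a..b} \<and> (\<forall>t. 0 \<le> \<rho> t) \<and>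
     (\<forall>s t. a \<le> s \<and> s \<le> t \<and> t \<le> b \<longrightarrow> \<bar>u t - u s\<bar> \<le> integral {s..t} \<rho>))"

lemma ac_onI:
  assumes "\<rho> integrable_on {a..b}" "\<And>t. 0 \<le> \<rho> t"
    "\<And>s t. a \<le> s \<Longrightarrow> s \<le> t \<Longrightarrow> t \<le> b \<Longrightarrow> \<bar>u t - u s\<bar> \<le> integral {s..t} \<rho>"
  shows "ac_on a b u"
  using assms unfolding ac_on_def by blast

lemma ac_onE:
  assumes "ac_on a b u"
  obtains \<rho> where "\<rho> integrable_on {a..b}" "\<And>t. 0 \<le> \<rho> t"
    "\<And>s t. a \<le> s \<Longrightarrow> s \<le> t \<Longrightarrow> t \<le> b \<Longrightarrow> \<bar>u t - u s\<bar> \<le> integral {s..t} \<rho>"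
  using assms unfolding ac_on_def by blast

lemma ac_on_subinterval:
  assumes "ac_on a b u" "a \<le> c" "d \<le> b"
  shows "ac_on c d u"
proof -
  obtain \<rho> where r: "\<rho> integrable_on {a..b}" "\<And>t. 0 \<le> \<rho> t"
    "\<And>s t. a \<le> s \<Longrightarrow> s \<le> t \<Longrightarrow> t \<le> b \<Longrightarrow> \<bar>u t - u s\<bar> \<le> integral {s..t} \<rho>"
    using assms(1) by (rule ac_onE) (rule that)
  have "\<rho> integrable_on {c..d}" by (rule integrable_subinterval_real[OF r(1)]) (use assms in auto)
  then show ?thesis by (rule ac_onI[OF _ r(2)]) (rule r(3); use assms in linarith)
qed

lemma ac_on_lipschitz:
  assumes "0 \<le> C" "\<And>s t. a \<le> s \<Longrightarrow> s \<le> t \<Longrightarrow> t \<le> b \<Longrightarrow> \<bar>u t - u s\<bar> \<le> C * (t - s)"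
  shows "ac_on a b u"
  by (rule ac_onI[of "\<lambda>_. C"]) (use assms in \<open>auto simp: integrable_on_const mult.commute\<close>)

lemma ac_on_continuous:
  assumes "ac_on a b u"
  shows "continuous_on {a..b} u"
proof -
  obtain \<rho> where r: "\<rho> integrable_on {a..b}" "\<And>t. 0 \<le> \<rho> t"
    "\<And>s t. a \<le> s \<Longrightarrow> s \<le> t \<Longrightarrow> t \<le> b \<Longrightarrow> \<bar>u t - u s\<bar> \<le> integral {s..t} \<rho>"
    using assms by (rule ac_onE) (rule that)
  define I where "I t = integral {a..t} \<rho>" for t
  have cI: "continuous_on {a..b} I" unfolding I_def by (rule indefinite_integral_continuous_1[OF r(1)])
  have "integral {s..t} \<rho> = I t - I s" if "a \<le> s" "s \<le> t" "t \<le> b" for s t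
  proof -
    have "\<rho> integrable_on {a..t}" by (rule integrable_subinterval_real[OF r(1)]) (use that in auto)
    then have "integral {a..s} \<rho> + integral {s..t} \<rho> = integral {a..t} \<rho>"
      using that by (intro Henstock_Kurzweil_Integration.integral_combine) auto
    then show ?thesis by (simp add: I_def)
  qed
  then have le: "\<bar>u t - u s\<bar> \<le> I t - I s" if "a \<le> s" "s \<le> t" "t \<le> b" for s t
    using r(3) that by simp
  have dist: "dist (u t) (u s) \<le> dist (I t) (I s)" if "s \<in> {a..b}" "t \<in> {a..b}" for s t
    using le[of s t] le[of t s] that by (cases "s \<le> t") (auto simp: dist_real_def)
  show ?thesis
    unfolding continuous_on_iff
  proof (intro ballI allI impI)
    fix t e :: real assume "t \<in> {a..b}" "0 < e"
    then obtain d where "d > 0" "\<And>s. s \<in> {a..b} \<Longrightarrow> dist s t < d \<Longrightarrow> dist (I s) (I t) < e"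
      using cI unfolding continuous_on_iff by metis
    then show "\<exists>d>0. \<forall>s\<in>{a..b}. dist s t < d \<longrightarrow> dist (u s) (u t) < e"
      using dist[OF \<open>t \<in> {a..b}\<close>] by (meson le_less_trans)
  qed
qed

text \<open>Products and inverses fit this pattern because the factors are bounded on the compact
  interval.\<close>

lemma ac_on_combine:
  assumes "ac_on a b u" "ac_on a b v" "0 \<le> A" "0 \<le> B"
    and w: "\<And>s t. a \<le> s \<Longrightarrow> s \<le> t \<Longrightarrow> t \<le> b \<Longrightarrow> \<bar>w t - w s\<bar> \<le> A * \<bar>u t - u s\<bar> + B * \<bar>v t - v s\<bar>"
  shows "ac_on a b w"
proof -
  obtain \<rho> where r: "\<rho> integrable_on {a..b}" "\<And>t. 0 \<le> \<rho> t"
    "\<And>s t. a \<le> s \<Longrightarrow> s \<le> t \<Longrightarrow> t \<le> b \<Longrightarrow> \<bar>u t - u s\<bar> \<le> integral {s..t} \<rho>"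
    using assms(1) by (rule ac_onE) (rule that)
  obtain \<sigma> where q: "\<sigma> integrable_on {a..b}" "\<And>t. 0 \<le> \<sigma> t"
    "\<And>s t. a \<le> s \<Longrightarrow> s \<le> t \<Longrightarrow> t \<le> b \<Longrightarrow> \<bar>v t - v s\<bar> \<le> integral {s..t} \<sigma>"
    using assms(2) by (rule ac_onE) (rule that)
  show ?thesis
  proof (rule ac_onI)
    show "(\<lambda>t. A * \<rho> t + B * \<sigma> t) integrable_on {a..b}"
      by (intro integrable_add integrable_on_mult_right r(1) q(1))
    show "0 \<le> A * \<rho> t + B * \<sigma> t" for t using r(2) q(2) assms(3,4) by simp
    fix s t assume st: "a \<le> s" "s \<le> t" "t \<le> b"
    have "\<rho> integrable_on {s..t}" "\<sigma> integrable_on {s..t}"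
      using integrable_subinterval_real[OF r(1), of s t] integrable_subinterval_real[OF q(1), of s t] st by auto
    then have "integral {s..t} (\<lambda>t. A * \<rho> t + B * \<sigma> t) = A * integral {s..t} \<rho> + B * integral {s..t} \<sigma>"
      by (simp add: Henstock_Kurzweil_Integration.integral_add integrable_on_mult_right)
    moreover have "A * \<bar>u t - u s\<bar> + B * \<bar>v t - v s\<bar> \<le> A * integral {s..t} \<rho> + B * integral {s..t} \<sigma>"
      by (intro add_mono mult_left_mono r(3) q(3) st assms(3,4))
    ultimately show "\<bar>w t - w s\<bar> \<le> integral {s..t} (\<lambda>t. A * \<rho> t + B * \<sigma> t)" using w[OF st] by linarith
  qed
qed

lemma ac_on_const: "ac_on a b (\<lambda>_. c)"
  by (rule ac_on_lipschitz[of 0]) auto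

lemma ac_on_add: "ac_on a b u \<Longrightarrow> ac_on a b v \<Longrightarrow> ac_on a b (\<lambda>t. u t + v t)"
  by (rule ac_on_combine[of a b u v 1 1]) auto

lemma ac_on_bounded:
  assumes "ac_on a b u"
  obtains B where "0 \<le> B" "\<And>t. a \<le> t \<Longrightarrow> t \<le> b \<Longrightarrow> \<bar>u t\<bar> \<le> B"
proof -
  have "bounded (u ` {a..b})"
    by (intro compact_imp_bounded compact_continuous_image ac_on_continuous assms) simp
  then obtain B where "0 < B" "\<And>t. t \<in> {a..b} \<Longrightarrow> \<bar>u t\<bar> \<le> B" by (auto simp: bounded_pos)
  then show ?thesis using that[of B] by auto
qed

lemma ac_on_mult:
  assumes u: "ac_on a b u" and v: "ac_on a b v"
  shows "ac_on a b (\<lambda>t. u t * v t)"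
proof -
  obtain A where A: "0 \<le> A" "\<And>t. a \<le> t \<Longrightarrow> t \<le> b \<Longrightarrow> \<bar>u t\<bar> \<le> A" using u by (rule ac_on_bounded) blast
  obtain B where B: "0 \<le> B" "\<And>t. a \<le> t \<Longrightarrow> t \<le> b \<Longrightarrow> \<bar>v t\<bar> \<le> B" using v by (rule ac_on_bounded) blast
  show ?thesis
  proof (rule ac_on_combine[OF u v B(1) A(1)])
    fix s t assume st: "a \<le> s" "s \<le> t" "t \<le> b"
    have "u t * v t - u s * v s = v t * (u t - u s) + u s * (v t - v s)" by (simp add: algebra_simps)
    then have "\<bar>u t * v t - u s * v s\<bar> \<le> \<bar>v t\<bar> * \<bar>u t - u s\<bar> + \<bar>u s\<bar> * \<bar>v t - v s\<bar>"
      using abs_triangle_ineq[of "v t * (u t - u s)" "u s * (v t - v s)"] by (simp only: abs_mult)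
    also have "\<dots> \<le> B * \<bar>u t - u s\<bar> + A * \<bar>v t - v s\<bar>"
      using st by (intro add_mono mult_right_mono A B) auto
    finally show "\<bar>u t * v t - u s * v s\<bar> \<le> B * \<bar>u t - u s\<bar> + A * \<bar>v t - v s\<bar>" .
  qed
qed

lemma ac_on_inverse:
  assumes u: "ac_on a b u" and nz: "\<And>t. a \<le> t \<Longrightarrow> t \<le> b \<Longrightarrow> u t \<noteq> 0"
  shows "ac_on a b (\<lambda>t. inverse (u t))"
proof -
  have "bounded ((\<lambda>t. inverse (u t)) ` {a..b})"
    by (intro compact_imp_bounded compact_continuous_image continuous_on_inverse ac_on_continuous u) (use nz in auto)
  then obtain B where B: "0 < B" "\<And>t. t \<in> {a..b} \<Longrightarrow> \<bar>inverse (u t)\<bar> \<le> B" by (auto simp: bounded_pos)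
  show ?thesis
  proof (rule ac_on_combine[OF u ac_on_const[of _ _ 0], of "B * B" 0])
    fix s t assume st: "a \<le> s" "s \<le> t" "t \<le> b"
    have "inverse (u t) - inverse (u s) = - (inverse (u t) * (u t - u s) * inverse (u s))"
      using nz st by (intro inverse_diff_inverse) auto
    then have "\<bar>inverse (u t) - inverse (u s)\<bar> = \<bar>inverse (u t)\<bar> * \<bar>inverse (u s)\<bar> * \<bar>u t - u s\<bar>"
      by (simp only: abs_minus_cancel abs_mult mult_ac)
    also have "\<dots> \<le> B * B * \<bar>u t - u s\<bar>" using st B by (intro mult_right_mono mult_mono) auto
    finally show "\<bar>inverse (u t) - inverse (u s)\<bar> \<le> B * B * \<bar>u t - u s\<bar> + 0 * \<bar>0 - 0\<bar>" by simp
  qed (use B in auto)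
qed

lemma ac_on_sum: "(\<And>i. i \<in> A \<Longrightarrow> ac_on a b (u i)) \<Longrightarrow> ac_on a b (\<lambda>t. \<Sum>i\<in>A. u i t)"
  by (induction A rule: infinite_finite_induct) (auto intro: ac_on_const ac_on_add)

lemma ac_on_power: "ac_on a b u \<Longrightarrow> ac_on a b (\<lambda>t. u t ^ n)"
  by (induction n) (auto intro: ac_on_const ac_on_mult)

lemma ac_on_primitive:
  fixes g :: "real \<Rightarrow> real"
  assumes g: "g absolutely_integrable_on {a..b}"
    and u: "\<And>s t. a \<le> s \<Longrightarrow> s \<le> t \<Longrightarrow> t \<le> b \<Longrightarrow> (g has_integral (u t - u s)) {s..t}"
  shows "ac_on a b u"
proof (rule ac_onI)
  show i: "(\<lambda>t. \<bar>g t\<bar>) integrable_on {a..b}" using g by (simp add: absolutely_integrable_on_def)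
  fix s t assume st: "a \<le> s" "s \<le> t" "t \<le> b"
  have "\<bar>integral {s..t} g\<bar> \<le> integral {s..t} (\<lambda>t. \<bar>g t\<bar>)"
  proof -
    have "(\<lambda>t. \<bar>g t\<bar>) integrable_on {s..t}" by (rule integrable_subinterval_real[OF i]) (use st in auto)
    then have "norm (integral {s..t} g) \<le> integral {s..t} (\<lambda>t. \<bar>g t\<bar>)"
      by (intro integral_norm_bound_integral has_integral_integrable[OF u[OF st]]) auto
    then show ?thesis by simp
  qed
  then show "\<bar>u t - u s\<bar> \<le> integral {s..t} (\<lambda>t. \<bar>g t\<bar>)" using integral_unique[OF u[OF st]] by simp
qed simp

lemma ac_on_derivative:
  assumes u: "\<And>t. t \<in> {a..b} \<Longrightarrow> (u has_real_derivative u' t) (at t within {a..b})"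
    and u': "continuous_on {a..b} u'"
  shows "ac_on a b u"
proof -
  have "bounded (u' ` {a..b})" by (intro compact_imp_bounded compact_continuous_image u') simp
  then obtain C where C: "0 < C" "\<And>t. t \<in> {a..b} \<Longrightarrow> \<bar>u' t\<bar> \<le> C" by (auto simp: bounded_pos)
  show ?thesis
  proof (rule ac_on_lipschitz)
    fix s t assume st: "a \<le> s" "s \<le> t" "t \<le> b"
    have "norm (u t - u s) \<le> C * norm (t - s)"
      by (rule field_differentiable_bound[of "{a..b}" u u']) (use u C st in auto)
    then show "\<bar>u t - u s\<bar> \<le> C * (t - s)" using st by simp
  qed (use C in simp)
qed

text \<open>Lusin's condition: the majorant is the density of a finite measure dominating the
  increments, which brings \<open>negligible_image_dominated\<close> into play after clamping to
  \<open>[a, b]\<close>.\<close>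

lemma ac_on_negligible_image:
  assumes u: "ac_on a b u" and N: "negligible N" "N \<subseteq> {a..b}"
  shows "negligible (u ` N)"
proof (cases "a \<le> b")
  case False
  then have "N = {}" using N(2) by auto
  then show ?thesis by simp
next
  case True
  obtain \<rho> where r: "\<rho> integrable_on {a..b}" "\<And>t. 0 \<le> \<rho> t"
    "\<And>s t. a \<le> s \<Longrightarrow> s \<le> t \<Longrightarrow> t \<le> b \<Longrightarrow> \<bar>u t - u s\<bar> \<le> integral {s..t} \<rho>"
    using u by (rule ac_onE) (rule that)
  define F where "F t = indicat_real {a..b} t * \<rho> t" for t
  have F0: "0 \<le> F t" for t using r(2) by (simp add: F_def)
  have "\<rho> absolutely_integrable_on {a..b}"
    using r by (intro nonnegative_absolutely_integrable_1) auto
  then have F: "integrable lebesgue F" by (simp add: F_def[abs_def] set_integrable_def)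
  then have "F \<in> borel_measurable (completion lborel)" by (rule borel_measurable_integrable)
  \<comment> \<open>The majorant is only Lebesgue measurable, while the covering lemma wants a Borel
    measure; a Borel representative gives the same increments.\<close>
  then obtain h where h: "h \<in> borel_measurable lborel" "AE t in lborel. F t = h t"
    using completion_ex_borel_measurable_real by blast
  define M where "M = density lborel (\<lambda>t. ennreal (h t))"
  have aeF: "AE t in lebesgue. F t = h t" using h(2) by (rule AE_completion)
  have em: "emeasure M A = ennreal (LINT t|lebesgue. indicat_real A t * F t)" if A: "A \<in> sets borel" for A
  proof -
    have A': "A \<in> sets lebesgue" using A by (intro sets_completionI_sets) simp
    have "integrable lebesgue (\<lambda>t. indicat_real A t *\<^sub>R F t)"
      using F A' by (intro integrable_mult_indicator) auto
    then have i: "integrable lebesgue (\<lambda>t. indicat_real A t * F t)" by simp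
    have "emeasure M A = (\<integral>\<^sup>+t. ennreal (h t) * indicator A t \<partial>lborel)"
      unfolding M_def using h(1) A by (intro emeasure_density) auto
    also have "\<dots> = (\<integral>\<^sup>+t. ennreal (h t) * indicator A t \<partial>lebesgue)" by (simp add: nn_integral_completion)
    also have "\<dots> = (\<integral>\<^sup>+t. ennreal (indicat_real A t * F t) \<partial>lebesgue)"
      using aeF by (intro nn_integral_cong_AE) (rule AE_mp[OF _ AE_I2], assumption, simp split: split_indicator)
    also have "\<dots> = ennreal (LINT t|lebesgue. indicat_real A t * F t)"
      using i F0 by (intro nn_integral_eq_integral) auto
    finally show ?thesis .
  qed
  have inc: "integral {s..t} \<rho> = measure M {s<..t}" if "a \<le> s" "s \<le> t" "t \<le> b" for s t
  proof -
    have "\<rho> integrable_on {s..t}" by (rule integrable_subinterval_real[OF r(1)]) (use that in auto)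
    then have "\<rho> absolutely_integrable_on {s..t}" using r by (intro nonnegative_absolutely_integrable_1) auto
    then have "integral {s..t} \<rho> = (LINT t:{s..t}|lebesgue. \<rho> t)"
      using set_lebesgue_integral_eq_integral(2) by metis
    also have "\<dots> = (LINT x|lebesgue. indicat_real {s<..t} x * F x)"
      unfolding set_lebesgue_integral_def
    proof (rule integral_cong_AE)
      have "AE x in lebesgue. x \<noteq> s"
        using AE_lborel_singleton[of s] by (rule AE_completion)
      then show "AE x in lebesgue. indicat_real {s..t} x *\<^sub>R \<rho> x = indicat_real {s<..t} x * F x"
        by eventually_elim (use that in \<open>auto simp: F_def split: split_indicator\<close>)
      show "(\<lambda>x. indicat_real {s..t} x *\<^sub>R \<rho> x) \<in> borel_measurable lebesgue"
        using \<open>\<rho> absolutely_integrable_on {s..t}\<close> unfolding set_integrable_def by (rule borel_measurable_integrable)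
      show "(\<lambda>x. indicat_real {s<..t} x * F x) \<in> borel_measurable lebesgue"
        using borel_measurable_integrable[OF F] by (intro borel_measurable_times borel_measurable_indicator) auto
    qed
    also have "\<dots> = measure M {s<..t}"
      using em[of "{s<..t}"] F0 by (simp add: measure_def integral_nonneg)
    finally show ?thesis .
  qed
  define G where "G t = u (max a (min b t))" for t
  have fin: "emeasure M (space M) \<noteq> \<infinity>" using em[of UNIV] by (simp add: M_def)
  have "negligible (G ` N)"
  proof (rule negligible_image_dominated[OF _ fin])
    show "sets M = sets borel" by (simp add: M_def)
    show "absolutely_continuous lborel M" unfolding M_def
      using h(1) by (intro absolutely_continuousI_density) auto
    show "negligible N" by (rule N)
    fix s t :: real assume st: "s \<le> t"
    let ?s = "max a (min b s)" and ?t = "max a (min b t)"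
    have "\<bar>G t - G s\<bar> \<le> measure M {?s<..?t}"
      unfolding G_def using r(3)[of ?s ?t] inc[of ?s ?t] st True by auto
    also have "\<dots> \<le> measure M {s<..t}"
    proof (rule measure_mono_fmeasurable)
      show "{?s<..?t} \<subseteq> {s<..t}" using True by auto
      have "emeasure M {s<..t} \<le> emeasure M (space M)" by (rule emeasure_space)
      then show "{s<..t} \<in> fmeasurable M" using fin by (intro fmeasurableI) (auto simp: M_def top.not_eq_extremum order.strict_trans1)
    qed (simp add: M_def)
    finally show "\<bar>G t - G s\<bar> \<le> measure M {s<..t}" .
  qed
  moreover have "G ` N = u ` N" using N(2) by (intro image_cong) (auto simp: G_def max_def min_def)
  ultimately show ?thesis by simp
qed

text \<open>The space W^{2,1} of a compact interval in classical terms. It is a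
  \<open>function_ring\<close>, so polynomial expressions in the curve stay in it.\<close>

definition ac_derivative_functions :: "real \<Rightarrow> real \<Rightarrow> (real \<Rightarrow> real) set" where
  "ac_derivative_functions a b = {u. \<exists>u'. (\<forall>t\<in>{a..b}. (u has_real_derivative u' t) (at t within {a..b})) \<and> ac_on a b u'}"

lemma ac_derivative_functionsI:
  assumes "\<And>t. t \<in> {a..b} \<Longrightarrow> (u has_real_derivative u' t) (at t within {a..b})" "ac_on a b u'"
  shows "u \<in> ac_derivative_functions a b"
  using assms unfolding ac_derivative_functions_def mem_Collect_eq by blast

lemma ac_derivative_functionsE:
  assumes "u \<in> ac_derivative_functions a b"
  obtains u' where "\<And>t. t \<in> {a..b} \<Longrightarrow> (u has_real_derivative u' t) (at t within {a..b})" "ac_on a b u'"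
  using assms unfolding ac_derivative_functions_def mem_Collect_eq by blast

lemma ac_derivative_functions_const: "(\<lambda>_. c) \<in> ac_derivative_functions a b"
  unfolding ac_derivative_functions_def by (auto intro!: exI[of _ "\<lambda>_. 0"] ac_on_const)

lemma ac_derivative_functions_mult:
  assumes u: "u \<in> ac_derivative_functions a b" and v: "v \<in> ac_derivative_functions a b"
  shows "(\<lambda>t. u t * v t) \<in> ac_derivative_functions a b"
proof -
  obtain u' where u': "\<And>t. t \<in> {a..b} \<Longrightarrow> (u has_real_derivative u' t) (at t within {a..b})" "ac_on a b u'"
    by (rule ac_derivative_functionsE[OF u]) (rule that)
  obtain v' where v': "\<And>t. t \<in> {a..b} \<Longrightarrow> (v has_real_derivative v' t) (at t within {a..b})" "ac_on a b v'"
    by (rule ac_derivative_functionsE[OF v]) (rule that)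
  have "ac_on a b u" "ac_on a b v"
    using ac_on_derivative[OF u'(1) ac_on_continuous[OF u'(2)]] ac_on_derivative[OF v'(1) ac_on_continuous[OF v'(2)]] by auto
  then have "ac_on a b (\<lambda>t. u' t * v t + v' t * u t)" by (intro ac_on_add ac_on_mult u' v')
  then show ?thesis by (rule ac_derivative_functionsI[rotated]) (intro DERIV_mult u' v')
qed

lemma function_ring_ac_derivative_functions: "function_ring (ac_derivative_functions a b)"
  unfolding function_ring_def
proof (intro conjI ballI allI impI)
  let ?R = "ac_derivative_functions a b"
  show "(\<lambda>_. 1) \<in> ?R" by (rule ac_derivative_functions_const)
  show neg: "(\<lambda>t. - u t) \<in> ?R" if "u \<in> ?R" for u
    using ac_derivative_functions_mult[OF ac_derivative_functions_const[of "-1"] that] by simp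
  show "(\<lambda>t. u t * v t) \<in> ?R" if "u \<in> ?R" "v \<in> ?R" for u v
    using that by (rule ac_derivative_functions_mult)
  show "(\<lambda>t. u t + v t) \<in> ?R" if u: "u \<in> ?R" and v: "v \<in> ?R" for u v
  proof -
    obtain u' where u': "\<And>t. t \<in> {a..b} \<Longrightarrow> (u has_real_derivative u' t) (at t within {a..b})" "ac_on a b u'"
      by (rule ac_derivative_functionsE[OF u]) (rule that)
    obtain v' where v': "\<And>t. t \<in> {a..b} \<Longrightarrow> (v has_real_derivative v' t) (at t within {a..b})" "ac_on a b v'"
      by (rule ac_derivative_functionsE[OF v]) (rule that)
    show ?thesis by (rule ac_derivative_functionsI[OF _ ac_on_add[OF u'(2) v'(2)]]) (intro DERIV_add u' v')
  qed
  show "u \<in> ?R" if "(\<lambda>t. of_nat (Suc n) * u t) \<in> ?R" for n u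
  proof -
    have "inverse (of_nat (Suc n)) * (of_nat (Suc n) * x) = x" for x :: real
      by (simp add: field_simps del: of_nat_Suc)
    then show ?thesis
      using ac_derivative_functions_mult[OF ac_derivative_functions_const[of "inverse (of_nat (Suc n))"] that] by (simp only:)
  qed
qed

text \<open>The coefficients are polynomials in the components of the curve, so they lie in every
  function ring containing these and the constants.\<close>

lemma rpoly_line_coeff_ac_derivative:
  fixes x :: "real \<Rightarrow> real ^ 'n::finite"
  assumes x: "\<And>i. (\<lambda>t. x t $ i) \<in> ac_derivative_functions a b"
  shows "(\<lambda>t. coeff (rpoly_line f v (x t)) j) \<in> ac_derivative_functions a b"
proof -
  let ?R = "ac_derivative_functions a b"
  let ?S = "{F. \<forall>j. (\<lambda>t. coeff (F t) j) \<in> ?R}"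
  have c: "(\<lambda>_. [:c:]) \<in> ?S" for c by (simp add: ac_derivative_functions_const)
  have l: "(\<lambda>t. [:x t $ i, - (v $ i):]) \<in> ?S" for i
  proof -
    have "(\<lambda>t. coeff [:x t $ i, - (v $ i):] j) \<in> ?R" for j
      using x[of i] by (cases j) (simp_all add: ac_derivative_functions_const)
    then show ?thesis by simp
  qed
  have "(\<lambda>t. rpoly_line f v (x t)) \<in> ?S"
    unfolding rpoly_line_def
    by (rule rpoly_subst_in_function_ring[OF function_ring_coeffs[OF function_ring_ac_derivative_functions] c l])
  then show ?thesis by simp
qed

text \<open>Each isolated point is singled out by an interval with rational end points.\<close>

lemma countable_isolated_points:
  fixes Z :: "real set"
  shows "countable {t \<in> Z. \<not> t islimpt Z}"
proof -
  let ?C = "\<lambda>(p, q). {t \<in> {p<..<q}. Z \<inter> {p<..<q} = {t}}"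
  have "{t \<in> Z. \<not> t islimpt Z} \<subseteq> (\<Union>pq\<in>\<rat> \<times> \<rat>. ?C pq)"
  proof
    fix t assume "t \<in> {t \<in> Z. \<not> t islimpt Z}"
    then obtain e where e: "e > 0" "\<And>s. s \<in> Z \<Longrightarrow> s \<noteq> t \<Longrightarrow> \<not> dist s t < e" and t: "t \<in> Z"
      unfolding islimpt_approachable by blast
    obtain p where p: "p \<in> \<rat>" "t - e < p" "p < t" using Rats_dense_in_real[of "t - e" t] e(1) by auto
    obtain q where q: "q \<in> \<rat>" "t < q" "q < t + e" using Rats_dense_in_real[of t "t + e"] e(1) by auto
    have "Z \<inter> {p<..<q} = {t}"
    proof -
      have "s = t" if "s \<in> Z" "p < s" "s < q" for s
      proof (rule ccontr)
        assume "s \<noteq> t"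
        then have "\<not> \<bar>s - t\<bar> < e" using e(2)[OF that(1)] by (simp add: dist_real_def)
        then show False using that(2,3) p(2) q(3) by linarith
      qed
      then have "Z \<inter> {p<..<q} \<subseteq> {t}" by (metis IntE greaterThanLessThan_iff singleton_iff subsetI)
      moreover have "{t} \<subseteq> Z \<inter> {p<..<q}" using t p(3) q(2) by simp
      ultimately show ?thesis by (rule equalityI)
    qed
    then have "t \<in> ?C (p, q)" using p q by simp
    then show "t \<in> (\<Union>pq\<in>\<rat> \<times> \<rat>. ?C pq)" using p(1) q(1) by blast
  qed
  moreover have "countable (?C pq)" for pq
  proof (cases pq)
    case (Pair p q)
    have "?C pq \<subseteq> {THE t. Z \<inter> {p<..<q} = {t}}" unfolding Pair by auto
    then show ?thesis by (rule countable_subset) simp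
  qed
  ultimately show ?thesis
    by (rule countable_subset[OF _ countable_UN[OF countable_SIGMA[OF countable_rat countable_rat]]])
qed

lemma derivative_zero_at_limit_of_zeros:
  fixes w :: "real \<Rightarrow> real"
  assumes w: "(w has_real_derivative D) (at t)" and Z: "t islimpt Z" "t \<in> Z" "\<And>s. s \<in> Z \<Longrightarrow> w s = 0"
  shows "D = 0"
proof -
  have "((\<lambda>s. (w s - w t) / (s - t)) \<longlongrightarrow> D) (at t within Z)"
    using w unfolding has_field_derivative_iff by (rule tendsto_within_subset) simp
  moreover have "\<forall>\<^sub>F s in at t within Z. (w s - w t) / (s - t) = 0"
    using Z(2,3) by (auto simp: eventually_at_filter)
  then have "((\<lambda>s. (w s - w t) / (s - t)) \<longlongrightarrow> 0) (at t within Z)" by (rule tendsto_eventually)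
  moreover have "at t within Z \<noteq> bot" using Z(1) by (simp add: trivial_limit_within)
  ultimately show ?thesis by (rule tendsto_unique[rotated])
qed

lemma poly_sum_atMost:
  fixes p :: "real poly"
  assumes "degree p \<le> d"
  shows "poly p z = (\<Sum>i\<le>d. coeff p i * z ^ i)"
  unfolding poly_altdef using assms
  by (intro sum.mono_neutral_left) (auto intro: coeff_eq_0)

lemma poly_pderiv_sum_atMost:
  fixes p :: "real poly"
  assumes "degree p \<le> d"
  shows "poly (pderiv p) z = (\<Sum>i\<le>d. coeff p i * (of_nat i * z ^ (i - 1)))"
proof (rule DERIV_unique)
  show "((\<lambda>z. \<Sum>i\<le>d. coeff p i * z ^ i) has_real_derivative (\<Sum>i\<le>d. coeff p i * (of_nat i * z ^ (i - 1)))) (at z)"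
    by (auto intro!: derivative_eq_intros simp: mult_ac)
  show "((\<lambda>z. \<Sum>i\<le>d. coeff p i * z ^ i) has_real_derivative poly (pderiv p) z) (at z)"
    using poly_DERIV[of p z] unfolding poly_sum_atMost[OF assms, abs_def] .
qed

text \<open>At a limit point of the set where the root has multiplicity \<open>m\<close>, the derivative of the root is
  the quotient of two absolutely continuous functions; the remaining points are countable.\<close>

lemma root_derivative_negligible_image:
  fixes P :: "real \<Rightarrow> real poly" and l l' :: "real \<Rightarrow> real"
  assumes P: "\<And>j. (\<lambda>t. coeff (P t) j) \<in> ac_derivative_functions a b"
    and deg: "\<And>t. t \<in> {a..b} \<Longrightarrow> degree (P t) = d" "\<And>t. t \<in> {a..b} \<Longrightarrow> P t \<noteq> 0"
    and root: "\<And>t. t \<in> {a..b} \<Longrightarrow> poly (P t) (l t) = 0"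
    and l: "\<And>t. t \<in> {a..b} \<Longrightarrow> (l has_real_derivative l' t) (at t within {a..b})" "continuous_on {a..b} l'"
    and N: "negligible N" "N \<subseteq> {a..b}"
  shows "negligible (l' ` N)"
proof -
  define c where "c k i t = coeff ((pderiv ^^ k) (P t)) i" for k i t
  have "c k i \<in> ac_derivative_functions a b" for k i
    unfolding c_def coeff_higher_pderiv
    by (intro ac_derivative_functions_mult ac_derivative_functions_const P)
  then have "\<exists>u'. (\<forall>t\<in>{a..b}. (c k i has_real_derivative u' t) (at t within {a..b})) \<and> ac_on a b u'" for k i
    unfolding ac_derivative_functions_def mem_Collect_eq by blast
  then obtain c' where c': "\<And>k i t. t \<in> {a..b} \<Longrightarrow> (c k i has_real_derivative c' k i t) (at t within {a..b})"
      "\<And>k i. ac_on a b (c' k i)"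
    by metis
  \<comment> \<open>\<open>w k t\<close> is the \<open>k\<close>-th derivative of the polynomial at
    the root, and \<open>A k t\<close> the part of its time derivative caused by the moving
    coefficients. Differentiation gives \<open>A k + w (Suc k) * l'\<close>.\<close>
  define w where "w k t = (\<Sum>i\<le>d. c k i t * l t ^ i)" for k t
  define A where "A k t = (\<Sum>i\<le>d. c' k i t * l t ^ i)" for k t
  have lac: "ac_on a b l" by (rule ac_on_derivative[OF l])
  have cac: "ac_on a b (c k i)" for k i by (rule ac_on_derivative[OF c'(1) ac_on_continuous[OF c'(2)]])
  have wac: "ac_on a b (w k)" for k unfolding w_def by (intro ac_on_sum ac_on_mult cac ac_on_power lac)
  have Aac: "ac_on a b (A k)" for k unfolding A_def by (intro ac_on_sum ac_on_mult c' ac_on_power lac)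
  have dk: "degree ((pderiv ^^ k) (P t)) \<le> d" if "t \<in> {a..b}" for k t
    using deg(1)[OF that] by (simp add: degree_higher_pderiv)
  have wd: "(w k has_real_derivative A k t + w (Suc k) t * l' t) (at t within {a..b})" if t: "t \<in> {a..b}" for k t
  proof -
    have "w (Suc k) t = poly (pderiv ((pderiv ^^ k) (P t))) (l t)"
      using poly_sum_atMost[OF dk[OF t, of "Suc k"], of "l t"] by (simp add: w_def c_def)
    also have "\<dots> = (\<Sum>i\<le>d. c k i t * (of_nat i * l t ^ (i - 1)))"
      unfolding c_def by (rule poly_pderiv_sum_atMost[OF dk[OF t]])
    finally have ws: "w (Suc k) t * l' t = (\<Sum>i\<le>d. c k i t * (of_nat i * l t ^ (i - 1)) * l' t)"
      by (simp add: sum_distrib_right)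
    have "((\<lambda>t. c k i t * l t ^ i) has_real_derivative
        c' k i t * l t ^ i + c k i t * (of_nat i * l t ^ (i - 1)) * l' t) (at t within {a..b})" for i
      by (rule DERIV_cong[OF DERIV_mult[OF c'(1)[OF t] DERIV_power[OF l(1)[OF t]]]]) (simp add: mult_ac)
    then have "(w k has_real_derivative (\<Sum>i\<le>d. c' k i t * l t ^ i + c k i t * (of_nat i * l t ^ (i - 1)) * l' t)) (at t within {a..b})"
      unfolding w_def[abs_def] by (intro DERIV_sum)
    then show ?thesis by (simp only: ws A_def sum.distrib)
  qed
  have w0: "w 0 t = 0" if "t \<in> {a..b}" for t
    using poly_sum_atMost[OF dk[OF that, of 0], of "l t"] root[OF that] by (simp add: w_def c_def)
  \<comment> \<open>The derivative of order \<open>d\<close> is the nonzero constant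
    \<open>fact d * lead_coeff (P t)\<close>, so every multiplicity is detected by some
    \<open>m < d\<close>.\<close>
  have wtop: "w d t \<noteq> 0" if t: "t \<in> {a..b}" for t
  proof -
    let ?p = "(pderiv ^^ d) (P t)"
    have "degree ?p = 0" using deg(1)[OF t] by (simp add: degree_higher_pderiv)
    then have "poly ?p (l t) = coeff ?p 0" by (simp add: poly_altdef)
    also have "\<dots> = fact d * lead_coeff (P t)"
      using deg(1)[OF t] by (simp add: coeff_higher_pderiv pochhammer_fact)
    finally have "poly ?p (l t) \<noteq> 0" using deg(2)[OF t] by simp
    then show ?thesis using poly_sum_atMost[OF dk[OF t, of d], of "l t"] by (simp add: w_def c_def)
  qed
  \<comment> \<open>A root of multiplicity \<open>m + 1\<close> puts \<open>t\<close> into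
    \<open>Z m\<close>. At limit points of \<open>Z m\<close> inside it, the derivative of
    \<open>w m\<close> is 0, which can be solved for \<open>l' t\<close>.\<close>
  define Z where "Z m = {t \<in> {a<..<b}. w m t = 0 \<and> w (Suc m) t \<noteq> 0}" for m
  have "negligible (l' ` (N \<inter> Z m))" for m
  proof -
    define h where "h t = (- 1) * A m t * inverse (w (Suc m) t)" for t
    \<comment> \<open>The quotient \<open>h\<close> is absolutely continuous where its denominator
      stays away from 0, so \<open>V\<close> is exhausted by countably many compact
      intervals.\<close>
    define V where "V = {t \<in> {a<..<b}. w (Suc m) t \<noteq> 0}"
    have "open ({a<..<b} \<inter> w (Suc m) -` (- {0}))"
      by (rule continuous_open_preimage[OF continuous_on_subset[OF ac_on_continuous[OF wac]]]) auto
    also have "{a<..<b} \<inter> w (Suc m) -` (- {0}) = V" by (auto simp: V_def)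
    finally obtain \<D> where D: "countable \<D>" "\<D> \<subseteq> Pow V" "\<And>X. X \<in> \<D> \<Longrightarrow> \<exists>p q. X = cbox p q" "\<Union>\<D> = V"
      by (rule open_countable_Union_open_cbox) (rule that)
    have "negligible (h ` (N \<inter> X))" if X: "X \<in> \<D>" for X
    proof -
      obtain p q where pq: "X = {p..q}" using D(3)[OF X] by auto
      have XV: "X \<subseteq> V" using D(2) X by blast
      show ?thesis
      proof (cases "p \<le> q")
        case True
        then have "p \<in> V" "q \<in> V" using XV pq by auto
        then have sub: "a \<le> p" "q \<le> b" by (auto simp: V_def)
        have "w (Suc m) t \<noteq> 0" if "p \<le> t" "t \<le> q" for t
        proof -
          have "t \<in> V" using that XV pq by auto
          then show ?thesis by (simp add: V_def)
        qed
        then have "ac_on p q h" unfolding h_def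
          by (intro ac_on_mult ac_on_const ac_on_inverse ac_on_subinterval[OF Aac sub] ac_on_subinterval[OF wac sub])
        then show ?thesis
          by (rule ac_on_negligible_image) (use N pq in \<open>auto intro: negligible_subset\<close>)
      qed (simp add: pq)
    qed
    then have "negligible (\<Union>((\<lambda>X. h ` (N \<inter> X)) ` \<D>))"
      using D(1) by (intro negligible_countable_Union) auto
    moreover have "negligible (l' ` {t \<in> Z m. \<not> t islimpt Z m})"
      
      unfolding negligible_iff_null_sets
      by (intro null_sets_completionI countable_imp_null_set_lborel countable_image countable_isolated_points)
    moreover have "l' ` (N \<inter> Z m) \<subseteq> (\<Union>((\<lambda>X. h ` (N \<inter> X)) ` \<D>)) \<union> l' ` {t \<in> Z m. \<not> t islimpt Z m}"
    proof
      fix y assume "y \<in> l' ` (N \<inter> Z m)"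
      then obtain t where t: "t \<in> N" "t \<in> Z m" "y = l' t" by blast
      show "y \<in> (\<Union>((\<lambda>X. h ` (N \<inter> X)) ` \<D>)) \<union> l' ` {t \<in> Z m. \<not> t islimpt Z m}"
      proof (cases "t islimpt Z m")
        case True
        have tab: "a < t" "t < b" "w (Suc m) t \<noteq> 0" using t(2) by (auto simp: Z_def)
        have "(w m has_real_derivative A m t + w (Suc m) t * l' t) (at t)"
          using wd[of t m] tab by (simp add: at_within_Icc_at)
        then have "A m t + w (Suc m) t * l' t = 0"
          by (rule derivative_zero_at_limit_of_zeros[OF _ True t(2)]) (simp add: Z_def)
        then have "y = h t" using tab(3) t(3) by (simp add: h_def field_simps)
        moreover have "t \<in> \<Union>\<D>" using tab D(4) by (simp add: V_def)
        ultimately show ?thesis using t(1) by blast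
      qed (use t in auto)
    qed
    ultimately show ?thesis by (rule_tac negligible_subset[OF negligible_Un])
  qed
  then have "negligible (\<Union>m. l' ` (N \<inter> Z m))" by (intro negligible_Union_nat) auto
  moreover have "negligible (l' ` {a, b})" by simp
  moreover have "l' ` N \<subseteq> (\<Union>m. l' ` (N \<inter> Z m)) \<union> l' ` {a, b}"
  proof -
    have "\<exists>m. t \<in> Z m" if t: "t \<in> {a<..<b}" for t
    proof (rule ccontr)
      assume neg: "\<not> ?thesis"
      have "w k t = 0" for k
      proof (induction k)
        case 0
        then show ?case using w0 t by simp
      next
        case (Suc k)
        then show ?case using neg t by (auto simp: Z_def)
      qed
      then show False using wtop[of t] t by simp
    qed
    note inZ = this
    show ?thesis
    proof
      fix y assume "y \<in> l' ` N"
      then obtain t where t: "t \<in> N" "y = l' t" by blast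
      show "y \<in> (\<Union>m. l' ` (N \<inter> Z m)) \<union> l' ` {a, b}"
      proof (cases "t \<in> {a<..<b}")
        case True
        then show ?thesis using inZ[of t] t by blast
      next
        case False
        then have "t = a \<or> t = b" using N(2) t(1) by force
        then show ?thesis using t(2) by blast
      qed
    qed
  qed
  ultimately show ?thesis by (rule_tac negligible_subset[OF negligible_Un])
qed

section \<open>Differentiable systems of roots\<close>

lemma bottom_sum_lipschitz:
  fixes f :: "'n::finite rpoly"
  assumes f: "f \<in> Hyp d v"
  obtains L where "0 \<le> L"
    "\<And>k y z. k \<le> d \<Longrightarrow> \<bar>bottom_sum f v d k y - bottom_sum f v d k z\<bar> \<le> L * (\<Sum>i\<in>UNIV. \<bar>y $ i - z $ i\<bar>)"
proof -
  obtain L where L: "0 \<le> L" "\<And>k x. k \<le> d \<Longrightarrow> - (L * (\<Sum>i\<in>UNIV. \<bar>x $ i\<bar>)) \<le> bottom_sum f v d k x"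
    by (rule bottom_sum_lower_bound[OF f]) (rule that)
  have "\<bar>bottom_sum f v d k y - bottom_sum f v d k z\<bar> \<le> L * (\<Sum>i\<in>UNIV. \<bar>y $ i - z $ i\<bar>)" if k: "k \<le> d" for k y z
  proof -
    have "(\<Sum>i\<in>UNIV. \<bar>z $ i - y $ i\<bar>) = (\<Sum>i\<in>UNIV. \<bar>y $ i - z $ i\<bar>)" by (simp only: abs_minus_commute)
    then show ?thesis
      using bottom_sum_convex_aux[OF f k L(2)[OF k], of y z] bottom_sum_convex_aux[OF f k L(2)[OF k], of z y]
      by (simp only: abs_le_iff) linarith
  qed
  then show ?thesis by (rule that[OF L(1)])
qed

lemma convex_right_continuous:
  fixes P :: "real \<Rightarrow> real"
  assumes "open J" "convex_on J P" "t \<in> J"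
  shows "(P \<longlongrightarrow> P t) (at_right t)"
proof -
  have "continuous_on J P" using assms by (intro convex_on_continuous)
  then have "isCont P t" using assms by (simp add: continuous_on_eq_continuous_at)
  then show ?thesis by (simp add: isCont_def filterlim_at_split)
qed

context
  fixes J I :: "real set" and P :: "nat \<Rightarrow> real \<Rightarrow> real" and g g' :: "real \<Rightarrow> real" and d :: nat
  assumes J: "open J" and I: "open I" "I \<subseteq> J" and P: "\<And>k. k \<le> d \<Longrightarrow> convex_on J (P k)"
    and g: "\<And>t. t \<in> I \<Longrightarrow> (g has_real_derivative g' t) (at t)"
    and sel: "\<And>t. t \<in> I \<Longrightarrow> \<exists>j<d. g t = P (d - Suc j) t - P (d - j) t"
begin

text \<open>Near \<open>t\<close> the root follows finitely many differences of convex functions,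
  each with a right derivative. The slopes are taken in the larger set \<open>J\<close>, which later
  keeps them bounded up to the ends of \<open>I\<close>.\<close>

lemma root_derivative_eq_slope:
  assumes t: "t \<in> I"
  shows "\<exists>j<d. g' t = right_slope J (P (d - Suc j)) t - right_slope J (P (d - j)) t"
proof -
  have tJ: "t \<in> J" using t I by blast
  have "\<exists>j\<in>{..<d}. g' t = right_slope J (P (d - Suc j)) t - right_slope J (P (d - j)) t"
  proof (rule selection_right_derivative[where m = "\<lambda>j t. P (d - Suc j) t - P (d - j) t"])
    have "((\<lambda>u. (g u - g t) / (u - t)) \<longlongrightarrow> g' t) (at t)" "(g \<longlongrightarrow> g t) (at t)"
      using g[OF t] DERIV_isCont[OF g[OF t]] by (auto simp: has_field_derivative_iff isCont_def)
    then show "((\<lambda>u. (g u - g t) / (u - t)) \<longlongrightarrow> g' t) (at_right t)" "(g \<longlongrightarrow> g t) (at_right t)"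
      by (auto simp: filterlim_at_split)
    show "\<forall>\<^sub>F u in at_right t. \<exists>j\<in>{..<d}. g u = P (d - Suc j) u - P (d - j) u"
    proof -
      have "\<forall>\<^sub>F u in at t. u \<in> I" using I(1) t by (rule eventually_at_in_open')
      then have "\<forall>\<^sub>F u in at_right t. u \<in> I" by (simp add: eventually_at_split)
      then show ?thesis by eventually_elim (use sel in blast)
    qed
    fix j assume "j \<in> {..<d}"
    then have c: "convex_on J (P (d - Suc j))" "convex_on J (P (d - j))" by (auto intro: P)
    have *: "(P (d - Suc j) u - P (d - j) u - (P (d - Suc j) t - P (d - j) t)) / (u - t) =
      (P (d - Suc j) u - P (d - Suc j) t) / (u - t) - (P (d - j) u - P (d - j) t) / (u - t)" for u
      by (simp add: diff_divide_distrib)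
    show "((\<lambda>u. (P (d - Suc j) u - P (d - j) u - (P (d - Suc j) t - P (d - j) t)) / (u - t))
      \<longlongrightarrow> right_slope J (P (d - Suc j)) t - right_slope J (P (d - j)) t) (at_right t)"
      unfolding * by (intro tendsto_diff right_slope_has_derivative J c tJ)
    show "((\<lambda>t. P (d - Suc j) t - P (d - j) t) \<longlongrightarrow> P (d - Suc j) t - P (d - j) t) (at_right t)"
      by (intro tendsto_diff convex_right_continuous[OF J] c tJ)
  qed simp
  then show ?thesis by auto
qed

lemma root_derivative_increment:
  assumes st: "s \<le> t" "{s..t} \<subseteq> I"
  shows "\<bar>g' t - g' s\<bar> \<le> (\<Sum>j<d. right_slope J (P (d - Suc j)) t + right_slope J (P (d - j)) t) -
    (\<Sum>j<d. right_slope J (P (d - Suc j)) s + right_slope J (P (d - j)) s)"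
proof -
  have stJ: "r \<in> J" if "r \<in> {s..t}" for r using that st I by blast
  have mono: "mono_on {s..t} (right_slope J (P k))" if "k \<le> d" for k
    unfolding mono_on_def using stJ by (intro allI impI right_slope_increment(3)[OF J P[OF that]]) auto
  have "\<bar>g' t - g' s\<bar> \<le> (\<Sum>j<d. (right_slope J (P (d - Suc j)) t - right_slope J (P (d - Suc j)) s) +
     (right_slope J (P (d - j)) t - right_slope J (P (d - j)) s))"
  proof (rule selection_derivative_increment[OF st(1)])
    fix r assume r: "r \<in> {s..t}"
    then have "r \<in> I" using st by blast
    then show "(g has_real_derivative g' r) (at r)"
      "\<exists>j\<in>{..<d}. g' r = right_slope J (P (d - Suc j)) r - right_slope J (P (d - j)) r"
      using g root_derivative_eq_slope by auto
  qed (auto intro: mono)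
  then show ?thesis by (simp add: sum.distrib sum_subtractf)
qed

end

text \<open>\<open>G\<close> plays the part of a right derivative of \<open>l\<close>. Unlike
  differentiability, these inequalities involve two times only and survive pointwise limits, and
  they return differentiability wherever \<open>\<Phi>\<close> is continuous.\<close>

definition dominated :: "(real \<Rightarrow> real) \<Rightarrow> (real \<Rightarrow> real) \<Rightarrow> (real \<Rightarrow> real) \<Rightarrow> bool" where
  "dominated \<Phi> l G \<longleftrightarrow> (\<forall>s t. s \<le> t \<longrightarrow>
     \<bar>G t - G s\<bar> \<le> \<Phi> t - \<Phi> s \<and> \<bar>l t - l s - G s * (t - s)\<bar> \<le> (t - s) * (\<Phi> t - \<Phi> s))"

lemma dominatedD:
  assumes "dominated \<Phi> l G" "s \<le> t"
  shows "\<bar>G t - G s\<bar> \<le> \<Phi> t - \<Phi> s" "\<bar>l t - l s - G s * (t - s)\<bar> \<le> (t - s) * (\<Phi> t - \<Phi> s)"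
    "\<Phi> s \<le> \<Phi> t"
proof -
  show 1: "\<bar>G t - G s\<bar> \<le> \<Phi> t - \<Phi> s" and "\<bar>l t - l s - G s * (t - s)\<bar> \<le> (t - s) * (\<Phi> t - \<Phi> s)"
    using assms unfolding dominated_def by blast+
  show "\<Phi> s \<le> \<Phi> t" using 1 by linarith
qed

lemma eventually_less_at_left:
  fixes b :: real
  shows "\<forall>\<^sub>F u in at_left b. u < b" "s < b \<Longrightarrow> \<forall>\<^sub>F u in at_left b. u \<in> {s<..<b}"
  by (rule eventually_at_leftI[of "b - 1"], simp, simp) (rule eventually_at_leftI)

lemma dominated_convex_difference:
  assumes P: "convex_on UNIV P" and Q: "convex_on UNIV Q"
    and \<Phi>: "\<And>s t. s \<le> t \<Longrightarrow> right_slope UNIV P t + right_slope UNIV Q t - (right_slope UNIV P s + right_slope UNIV Q s) \<le> \<Phi> t - \<Phi> s"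
  shows "dominated \<Phi> (\<lambda>t. P t - Q t) (\<lambda>t. right_slope UNIV P t - right_slope UNIV Q t)"
  unfolding dominated_def
proof (intro allI impI)
  fix s t :: real assume st: "s \<le> t"
  let ?P = "right_slope UNIV P" and ?Q = "right_slope UNIV Q"
  note p = right_slope_increment(3,4)[OF open_UNIV P UNIV_I UNIV_I st]
  note q = right_slope_increment(3,4)[OF open_UNIV Q UNIV_I UNIV_I st]
  have "\<bar>P t - Q t - (P s - Q s) - (?P s - ?Q s) * (t - s)\<bar> = \<bar>(P t - P s - ?P s * (t - s)) - (Q t - Q s - ?Q s * (t - s))\<bar>"
    by (simp add: algebra_simps)
  also have "\<dots> \<le> \<bar>P t - P s - ?P s * (t - s)\<bar> + \<bar>Q t - Q s - ?Q s * (t - s)\<bar>" by (rule abs_triangle_ineq4)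
  also have "\<dots> \<le> (t - s) * (?P t - ?P s) + (t - s) * (?Q t - ?Q s)" using p(2) q(2) by (rule add_mono)
  also have "\<dots> = (t - s) * (?P t + ?Q t - (?P s + ?Q s))" by (simp add: algebra_simps)
  also have "\<dots> \<le> (t - s) * (\<Phi> t - \<Phi> s)" using \<Phi>[OF st] st by (intro mult_left_mono) auto
  finally show "\<bar>(?P t - ?Q t) - (?P s - ?Q s)\<bar> \<le> \<Phi> t - \<Phi> s \<and>
    \<bar>P t - Q t - (P s - Q s) - (?P s - ?Q s) * (t - s)\<bar> \<le> (t - s) * (\<Phi> t - \<Phi> s)"
    using p(1) q(1) \<Phi>[OF st] by (auto simp: abs_le_iff)
qed

lemma dominated_right_derivative:
  assumes dom: "dominated \<Phi> l G" and \<Phi>: "(\<Phi> \<longlongrightarrow> \<Phi> b) (at_right b)"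
  shows "((\<lambda>u. (l u - l b) / (u - b)) \<longlongrightarrow> G b) (at_right b)"
proof (rule LIM_zero_cancel, rule Lim_transform_bound)
  show "\<forall>\<^sub>F u in at_right b. norm ((l u - l b) / (u - b) - G b) \<le> norm (\<Phi> u - \<Phi> b)"
    using eventually_at_right_less[of b]
  proof eventually_elim
    case (elim u)
    have "(l u - l b) / (u - b) - G b = (l u - l b - G b * (u - b)) / (u - b)"
      using elim by (simp add: field_simps)
    then have "\<bar>(l u - l b) / (u - b) - G b\<bar> = \<bar>l u - l b - G b * (u - b)\<bar> / (u - b)"
      using elim by (simp add: abs_divide)
    also have "\<dots> \<le> \<Phi> u - \<Phi> b"
      using dominatedD(2)[OF dom, of b u] elim by (simp add: field_simps)
    finally show ?case by simp
  qed
  have "((\<lambda>u. \<Phi> u - \<Phi> b) \<longlongrightarrow> \<Phi> b - \<Phi> b) (at_right b)" by (intro tendsto_intros \<Phi>)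
  then show "((\<lambda>u. \<Phi> u - \<Phi> b) \<longlongrightarrow> 0) (at_right b)" by simp
qed

lemma abs_diff_le_twice:
  fixes p q g Y :: real
  shows "\<bar>p - g\<bar> \<le> Y \<Longrightarrow> \<bar>q - g\<bar> \<le> Y \<Longrightarrow> \<bar>p - q\<bar> \<le> 2 * Y"
  by linarith

lemma mono_left_limit:
  fixes \<Phi> :: "real \<Rightarrow> real"
  assumes "mono \<Phi>"
  obtains y where "(\<Phi> \<longlongrightarrow> y) (at_left b)" "\<And>s. s < b \<Longrightarrow> \<Phi> s \<le> y" "y \<le> \<Phi> b"
proof (rule that)
  let ?y = "Sup (\<Phi> ` {..<b})"
  have bdd: "bdd_above (\<Phi> ` {..<b})" by (rule bdd_aboveI2[of _ _ "\<Phi> b"]) (auto intro: monoD[OF assms])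
  have ne: "\<Phi> ` {..<b} \<noteq> {}" by auto
  show le: "\<Phi> s \<le> ?y" if "s < b" for s using that by (intro cSup_upper bdd) auto
  show "?y \<le> \<Phi> b" by (rule cSup_least[OF ne]) (auto intro: monoD[OF assms])
  show "(\<Phi> \<longlongrightarrow> ?y) (at_left b)"
  proof (rule order_tendstoI)
    fix a assume "a < ?y"
    then obtain s where s: "s < b" "a < \<Phi> s" using less_cSup_iff[OF ne bdd] by auto
    have "\<forall>\<^sub>F u in at_left b. u \<in> {s<..<b}" using s(1) by (rule eventually_less_at_left(2))
    then show "\<forall>\<^sub>F u in at_left b. a < \<Phi> u"
    proof eventually_elim
      case (elim u)
      then have "\<Phi> s \<le> \<Phi> u" by (intro monoD[OF assms]) simp
      then show ?case using s(2) by simp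
    qed
  next
    fix a assume "?y < a"
    show "\<forall>\<^sub>F u in at_left b. \<Phi> u < a"
      using eventually_less_at_left(1)[of b]
    proof eventually_elim
      case (elim u)
      show ?case using \<open>?y < a\<close> by (rule le_less_trans[OF le[OF elim]])
    qed
  qed
qed

text \<open>\<open>G + \<Phi>\<close> is increasing and \<open>\<Phi>\<close> has a left limit, so
  \<open>G\<close> has a left limit \<open>E\<close>. Letting the right end tend to \<open>b\<close>
  in the domination gives the estimates with \<open>y\<close> instead of \<open>\<Phi> b\<close>,
  the ones needed for attaching another branch at \<open>b\<close>.\<close>

lemma dominated_left_derivative:
  assumes dom: "dominated \<Phi> l G" and \<Phi>: "(\<Phi> \<longlongrightarrow> y) (at_left b)" "\<And>s. s < b \<Longrightarrow> \<Phi> s \<le> y"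
  obtains E where "((\<lambda>u. (l u - l b) / (u - b)) \<longlongrightarrow> E) (at_left b)"
    "\<And>s. s < b \<Longrightarrow> \<bar>E - G s\<bar> \<le> y - \<Phi> s"
    "\<And>s. s < b \<Longrightarrow> \<bar>l b - l s - G s * (b - s)\<bar> \<le> (b - s) * (y - \<Phi> s)"
proof -
  have lip: "\<bar>l b - l s\<bar> \<le> (\<bar>G s\<bar> + (\<Phi> b - \<Phi> s)) * (b - s)" if "s < b" for s
  proof -
    have "\<bar>l b - l s\<bar> \<le> \<bar>l b - l s - G s * (b - s)\<bar> + \<bar>G s * (b - s)\<bar>" by linarith
    also have "\<dots> \<le> (b - s) * (\<Phi> b - \<Phi> s) + \<bar>G s\<bar> * (b - s)"
      using dominatedD(2)[OF dom, of s b] that by (simp add: abs_mult)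
    finally show ?thesis by (simp add: algebra_simps)
  qed
  have m: "mono \<Phi>" using dominatedD(3)[OF dom] by (intro monoI)
  have Gm: "mono (\<lambda>s. G s + \<Phi> s)"
  proof (rule monoI)
    fix s t :: real assume "s \<le> t"
    then show "G s + \<Phi> s \<le> G t + \<Phi> t" using dominatedD(1)[OF dom, of s t] by (simp add: abs_le_iff)
  qed
  obtain z where z: "((\<lambda>s. G s + \<Phi> s) \<longlongrightarrow> z) (at_left b)" by (rule mono_left_limit[OF Gm]) (rule that)
  define E where "E = z - y"
  have GE: "(G \<longlongrightarrow> E) (at_left b)" using tendsto_diff[OF z \<Phi>(1)] by (simp add: E_def)
  have nb: "at_left b \<noteq> bot" by simp
  have lc: "(l \<longlongrightarrow> l b) (at_left b)"
  proof -
    have "((\<lambda>s. (\<bar>G s\<bar> + (\<Phi> b - \<Phi> s)) * (b - s)) \<longlongrightarrow> (\<bar>E\<bar> + (\<Phi> b - y)) * (b - b)) (at_left b)"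
      by (intro tendsto_intros GE \<Phi>)
    then have 0: "((\<lambda>s. (\<bar>G s\<bar> + (\<Phi> b - \<Phi> s)) * (b - s)) \<longlongrightarrow> 0) (at_left b)" by simp
    have "\<forall>\<^sub>F s in at_left b. norm (l b - l s) \<le> (\<bar>G s\<bar> + (\<Phi> b - \<Phi> s)) * (b - s)"
      using eventually_less_at_left(1)[of b] by eventually_elim (use lip in simp)
    then have "((\<lambda>s. l b - l s) \<longlongrightarrow> 0) (at_left b)" by (rule Lim_null_comparison[OF _ 0])
    from tendsto_diff[OF tendsto_const[of "l b"] this] show ?thesis by simp
  qed
  have E1: "\<bar>E - G s\<bar> \<le> y - \<Phi> s" if s: "s < b" for s
  proof (rule tendsto_le[OF nb])
    show "((\<lambda>t. \<bar>G t - G s\<bar>) \<longlongrightarrow> \<bar>E - G s\<bar>) (at_left b)" by (intro tendsto_intros GE)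
    show "((\<lambda>t. \<Phi> t - \<Phi> s) \<longlongrightarrow> y - \<Phi> s) (at_left b)" by (intro tendsto_intros \<Phi>)
    have "\<forall>\<^sub>F t in at_left b. t \<in> {s<..<b}" using s by (rule eventually_less_at_left(2))
    then show "\<forall>\<^sub>F t in at_left b. \<bar>G t - G s\<bar> \<le> \<Phi> t - \<Phi> s"
      by eventually_elim (use dominatedD(1)[OF dom, of s] in force)
  qed
  have E2: "\<bar>l b - l s - G s * (b - s)\<bar> \<le> (b - s) * (y - \<Phi> s)" if s: "s < b" for s
  proof (rule tendsto_le[OF nb])
    show "((\<lambda>t. \<bar>l t - l s - G s * (t - s)\<bar>) \<longlongrightarrow> \<bar>l b - l s - G s * (b - s)\<bar>) (at_left b)" by (intro tendsto_intros lc)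
    show "((\<lambda>t. (t - s) * (\<Phi> t - \<Phi> s)) \<longlongrightarrow> (b - s) * (y - \<Phi> s)) (at_left b)" by (intro tendsto_intros \<Phi>)
    have "\<forall>\<^sub>F t in at_left b. t \<in> {s<..<b}" using s by (rule eventually_less_at_left(2))
    then show "\<forall>\<^sub>F t in at_left b. \<bar>l t - l s - G s * (t - s)\<bar> \<le> (t - s) * (\<Phi> t - \<Phi> s)"
      by eventually_elim (use dominatedD(2)[OF dom, of s] in force)
  qed
  have "((\<lambda>u. (l u - l b) / (u - b)) \<longlongrightarrow> E) (at_left b)"
  proof (rule LIM_zero_cancel, rule Lim_transform_bound)
    show "\<forall>\<^sub>F u in at_left b. norm ((l u - l b) / (u - b) - E) \<le> norm (2 * (y - \<Phi> u))"
      using eventually_less_at_left(1)[of b]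
    proof eventually_elim
      case (elim u)
      have "(l u - l b) / (u - b) - G u = (l b - l u - G u * (b - u)) / (b - u)"
        using elim by (simp add: field_simps)
      then have "\<bar>(l u - l b) / (u - b) - G u\<bar> = \<bar>l b - l u - G u * (b - u)\<bar> / (b - u)"
        using elim by (simp add: abs_divide)
      also have "\<dots> \<le> y - \<Phi> u" using E2[OF elim] elim by (simp add: field_simps)
      finally have "\<bar>(l u - l b) / (u - b) - E\<bar> \<le> 2 * (y - \<Phi> u)" by (rule abs_diff_le_twice[OF _ E1[OF elim]])
      then show ?case using abs_ge_self[of "2 * (y - \<Phi> u)"] by simp
    qed
    have "((\<lambda>u. 2 * (y - \<Phi> u)) \<longlongrightarrow> 2 * (y - y)) (at_left b)" by (intro tendsto_intros \<Phi>)
    then show "((\<lambda>u. 2 * (y - \<Phi> u)) \<longlongrightarrow> 0) (at_left b)" by simp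
  qed
  then show ?thesis using E1 E2 by (rule that)
qed

lemma dominated_derivative:
  assumes dom: "dominated \<Phi> l G" and \<Phi>: "(\<Phi> \<longlongrightarrow> \<Phi> b) (at b)"
  shows "(l has_real_derivative G b) (at b)"
proof -
  have 1: "((\<lambda>u. (l u - l b) / (u - b)) \<longlongrightarrow> G b) (at_right b)"
    using \<Phi> by (intro dominated_right_derivative[OF dom]) (simp add: filterlim_at_split)
  have lb: "(\<Phi> \<longlongrightarrow> \<Phi> b) (at_left b)" using \<Phi> by (simp add: filterlim_at_split)
  obtain E where E: "((\<lambda>u. (l u - l b) / (u - b)) \<longlongrightarrow> E) (at_left b)" "\<And>s. s < b \<Longrightarrow> \<bar>E - G s\<bar> \<le> \<Phi> b - \<Phi> s"
    by (rule dominated_left_derivative[OF dom lb]) (use dominatedD(3)[OF dom] in auto)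
  have Eb: "\<bar>E - G b\<bar> \<le> 2 * (\<Phi> b - \<Phi> s)" if "s < b" for s
    by (rule abs_diff_le_twice[OF E(2)[OF that] dominatedD(1)[OF dom less_imp_le[OF that]]])
  have "\<bar>E - G b\<bar> \<le> 0"
  proof (rule tendsto_le[OF _ _ tendsto_const])
    have "((\<lambda>s. 2 * (\<Phi> b - \<Phi> s)) \<longlongrightarrow> 2 * (\<Phi> b - \<Phi> b)) (at_left b)" by (intro tendsto_intros lb)
    then show "((\<lambda>s. 2 * (\<Phi> b - \<Phi> s)) \<longlongrightarrow> 0) (at_left b)" by simp
    show "\<forall>\<^sub>F s in at_left b. \<bar>E - G b\<bar> \<le> 2 * (\<Phi> b - \<Phi> s)"
      using eventually_less_at_left(1)[of b]
      by eventually_elim (rule Eb)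
  qed simp
  then have "E = G b" by simp
  then show ?thesis using 1 E(1) by (simp add: has_field_derivative_iff filterlim_at_split)
qed

section \<open>Left and right derivatives of an unordered tuple\<close>

lemma poly_leading_term_at_right:
  fixes q :: "real poly"
  assumes "((\<lambda>u. poly q u / (u - b) ^ m) \<longlongrightarrow> A) (at_right b)"
  shows "((\<lambda>u. poly q u / (u - b) ^ m) \<longlongrightarrow> A) (at b)"
  using assms
proof (induction m arbitrary: q)
  case 0
  have lim: "((\<lambda>u. poly q u) \<longlongrightarrow> poly q b) (at b)" using DERIV_isCont[OF poly_DERIV[of q b]] by (simp add: isCont_def)
  then have "((\<lambda>u. poly q u) \<longlongrightarrow> poly q b) (at_right b)" by (simp add: filterlim_at_split)
  then have "poly q b = A" using 0 by (intro tendsto_unique[of "at_right b"]) auto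
  then show ?case using lim by simp
next
  case (Suc m)
  have "((\<lambda>u. poly q u / (u - b) ^ Suc m * (u - b) ^ Suc m) \<longlongrightarrow> A * (b - b) ^ Suc m) (at_right b)"
    by (intro tendsto_intros Suc.prems)
  then have "((\<lambda>u. poly q u / (u - b) ^ Suc m * (u - b) ^ Suc m) \<longlongrightarrow> 0) (at_right b)" by simp
  moreover have "\<forall>\<^sub>F u in at_right b. poly q u / (u - b) ^ Suc m * (u - b) ^ Suc m = poly q u"
    using eventually_at_right_less[of b] by eventually_elim simp
  ultimately have "((\<lambda>u. poly q u) \<longlongrightarrow> 0) (at_right b)" by (rule Lim_transform_eventually)
  moreover have "((\<lambda>u. poly q u) \<longlongrightarrow> poly q b) (at_right b)"
    using DERIV_isCont[OF poly_DERIV[of q b]] by (simp add: isCont_def filterlim_at_split)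
  \<comment> \<open>The finite limit forces a zero at \<open>b\<close>. Dividing it out lowers the
    exponent, and the last quotient is a polynomial, whose limits from both sides agree.\<close>
  ultimately have "poly q b = 0" by (intro tendsto_unique[of "at_right b"]) auto
  then obtain r where r: "q = [:- b, 1:] * r" by (auto simp: poly_eq_0_iff_dvd)
  have eq: "poly q u / (u - b) ^ Suc m = poly r u / (u - b) ^ m" if "u \<noteq> b" for u
  proof -
    have "poly q u = (u - b) * poly r u" by (simp add: r algebra_simps)
    then show ?thesis using that by (simp only: power_Suc) (simp only: mult_divide_mult_cancel_left_if right_minus_eq if_False)
  qed
  have "\<forall>\<^sub>F u in at_right b. poly q u / (u - b) ^ Suc m = poly r u / (u - b) ^ m"
    using eventually_at_right_less[of b] by eventually_elim (rule eq, simp)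
  then have "((\<lambda>u. poly r u / (u - b) ^ m) \<longlongrightarrow> A) (at_right b)"
    by (rule Lim_transform_eventually[OF Suc.prems])
  from Suc.IH[OF this] show ?case
  proof (rule Lim_transform_eventually)
    have "\<forall>\<^sub>F u in at b. u \<noteq> b" by (simp add: eventually_at_filter)
    then show "\<forall>\<^sub>F u in at b. poly r u / (u - b) ^ m = poly q u / (u - b) ^ Suc m"
      by eventually_elim (rule eq[symmetric])
  qed
qed

lemma mult_quotient_diff:
  fixes e p c :: real
  shows "e \<noteq> 0 \<Longrightarrow> e * (p / e - c) = p - e * c"
  by (simp add: right_diff_distrib)

text \<open>Evaluate the product at \<open>z + (u - b) * \<zeta>\<close>: a factor that starts at
  \<open>z\<close> contributes \<open>(u - b) * (D j - \<zeta>)\<close> to first order, the others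
  tend to \<open>a b j - z\<close>. As \<open>\<zeta>\<close> is free, the limit records the
  multiset of derivatives of the entries meeting at \<open>z\<close>.\<close>

lemma prod_leading_term:
  fixes a :: "real \<Rightarrow> 'i \<Rightarrow> real"
  assumes F: "F \<le> at b" and A: "finite A"
    and D: "\<And>j. j \<in> A \<Longrightarrow> ((\<lambda>u. (a u j - a b j) / (u - b)) \<longlongrightarrow> D j) F"
  shows "((\<lambda>u. (\<Prod>j\<in>A. a u j - z - (u - b) * \<zeta>) / (u - b) ^ card {j \<in> A. a b j = z}) \<longlongrightarrow>
    (\<Prod>j | j \<in> A \<and> a b j = z. D j - \<zeta>) * (\<Prod>j | j \<in> A \<and> a b j \<noteq> z. a b j - z)) F"
proof -
  let ?B = "{j \<in> A. a b j = z}" and ?C = "{j \<in> A. a b j \<noteq> z}"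
  have evne: "\<forall>\<^sub>F u in F. u \<noteq> b" using F by (rule filter_leD) (simp add: eventually_at_filter)
  have id: "((\<lambda>u. u - b) \<longlongrightarrow> 0) F"
  proof -
    have "((\<lambda>u. u - b) \<longlongrightarrow> b - b) (at b)" by (intro tendsto_intros)
    then show ?thesis using tendsto_mono[OF F] by simp
  qed
  have "((\<lambda>u. (\<Prod>j\<in>?B. (a u j - a b j) / (u - b) - \<zeta>) * (\<Prod>j\<in>?C. a b j - z + (u - b) * ((a u j - a b j) / (u - b) - \<zeta>))) \<longlongrightarrow>
    (\<Prod>j\<in>?B. D j - \<zeta>) * (\<Prod>j\<in>?C. a b j - z + 0 * (D j - \<zeta>))) F"
    by (intro tendsto_intros D id) auto
  moreover have "\<forall>\<^sub>F u in F. (\<Prod>j\<in>?B. (a u j - a b j) / (u - b) - \<zeta>) * (\<Prod>j\<in>?C. a b j - z + (u - b) * ((a u j - a b j) / (u - b) - \<zeta>))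
     = (\<Prod>j\<in>A. a u j - z - (u - b) * \<zeta>) / (u - b) ^ card ?B"
    using evne
  proof eventually_elim
    case (elim u)
    have "(\<Prod>j\<in>A. a u j - z - (u - b) * \<zeta>) = (\<Prod>j\<in>?B. a u j - z - (u - b) * \<zeta>) * (\<Prod>j\<in>?C. a u j - z - (u - b) * \<zeta>)"
      using A by (subst prod.union_disjoint[symmetric]) (auto intro!: prod.cong)
    also have "(\<Prod>j\<in>?B. a u j - z - (u - b) * \<zeta>) = (\<Prod>j\<in>?B. (u - b) * ((a u j - a b j) / (u - b) - \<zeta>))"
      using elim by (intro prod.cong refl) (simp add: mult_quotient_diff)
    also have "\<dots> = (u - b) ^ card ?B * (\<Prod>j\<in>?B. (a u j - a b j) / (u - b) - \<zeta>)"
      by (simp add: prod.distrib)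
    also have "(\<Prod>j\<in>?C. a u j - z - (u - b) * \<zeta>) = (\<Prod>j\<in>?C. a b j - z + (u - b) * ((a u j - a b j) / (u - b) - \<zeta>))"
      using elim by (intro prod.cong refl) (simp add: mult_quotient_diff)
    finally show ?case using elim by simp
  qed
  ultimately show ?thesis by (simp add: Lim_transform_eventually)
qed

lemma mset_eq_of_prod_eq:
  fixes E G :: "'i \<Rightarrow> real"
  assumes B: "finite B" and eq: "\<And>\<zeta>. (\<Prod>j\<in>B. E j - \<zeta>) = (\<Prod>j\<in>B. G j - \<zeta>)"
  shows "image_mset E (mset_set B) = image_mset G (mset_set B)"
proof -
  let ?p = "\<lambda>E. \<Prod>j\<in>B. [:- (E j), 1 :: real:]"
  have p: "poly (?p E) \<zeta> = (- 1) ^ card B * (\<Prod>j\<in>B. E j - \<zeta>)" for E \<zeta>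
  proof -
    have "poly (?p E) \<zeta> = (\<Prod>j\<in>B. - (E j - \<zeta>))" unfolding poly_prod by (intro prod.cong refl) simp
    then show ?thesis by (simp only: prod_uminus)
  qed
  have pe: "?p E = ?p G" by (intro poly_ext) (simp only: p eq)
  have pr: "proots (\<Prod>x\<in>#A. [:- x, 1:]) = A" for A :: "real multiset"
  proof (induction A)
    case (add x A)
    have "(\<Prod>x\<in>#A. [:- x, 1:]) \<noteq> 0" by (auto simp: prod_mset_zero_iff)
    then have "proots ([:- x, 1:] * (\<Prod>x\<in>#A. [:- x, 1:])) = proots [:- x, 1:] + proots (\<Prod>x\<in>#A. [:- x, 1:])"
      by (intro proots_mult) auto
    then show ?case using add by (simp del: mult_pCons_left)
  qed simp
  have r: "?p E = (\<Prod>x\<in>#image_mset E (mset_set B). [:- x, 1:])" for E :: "'i \<Rightarrow> real"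
    by (simp only: prod_unfold_prod_mset multiset.map_comp comp_def)
  show ?thesis by (rule trans[OF pr[symmetric] trans[OF _ pr]]) (simp only: r[symmetric] pe)
qed

lemma mset_pair_eqI:
  fixes a E G :: "'i::finite \<Rightarrow> real"
  assumes "\<And>z. image_mset E (mset_set {j. a j = z}) = image_mset G (mset_set {j. a j = z})"
  shows "image_mset (\<lambda>j. (a j, E j)) (mset_set UNIV) = image_mset (\<lambda>j. (a j, G j)) (mset_set UNIV)"
proof (rule multiset_eqI)
  fix zc :: "real \<times> real"
  obtain z c where zc: "zc = (z, c)" by (cases zc)
  have *: "count (image_mset (\<lambda>j. (a j, H j)) (mset_set UNIV)) zc = count (image_mset H (mset_set {j. a j = z})) c" for H :: "'i \<Rightarrow> real"
  proof -
    have "{j \<in> UNIV. (a j, H j) = zc} = {j \<in> {j. a j = z}. H j = c}" by (auto simp: zc)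
    then show ?thesis by (simp add: count_image_mset_eq_card_vimage)
  qed
  show "count (image_mset (\<lambda>j. (a j, E j)) (mset_set UNIV)) zc = count (image_mset (\<lambda>j. (a j, G j)) (mset_set UNIV)) zc"
    by (simp only: * assms)
qed

lemma char_map_lipschitz:
  fixes f :: "'n::finite rpoly"
  assumes f: "f \<in> Hyp d v"
  obtains L where "0 \<le> L"
    "\<And>j y z. j < d \<Longrightarrow> \<bar>char_map f v y ! j - char_map f v z ! j\<bar> \<le> L * (\<Sum>i\<in>UNIV. \<bar>y $ i - z $ i\<bar>)"
proof -
  obtain L where L: "0 \<le> L"
    "\<And>k y z. k \<le> d \<Longrightarrow> \<bar>bottom_sum f v d k y - bottom_sum f v d k z\<bar> \<le> L * (\<Sum>i\<in>UNIV. \<bar>y $ i - z $ i\<bar>)"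
    by (rule bottom_sum_lipschitz[OF f]) (rule that)
  have "\<bar>char_map f v y ! j - char_map f v z ! j\<bar> \<le> (2 * L) * (\<Sum>i\<in>UNIV. \<bar>y $ i - z $ i\<bar>)" if j: "j < d" for j y z
  proof -
    have "\<bar>bottom_sum f v d (d - j) y - bottom_sum f v d (d - j) z\<bar> \<le> L * (\<Sum>i\<in>UNIV. \<bar>y $ i - z $ i\<bar>)"
      "\<bar>bottom_sum f v d (d - Suc j) y - bottom_sum f v d (d - Suc j) z\<bar> \<le> L * (\<Sum>i\<in>UNIV. \<bar>y $ i - z $ i\<bar>)"
      by (rule L(2); simp)+
    then have "\<bar>char_map f v y ! j - char_map f v z ! j\<bar> \<le> L * (\<Sum>i\<in>UNIV. \<bar>y $ i - z $ i\<bar>) + L * (\<Sum>i\<in>UNIV. \<bar>y $ i - z $ i\<bar>)"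
      unfolding char_map_nth_eq_diff[OF f j] by linarith
    then show ?thesis by simp
  qed
  then show ?thesis using L(1) by (intro that[of "2 * L"]) auto
qed

text \<open>At a point of differentiability the sorted roots have the same one-sided derivatives as those
  along the tangent line, where \<open>f\<close> restricts to a polynomial whose leading term is two-sided.\<close>

lemma one_sided_derivatives_mset:
  fixes f :: "'n::finite rpoly" and x :: "real \<Rightarrow> real ^ 'n" and l :: "real \<Rightarrow> real ^ 'd::finite"
  assumes f: "f \<in> Hyp CARD('d) v" and x: "(x has_vector_derivative y) (at b)"
    and Dm: "\<And>j. j < CARD('d) \<Longrightarrow> ((\<lambda>u. (char_map f v (x u) ! j - char_map f v (x b) ! j) / (u - b)) \<longlongrightarrow> Dm j) (at_left b)"
    and Dp: "\<And>j. j < CARD('d) \<Longrightarrow> ((\<lambda>u. (char_map f v (x u) ! j - char_map f v (x b) ! j) / (u - b)) \<longlongrightarrow> Dp j) (at_right b)"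
    and l: "\<And>u. image_mset (\<lambda>j. l u $ j) (mset_set UNIV) = mset (char_map f v (x u))"
    and E: "\<And>j. ((\<lambda>u. (l u $ j - l b $ j) / (u - b)) \<longlongrightarrow> E j) (at_left b)"
    and G: "\<And>j. ((\<lambda>u. (l u $ j - l b $ j) / (u - b)) \<longlongrightarrow> G j) (at_right b)"
  shows "image_mset (\<lambda>j. (l b $ j, E j)) (mset_set UNIV) = image_mset (\<lambda>j. (l b $ j, G j)) (mset_set UNIV)"
proof (rule mset_pair_eqI, rule mset_eq_of_prod_eq)
  fix z \<zeta> :: real
  let ?d = "CARD('d)"
  define s where "s u j = char_map f v (x u) ! j" for u j
  \<comment> \<open>The sorted roots along the tangent line at \<open>b\<close>.\<close>
  define r where "r u j = char_map f v (x b + (u - b) *\<^sub>R y) ! j" for u j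
  note F = char_map_factorization[OF f]
  have rs: "r b j = s b j" for j by (simp add: r_def s_def)
  have lprod: "(\<Prod>j\<in>UNIV. h (l u $ j)) = (\<Prod>j<?d. h (s u j))" for h :: "real \<Rightarrow> real" and u
  proof -
    have "(\<Prod>j\<in>UNIV. h (l u $ j)) = prod_mset (image_mset h (image_mset (\<lambda>j. l u $ j) (mset_set UNIV)))"
      by (simp only: prod_unfold_prod_mset multiset.map_comp comp_def)
    also have "\<dots> = prod_list (map h (char_map f v (x u)))" by (simp only: l mset_map[symmetric] prod_mset_prod_list)
    finally show ?thesis by (simp only: prod_list_prod_nth_map F(1) s_def)
  qed
  have card: "card {j. l b $ j = z} = card {j. j < ?d \<and> s b j = z}"
  proof -
    have "card {j \<in> UNIV. l b $ j = z} = count (mset (char_map f v (x b))) z"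
      by (simp only: l[symmetric] count_image_mset_eq_card_vimage[OF finite_class.finite_UNIV])
    also have "\<dots> = count (image_mset (s b) (mset_set {..<?d})) z"
    proof -
      have "mset (char_map f v (x b)) = mset (map (s b) [0..<?d])"
        by (rule arg_cong[where f = mset], rule nth_equalityI) (simp_all add: F s_def)
      then show ?thesis by (simp only: mset_map mset_upt atLeast0LessThan)
    qed
    finally show ?thesis by (simp add: count_image_mset_eq_card_vimage conj_commute)
  qed
  define m where "m = card {j. j < ?d \<and> s b j = z}"
  define C where "C = (\<Prod>j | j < ?d \<and> s b j \<noteq> z. s b j - z)"
  have "C \<noteq> 0" by (simp add: C_def)
  have Cl: "(\<Prod>j | l b $ j \<noteq> z. l b $ j - z) = C"
  proof -
    have "(\<Prod>j\<in>UNIV. if l b $ j \<noteq> z then l b $ j - z else 1) = (\<Prod>j<?d. if s b j \<noteq> z then s b j - z else 1)"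
      by (rule lprod)
    then show ?thesis by (simp add: prod.If_cases C_def Collect_conj_eq lessThan_def Collect_neg_eq)
  qed
  obtain L where L: "0 \<le> L" "\<And>j y z. j < ?d \<Longrightarrow> \<bar>char_map f v y ! j - char_map f v z ! j\<bar> \<le> L * (\<Sum>i\<in>UNIV. \<bar>y $ i - z $ i\<bar>)"
    by (rule char_map_lipschitz[OF f]) (rule that)
  \<comment> \<open>The characteristic map is Lipschitz and the tangent approximates the curve to
    order \<open>o(u - b)\<close>, so sorted roots along both have the same one-sided
    derivatives.\<close>
  have dr: "((\<lambda>u. (r u j - r b j) / (u - b)) \<longlongrightarrow> D) F"
    if sj: "((\<lambda>u. (s u j - s b j) / (u - b)) \<longlongrightarrow> D) F" and F: "F \<le> at b" and j: "j < ?d" for D j F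
  proof -
    have evne: "\<forall>\<^sub>F u in F. u \<noteq> b" using F by (rule filter_leD) (simp add: eventually_at_filter)
    have "((\<lambda>u. (x u $ i - x b $ i) / (u - b) - y $ i) \<longlongrightarrow> 0) F" for i
    proof -
      have "((\<lambda>u. x u $ i) has_vector_derivative y $ i) (at b)"
        using bounded_linear.has_vector_derivative[OF bounded_linear_vec_nth x] .
      then have "((\<lambda>u. (x u $ i - x b $ i) / (u - b)) \<longlongrightarrow> y $ i) (at b)"
        by (simp add: has_real_derivative_iff_has_vector_derivative[symmetric] has_field_derivative_iff)
      from LIM_zero[OF tendsto_mono[OF F this]] show ?thesis .
    qed
    then have "((\<lambda>u. L * (\<Sum>i\<in>UNIV. \<bar>(x u $ i - x b $ i) / (u - b) - y $ i\<bar>)) \<longlongrightarrow> L * (\<Sum>i\<in>(UNIV :: 'n set). \<bar>0\<bar>)) F"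
      by (intro tendsto_intros)
    then have lim0: "((\<lambda>u. L * (\<Sum>i\<in>UNIV. \<bar>(x u $ i - x b $ i) / (u - b) - y $ i\<bar>)) \<longlongrightarrow> 0) F" by simp
    have "\<forall>\<^sub>F u in F. norm ((r u j - s u j) / (u - b)) \<le> L * (\<Sum>i\<in>UNIV. \<bar>(x u $ i - x b $ i) / (u - b) - y $ i\<bar>)"
      using evne
    proof eventually_elim
      case (elim u)
      have "\<bar>s u j - r u j\<bar> \<le> L * (\<Sum>i\<in>UNIV. \<bar>x u $ i - (x b + (u - b) *\<^sub>R y) $ i\<bar>)"
        unfolding s_def r_def by (rule L(2)[OF j])
      also have "(\<Sum>i\<in>UNIV. \<bar>x u $ i - (x b + (u - b) *\<^sub>R y) $ i\<bar>) = (\<Sum>i\<in>UNIV. \<bar>u - b\<bar> * \<bar>(x u $ i - x b $ i) / (u - b) - y $ i\<bar>)"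
      proof (intro sum.cong refl)
        fix i
        have "x u $ i - (x b + (u - b) *\<^sub>R y) $ i = (u - b) * ((x u $ i - x b $ i) / (u - b) - y $ i)"
          using elim by (simp add: mult_quotient_diff)
        then show "\<bar>x u $ i - (x b + (u - b) *\<^sub>R y) $ i\<bar> = \<bar>u - b\<bar> * \<bar>(x u $ i - x b $ i) / (u - b) - y $ i\<bar>"
          by (simp only: abs_mult)
      qed
      finally have "\<bar>s u j - r u j\<bar> \<le> \<bar>u - b\<bar> * (L * (\<Sum>i\<in>UNIV. \<bar>(x u $ i - x b $ i) / (u - b) - y $ i\<bar>))"
        by (simp only: sum_distrib_left[symmetric] mult.left_commute)
      then have "\<bar>r u j - s u j\<bar> / \<bar>u - b\<bar> \<le> L * (\<Sum>i\<in>UNIV. \<bar>(x u $ i - x b $ i) / (u - b) - y $ i\<bar>)"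
        using elim by (simp add: pos_divide_le_eq abs_minus_commute mult.commute)
      then show ?case by (simp only: real_norm_def abs_divide)
    qed
    then have "((\<lambda>u. (r u j - s u j) / (u - b)) \<longlongrightarrow> 0) F" by (rule Lim_null_comparison[OF _ lim0])
    from tendsto_add[OF this sj] show ?thesis by (simp add: rs add_divide_distrib[symmetric])
  qed
  \<comment> \<open>\<open>f\<close> on the line \<open>x b - z v + (u - b) (y - \<zeta> v)\<close>,
    a polynomial in \<open>u\<close>. The signs compensate the convention \<open>x - T v\<close> of
    \<open>rpoly_line\<close>.\<close>
  define q where "q = rpoly_line f (- (y - \<zeta> *\<^sub>R v)) (x b - z *\<^sub>R v - b *\<^sub>R (y - \<zeta> *\<^sub>R v))"
  have q: "poly q u = rpoly_eval f v * (\<Prod>j<?d. r u j - z - (u - b) * \<zeta>)" for u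
  proof -
    have "poly q u = rpoly_eval f ((x b + (u - b) *\<^sub>R y) + (- z - (u - b) * \<zeta>) *\<^sub>R v)"
      unfolding q_def poly_rpoly_line by (rule arg_cong[where f = "rpoly_eval f"]) (simp add: algebra_simps)
    also have "\<dots> = rpoly_eval f v * (\<Prod>j<?d. - z - (u - b) * \<zeta> + r u j)" unfolding r_def by (rule F(3))
    finally show ?thesis by (simp add: algebra_simps)
  qed
  \<comment> \<open>\<open>l\<close> and the sorted roots give the same product for every
    \<open>u\<close>, hence the same leading term; the roots along the tangent share it as well, and
    there it belongs to a polynomial.\<close>
  have lim: "(\<Prod>j | l b $ j = z. H j - \<zeta>) = (\<Prod>j | j < ?d \<and> s b j = z. D j - \<zeta>)"
    and limq: "((\<lambda>u. poly q u / (u - b) ^ m) \<longlongrightarrow> rpoly_eval f v * ((\<Prod>j | j < ?d \<and> s b j = z. D j - \<zeta>) * C)) F"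
    if F: "F \<le> at b" "F \<noteq> bot" and D: "\<And>j. j < ?d \<Longrightarrow> ((\<lambda>u. (s u j - s b j) / (u - b)) \<longlongrightarrow> D j) F"
      and H: "\<And>j. ((\<lambda>u. (l u $ j - l b $ j) / (u - b)) \<longlongrightarrow> H j) F" for F D H
  proof -
    have 1: "((\<lambda>u. (\<Prod>j<?d. s u j - z - (u - b) * \<zeta>) / (u - b) ^ m) \<longlongrightarrow> (\<Prod>j | j < ?d \<and> s b j = z. D j - \<zeta>) * C) F"
      using prod_leading_term[OF F(1) finite_lessThan[of ?d], of s D z \<zeta>] D by (simp add: m_def C_def)
    have "((\<lambda>u. (\<Prod>j\<in>UNIV. l u $ j - z - (u - b) * \<zeta>) / (u - b) ^ m) \<longlongrightarrow> (\<Prod>j | l b $ j = z. H j - \<zeta>) * C) F"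
      using prod_leading_term[OF F(1) finite_class.finite_UNIV, of "\<lambda>u j. l u $ j" H z \<zeta>] H by (simp add: m_def card Cl)
    then have "((\<lambda>u. (\<Prod>j<?d. s u j - z - (u - b) * \<zeta>) / (u - b) ^ m) \<longlongrightarrow> (\<Prod>j | l b $ j = z. H j - \<zeta>) * C) F"
      by (simp only: lprod[of "\<lambda>a. a - z - (_ - b) * \<zeta>"])
    from tendsto_unique[OF F(2) this 1] show "(\<Prod>j | l b $ j = z. H j - \<zeta>) = (\<Prod>j | j < ?d \<and> s b j = z. D j - \<zeta>)"
      using \<open>C \<noteq> 0\<close> by simp
    have "((\<lambda>u. (\<Prod>j<?d. r u j - z - (u - b) * \<zeta>) / (u - b) ^ m) \<longlongrightarrow> (\<Prod>j | j < ?d \<and> s b j = z. D j - \<zeta>) * C) F"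
      using prod_leading_term[OF F(1) finite_lessThan[of ?d], of r D z \<zeta>] dr[OF D F(1)] by (simp add: m_def C_def rs)
    then show "((\<lambda>u. poly q u / (u - b) ^ m) \<longlongrightarrow> rpoly_eval f v * ((\<Prod>j | j < ?d \<and> s b j = z. D j - \<zeta>) * C)) F"
      unfolding q times_divide_eq_right[symmetric] by (intro tendsto_intros)
  qed
  have at: "at_left b \<le> at b" "at_right b \<le> at b" by (auto intro: at_le)
  note lr = Dp[folded s_def] and ll = Dm[folded s_def]
  have "((\<lambda>u. poly q u / (u - b) ^ m) \<longlongrightarrow> rpoly_eval f v * ((\<Prod>j | j < ?d \<and> s b j = z. Dp j - \<zeta>) * C)) (at b)"
    by (rule poly_leading_term_at_right[OF limq[OF at(2) _ lr G]]) simp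
  then have "((\<lambda>u. poly q u / (u - b) ^ m) \<longlongrightarrow> rpoly_eval f v * ((\<Prod>j | j < ?d \<and> s b j = z. Dp j - \<zeta>) * C)) (at_left b)"
    by (rule tendsto_mono[OF at(1)])
  from tendsto_unique[OF _ this limq[OF at(1) _ ll E]]
  have "(\<Prod>j | j < ?d \<and> s b j = z. Dp j - \<zeta>) = (\<Prod>j | j < ?d \<and> s b j = z. Dm j - \<zeta>)"
    using \<open>C \<noteq> 0\<close> Hyp_D(2)[OF f] by simp
  then show "(\<Prod>j | l b $ j = z. E j - \<zeta>) = (\<Prod>j | l b $ j = z. G j - \<zeta>)"
    using lim[OF at(2) _ lr G] lim[OF at(1) _ ll E] by simp
qed simp

section \<open>Relabelling a system of roots at its kinks\<close>

definition dominated_system :: "(real \<Rightarrow> real) \<Rightarrow> (real \<Rightarrow> (real ^ 'd) \<times> (real ^ 'd)) \<Rightarrow> bool" where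
  "dominated_system \<Phi> W \<longleftrightarrow> (\<forall>j. dominated \<Phi> (\<lambda>t. fst (W t) $ j) (\<lambda>t. snd (W t) $ j))"

text \<open>A multiset of pairs and not a pair of multisets: relabelling has to move each root
  together with its slope.\<close>

definition entry_pairs :: "(real ^ 'd) \<times> (real ^ 'd::finite) \<Rightarrow> (real \<times> real) multiset" where
  "entry_pairs w = image_mset (\<lambda>j. (fst w $ j, snd w $ j)) (mset_set UNIV)"

lemma dominated_mono:
  assumes "dominated \<Phi> l G" "\<And>s t. s \<le> t \<Longrightarrow> \<Phi> t - \<Phi> s \<le> \<Psi> t - \<Psi> s"
  shows "dominated \<Psi> l G"
  unfolding dominated_def
proof (intro allI impI conjI)
  fix s t :: real assume st: "s \<le> t"
  show "\<bar>G t - G s\<bar> \<le> \<Psi> t - \<Psi> s" by (rule order_trans[OF dominatedD(1)[OF assms(1) st] assms(2)[OF st]])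
  show "\<bar>l t - l s - G s * (t - s)\<bar> \<le> (t - s) * (\<Psi> t - \<Psi> s)"
    by (rule order_trans[OF dominatedD(2)[OF assms(1) st] mult_left_mono[OF assms(2)[OF st]]]) (use st in simp)
qed

lemma tendsto_of_increment_le:
  fixes \<Phi> \<Psi> :: "real \<Rightarrow> real"
  assumes "(\<Psi> \<longlongrightarrow> \<Psi> b) F" "\<forall>\<^sub>F t in F. \<bar>\<Phi> t - \<Phi> b\<bar> \<le> \<bar>\<Psi> t - \<Psi> b\<bar>"
  shows "(\<Phi> \<longlongrightarrow> \<Phi> b) F"
proof (rule LIM_zero_cancel, rule Lim_null_comparison)
  show "\<forall>\<^sub>F t in F. norm (\<Phi> t - \<Phi> b) \<le> \<bar>\<Psi> t - \<Psi> b\<bar>" using assms(2) by simp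
  have "((\<lambda>t. \<bar>\<Psi> t - \<Psi> b\<bar>) \<longlongrightarrow> \<bar>\<Psi> b - \<Psi> b\<bar>) F" by (intro tendsto_intros assms)
  then show "((\<lambda>t. \<bar>\<Psi> t - \<Psi> b\<bar>) \<longlongrightarrow> 0) F" by simp
qed

lemma mset_fst_entry_pairs: "image_mset fst (entry_pairs w) = image_mset (\<lambda>j. fst w $ j) (mset_set UNIV)"
  by (simp add: entry_pairs_def multiset.map_comp comp_def)

text \<open>Gluing at \<open>b\<close>: the new slope \<open>H b\<close> satisfies the estimates of
  a left derivative of \<open>l\<close>, with \<open>y\<close> in place of \<open>\<Phi> b\<close>.
  Hence the jump \<open>\<Phi> b - y\<close> is no longer needed to pass \<open>b\<close> and is
  subtracted from \<open>\<Phi>\<close> on the right.\<close>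

lemma dominated_relabel:
  assumes W: "dominated \<Phi> l G" "dominated \<Phi> m H"
    and join: "l b = m b" "\<And>s. s < b \<Longrightarrow> \<bar>H b - G s\<bar> \<le> y - \<Phi> s"
      "\<And>s. s < b \<Longrightarrow> \<bar>l b - l s - G s * (b - s)\<bar> \<le> (b - s) * (y - \<Phi> s)"
  shows "dominated (\<lambda>t. if t < b then \<Phi> t else \<Phi> t - (\<Phi> b - y)) (\<lambda>t. if t < b then l t else m t) (\<lambda>t. if t < b then G t else H t)"
  unfolding dominated_def
proof (intro allI impI)
  fix s t :: real assume st: "s \<le> t"
  let ?\<Phi> = "\<lambda>t. if t < b then \<Phi> t else \<Phi> t - (\<Phi> b - y)"
  let ?l = "\<lambda>t. if t < b then l t else m t" and ?G = "\<lambda>t. if t < b then G t else H t"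
  consider "t < b" | "b \<le> s" | "s < b" "b \<le> t" using st by linarith
  then show "\<bar>?G t - ?G s\<bar> \<le> ?\<Phi> t - ?\<Phi> s \<and> \<bar>?l t - ?l s - ?G s * (t - s)\<bar> \<le> (t - s) * (?\<Phi> t - ?\<Phi> s)"
  proof cases
    case 1
    then show ?thesis using dominatedD(1,2)[OF W(1) st] st by simp
  next
    case 2
    then show ?thesis using dominatedD(1,2)[OF W(2) st] st by simp
  next
    case 3
    note a = dominatedD(1,2)[OF W(2) 3(2)] and c = join(2,3)[OF 3(1)]
    have y: "\<Phi> s \<le> y" using c(1) by linarith
    have "\<bar>H t - G s\<bar> \<le> \<Phi> t - \<Phi> b + (y - \<Phi> s)" using a(1) c(1) by linarith
    moreover have "\<bar>m t - l s - G s * (t - s)\<bar> \<le> (t - s) * (\<Phi> t - (\<Phi> b - y) - \<Phi> s)"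
    proof -
      have "m t - l s - G s * (t - s) = (m t - m b - H b * (t - b)) + (l b - l s - G s * (b - s)) + (H b - G s) * (t - b)"
        using join(1) by (simp add: algebra_simps)
      also have "\<bar>\<dots>\<bar> \<le> \<bar>m t - m b - H b * (t - b)\<bar> + \<bar>l b - l s - G s * (b - s)\<bar> + \<bar>(H b - G s) * (t - b)\<bar>"
        by linarith
      also have "\<dots> \<le> (t - b) * (\<Phi> t - \<Phi> b) + (b - s) * (y - \<Phi> s) + (y - \<Phi> s) * (t - b)"
        unfolding abs_mult using 3 y by (intro add_mono a c mult_mono) auto
      also have "\<dots> = (t - s) * (y - \<Phi> s) + (t - b) * (\<Phi> t - \<Phi> b)" by (simp add: algebra_simps)
      also have "\<dots> \<le> (t - s) * (y - \<Phi> s) + (t - s) * (\<Phi> t - \<Phi> b)"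
        using 3 dominatedD(3)[OF W(2) 3(2)] by (intro add_left_mono mult_right_mono) auto
      finally show ?thesis by (simp add: algebra_simps)
    qed
    ultimately show ?thesis using 3 by simp
  qed
qed

context
  fixes f :: "'n::finite rpoly" and v :: "real ^ 'n" and x x' :: "real \<Rightarrow> real ^ 'n"
    and W0 :: "real \<Rightarrow> (real ^ 'd::finite) \<times> (real ^ 'd)" and \<Phi>0 :: "real \<Rightarrow> real" and D :: "nat \<Rightarrow> real \<Rightarrow> real"
  assumes f: "f \<in> Hyp CARD('d) v" and x: "\<And>t. (x has_vector_derivative x' t) (at t)"
    and sorted: "\<And>j. j < CARD('d) \<Longrightarrow> dominated \<Phi>0 (\<lambda>t. char_map f v (x t) ! j) (D j)"
    and W0: "dominated_system \<Phi>0 W0"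
    and roots0: "\<And>t. image_mset fst (entry_pairs (W0 t)) = mset (char_map f v (x t))"
    and right0: "\<And>t. (\<Phi>0 \<longlongrightarrow> \<Phi>0 t) (at_right t)"
begin

text \<open>The left derivatives at \<open>b\<close> and the slopes there form, paired with the
  roots, the same multiset. A permutation realizing this, applied from \<open>b\<close> on, joins
  each left branch to a right branch with matching value and slope.\<close>

lemma relabel_at_point:
  fixes W :: "real \<Rightarrow> (real ^ 'd) \<times> (real ^ 'd)" and b :: real
  assumes W: "dominated_system \<Phi> W" "\<And>t. entry_pairs (W t) = entry_pairs (W0 t)"
    and \<Phi>: "\<And>s t. s \<le> t \<Longrightarrow> \<Phi> t - \<Phi> s \<le> \<Phi>0 t - \<Phi>0 s"
  obtains \<Psi> and V :: "real \<Rightarrow> (real ^ 'd) \<times> (real ^ 'd)" where "dominated_system \<Psi> V" "\<And>t. entry_pairs (V t) = entry_pairs (W0 t)"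
    "\<And>s t. s \<le> t \<Longrightarrow> \<Psi> t - \<Psi> s \<le> \<Phi> t - \<Phi> s" "(\<Psi> \<longlongrightarrow> \<Psi> b) (at_left b)"
proof -
  have domW: "dominated \<Phi> (\<lambda>t. fst (W t) $ j) (\<lambda>t. snd (W t) $ j)" for j
    using W(1) by (simp add: dominated_system_def)
  have m: "\<Phi> s \<le> \<Phi> t" if "s \<le> t" for s t using dominatedD(3)[OF domW that] .
  have m0: "\<Phi>0 s \<le> \<Phi>0 t" if "s \<le> t" for s t using m[OF that] \<Phi>[OF that] by linarith
  obtain y where y: "(\<Phi> \<longlongrightarrow> y) (at_left b)" "\<And>s. s < b \<Longrightarrow> \<Phi> s \<le> y" "y \<le> \<Phi> b"
    by (rule mono_left_limit[of \<Phi> b]) (auto intro: monoI m that)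
  obtain y0 where y0: "(\<Phi>0 \<longlongrightarrow> y0) (at_left b)" "\<And>s. s < b \<Longrightarrow> \<Phi>0 s \<le> y0"
    by (rule mono_left_limit[of \<Phi>0 b]) (auto intro: monoI m0 that)
  have right: "(\<Phi> \<longlongrightarrow> \<Phi> b) (at_right b)"
  proof (rule tendsto_of_increment_le[OF right0])
    show "\<forall>\<^sub>F t in at_right b. \<bar>\<Phi> t - \<Phi> b\<bar> \<le> \<bar>\<Phi>0 t - \<Phi>0 b\<bar>"
      using eventually_at_right_less[of b] 
    proof eventually_elim
      case (elim t)
      then show ?case using \<Phi>[of b t] m[of b t] by simp
    qed
  qed
  have "\<exists>E. ((\<lambda>u. (fst (W u) $ j - fst (W b) $ j) / (u - b)) \<longlongrightarrow> E) (at_left b) \<and>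
    (\<forall>s<b. \<bar>E - snd (W s) $ j\<bar> \<le> y - \<Phi> s) \<and>
    (\<forall>s<b. \<bar>fst (W b) $ j - fst (W s) $ j - snd (W s) $ j * (b - s)\<bar> \<le> (b - s) * (y - \<Phi> s))" for j
    by (rule dominated_left_derivative[OF domW[of j] y(1,2)], assumption) (intro exI conjI allI impI; assumption)
  then have "\<exists>E. \<forall>j. ((\<lambda>u. (fst (W u) $ j - fst (W b) $ j) / (u - b)) \<longlongrightarrow> E j) (at_left b) \<and>
    (\<forall>s<b. \<bar>E j - snd (W s) $ j\<bar> \<le> y - \<Phi> s) \<and>
    (\<forall>s<b. \<bar>fst (W b) $ j - fst (W s) $ j - snd (W s) $ j * (b - s)\<bar> \<le> (b - s) * (y - \<Phi> s))"
    by (intro choice allI)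
  then obtain E where "\<forall>j. ((\<lambda>u. (fst (W u) $ j - fst (W b) $ j) / (u - b)) \<longlongrightarrow> E j) (at_left b) \<and>
    (\<forall>s<b. \<bar>E j - snd (W s) $ j\<bar> \<le> y - \<Phi> s) \<and>
    (\<forall>s<b. \<bar>fst (W b) $ j - fst (W s) $ j - snd (W s) $ j * (b - s)\<bar> \<le> (b - s) * (y - \<Phi> s))" ..
  then have E: "\<And>j. ((\<lambda>u. (fst (W u) $ j - fst (W b) $ j) / (u - b)) \<longlongrightarrow> E j) (at_left b)"
    "\<And>j s. s < b \<Longrightarrow> \<bar>E j - snd (W s) $ j\<bar> \<le> y - \<Phi> s"
    "\<And>j s. s < b \<Longrightarrow> \<bar>fst (W b) $ j - fst (W s) $ j - snd (W s) $ j * (b - s)\<bar> \<le> (b - s) * (y - \<Phi> s)"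
    by blast+
  have "\<exists>E. ((\<lambda>u. (char_map f v (x u) ! j - char_map f v (x b) ! j) / (u - b)) \<longlongrightarrow> E) (at_left b)" if "j < CARD('d)" for j
    by (rule dominated_left_derivative[OF sorted[OF that] y0], assumption) (rule exI)
  then have "\<exists>Dm. \<forall>j\<in>{..<CARD('d)}. ((\<lambda>u. (char_map f v (x u) ! j - char_map f v (x b) ! j) / (u - b)) \<longlongrightarrow> Dm j) (at_left b)"
    by (intro bchoice ballI) simp
  then obtain Dm where Dm: "\<And>j. j < CARD('d) \<Longrightarrow> ((\<lambda>u. (char_map f v (x u) ! j - char_map f v (x b) ! j) / (u - b)) \<longlongrightarrow> Dm j) (at_left b)"
    by auto
  have l: "image_mset (\<lambda>j. fst (W u) $ j) (mset_set UNIV) = mset (char_map f v (x u))" for u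
    by (simp only: mset_fst_entry_pairs[symmetric] W(2) roots0)
  have eq: "image_mset (\<lambda>j. (fst (W b) $ j, E j)) (mset_set UNIV) = image_mset (\<lambda>j. (fst (W b) $ j, snd (W b) $ j)) (mset_set UNIV)"
    by (rule one_sided_derivatives_mset[OF f x Dm dominated_right_derivative[OF sorted right0] l E(1) dominated_right_derivative[OF domW right]])
  obtain \<sigma> where "\<sigma> permutes UNIV" and \<sigma>': "\<forall>j\<in>UNIV. (fst (W b) $ j, E j) = (fst (W b) $ (\<sigma> j), snd (W b) $ (\<sigma> j))"
    by (rule image_mset_eq_implies_permutes[OF finite_class.finite_UNIV eq])
  then have \<sigma>: "\<sigma> permutes UNIV" "\<And>j. fst (W b) $ j = fst (W b) $ (\<sigma> j)" "\<And>j. E j = snd (W b) $ (\<sigma> j)"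
    using \<sigma>' by (simp_all only: prod.inject ball_UNIV)
  define V where "V t = (if t < b then W t else (\<chi> j. fst (W t) $ (\<sigma> j), \<chi> j. snd (W t) $ (\<sigma> j)))" for t
  define \<Psi> where "\<Psi> t = (if t < b then \<Phi> t else \<Phi> t - (\<Phi> b - y))" for t
  show ?thesis
  proof (rule that)
    show "dominated_system \<Psi> V"
      unfolding dominated_system_def
    proof
      fix j
      have "dominated \<Psi> (\<lambda>t. if t < b then fst (W t) $ j else fst (W t) $ (\<sigma> j)) (\<lambda>t. if t < b then snd (W t) $ j else snd (W t) $ (\<sigma> j))"
        unfolding \<Psi>_def[abs_def]
        by (rule dominated_relabel[OF domW domW \<sigma>(2)]) (simp_all only: E(2) E(3) \<sigma>(3)[symmetric])
      moreover have "(\<lambda>t. fst (V t) $ j) = (\<lambda>t. if t < b then fst (W t) $ j else fst (W t) $ (\<sigma> j))"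
        "(\<lambda>t. snd (V t) $ j) = (\<lambda>t. if t < b then snd (W t) $ j else snd (W t) $ (\<sigma> j))"
        by (intro ext, simp add: V_def)+
      ultimately show "dominated \<Psi> (\<lambda>t. fst (V t) $ j) (\<lambda>t. snd (V t) $ j)" by simp
    qed
    show "entry_pairs (V t) = entry_pairs (W0 t)" for t
    proof (cases "t < b")
      case False
      have "entry_pairs (V t) = entry_pairs (W t)"
        unfolding entry_pairs_def
        by (rule permutes_implies_image_mset_eq[OF \<sigma>(1), symmetric]) (simp add: V_def False)
      then show ?thesis using W(2) by simp
    qed (simp add: V_def W(2))
    show "\<Psi> t - \<Psi> s \<le> \<Phi> t - \<Phi> s" if "s \<le> t" for s t
      using that y(3) by (auto simp: \<Psi>_def)
    have "\<forall>\<^sub>F t in at_left b. \<Phi> t = \<Psi> t"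
      using eventually_less_at_left(1)[of b] by eventually_elim (simp add: \<Psi>_def)
    from Lim_transform_eventually[OF y(1) this] show "(\<Psi> \<longlongrightarrow> \<Psi> b) (at_left b)" by (simp add: \<Psi>_def[abs_def])
  qed
qed

text \<open>Dependent choice over the points \<open>c n\<close>. Increments of the dominating
  functions decrease along the sequence, so left continuity gained at one point persists.\<close>

lemma relabel_at_sequence:
  fixes c :: "nat \<Rightarrow> real"
  obtains \<Psi> and V :: "nat \<Rightarrow> real \<Rightarrow> (real ^ 'd) \<times> (real ^ 'd)" where "\<And>n. dominated_system (\<Psi> n) (V n)" "\<And>n t. entry_pairs (V n t) = entry_pairs (W0 t)"
    "\<And>n s t. s \<le> t \<Longrightarrow> \<Psi> n t - \<Psi> n s \<le> \<Phi>0 t - \<Phi>0 s"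
    "\<And>n s t. s \<le> t \<Longrightarrow> \<Psi> (Suc n) t - \<Psi> (Suc n) s \<le> \<Psi> n t - \<Psi> n s"
    "\<And>n. (\<Psi> (Suc n) \<longlongrightarrow> \<Psi> (Suc n) (c n)) (at_left (c n))"
proof -
  define good where "good \<Phi>W \<longleftrightarrow> dominated_system (fst \<Phi>W) (snd \<Phi>W) \<and> (\<forall>t. entry_pairs (snd \<Phi>W t) = entry_pairs (W0 t)) \<and>
    (\<forall>s t. s \<le> t \<longrightarrow> fst \<Phi>W t - fst \<Phi>W s \<le> \<Phi>0 t - \<Phi>0 s)" for \<Phi>W :: "(real \<Rightarrow> real) \<times> (real \<Rightarrow> (real ^ 'd) \<times> (real ^ 'd))"
  define next_to where "next_to n \<Phi>W \<Psi>V \<longleftrightarrow> (\<forall>s t. s \<le> t \<longrightarrow> fst \<Psi>V t - fst \<Psi>V s \<le> fst \<Phi>W t - fst \<Phi>W s) \<and>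
    (fst \<Psi>V \<longlongrightarrow> fst \<Psi>V (c n)) (at_left (c n))" for n and \<Phi>W \<Psi>V :: "(real \<Rightarrow> real) \<times> (real \<Rightarrow> (real ^ 'd) \<times> (real ^ 'd))"
  have "\<exists>\<Psi>V. good \<Psi>V \<and> next_to n \<Phi>W \<Psi>V" if g: "good \<Phi>W" for n \<Phi>W
  proof -
    obtain \<Psi> and V :: "real \<Rightarrow> (real ^ 'd) \<times> (real ^ 'd)" where "dominated_system \<Psi> V" "\<And>t. entry_pairs (V t) = entry_pairs (W0 t)"
      and le: "\<And>s t. s \<le> t \<Longrightarrow> \<Psi> t - \<Psi> s \<le> fst \<Phi>W t - fst \<Phi>W s" and lim: "(\<Psi> \<longlongrightarrow> \<Psi> (c n)) (at_left (c n))"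
      by (rule relabel_at_point[of "fst \<Phi>W" "snd \<Phi>W" "c n"]) (use g in \<open>auto simp: good_def\<close>)
    moreover have "\<Psi> t - \<Psi> s \<le> \<Phi>0 t - \<Phi>0 s" if "s \<le> t" for s t
    proof (rule order_trans[OF le[OF that]])
      show "fst \<Phi>W t - fst \<Phi>W s \<le> \<Phi>0 t - \<Phi>0 s" using g that unfolding good_def by blast
    qed
    ultimately have "good (\<Psi>, V)" by (simp add: good_def)
    moreover have "next_to n \<Phi>W (\<Psi>, V)" using le lim by (simp add: next_to_def)
    ultimately show ?thesis by blast
  qed
  moreover have "good (\<Phi>0, W0)" using W0 by (simp add: good_def)
  ultimately have "\<exists>\<Psi>V. \<forall>n. good (\<Psi>V n) \<and> next_to n (\<Psi>V n) (\<Psi>V (Suc n))"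
    by (intro dependent_nat_choice[where P = "\<lambda>_. good"]) blast+
  then obtain \<Psi>V where "\<And>n. good (\<Psi>V n)" "\<And>n. next_to n (\<Psi>V n) (\<Psi>V (Suc n))" by blast
  then show ?thesis
    by (intro that[of "\<lambda>n. fst (\<Psi>V n)" "\<lambda>n. snd (\<Psi>V n)"]) (auto simp: good_def next_to_def)
qed

text \<open>Relabelling at the countably many jumps of \<open>\<Phi>0\<close> and passing to the limit in the product of
  the finite sets of admissible values.\<close>

lemma dominated_system_limit:
  obtains W :: "real \<Rightarrow> (real ^ 'd) \<times> (real ^ 'd)" where "\<And>t. entry_pairs (W t) = entry_pairs (W0 t)"
    "\<And>t j. ((\<lambda>t. fst (W t) $ j) has_real_derivative snd (W t) $ j) (at t)"
proof -
  have m0: "\<Phi>0 s \<le> \<Phi>0 t" if "s \<le> t" for s t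
    using W0 dominatedD(3)[OF _ that] by (auto simp: dominated_system_def)
  have "countable {a. \<not> isCont \<Phi>0 a}" by (rule mono_ctble_discont) (intro monoI m0)
  then have "\<exists>c :: nat \<Rightarrow> real. {a. \<not> isCont \<Phi>0 a} \<subseteq> range c"
  proof (cases "{a. \<not> isCont \<Phi>0 a} = {}")
    case False
    assume "countable {a. \<not> isCont \<Phi>0 a}"
    from range_from_nat_into[OF False this] show ?thesis by (intro exI equalityD2)
  qed (simp only: empty_subsetI simp_thms)
  then obtain c :: "nat \<Rightarrow> real" where c: "{a. \<not> isCont \<Phi>0 a} \<subseteq> range c" ..
  obtain \<Psi> and V :: "nat \<Rightarrow> real \<Rightarrow> (real ^ 'd) \<times> (real ^ 'd)" where V: "\<And>n. dominated_system (\<Psi> n) (V n)" "\<And>n t. entry_pairs (V n t) = entry_pairs (W0 t)"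
    and \<Psi>: "\<And>n s t. s \<le> t \<Longrightarrow> \<Psi> n t - \<Psi> n s \<le> \<Phi>0 t - \<Phi>0 s"
    "\<And>n s t. s \<le> t \<Longrightarrow> \<Psi> (Suc n) t - \<Psi> (Suc n) s \<le> \<Psi> n t - \<Psi> n s"
    "\<And>n. (\<Psi> (Suc n) \<longlongrightarrow> \<Psi> (Suc n) (c n)) (at_left (c n))"
    by (rule relabel_at_sequence) (rule that)
  have mono\<Psi>: "\<Psi> n s \<le> \<Psi> n t" if "s \<le> t" for n s t
    using V(1)[of n] dominatedD(3)[OF _ that] by (auto simp: dominated_system_def)
  have anti: "\<Psi> n t - \<Psi> n s \<le> \<Psi> k t - \<Psi> k s" if "k \<le> n" "s \<le> t" for k n s t
    using that(1) by (induction rule: dec_induct) (use \<Psi>(2)[OF that(2)] in \<open>auto intro: order_trans\<close>)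
  \<comment> \<open>The pairs admissible at time \<open>t\<close>: rearrangements of the entries of
    \<open>W0 t\<close>, hence finitely many.\<close>
  define F where "F t = {w :: (real ^ 'd) \<times> (real ^ 'd). entry_pairs w = entry_pairs (W0 t)}" for t
  have finF: "finite (F t)" for t
  proof -
    let ?A = "fst ` set_mset (entry_pairs (W0 t))" and ?B = "snd ` set_mset (entry_pairs (W0 t))"
    have fin: "finite {y :: real ^ 'd. \<forall>j. y $ j \<in> A}" if "finite A" for A
    proof -
      have "finite (PiE (UNIV :: 'd set) (\<lambda>_. A))" using that by (intro finite_PiE) auto
      then have "finite ((\<lambda>g. \<chi> j. g j) ` PiE (UNIV :: 'd set) (\<lambda>_. A))" by simp
      then show ?thesis
        by (rule finite_subset[rotated]) (auto intro!: image_eqI[where x = "\<lambda>j. _ $ j"] simp: vec_eq_iff)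
    qed
    have "w \<in> {y. \<forall>j. y $ j \<in> ?A} \<times> {y. \<forall>j. y $ j \<in> ?B}" if "w \<in> F t" for w
    proof -
      have "(fst w $ j, snd w $ j) \<in># entry_pairs (W0 t)" for j
      proof -
        have "(fst w $ j, snd w $ j) \<in># entry_pairs w" by (simp add: entry_pairs_def)
        then show ?thesis using that by (simp add: F_def)
      qed
      then show ?thesis by (auto simp: mem_Times_iff intro!: image_eqI)
    qed
    then have "F t \<subseteq> {y. \<forall>j. y $ j \<in> ?A} \<times> {y. \<forall>j. y $ j \<in> ?B}" by blast
    then show ?thesis by (rule finite_subset) (intro finite_cartesian_product fin; simp)
  qed
  \<comment> \<open>Tychonoff's theorem for a product of finite sets over all times.\<close>
  have comp: "compact (PiE UNIV F)"
  proof -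
    have "compactin (product_topology (\<lambda>_. euclidean) UNIV) (PiE UNIV F)"
      unfolding compactin_PiE using finF by (auto intro: finite_imp_compact)
    then show ?thesis by (simp add: euclidean_product_topology)
  qed
  \<comment> \<open>Each inequality in \<open>dominated_system\<close> involves two times and so
    defines a closed set. The conditions become stronger with the index, and \<open>V n\<close>
    satisfies those up to \<open>n\<close>.\<close>
  have "PiE UNIV F \<inter> (\<Inter>n\<in>UNIV. {W. dominated_system (\<Psi> n) W}) \<noteq> {}"
  proof (rule compact_imp_fip_image[OF comp])
    fix n :: nat
    have ev: "continuous_on UNIV (\<lambda>W :: real \<Rightarrow> (real ^ 'd) \<times> (real ^ 'd). W t)" for t by simp
    have "closed {W :: real \<Rightarrow> (real ^ 'd) \<times> (real ^ 'd). \<bar>snd (W t) $ j - snd (W s) $ j\<bar> \<le> \<Psi> n t - \<Psi> n s \<and>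
        \<bar>fst (W t) $ j - fst (W s) $ j - snd (W s) $ j * (t - s)\<bar> \<le> (t - s) * (\<Psi> n t - \<Psi> n s)}" for s t j
      by (intro closed_Collect_conj closed_Collect_le continuous_intros ev)
    then show "closed {W :: real \<Rightarrow> (real ^ 'd) \<times> (real ^ 'd). dominated_system (\<Psi> n) W}"
      unfolding dominated_system_def dominated_def
      by (intro closed_Collect_all closed_Collect_imp open_Collect_const)
  next
    fix I' :: "nat set" assume "finite I'"
    then obtain n where n: "\<And>k. k \<in> I' \<Longrightarrow> k \<le> n" by (meson finite_nat_set_iff_bounded_le)
    have "dominated_system (\<Psi> k) (V n)" if "k \<in> I'" for k
      using V(1)[of n] dominated_mono[OF _ anti[OF n[OF that]]] by (auto simp: dominated_system_def)
    then have "V n \<in> PiE UNIV F \<inter> (\<Inter>n\<in>I'. {W. dominated_system (\<Psi> n) W})" by (auto simp: F_def V(2))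
    then show "PiE UNIV F \<inter> (\<Inter>n\<in>I'. {W. dominated_system (\<Psi> n) W}) \<noteq> {}" by blast
  qed
  then obtain W where W: "W \<in> PiE UNIV F" "\<And>n. dominated_system (\<Psi> n) W" by blast
  show ?thesis
  proof (rule that)
    show "entry_pairs (W t) = entry_pairs (W0 t)" for t using W(1) by (auto simp: PiE_iff F_def)
    fix t j
    have le: "\<bar>\<Psi> n u - \<Psi> n t\<bar> \<le> \<bar>\<Phi>0 u - \<Phi>0 t\<bar>" for n u
      using \<Psi>(1)[of u t n] \<Psi>(1)[of t u n] mono\<Psi>[of u t n] mono\<Psi>[of t u n] by (cases "u \<le> t") auto
    \<comment> \<open>Index 0 serves where \<open>\<Phi>0\<close> is continuous; a jump at
      \<open>c n\<close> has been removed from the left in step \<open>Suc n\<close>, and right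
      continuity is inherited from \<open>\<Phi>0\<close>.\<close>
    have "\<exists>n. (\<Psi> n \<longlongrightarrow> \<Psi> n t) (at t)"
    proof (cases "isCont \<Phi>0 t")
      case True
      then have "(\<Psi> 0 \<longlongrightarrow> \<Psi> 0 t) (at t)"
        unfolding isCont_def by (rule tendsto_of_increment_le) (simp add: le)
      then show ?thesis by blast
    next
      case False
      then obtain n where n: "t = c n" using c by blast
      have "(\<Psi> (Suc n) \<longlongrightarrow> \<Psi> (Suc n) t) (at_right t)"
        using right0 by (rule tendsto_of_increment_le) (simp add: le)
      then show ?thesis using \<Psi>(3)[of n] n by (auto simp: filterlim_at_split)
    qed
    then obtain n where "(\<Psi> n \<longlongrightarrow> \<Psi> n t) (at t)" by blast
    moreover have "dominated (\<Psi> n) (\<lambda>t. fst (W t) $ j) (\<lambda>t. snd (W t) $ j)"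
      using W(2)[of n] by (simp add: dominated_system_def)
    ultimately show "((\<lambda>t. fst (W t) $ j) has_real_derivative snd (W t) $ j) (at t)"
      by (intro dominated_derivative)
  qed
qed

end

section \<open>Componentwise calculus and pointwise properties of root systems\<close>

lemma has_vector_derivative_componentwise:
  fixes g :: "real \<Rightarrow> real ^ 'm"
  assumes "\<And>j. ((\<lambda>t. g t $ j) has_real_derivative g' $ j) (at t within S)"
  shows "(g has_vector_derivative g') (at t within S)"
proof -
  have "((\<lambda>t. \<Sum>j\<in>UNIV. (g t $ j) *\<^sub>R axis j 1) has_vector_derivative (\<Sum>j\<in>UNIV. (g' $ j) *\<^sub>R axis j (1 :: real))) (at t within S)"
  proof (rule has_vector_derivative_sum)
    fix j
    show "((\<lambda>t. (g t $ j) *\<^sub>R axis j (1 :: real)) has_vector_derivative (g' $ j) *\<^sub>R axis j 1) (at t within S)"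
      using has_vector_derivative_scaleR[OF assms[of j] has_vector_derivative_const[of "axis j (1 :: real)"]] by simp
  qed
  moreover have "(\<Sum>j\<in>UNIV. (y $ j) *\<^sub>R axis j 1) = y" for y :: "real ^ 'm"
    using basis_expansion[of y] by (simp add: scalar_mult_eq_scaleR)
  ultimately show ?thesis by simp
qed

lemma has_real_derivative_component:
  fixes g :: "real \<Rightarrow> real ^ 'm"
  assumes "(g has_vector_derivative g') (at t within S)"
  shows "((\<lambda>t. g t $ j) has_real_derivative g' $ j) (at t within S)"
  using bounded_linear.has_vector_derivative[OF bounded_linear_vec_nth assms]
  by (simp add: has_real_derivative_iff_has_vector_derivative)

lemma has_integral_vec_componentwise:
  fixes g :: "real \<Rightarrow> real ^ 'm"
  assumes "\<And>j. ((\<lambda>t. g t $ j) has_integral I $ j) S"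
  shows "(g has_integral I) S"
proof (rule iffD2[OF has_integral_componentwise_iff], rule ballI)
  fix b :: "real ^ 'm" assume "b \<in> Basis"
  then obtain j where "b = axis j 1" by (auto simp: Basis_vec_def)
  then show "((\<lambda>t. g t \<bullet> b) has_integral I \<bullet> b) S" using assms[of j] by (simp only: inner_axis real_inner_1_right)
qed

lemma absolutely_integrable_vec_componentwise:
  fixes g :: "real \<Rightarrow> real ^ 'm"
  assumes "\<And>j. (\<lambda>t. g t $ j) absolutely_integrable_on S"
  shows "g absolutely_integrable_on S"
  by (rule absolutely_integrable_componentwise) (auto simp: Basis_vec_def inner_axis intro: assms)

lemma root_system_nth:
  fixes lam :: "real \<Rightarrow> real ^ 'd::finite"
  assumes f: "f \<in> Hyp CARD('d) v" and lam: "root_system f v J x lam" and t: "t \<in> J"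
  shows "\<exists>j<CARD('d). lam t $ i = char_map f v (x t) ! j"
proof -
  have "lam t $ i \<in># image_mset (\<lambda>j. lam t $ j) (mset_set UNIV)" by simp
  also have "image_mset (\<lambda>j. lam t $ j) (mset_set UNIV) = mset (char_map f v (x t))"
    using lam t unfolding root_system_def by blast
  finally have "lam t $ i \<in> set (char_map f v (x t))" by simp
  then show ?thesis using char_map_factorization(1)[OF f] by (metis in_set_conv_nth)
qed

lemma root_system_poly_zero:
  fixes lam :: "real \<Rightarrow> real ^ 'd::finite"
  assumes f: "f \<in> Hyp CARD('d) v" and lam: "root_system f v J x lam" and t: "t \<in> J"
  shows "poly (rpoly_line f v (x t)) (lam t $ i) = 0"
proof -
  obtain j where j: "j < CARD('d)" "lam t $ i = char_map f v (x t) ! j" using root_system_nth[OF assms] by blast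
  have "poly (rpoly_line f v (x t)) (lam t $ i) = rpoly_eval f (x t + (- (lam t $ i)) *\<^sub>R v)"
    by (simp add: poly_rpoly_line)
  also have "\<dots> = rpoly_eval f v * (\<Prod>j<CARD('d). - (lam t $ i) + char_map f v (x t) ! j)"
    by (rule char_map_factorization(3)[OF f])
  also have "(\<Prod>j<CARD('d). - (lam t $ i) + char_map f v (x t) ! j) = 0"
    using j by (intro prod_zero) auto
  finally show ?thesis by simp
qed

lemma DC_on_UNIV_convexE:
  fixes x :: "'a::real_normed_vector \<Rightarrow> real ^ 'm::finite"
  assumes "DC_on UNIV x"
  obtains p q where "\<And>i. convex_on UNIV (p i)" "\<And>i. convex_on UNIV (q i)" "\<And>i t. x t $ i = p i t - q i t"
proof -
  have "\<exists>p q. convex_on UNIV p \<and> convex_on UNIV q \<and> (\<forall>t. x t $ i = p t - q t)" for i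
  proof -
    have "dc_on UNIV (\<lambda>t. x t $ i)" using assms by (simp add: DC_on_def)
    then show ?thesis unfolding dc_on_def by (elim exE conjE) (intro exI conjI allI, assumption+, simp)
  qed
  then obtain p q where "\<And>i. convex_on UNIV (p i)" "\<And>i. convex_on UNIV (q i)" "\<And>i t. x t $ i = p i t - q i t"
    by metis
  then show ?thesis by (rule that)
qed

text \<open>One function dominates all roots: the sum of the right derivatives of the convex functions
  whose differences are the sorted roots.\<close>

lemma exists_differentiable_root_system:
  fixes x :: "real \<Rightarrow> real ^ 'n::finite"
  assumes f: "f \<in> Hyp CARD('d::finite) v" and DC: "DC_on UNIV x" and C1: "C1_on UNIV x"
  obtains lam :: "real \<Rightarrow> real ^ 'd" where "root_system f v UNIV x lam" "lam differentiable_on UNIV"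
proof -
  let ?d = "CARD('d)"
  obtain p q where pq: "\<And>i. convex_on UNIV (p i)" "\<And>i. convex_on UNIV (q i)" "\<And>i t. x t $ i = p i t - q i t"
    by (rule DC_on_UNIV_convexE[OF DC]) (rule that)
  obtain x' where x': "\<And>t. (x has_vector_derivative x' t) (at t)"
    using C1 by (auto simp: C1_on_def)
  obtain L where L: "0 \<le> L" "\<And>k x. k \<le> ?d \<Longrightarrow> - (L * (\<Sum>i\<in>UNIV. \<bar>x $ i\<bar>)) \<le> bottom_sum f v ?d k x"
    by (rule bottom_sum_lower_bound[OF f]) (rule that)
  define P where "P k t = L * (\<Sum>i\<in>UNIV. p i t + q i t) - bottom_sum f v ?d k (x t)" for k t
  have P: "convex_on UNIV (P k)" if "k \<le> ?d" for k
    unfolding P_def by (rule convex_on_majorant_minus_bottom_sum[OF f that L(1) L(2)[OF that] pq])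
  have s: "char_map f v (x t) ! j = P (?d - Suc j) t - P (?d - j) t" if "j < ?d" for j t
    by (simp add: char_map_nth_eq_diff[OF f that] P_def)
  define S where "S k = right_slope UNIV (P k)" for k
  define D where "D j t = S (?d - Suc j) t - S (?d - j) t" for j t
  define \<Phi> where "\<Phi> t = (\<Sum>j<?d. S (?d - Suc j) t + S (?d - j) t)" for t
  have mono: "S k r \<le> S k t" if "k \<le> ?d" "r \<le> t" for k r t
    unfolding S_def by (rule right_slope_increment(3)[OF open_UNIV P[OF that(1)] UNIV_I UNIV_I that(2)])
  have dom: "dominated \<Phi> (\<lambda>t. char_map f v (x t) ! j) (D j)" if j: "j < ?d" for j
  proof -
    have "dominated \<Phi> (\<lambda>t. P (?d - Suc j) t - P (?d - j) t) (\<lambda>t. right_slope UNIV (P (?d - Suc j)) t - right_slope UNIV (P (?d - j)) t)"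
    proof (rule dominated_convex_difference)
      fix r t :: real assume rt: "r \<le> t"
      have "(S (?d - Suc j) t + S (?d - j) t) - (S (?d - Suc j) r + S (?d - j) r) \<le>
         (\<Sum>j<?d. (S (?d - Suc j) t + S (?d - j) t) - (S (?d - Suc j) r + S (?d - j) r))"
        by (rule member_le_sum[where f = "\<lambda>j. (S (?d - Suc j) t + S (?d - j) t) - (S (?d - Suc j) r + S (?d - j) r)"])
          (use j mono[OF _ rt] in \<open>auto simp: add_mono\<close>)
      then show "right_slope UNIV (P (?d - Suc j)) t + right_slope UNIV (P (?d - j)) t -
        (right_slope UNIV (P (?d - Suc j)) r + right_slope UNIV (P (?d - j)) r) \<le> \<Phi> t - \<Phi> r"
        by (simp only: S_def \<Phi>_def sum_subtractf)
    qed (simp_all add: P)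
    then show ?thesis by (simp add: s[OF j] D_def[abs_def] S_def)
  qed
  have right: "(\<Phi> \<longlongrightarrow> \<Phi> t) (at_right t)" for t
    unfolding \<Phi>_def S_def
    by (intro tendsto_sum tendsto_add right_slope_right_continuous) (auto intro: P)
  obtain e where e: "bij_betw e (UNIV :: 'd set) {0..<?d}"
    using ex_bij_betw_finite_nat[OF finite_class.finite_UNIV] by blast
  have ej: "e j < ?d" for j using bij_betwE[OF e] by auto
  define W0 :: "real \<Rightarrow> (real ^ 'd) \<times> (real ^ 'd)" where "W0 t = (\<chi> j. char_map f v (x t) ! (e j), \<chi> j. D (e j) t)" for t
  have domW0: "dominated_system \<Phi> W0"
    unfolding dominated_system_def W0_def by (simp add: dom[OF ej])
  have roots0: "image_mset fst (entry_pairs (W0 t)) = mset (char_map f v (x t))" for t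
  proof -
    have "image_mset fst (entry_pairs (W0 t)) = image_mset (nth (char_map f v (x t))) (image_mset e (mset_set UNIV))"
      by (simp add: mset_fst_entry_pairs W0_def multiset.map_comp comp_def)
    also have "image_mset e (mset_set UNIV) = mset_set {0..<?d}"
      using e by (simp add: image_mset_mset_set bij_betw_def)
    also have "image_mset (nth (char_map f v (x t))) (mset_set {0..<?d}) = mset (map (nth (char_map f v (x t))) [0..<?d])"
      by (simp only: mset_map mset_upt)
    also have "map (nth (char_map f v (x t))) [0..<?d] = char_map f v (x t)"
      using map_nth[of "char_map f v (x t)"] by (simp only: char_map_factorization(1)[OF f])
    finally show ?thesis .
  qed
  obtain W :: "real \<Rightarrow> (real ^ 'd) \<times> (real ^ 'd)" where W: "\<And>t. entry_pairs (W t) = entry_pairs (W0 t)"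
    "\<And>t j. ((\<lambda>t. fst (W t) $ j) has_real_derivative snd (W t) $ j) (at t)"
    by (rule dominated_system_limit[OF f x' dom domW0 roots0 right]) (assumption | rule that)+
  show ?thesis
  proof (rule that[of "\<lambda>t. fst (W t)"])
    show "root_system f v UNIV x (\<lambda>t. fst (W t))"
      by (simp add: root_system_def mset_fst_entry_pairs[symmetric] W(1) roots0)
    have "((\<lambda>t. fst (W t)) has_vector_derivative snd (W t)) (at t)" for t
      by (rule has_vector_derivative_componentwise) (rule W(2))
    then show "(\<lambda>t. fst (W t)) differentiable_on UNIV"
      by (auto simp: differentiable_on_def intro: differentiableI_vector)
  qed
qed

text \<open>With \<open>K\<close> a primitive of \<open>\<Phi>\<close>, write \<open>g\<close> as
  \<open>(K + g) - K\<close>. Both \<open>\<Phi>\<close> and \<open>\<Phi> + g'\<close> are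
  increasing, so both terms are convex.\<close>

lemma dominated_derivative_imp_dc:
  fixes g g' \<Phi> :: "real \<Rightarrow> real"
  assumes g: "\<And>t. (g has_real_derivative g' t) (at t)"
    and dom: "\<And>s t. s \<le> t \<Longrightarrow> \<bar>g' t - g' s\<bar> \<le> \<Phi> t - \<Phi> s"
  shows "dc_on UNIV g"
proof -
  have m: "\<Phi> s \<le> \<Phi> t" if "s \<le> t" for s t using dom[OF that] by linarith
  have mg: "\<Phi> s + g' s \<le> \<Phi> t + g' t" if "s \<le> t" for s t using dom[OF that] by linarith
  \<comment> \<open>Two integrals, because \<open>{0..t}\<close> is empty for negative
    \<open>t\<close>.\<close>
  define K where "K t = integral {0..t} \<Phi> - integral {t..0} \<Phi>" for t
  have int: "h integrable_on {s..t}" if "\<And>s t. s \<le> t \<Longrightarrow> h s \<le> h t" for h :: "real \<Rightarrow> real" and s t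
    by (rule integrable_on_mono_on) (auto simp: mono_on_def that)
  have comb: "integral {r..s} \<Phi> + integral {s..t} \<Phi> = integral {r..t} \<Phi>" if "r \<le> s" "s \<le> t" for r s t
    using that by (intro Henstock_Kurzweil_Integration.integral_combine int m)
  have K: "K t - K s = integral {s..t} \<Phi>" if st: "s \<le> t" for s t
  proof -
    consider "0 \<le> s" | "t \<le> 0" "s < 0" | "s < 0" "0 < t" by linarith
    then show ?thesis
    proof cases
      case 1
      then show ?thesis using comb[of 0 s t] st by (cases "s = 0"; cases "t = 0") (auto simp: K_def)
    next
      case 2
      then show ?thesis using comb[of s t 0] st by (cases "t = 0") (auto simp: K_def)
    next
      case 3
      then show ?thesis using comb[of s 0 t] by (simp add: K_def)
    qed
  qed
  have conv: "convex_on UNIV H"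
    if H: "\<And>s t. s \<le> t \<Longrightarrow> (h has_integral (H t - H s)) {s..t}" and h: "\<And>s t. s \<le> t \<Longrightarrow> h s \<le> h t" for H h :: "real \<Rightarrow> real"
  proof (rule convex_on_subgradientI[where D = h])
    fix s t :: real
    show "H s + h s * (t - s) \<le> H t"
    proof (cases "s \<le> t")
      case True
      have "((\<lambda>_. h s) has_integral (t - s) *\<^sub>R h s) {s..t}" using has_integral_const_real[of "h s" s t] True by simp
      from has_integral_le[OF this H[OF True]] h show ?thesis by (simp add: mult.commute)
    next
      case False
      then have ts: "t \<le> s" by simp
      have "((\<lambda>_. h s) has_integral (s - t) *\<^sub>R h s) {t..s}" using has_integral_const_real[of "h s" t s] ts by simp
      from has_integral_le[OF H[OF ts] this] h show ?thesis by (simp add: algebra_simps)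
    qed
  qed simp
  have Ki: "(\<Phi> has_integral (K t - K s)) {s..t}" if "s \<le> t" for s t
    unfolding K[OF that] by (rule integrable_integral[OF int[OF m]])
  have gi: "(g' has_integral (g t - g s)) {s..t}" if "s \<le> t" for s t
    by (rule fundamental_theorem_of_calculus[OF that])
      (use g in \<open>auto simp: has_real_derivative_iff_has_vector_derivative[symmetric] intro: has_field_derivative_at_within\<close>)
  have cK: "convex_on UNIV K" by (rule conv[OF Ki m])
  have cKg: "convex_on UNIV (\<lambda>t. K t + g t)"
  proof (rule conv[OF _ mg])
    fix s t :: real assume "s \<le> t"
    from has_integral_add[OF Ki[OF this] gi[OF this]]
    show "((\<lambda>t. \<Phi> t + g' t) has_integral (K t + g t - (K s + g s))) {s..t}" by (simp add: algebra_simps)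
  qed
  show ?thesis
    unfolding dc_on_def
    by (rule exI[of _ "\<lambda>t. K t + g t"], rule exI[of _ K])
      (use cK cKg in \<open>auto intro: convex_on_continuous\<close>)
qed

text \<open>Each component of \<open>g'\<close> is an indefinite integral by
  \<open>lusin_imp_indefinite_integral\<close>, which also supplies the constant 6. The number of
  components enters when the norm of the second derivative is bounded by the sum of its
  entries.\<close>

lemma W21_of_dominated_derivative:
  fixes g g' :: "real \<Rightarrow> real ^ 'm::finite"
  assumes ab: "a < b" and g: "\<And>t j. t \<in> {a..b} \<Longrightarrow> ((\<lambda>t. g t $ j) has_real_derivative g' t $ j) (at t within {a..b})"
    and g': "continuous_on {a..b} g'"
    and dom: "\<And>s t j. a \<le> s \<Longrightarrow> s \<le> t \<Longrightarrow> t \<le> b \<Longrightarrow> \<bar>g' t $ j - g' s $ j\<bar> \<le> \<Phi> t - \<Phi> s"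
    and null: "\<And>N j. negligible N \<Longrightarrow> N \<subseteq> {a..b} \<Longrightarrow> negligible ((\<lambda>t. g' t $ j) ` N)"
  shows "open V \<Longrightarrow> V \<subseteq> {a<..<b} \<Longrightarrow> W21 V g"
    and "(\<And>t. t \<in> {a<..<b} \<Longrightarrow> norm (g t) \<le> B) \<Longrightarrow> (\<And>t. t \<in> {a<..<b} \<Longrightarrow> norm (g' t) \<le> B') \<Longrightarrow>
      W21_norm {a<..<b} g \<le> (b - a) * B + (b - a) * B' + of_nat CARD('m) * (6 * (\<Phi> b - \<Phi> a))"
proof -
  have "\<exists>h. h absolutely_integrable_on {a..b} \<and> (\<forall>s t. a \<le> s \<and> s \<le> t \<and> t \<le> b \<longrightarrow> (h has_integral (g' t $ j - g' s $ j)) {s..t}) \<and>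
     integral {a..b} (\<lambda>t. \<bar>h t\<bar>) \<le> 6 * (\<Phi> b - \<Phi> a)" for j
  proof -
    have c: "continuous_on {a..b} (\<lambda>t. g' t $ j)" by (intro continuous_intros g')
    show ?thesis
      by (rule lusin_imp_indefinite_integral[OF less_imp_le[OF ab] c dom null]) (assumption | blast)+
  qed
  then have "\<exists>h. \<forall>j. h j absolutely_integrable_on {a..b} \<and> (\<forall>s t. a \<le> s \<and> s \<le> t \<and> t \<le> b \<longrightarrow> (h j has_integral (g' t $ j - g' s $ j)) {s..t}) \<and>
     integral {a..b} (\<lambda>t. \<bar>h j t\<bar>) \<le> 6 * (\<Phi> b - \<Phi> a)"
    by (intro choice allI)
  then obtain h where h: "\<And>j. h j absolutely_integrable_on {a..b}"
    "\<And>j s t. a \<le> s \<Longrightarrow> s \<le> t \<Longrightarrow> t \<le> b \<Longrightarrow> (h j has_integral (g' t $ j - g' s $ j)) {s..t}"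
    "\<And>j. integral {a..b} (\<lambda>t. \<bar>h j t\<bar>) \<le> 6 * (\<Phi> b - \<Phi> a)"
    by blast
  define H where "H t = (\<chi> j. h j t)" for t
  have H: "H absolutely_integrable_on {a..b}"
    by (rule absolutely_integrable_vec_componentwise) (simp add: H_def h(1))
  have gi: "(g' has_integral (g t - g s)) {s..t}" if "a \<le> s" "s \<le> t" "t \<le> b" for s t
  proof (rule has_integral_vec_componentwise)
    fix j
    have "((\<lambda>t. g' t $ j) has_integral (g t $ j - g s $ j)) {s..t}"
    proof (rule fundamental_theorem_of_calculus[OF that(2)])
      fix u assume "u \<in> {s..t}"
      then have "u \<in> {a..b}" using that by auto
      from has_field_derivative_subset[OF g[OF this], of "{s..t}"] that
      show "((\<lambda>t. g t $ j) has_vector_derivative g' u $ j) (at u within {s..t})"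
        by (simp add: has_real_derivative_iff_has_vector_derivative)
    qed
    then show "((\<lambda>t. g' t $ j) has_integral (g t - g s) $ j) {s..t}" by simp
  qed
  have Hi: "(H has_integral (g' t - g' s)) {s..t}" if "a \<le> s" "s \<le> t" "t \<le> b" for s t
    by (rule has_integral_vec_componentwise) (simp add: H_def h(2) that)
  show "W21 V g" if V: "open V" "V \<subseteq> {a<..<b}"
    by (rule W21_indefinite_integrals(1)[where u' = g' and g = H, OF ab H _ _ V]) (rule gi Hi; assumption)+
  have W: "W21_norm {a<..<b} g = (LINT t:{a<..<b}|lebesgue. norm (g t)) +
      (LINT t:{a<..<b}|lebesgue. norm (g' t)) + (LINT t:{a<..<b}|lebesgue. norm (H t))"
    by (rule W21_indefinite_integrals(2)[OF ab H]) (rule gi Hi; assumption)+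
  assume B: "\<And>t. t \<in> {a<..<b} \<Longrightarrow> norm (g t) \<le> B" "\<And>t. t \<in> {a<..<b} \<Longrightarrow> norm (g' t) \<le> B'"
  have ai: "g' absolutely_integrable_on {a..b}" "g absolutely_integrable_on {a..b}"
    by (rule indefinite_integrals_absolutely_integrable[where u = g and u' = g' and g = H, OF ab H]; rule gi Hi; assumption)+
  have bound: "(LINT t:{a<..<b}|lebesgue. norm (w t)) \<le> (b - a) * C"
    if w: "w absolutely_integrable_on {a..b}" "\<And>t. t \<in> {a<..<b} \<Longrightarrow> norm (w t) \<le> C" for w :: "real \<Rightarrow> real ^ 'm" and C
  proof -
    have i: "(\<lambda>t. norm (w t)) absolutely_integrable_on {a<..<b}"
      by (rule set_integrable_subset[OF absolutely_integrable_norm[OF w(1), unfolded comp_def]]) auto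
    have c: "(\<lambda>_. C) absolutely_integrable_on {a<..<b}"
      by (rule set_integrable_subset[OF absolutely_integrable_continuous_real[OF continuous_on_const, of a b]]) auto
    have "(LINT t:{a<..<b}|lebesgue. norm (w t)) \<le> (LINT t:{a<..<b}|lebesgue. C)"
      by (rule set_integral_mono[OF i c w(2)])
    also have "\<dots> = (b - a) * C" using ab by (simp add: set_lebesgue_integral_def)
    finally show ?thesis .
  qed
  have "(LINT t:{a<..<b}|lebesgue. norm (H t)) \<le> (LINT t:{a<..<b}|lebesgue. \<Sum>j\<in>UNIV. \<bar>h j t\<bar>)"
  proof (rule set_integral_mono)
    show "(\<lambda>t. norm (H t)) absolutely_integrable_on {a<..<b}"
      by (rule set_integrable_subset[OF absolutely_integrable_norm[OF H, unfolded comp_def]]) auto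
    show "(\<lambda>t. \<Sum>j\<in>UNIV. \<bar>h j t\<bar>) absolutely_integrable_on {a<..<b}"
      by (intro absolutely_integrable_sum set_integrable_subset[OF absolutely_integrable_norm[OF h(1), unfolded comp_def real_norm_def]]) auto
    show "norm (H t) \<le> (\<Sum>j\<in>UNIV. \<bar>h j t\<bar>)" for t
      using norm_le_l1_cart[of "H t"] by (simp add: H_def)
  qed
  also have "\<dots> = integral {a<..<b} (\<lambda>t. \<Sum>j\<in>UNIV. \<bar>h j t\<bar>)"
    by (intro set_lebesgue_integral_eq_integral(2) absolutely_integrable_sum
        set_integrable_subset[OF absolutely_integrable_norm[OF h(1), unfolded comp_def real_norm_def]]) auto
  also have "\<dots> = integral {a..b} (\<lambda>t. \<Sum>j\<in>UNIV. \<bar>h j t\<bar>)" by (simp add: integral_open_interval_real)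
  also have "\<dots> = (\<Sum>j\<in>UNIV. integral {a..b} (\<lambda>t. \<bar>h j t\<bar>))"
  proof (rule Henstock_Kurzweil_Integration.integral_sum)
    show "(\<lambda>t. \<bar>h j t\<bar>) integrable_on {a..b}" for j
      using h(1)[of j] by (simp add: absolutely_integrable_on_def)
  qed simp
  also have "\<dots> \<le> (\<Sum>j\<in>(UNIV :: 'm set). 6 * (\<Phi> b - \<Phi> a))" by (intro sum_mono h(3))
  finally have "(LINT t:{a<..<b}|lebesgue. norm (H t)) \<le> of_nat CARD('m) * (6 * (\<Phi> b - \<Phi> a))" by simp
  then show "W21_norm {a<..<b} g \<le> (b - a) * B + (b - a) * B' + of_nat CARD('m) * (6 * (\<Phi> b - \<Phi> a))"
    unfolding W using bound[OF ai(2) B(1)] bound[OF ai(1) B(2)] by linarith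
qed

text \<open>The representation of the derivative of \<open>x\<close> by an integral is available
  inside the open interval. So \<open>N\<close> is cut by countably many compact subintervals, the
  end points adding at most two values.\<close>

lemma root_system_derivative_negligible_image:
  fixes x :: "real \<Rightarrow> real ^ 'n::finite" and lam lam' :: "real \<Rightarrow> real ^ 'd::finite"
  assumes f: "f \<in> Hyp CARD('d) v" and ab: "a < b" and x: "continuous_on {a<..<b} x" "W21 {a<..<b} x"
    and lam: "root_system f v {a..b} x lam"
    and l: "\<And>t j. t \<in> {a..b} \<Longrightarrow> ((\<lambda>t. lam t $ j) has_real_derivative lam' t $ j) (at t within {a..b})"
      "continuous_on {a..b} lam'"
    and N: "negligible N" "N \<subseteq> {a..b}"
  shows "negligible ((\<lambda>t. lam' t $ j) ` N)"
proof -
  let ?d = "CARD('d)"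
  note H = Hyp_D[OF f]
  have inner: "negligible ((\<lambda>t. lam' t $ j) ` (N \<inter> {c..e}))" if ce: "a < c" "e < b" for c e
  proof (rule root_derivative_negligible_image[where P = "\<lambda>t. rpoly_line f v (x t)" and d = ?d and l = "\<lambda>t. lam t $ j"])
    show "(\<lambda>t. coeff (rpoly_line f v (x t)) k) \<in> ac_derivative_functions c e" for k
    proof (rule rpoly_line_coeff_ac_derivative)
      fix i
      obtain x' h where xh: "\<And>t. t \<in> {a<..<b} \<Longrightarrow> ((\<lambda>t. x t $ i) has_real_derivative x' t) (at t)"
        "h absolutely_integrable_on {a..b}"
        "\<And>s t. a < s \<Longrightarrow> s \<le> t \<Longrightarrow> t < b \<Longrightarrow> (h has_integral (x' t - x' s)) {s..t}"
        by (rule W21_imp_derivative[OF ab x]) (rule that)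
      show "(\<lambda>t. x t $ i) \<in> ac_derivative_functions c e"
      proof (rule ac_derivative_functionsI)
        fix t assume "t \<in> {c..e}"
        then have "t \<in> {a<..<b}" using ce by auto
        then show "((\<lambda>t. x t $ i) has_real_derivative x' t) (at t within {c..e})"
          by (rule has_field_derivative_at_within[OF xh(1)])
      next
        have "h absolutely_integrable_on {c..e}" by (rule set_integrable_subset[OF xh(2)]) (use ce in auto)
        then show "ac_on c e x'" by (rule ac_on_primitive) (rule xh(3); use ce in linarith)
      qed
    qed
    have coeff: "coeff (rpoly_line f v (x t)) ?d \<noteq> 0" for t using rpoly_line_degree(2)[OF H(1)] H(2) by simp
    show "degree (rpoly_line f v (x t)) = ?d" for t
      using rpoly_line_degree(1)[OF H(1), of v "x t"] le_degree[OF coeff[of t]] by simp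
    show "rpoly_line f v (x t) \<noteq> 0" for t using coeff[of t] by auto
    have sub: "{c..e} \<subseteq> {a..b}" using ce by auto
    show "poly (rpoly_line f v (x t)) (lam t $ j) = 0" if "t \<in> {c..e}" for t
      using root_system_poly_zero[OF f lam] that sub by blast
    show "((\<lambda>t. lam t $ j) has_real_derivative lam' t $ j) (at t within {c..e})" if "t \<in> {c..e}" for t
      using has_field_derivative_subset[OF l(1) sub] that sub by blast
    show "continuous_on {c..e} (\<lambda>t. lam' t $ j)"
      by (intro continuous_intros continuous_on_subset[OF l(2) sub])
    show "negligible (N \<inter> {c..e})" using N(1) by (rule negligible_subset) simp
  qed simp
  let ?c = "\<lambda>n. a + inverse (real (Suc n))" and ?e = "\<lambda>n. b - inverse (real (Suc n))"
  have "negligible (\<Union>n. (\<lambda>t. lam' t $ j) ` (N \<inter> {?c n..?e n}))"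
    by (intro negligible_Union_nat inner) auto
  then have "negligible ((\<Union>n. (\<lambda>t. lam' t $ j) ` (N \<inter> {?c n..?e n})) \<union> (\<lambda>t. lam' t $ j) ` {a, b})"
    by (intro negligible_Un) auto
  moreover have "(\<lambda>t. lam' t $ j) ` N \<subseteq> (\<Union>n. (\<lambda>t. lam' t $ j) ` (N \<inter> {?c n..?e n})) \<union> (\<lambda>t. lam' t $ j) ` {a, b}"
  proof
    fix y assume "y \<in> (\<lambda>t. lam' t $ j) ` N"
    then obtain t where t: "t \<in> N" "y = lam' t $ j" by blast
    show "y \<in> (\<Union>n. (\<lambda>t. lam' t $ j) ` (N \<inter> {?c n..?e n})) \<union> (\<lambda>t. lam' t $ j) ` {a, b}"
    proof (cases "t = a \<or> t = b")
      case False
      then have "0 < min (t - a) (b - t)" using t N(2) by force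
      then obtain n where "inverse (real (Suc n)) < min (t - a) (b - t)" using reals_Archimedean by blast
      then have "t \<in> N \<inter> {?c n..?e n}" using t(1) by auto
      then show ?thesis using t(2) by blast
    qed (use t(2) in auto)
  qed
  ultimately show ?thesis by (rule negligible_subset)
qed

lemma bounded_real_set_subset_interval:
  fixes V :: "real set"
  assumes "compact (closure V)"
  obtains n :: nat where "V \<subseteq> {- real (Suc n)<..<real (Suc n)}"
proof -
  have "bounded V" using assms compact_imp_bounded bounded_closure_image by (meson bounded_subset closure_subset)
  then obtain B where B: "\<And>t. t \<in> V \<Longrightarrow> \<bar>t\<bar> \<le> B" by (auto simp: bounded_iff)
  obtain n :: nat where "B < real n" using reals_Archimedean2 by blast
  then have "V \<subseteq> {- real (Suc n)<..<real (Suc n)}" using B by (force simp: abs_le_iff)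
  then show ?thesis by (rule that)
qed

text \<open>A single increasing \<open>\<Phi>\<close>, the sum of the slopes of all convex functions
  involved, dominates the derivative of every component. Continuity and difference-convexity follow
  from this alone; the Sobolev part also uses the null-set property.\<close>

lemma differentiable_root_system_regular:
  fixes x :: "real \<Rightarrow> real ^ 'n::finite" and lam :: "real \<Rightarrow> real ^ 'd::finite"
  assumes f: "f \<in> Hyp CARD('d) v" and DC: "DC_on UNIV x" and W: "W21_loc UNIV x"
    and lam: "root_system f v UNIV x lam" "lam differentiable_on UNIV"
  shows "C1_on UNIV lam" "DC_on UNIV lam" "W21_loc UNIV lam"
proof -
  let ?d = "CARD('d)"
  obtain p q where pq: "\<And>i. convex_on UNIV (p i)" "\<And>i. convex_on UNIV (q i)" "\<And>i t. x t $ i = p i t - q i t"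
    by (rule DC_on_UNIV_convexE[OF DC]) (rule that)
  have xc: "continuous_on UNIV x"
  proof -
    have "continuous_on UNIV (\<lambda>t. x t $ i)" for i
      unfolding pq(3) by (intro continuous_on_diff convex_on_continuous pq open_UNIV)
    then show ?thesis using continuous_on_vec_lambda[of UNIV "\<lambda>i t. x t $ i"] by simp
  qed
  obtain L where L: "0 \<le> L" "\<And>k x. k \<le> ?d \<Longrightarrow> - (L * (\<Sum>i\<in>UNIV. \<bar>x $ i\<bar>)) \<le> bottom_sum f v ?d k x"
    by (rule bottom_sum_lower_bound[OF f]) (rule that)
  define P where "P k t = L * (\<Sum>i\<in>UNIV. p i t + q i t) - bottom_sum f v ?d k (x t)" for k t
  have P: "convex_on UNIV (P k)" if "k \<le> ?d" for k
    unfolding P_def by (rule convex_on_majorant_minus_bottom_sum[OF f that L(1) L(2)[OF that] pq])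
  have s: "char_map f v (x t) ! j = P (?d - Suc j) t - P (?d - j) t" if "j < ?d" for j t
    by (simp add: char_map_nth_eq_diff[OF f that] P_def)
  define \<Phi> where "\<Phi> t = (\<Sum>j<?d. right_slope UNIV (P (?d - Suc j)) t + right_slope UNIV (P (?d - j)) t)" for t
  define lam' where "lam' t = vector_derivative lam (at t)" for t
  have "(lam has_vector_derivative lam' t) (at t)" for t
    using lam(2) unfolding lam'_def by (simp add: differentiable_on_def vector_derivative_works)
  then have d: "((\<lambda>t. lam t $ i) has_real_derivative lam' t $ i) (at t)" for t i
    by (rule has_real_derivative_component)
  have dom: "\<bar>lam' t $ i - lam' r $ i\<bar> \<le> \<Phi> t - \<Phi> r" if "r \<le> t" for r t i
    unfolding \<Phi>_def
  proof (rule root_derivative_increment[OF open_UNIV open_UNIV subset_UNIV P d])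
    show "\<exists>j<?d. lam t $ i = P (?d - Suc j) t - P (?d - j) t" for t
      using root_system_nth[OF f lam(1), of t i] s by auto
  qed (use that in auto)
  have "continuous_on UNIV (\<lambda>t. lam' t $ i)" for i
    by (rule dominated_derivative_continuous_on[OF open_UNIV convex_UNIV d dom])
  then have c': "continuous_on UNIV lam'"
    using continuous_on_vec_lambda[of UNIV "\<lambda>i t. lam' t $ i"] by simp
  have vd: "(lam has_vector_derivative lam' t) (at t)" for t
    by (rule has_vector_derivative_componentwise) (rule d)
  then show "C1_on UNIV lam" using c' by (auto simp: C1_on_def)
  show "DC_on UNIV lam"
    unfolding DC_on_def using dominated_derivative_imp_dc[OF d dom] by blast
  show "W21_loc UNIV lam"
    unfolding W21_loc_def
  proof (intro allI impI, elim conjE)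
    fix V :: "real set" assume V: "open V" "compact (closure V)"
    obtain n where n: "V \<subseteq> {- real (Suc n)<..<real (Suc n)}" using V(2) by (rule bounded_real_set_subset_interval)
    let ?a = "- real (Suc n)" and ?b = "real (Suc n)"
    have ab: "?a < ?b" by simp
    have "W21 {?a<..<?b} x"
    proof -
      have "compact (closure {?a<..<?b})" unfolding closure_greaterThanLessThan[OF ab] by (rule compact_Icc)
      then show ?thesis using W[unfolded W21_loc_def, rule_format, of "{?a<..<?b}"] open_greaterThanLessThan subset_UNIV by blast
    qed
    note null = root_system_derivative_negligible_image[OF f ab continuous_on_subset[OF xc subset_UNIV] this,
        where lam = lam and lam' = lam']
    show "W21 V lam"
    proof (rule W21_of_dominated_derivative(1)[OF ab _ _ _ _ V(1) n])
      show "((\<lambda>t. lam t $ j) has_real_derivative lam' t $ j) (at t within {?a..?b})" for t j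
        using d by (rule has_field_derivative_at_within)
      show "continuous_on {?a..?b} lam'" by (rule continuous_on_subset[OF c' subset_UNIV])
      show "negligible ((\<lambda>t. lam' t $ j) ` N)" if "negligible N" "N \<subseteq> {?a..?b}" for N j
        by (rule null) (use lam(1) d that c' in \<open>auto simp: root_system_def intro: has_field_derivative_at_within continuous_on_subset\<close>)
    qed (rule dom)
  qed
qed

section \<open>Uniform bounds\<close>

lemma locally_lipschitz_imp_dominated:
  fixes G :: "real \<Rightarrow> real ^ 'n"
  assumes lip: "\<And>t. \<exists>e>0. \<exists>L. L-lipschitz_on (ball t e) G"
  obtains \<Phi> M where "\<And>s t j. s \<le> t \<Longrightarrow> \<bar>G t $ j - G s $ j\<bar> \<le> \<Phi> t - \<Phi> s"
    "\<And>(n :: nat) s t j. \<bar>s\<bar> \<le> real n \<Longrightarrow> \<bar>t\<bar> \<le> real n \<Longrightarrow> \<bar>G t $ j - G s $ j\<bar> \<le> M n * \<bar>t - s\<bar>"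
    "\<And>n. 0 \<le> M n"
proof -
  have "\<exists>L. L-lipschitz_on {- real n..real n} G" for n :: nat
  proof -
    \<comment> \<open>A dummy one-point parameter set, in order to use the passage from local
      Lipschitz bounds to one on a compact interval.\<close>
    have "local_lipschitz {0 :: real} {- real n..real n} (\<lambda>_. G)"
      unfolding local_lipschitz_def
    proof (intro ballI)
      fix t :: real assume "t \<in> {- real n..real n}"
      obtain e L where e: "e > 0" "L-lipschitz_on (ball t e) G" using lip[of t] by blast
      have "L-lipschitz_on (cball t (e / 2) \<inter> {- real n..real n}) G"
        by (rule lipschitz_on_subset[OF e(2)]) (use e(1) in auto)
      then show "\<exists>u>0. \<exists>L. \<forall>t'\<in>cball x u \<inter> {0}. L-lipschitz_on (cball t u \<inter> {- real n..real n}) G" for x :: real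
        using e(1) by (intro exI[of _ "e / 2"] conjI exI[of _ L]) auto
    qed
    then obtain L where "\<And>t. t \<in> {0 :: real} \<Longrightarrow> L-lipschitz_on {- real n..real n} G"
      by (rule local_lipschitz_compact_implies_lipschitz) (auto intro: continuous_on_const)
    then show ?thesis by blast
  qed
  then have "\<exists>L. \<forall>n :: nat. (L n)-lipschitz_on {- real n..real n} G" by (intro choice allI)
  then obtain L :: "nat \<Rightarrow> real" where L: "\<And>n. (L n)-lipschitz_on {- real n..real n} G" by blast
  \<comment> \<open>Partial sums make the Lipschitz constants increasing in
    \<open>n\<close>.\<close>
  define M where "M n = (\<Sum>k\<le>n. L k)" for n :: nat
  have L0: "0 \<le> L n" for n using L by (rule lipschitz_on_nonneg)
  have M0: "0 \<le> M n" for n unfolding M_def by (intro sum_nonneg L0)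
  have Mmono: "M m \<le> M n" if "m \<le> n" for m n unfolding M_def using that by (intro sum_mono2 L0) auto
  have M: "\<bar>G t $ j - G s $ j\<bar> \<le> M n * \<bar>t - s\<bar>" if "\<bar>s\<bar> \<le> real n" "\<bar>t\<bar> \<le> real n" for n s t j
  proof -
    have "\<bar>G t $ j - G s $ j\<bar> \<le> dist (G t) (G s)"
      using component_le_norm_cart[of "G t - G s" j] by (simp add: dist_norm)
    also have "\<dots> \<le> L n * dist t s" by (rule lipschitz_onD[OF L]) (use that in \<open>auto simp: abs_le_iff\<close>)
    also have "\<dots> \<le> M n * dist t s" unfolding M_def by (intro mult_right_mono member_le_sum L0) auto
    finally show ?thesis by (simp add: dist_real_def)
  qed
  define N where "N t = nat \<lceil>\<bar>t\<bar>\<rceil>" for t :: real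
  have N: "\<bar>t\<bar> \<le> real (N t)" for t unfolding N_def by linarith
  have Nmono: "N s \<le> N t" if "\<bar>s\<bar> \<le> \<bar>t\<bar>" for s t unfolding N_def using that by (intro nat_mono ceiling_mono)
  \<comment> \<open>\<open>M (N t)\<close> is a Lipschitz constant on all points of modulus at most
    \<open>\<bar>t\<bar>\<close> and grows with \<open>\<bar>t\<bar>\<close>. Multiplied by
    \<open>t\<close>, it increases at least at this rate on either side of 0.\<close>
  define \<Phi> where "\<Phi> t = t * M (N t)" for t
  have pos: "\<bar>G t $ j - G s $ j\<bar> \<le> \<Phi> t - \<Phi> s" if st: "0 \<le> s" "s \<le> t" for s t j
  proof -
    have "\<bar>G t $ j - G s $ j\<bar> \<le> M (N t) * \<bar>t - s\<bar>" using N[of t] st by (intro M) auto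
    also have "\<dots> = t * M (N t) - s * M (N t)" using st by (simp add: algebra_simps)
    also have "\<dots> \<le> \<Phi> t - \<Phi> s" using Mmono[OF Nmono[of s t]] st unfolding \<Phi>_def by (simp add: mult_left_mono)
    finally show ?thesis .
  qed
  have neg: "\<bar>G t $ j - G s $ j\<bar> \<le> \<Phi> t - \<Phi> s" if st: "s \<le> t" "t \<le> 0" for s t j
  proof -
    have "\<bar>G t $ j - G s $ j\<bar> \<le> M (N s) * \<bar>t - s\<bar>" using N[of s] st by (intro M) auto
    also have "\<dots> = t * M (N s) - s * M (N s)" using st by (simp add: algebra_simps)
    also have "\<dots> \<le> \<Phi> t - \<Phi> s" using Mmono[OF Nmono[of t s]] st unfolding \<Phi>_def by (simp add: mult_left_mono_neg)
    finally show ?thesis .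
  qed
  have "\<bar>G t $ j - G s $ j\<bar> \<le> \<Phi> t - \<Phi> s" if st: "s \<le> t" for s t j
  proof -
    consider "0 \<le> s" | "t \<le> 0" | "s < 0" "0 < t" by linarith
    then show ?thesis
    proof cases
      case 3
      then show ?thesis using pos[of 0 t j] neg[of s 0 j] by linarith
    qed (use pos neg st in auto)
  qed
  then show ?thesis using M M0 by (rule that)
qed

text \<open>The criterion used for the roots applies to the curve: a locally Lipschitz derivative is
  dominated by an increasing function and maps null sets to null sets.\<close>

lemma C11_imp_DC_W21_loc:
  fixes x :: "real \<Rightarrow> real ^ 'n::finite"
  assumes "C11 x"
  shows "DC_on UNIV x" "W21_loc UNIV x"
proof -
  let ?x' = "\<lambda>t. vector_derivative x (at t)"
  have C1: "C1_on UNIV x" and lip: "\<And>t. \<exists>e>0. \<exists>L. L-lipschitz_on (ball t e) ?x'"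
    using assms by (auto simp: C11_def)
  obtain g' where g': "\<And>t. (x has_vector_derivative g' t) (at t)" "continuous_on UNIV g'"
    using C1 by (auto simp: C1_on_def)
  have eq: "?x' = g'" using vector_derivative_at[OF g'(1)] by (intro ext)
  have d: "((\<lambda>t. x t $ j) has_real_derivative g' t $ j) (at t)" for t j
    by (rule has_real_derivative_component[OF g'(1)])
  obtain \<Phi> M where dom: "\<And>s t j. s \<le> t \<Longrightarrow> \<bar>g' t $ j - g' s $ j\<bar> \<le> \<Phi> t - \<Phi> s"
    and M: "\<And>(n :: nat) s t j. \<bar>s\<bar> \<le> real n \<Longrightarrow> \<bar>t\<bar> \<le> real n \<Longrightarrow> \<bar>g' t $ j - g' s $ j\<bar> \<le> M n * \<bar>t - s\<bar>" "\<And>n. 0 \<le> M n"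
    by (rule locally_lipschitz_imp_dominated[OF lip[unfolded eq]]) (rule that)
  show "DC_on UNIV x" unfolding DC_on_def using dominated_derivative_imp_dc[OF d dom] by blast
  show "W21_loc UNIV x"
    unfolding W21_loc_def
  proof (intro allI impI, elim conjE)
    fix V :: "real set" assume V: "open V" "compact (closure V)"
    obtain n where n: "V \<subseteq> {- real (Suc n)<..<real (Suc n)}" using V(2) by (rule bounded_real_set_subset_interval)
    let ?a = "- real (Suc n)" and ?b = "real (Suc n)"
    have ab: "?a < ?b" by simp
    show "W21 V x"
    proof (rule W21_of_dominated_derivative(1)[OF ab _ _ _ _ V(1) n])
      show "((\<lambda>t. x t $ j) has_real_derivative g' t $ j) (at t within {?a..?b})" for t j
        using d by (rule has_field_derivative_at_within)
      show "continuous_on {?a..?b} g'" by (rule continuous_on_subset[OF g'(2) subset_UNIV])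
      fix N j assume N: "negligible N" "N \<subseteq> {?a..?b}"
      have "ac_on ?a ?b (\<lambda>t. g' t $ j)"
      proof (rule ac_on_lipschitz[OF M(2)])
        fix s t assume st: "?a \<le> s" "s \<le> t" "t \<le> ?b"
        have "\<bar>s\<bar> \<le> real (Suc n)" "\<bar>t\<bar> \<le> real (Suc n)" using st by linarith+
        then have "\<bar>g' t $ j - g' s $ j\<bar> \<le> M (Suc n) * \<bar>t - s\<bar>" by (rule M(1))
        then show "\<bar>g' t $ j - g' s $ j\<bar> \<le> M (Suc n) * (t - s)" using st(2) by simp
      qed
      then show "negligible ((\<lambda>t. g' t $ j) ` N)" using N by (rule ac_on_negligible_image)
    qed (rule dom)
  qed
qed

section \<open>Estimates uniform in the parameter\<close>

lemma convex_on_slice: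
  fixes p :: "real \<times> 'b::real_normed_vector \<Rightarrow> real"
  assumes p: "convex_on N p" and J: "convex J" and sub: "\<And>t. t \<in> J \<Longrightarrow> (t, r) \<in> N"
  shows "convex_on J (\<lambda>t. p (t, r))"
proof (rule convex_onI[OF _ J])
  fix u s t :: real assume u: "0 < u" "u < 1" and st: "s \<in> J" "t \<in> J"
  have "((1 - u) *\<^sub>R s + u *\<^sub>R t, r) = (1 - u) *\<^sub>R (s, r) + u *\<^sub>R (t, r)" by (simp add: algebra_simps)
  then show "p ((1 - u) *\<^sub>R s + u *\<^sub>R t, r) \<le> (1 - u) * p (s, r) + u * p (t, r)"
    using convex_onD[OF p, of u "(s, r)" "(t, r)"] u sub st by simp
qed

text \<open>\<open>\<Phi>\<close> may jump at the ends, so the estimate is not extended by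
  continuity of both sides: increments of \<open>\<Phi>\<close> over shrunken intervals are bounded
  by the full one, and only \<open>G\<close> is passed to the limit.\<close>

lemma dominated_on_closed_interval:
  fixes G :: "real \<Rightarrow> real"
  assumes G: "continuous_on {s..t} G"
    and dom: "\<And>u w. s < u \<Longrightarrow> u \<le> w \<Longrightarrow> w < t \<Longrightarrow> \<bar>G w - G u\<bar> \<le> \<Phi> w - \<Phi> u"
    and mono: "\<And>u w. s \<le> u \<Longrightarrow> u \<le> w \<Longrightarrow> w \<le> t \<Longrightarrow> \<Phi> u \<le> \<Phi> w"
    and uw: "s \<le> u" "u \<le> w" "w \<le> t"
  shows "\<bar>G w - G u\<bar> \<le> \<Phi> w - \<Phi> u"
proof (cases "u = w")
  case False
  define e where "e n = (w - u) / 3 * inverse (real (Suc n))" for n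
  have e: "0 < e n" "e n \<le> (w - u) / 3" for n
  proof -
    have "inverse (real (Suc n)) \<le> 1" "0 < inverse (real (Suc n))" by (auto simp: inverse_le_1_iff)
    then show "0 < e n" "e n \<le> (w - u) / 3"
      unfolding e_def using False uw by (auto intro!: mult_pos_pos mult_left_le)
  qed
  have e0: "e \<longlonglongrightarrow> 0"
  proof -
    have "(\<lambda>n. (w - u) / 3 * inverse (real (Suc n))) \<longlonglongrightarrow> (w - u) / 3 * 0"
      by (intro tendsto_intros LIMSEQ_inverse_real_of_nat)
    then show ?thesis by (simp add: e_def[abs_def])
  qed
  have in_st: "s < u + e n" "u + e n \<le> w - e n" "w - e n < t" "u \<le> u + e n" "w - e n \<le> w" for n
    using e[of n] uw False by (auto simp: field_simps)
  have lim: "(\<lambda>n. G (c n)) \<longlonglongrightarrow> G l" if "c \<longlonglongrightarrow> l" "\<And>n. c n \<in> {s..t}" "l \<in> {s..t}" for c l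
    using G that unfolding continuous_on_sequentially comp_def by blast
  have 1: "(\<lambda>n. G (u + e n)) \<longlonglongrightarrow> G u"
  proof (rule lim)
    show "(\<lambda>n. u + e n) \<longlonglongrightarrow> u" using tendsto_add[OF tendsto_const[of u] e0] by simp
    show "u + e n \<in> {s..t}" for n using in_st[of n] uw by simp
  qed (use uw in simp)
  have 2: "(\<lambda>n. G (w - e n)) \<longlonglongrightarrow> G w"
  proof (rule lim)
    show "(\<lambda>n. w - e n) \<longlonglongrightarrow> w" using tendsto_diff[OF tendsto_const[of w] e0] by simp
    show "w - e n \<in> {s..t}" for n using in_st[of n] uw by simp
  qed (use uw in simp)
  have "\<bar>G (w - e n) - G (u + e n)\<bar> \<le> \<Phi> w - \<Phi> u" for n
    using dom[OF in_st(1-3)[of n]] mono[of u "u + e n"] mono[of "w - e n" w] in_st[of n] uw by linarith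
  then show ?thesis by (intro LIMSEQ_le_const2[OF tendsto_rabs[OF tendsto_diff[OF 2 1]]]) auto
qed simp

definition bounded_increments :: "(real \<Rightarrow> real ^ 'd) \<Rightarrow> real \<Rightarrow> real \<Rightarrow> real \<Rightarrow> bool" where
  "bounded_increments G s t C \<longleftrightarrow> (\<exists>\<Phi> :: real \<Rightarrow> real. (\<forall>u w j. s \<le> u \<and> u \<le> w \<and> w \<le> t \<longrightarrow> \<bar>G w $ j - G u $ j\<bar> \<le> \<Phi> w - \<Phi> u) \<and>
     \<Phi> t - \<Phi> s \<le> C)"

lemma bounded_increments_combine:
  assumes "bounded_increments G s c A" "bounded_increments G c t B" and sct: "s \<le> c" "c \<le> t"
  shows "bounded_increments G s t (A + B)"
proof -
  obtain \<Phi> where \<Phi>: "\<And>u w j. s \<le> u \<Longrightarrow> u \<le> w \<Longrightarrow> w \<le> c \<Longrightarrow> \<bar>G w $ j - G u $ j\<bar> \<le> \<Phi> w - \<Phi> u" "\<Phi> c - \<Phi> s \<le> A"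
    using assms(1) unfolding bounded_increments_def by blast
  obtain \<Psi> where \<Psi>: "\<And>u w j. c \<le> u \<Longrightarrow> u \<le> w \<Longrightarrow> w \<le> t \<Longrightarrow> \<bar>G w $ j - G u $ j\<bar> \<le> \<Psi> w - \<Psi> u" "\<Psi> t - \<Psi> c \<le> B"
    using assms(2) unfolding bounded_increments_def by blast
  define \<Theta> where "\<Theta> u = (if u \<le> c then \<Phi> u - \<Phi> c else \<Psi> u - \<Psi> c)" for u
  have "\<bar>G w $ j - G u $ j\<bar> \<le> \<Theta> w - \<Theta> u" if uw: "s \<le> u" "u \<le> w" "w \<le> t" for u w j
  proof -
    consider "w \<le> c" | "c < u" | "u \<le> c" "c < w" by linarith
    then show ?thesis
    proof cases
      case 1
      then show ?thesis using \<Phi>(1)[of u w j] uw by (simp add: \<Theta>_def)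
    next
      case 2
      then show ?thesis using \<Psi>(1)[of u w j] uw by (simp add: \<Theta>_def)
    next
      case 3
      then show ?thesis using \<Phi>(1)[of u c j] \<Psi>(1)[of c w j] uw by (simp add: \<Theta>_def)
    qed
  qed
  moreover have "\<Theta> t - \<Theta> s \<le> A + B"
  proof (cases "t = c")
    case True
    then have "0 \<le> B" using \<Psi>(1)[of c c] \<Psi>(2) by simp
    then show ?thesis using True sct \<Phi>(2) by (simp add: \<Theta>_def)
  next
    case False
    then show ?thesis using sct \<Phi>(2) \<Psi>(2) by (simp add: \<Theta>_def)
  qed
  ultimately show ?thesis unfolding bounded_increments_def by blast
qed

text \<open>Cut off a last piece of length at most \<open>\<delta>\<close> and induct. For
  \<open>n = 0\<close> a single, degenerate piece remains, which accounts for
  \<open>Suc n\<close>.\<close>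

lemma bounded_increments_chain:
  assumes \<delta>: "0 < \<delta>" and "0 \<le> C"
    and step: "\<And>s t. a \<le> s \<Longrightarrow> s \<le> t \<Longrightarrow> t \<le> b \<Longrightarrow> t \<le> s + \<delta> \<Longrightarrow> bounded_increments G s t C"
    and "a \<le> b" "b \<le> a + real n * \<delta>"
  shows "bounded_increments G a b (real (Suc n) * C)"
  using assms(4,5) step
proof (induction n arbitrary: b)
  case 0
  then show ?case using "0.prems"(3)[of a b] \<delta> by simp
next
  case (Suc n)
  define c where "c = max a (b - \<delta>)"
  have c: "a \<le> c" "c \<le> b" "b \<le> c + \<delta>" using Suc.prems(1) \<delta> by (auto simp: c_def)
  have "bounded_increments G a c (real (Suc n) * C)"
  proof (rule Suc.IH[OF c(1)])
    have "0 \<le> real n * \<delta>" using \<delta> by simp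
    then show "c \<le> a + real n * \<delta>" using Suc.prems(2) \<delta> unfolding c_def by (simp add: algebra_simps)
    show "bounded_increments G s t C" if "a \<le> s" "s \<le> t" "t \<le> c" "t \<le> s + \<delta>" for s t
      using Suc.prems(3)[of s t] that c by simp
  qed
  moreover have "bounded_increments G c b C" using Suc.prems(3)[of c b] c by simp
  ultimately have "bounded_increments G a b (real (Suc n) * C + C)" using c by (intro bounded_increments_combine)
  then show ?case by (simp add: algebra_simps)
qed

lemma locally_DC_onD:
  fixes x :: "'a::real_normed_vector \<Rightarrow> real ^ 'n"
  assumes "locally_DC_on U x" "z \<in> U"
  shows "\<exists>W N p q. open W \<and> z \<in> W \<and> W \<inter> U \<subseteq> N \<and> convex_on N p \<and> continuous_on N p \<and> convex_on N q \<and> continuous_on N q \<and>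
    (\<forall>y\<in>N. x y $ i = p y - q y)"
proof -
  have "locally_dc_on U (\<lambda>y. x y $ i)" using assms(1) by (simp add: locally_DC_on_def)
  then have "\<exists>W N. open W \<and> z \<in> W \<and> W \<inter> U \<subseteq> N \<and> N \<subseteq> U \<and> convex N \<and> dc_on N (\<lambda>y. x y $ i)"
    unfolding locally_dc_on_def using assms(2) by (rule bspec)
  then obtain W N where "open W" "z \<in> W" "W \<inter> U \<subseteq> N" "dc_on N (\<lambda>y. x y $ i)"
    by (elim exE conjE) (rule that)
  then show ?thesis unfolding dc_on_def by (elim exE conjE) (intro exI conjI; assumption)
qed

lemma dist_Pair_le: "dist (s, r) (t, q) \<le> dist s t + dist r q"
  unfolding dist_Pair_Pair by (rule sqrt_sum_squares_le_sum) auto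

text \<open>The convex functions are only known to be bounded near the given point; this bounds their
  slopes on a smaller neighbourhood.\<close>

lemma uniform_local_slopes:
  fixes x :: "real \<times> 'b::euclidean_space \<Rightarrow> real ^ 'n::finite" and t0 :: real and r0 :: 'b
  assumes f: "f \<in> Hyp d v" and U: "open U" and DC: "locally_DC_on U x" and z: "(t0, r0) \<in> U"
  shows "\<exists>e R. 0 < e \<and> 0 \<le> R \<and> (\<forall>r. dist r r0 < e \<longrightarrow> (\<exists>J P. open J \<and> ball t0 e \<subseteq> J \<and> (\<forall>k\<le>d. convex_on J (P k)) \<and>
    (\<forall>j<d. \<forall>t\<in>ball t0 e. char_map f v (x (t, r)) ! j = P (d - Suc j) t - P (d - j) t) \<and>
    (\<forall>k\<le>d. \<forall>t\<in>ball t0 e. \<bar>right_slope J (P k) t\<bar> \<le> R \<and> \<bar>P k t\<bar> \<le> R)))"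
proof -
  let ?z = "(t0, r0)"
  have "\<exists>W. \<forall>i. \<exists>N p q. open (W i) \<and> ?z \<in> W i \<and> W i \<inter> U \<subseteq> N \<and> convex_on N p \<and> continuous_on N p \<and> convex_on N q \<and> continuous_on N q \<and>
    (\<forall>y\<in>N. x y $ i = p y - q y)"
    by (intro choice allI locally_DC_onD[OF DC z])
  then obtain W where W: "\<And>i. \<exists>N p q. open (W i) \<and> ?z \<in> W i \<and> W i \<inter> U \<subseteq> N \<and> convex_on N p \<and> continuous_on N p \<and> convex_on N q \<and> continuous_on N q \<and>
    (\<forall>y\<in>N. x y $ i = p y - q y)" by blast
  have "open (W i) \<and> ?z \<in> W i" for i using W[of i] by (elim exE conjE) (intro conjI)
  then have Wz: "open (W i)" "?z \<in> W i" for i by simp_all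
  have "open ((\<Inter>i. W i) \<inter> U)" using U by (intro open_Int open_INT ballI Wz finite_class.finite_UNIV)
  moreover have "?z \<in> (\<Inter>i. W i) \<inter> U" using Wz(2) z by (intro IntI INT_I)
  ultimately have "\<exists>\<epsilon>>0. cball ?z \<epsilon> \<subseteq> (\<Inter>i. W i) \<inter> U" by (rule bspec[OF iffD1[OF open_contains_cball]])
  then obtain \<epsilon> where \<epsilon>: "\<epsilon> > 0" "cball ?z \<epsilon> \<subseteq> (\<Inter>i. W i) \<inter> U" by (elim exE conjE) (rule that)
  let ?K = "cball ?z \<epsilon>"
  have "\<exists>p q. convex_on ?K p \<and> convex_on ?K q \<and> (\<forall>y\<in>?K. x y $ i = p y - q y) \<and> (\<exists>B. \<forall>y\<in>?K. \<bar>p y\<bar> + \<bar>q y\<bar> \<le> B)" for i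
  proof -
    obtain N p q where N: "W i \<inter> U \<subseteq> N" "convex_on N p" "continuous_on N p" "convex_on N q" "continuous_on N q"
      "\<forall>y\<in>N. x y $ i = p y - q y" using W[of i] by (elim exE conjE) (rule that)
    have sub: "?K \<subseteq> N" using \<epsilon>(2) N(1) by blast
    have "continuous_on ?K (\<lambda>y. \<bar>p y\<bar> + \<bar>q y\<bar>)"
      by (intro continuous_intros continuous_on_subset[OF N(3) sub] continuous_on_subset[OF N(5) sub])
    then have "bounded ((\<lambda>y. \<bar>p y\<bar> + \<bar>q y\<bar>) ` ?K)" by (intro compact_imp_bounded compact_continuous_image compact_cball)
    then obtain B where "\<forall>y\<in>?K. norm (\<bar>p y\<bar> + \<bar>q y\<bar>) \<le> B" by (auto simp: bounded_iff)
    then have "\<forall>y\<in>?K. \<bar>p y\<bar> + \<bar>q y\<bar> \<le> B" by simp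
    moreover have "convex_on ?K p" "convex_on ?K q"
      using N(2,4) sub by (auto intro: convex_on_subset)
    moreover have "\<forall>y\<in>?K. x y $ i = p y - q y" using N(6) sub by (meson subsetD)
    ultimately show ?thesis by (intro exI[of _ p] exI[of _ q] exI[of _ B] conjI)
  qed
  then obtain p q B where pq: "\<And>i. convex_on ?K (p i)" "\<And>i. convex_on ?K (q i)" "\<And>i y. y \<in> ?K \<Longrightarrow> x y $ i = p i y - q i y"
    "\<And>i y. y \<in> ?K \<Longrightarrow> \<bar>p i y\<bar> + \<bar>q i y\<bar> \<le> B i"
    by metis
  \<comment> \<open>Slopes on the ball of radius \<open>e\<close> are bounded by difference
    quotients with step \<open>e\<close>, so times up to \<open>2 * e\<close> from \<open>t0\<close>
    and parameters up to \<open>e\<close> from \<open>r0\<close> must fit into the ball of radius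
    \<open>\<epsilon>\<close>.\<close>
  define e where "e = \<epsilon> / 3"
  have e: "0 < e" using \<epsilon> by (simp add: e_def)
  have inK: "(t, r) \<in> ?K" if "\<bar>t - t0\<bar> < 2 * e" "dist r r0 < e" for t r
    using dist_Pair_le[of t0 r0 t r] that by (simp add: e_def dist_real_def dist_commute abs_minus_commute)
  obtain L where L: "0 \<le> L" "\<And>k x. k \<le> d \<Longrightarrow> - (L * (\<Sum>i\<in>UNIV. \<bar>x $ i\<bar>)) \<le> bottom_sum f v d k x"
    by (rule bottom_sum_lower_bound[OF f]) (rule that)
  have Lub: "bottom_sum f v d k y \<le> L * (\<Sum>i\<in>UNIV. \<bar>y $ i\<bar>)" if k: "k \<le> d" for k y
  proof -
    have "bottom_sum f v d k 0 = 0" using bottom_sum_scale[OF f k, of 0 0] by simp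
    then show ?thesis using bottom_sum_convex_aux[OF f k L(2)[OF k], of y 0] by simp
  qed
  define M where "M = 2 * (L * (\<Sum>i\<in>UNIV. B i))"
  have SB: "(\<Sum>i\<in>UNIV. \<bar>x y $ i\<bar>) \<le> (\<Sum>i\<in>UNIV. B i)" "\<bar>\<Sum>i\<in>UNIV. p i y + q i y\<bar> \<le> (\<Sum>i\<in>UNIV. B i)" if y: "y \<in> ?K" for y
  proof -
    show "(\<Sum>i\<in>UNIV. \<bar>x y $ i\<bar>) \<le> (\<Sum>i\<in>UNIV. B i)"
    proof (rule sum_mono)
      show "\<bar>x y $ i\<bar> \<le> B i" for i using pq(3)[OF y, of i] pq(4)[OF y, of i] by linarith
    qed
    have "\<bar>\<Sum>i\<in>UNIV. p i y + q i y\<bar> \<le> (\<Sum>i\<in>UNIV. \<bar>p i y + q i y\<bar>)" by (rule sum_abs)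
    also have "\<dots> \<le> (\<Sum>i\<in>UNIV. B i)"
    proof (rule sum_mono)
      show "\<bar>p i y + q i y\<bar> \<le> B i" for i using pq(4)[OF y, of i] by linarith
    qed
    finally show "\<bar>\<Sum>i\<in>UNIV. p i y + q i y\<bar> \<le> (\<Sum>i\<in>UNIV. B i)" .
  qed
  have "0 \<le> (\<Sum>i\<in>UNIV. B i)" using SB(2)[of ?z] \<epsilon>(1) by simp
  then have M0: "0 \<le> M" using L(1) by (simp add: M_def)
  \<comment> \<open>\<open>M\<close> bounds the convex functions, and \<open>2 * M / e\<close>
    bounds their quotients over steps of length \<open>e\<close>, between which convexity squeezes
    the right slopes.\<close>
  define R where "R = M + 2 * M / e"
  have R: "0 \<le> R" "M \<le> R" "2 * M / e \<le> R" using M0 e by (auto simp: R_def)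
  have "\<exists>J P. open J \<and> ball t0 e \<subseteq> J \<and> (\<forall>k\<le>d. convex_on J (P k)) \<and>
    (\<forall>j<d. \<forall>t\<in>ball t0 e. char_map f v (x (t, r)) ! j = P (d - Suc j) t - P (d - j) t) \<and>
    (\<forall>k\<le>d. \<forall>t\<in>ball t0 e. \<bar>right_slope J (P k) t\<bar> \<le> R \<and> \<bar>P k t\<bar> \<le> R)" if r: "dist r r0 < e" for r
  proof -
    define J where "J = {t0 - 2 * e<..<t0 + 2 * e}"
    define P where "P k t = L * (\<Sum>i\<in>UNIV. p i (t, r) + q i (t, r)) - bottom_sum f v d k (x (t, r))" for k t
    have JK: "(t, r) \<in> ?K" if "t \<in> J" for t by (rule inK) (use that r in \<open>auto simp: J_def\<close>)
    have J: "open J" "convex J" by (simp_all add: J_def)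
    have cP: "convex_on J (P k)" if k: "k \<le> d" for k
      unfolding P_def
    proof (rule convex_on_majorant_minus_bottom_sum[OF f k L(1) L(2)[OF k]])
      show "convex_on J (\<lambda>t. p i (t, r))" "convex_on J (\<lambda>t. q i (t, r))" for i
        by (rule convex_on_slice[OF pq(1) J(2) JK] convex_on_slice[OF pq(2) J(2) JK]; assumption)+
      show "x (t, r) $ i = p i (t, r) - q i (t, r)" if "t \<in> J" for i t using pq(3)[OF JK[OF that]] .
    qed
    have PM: "\<bar>P k t\<bar> \<le> M" if k: "k \<le> d" and t: "t \<in> J" for k t
    proof -
      have "\<bar>L * (\<Sum>i\<in>UNIV. p i (t, r) + q i (t, r))\<bar> \<le> L * (\<Sum>i\<in>UNIV. B i)"
        unfolding abs_mult abs_of_nonneg[OF L(1)] by (rule mult_left_mono[OF SB(2)[OF JK[OF t]] L(1)])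
      moreover have "L * (\<Sum>i\<in>UNIV. \<bar>x (t, r) $ i\<bar>) \<le> L * (\<Sum>i\<in>UNIV. B i)"
        by (rule mult_left_mono[OF SB(1)[OF JK[OF t]] L(1)])
      ultimately show ?thesis
        using L(2)[OF k, of "x (t, r)"] Lub[OF k, of "x (t, r)"] unfolding P_def M_def by linarith
    qed
    have ball: "t \<in> J" "t + e \<in> J" "t - e \<in> J" if "t \<in> ball t0 e" for t
      using that by (auto simp: J_def dist_real_def)
    have slope: "\<bar>right_slope J (P k) t\<bar> \<le> R" if k: "k \<le> d" and t: "t \<in> ball t0 e" for k t
    proof -
      have "right_slope J (P k) t * (t + e - t) \<le> P k (t + e) - P k t"
        using e by (intro right_slope_increment(1)[OF J(1) cP[OF k]] ball[OF t]) simp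
      then have 1: "right_slope J (P k) t * e \<le> 2 * M"
        using PM[OF k ball(1)[OF t]] PM[OF k ball(2)[OF t]] by simp
      have "P k t - P k (t - e) \<le> right_slope J (P k) t * (t - (t - e))"
        using e by (intro right_slope_increment(2)[OF J(1) cP[OF k]] ball[OF t]) simp
      then have 2: "- (2 * M) \<le> right_slope J (P k) t * e"
        using PM[OF k ball(1)[OF t]] PM[OF k ball(3)[OF t]] by simp
      have "right_slope J (P k) t \<le> 2 * M / e" using 1 e by (simp add: pos_le_divide_eq)
      moreover have "- (2 * M / e) \<le> right_slope J (P k) t"
      proof -
        have "- (2 * M) / e \<le> right_slope J (P k) t" using 2 e by (simp only: pos_divide_le_eq)
        then show ?thesis by simp
      qed
      ultimately show ?thesis using R(3) by linarith
    qed
    show ?thesis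
    proof (intro exI[of _ J] exI[of _ P] conjI allI impI ballI J cP)
      show "ball t0 e \<subseteq> J" using ball(1) by blast
      show "char_map f v (x (t, r)) ! j = P (d - Suc j) t - P (d - j) t" if "j < d" for j t
        by (simp add: char_map_nth_eq_diff[OF f that] P_def)
      show "\<bar>P k t\<bar> \<le> R" if "k \<le> d" "t \<in> ball t0 e" for k t
        using PM[OF that(1) ball(1)[OF that(2)]] R(2) by linarith
    qed (use slope in auto)
  qed
  then show ?thesis using e R(1) by blast
qed

text \<open>Finitely many of the local neighbourhoods cover \<open>K\<close>, with the sum of their
  bounds as a common bound. A Lebesgue number of the cover gives a step length valid at every point;
  halving it fits the closed interval into an open ball.\<close>

lemma uniform_slopes:
  fixes x :: "real \<times> 'b::euclidean_space \<Rightarrow> real ^ 'n::finite" and K :: "(real \<times> 'b) set"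
  assumes f: "f \<in> Hyp d v" and U: "open U" and DC: "locally_DC_on U x" and K: "compact K" "K \<subseteq> U"
  obtains \<delta> R where "0 < \<delta>" "0 \<le> R"
    "\<And>s r. (s, r) \<in> K \<Longrightarrow> \<exists>I J P. {s..s + \<delta>} \<subseteq> I \<and> open J \<and> I \<subseteq> J \<and> (\<forall>k\<le>d. convex_on J (P k)) \<and>
      (\<forall>j<d. \<forall>t\<in>I. char_map f v (x (t, r)) ! j = P (d - Suc j) t - P (d - j) t) \<and>
      (\<forall>k\<le>d. \<forall>t\<in>I. \<bar>right_slope J (P k) t\<bar> \<le> R \<and> \<bar>P k t\<bar> \<le> R)"
proof -
  define Q where "Q t0 r0 e R \<longleftrightarrow> 0 < e \<and> 0 \<le> R \<and> (\<forall>r. dist r r0 < e \<longrightarrow> (\<exists>J P. open J \<and> ball t0 e \<subseteq> J \<and> (\<forall>k\<le>d. convex_on J (P k)) \<and>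
    (\<forall>j<d. \<forall>t\<in>ball t0 e. char_map f v (x (t, r)) ! j = P (d - Suc j) t - P (d - j) t) \<and>
    (\<forall>k\<le>d. \<forall>t\<in>ball t0 e. \<bar>right_slope J (P k) t\<bar> \<le> R \<and> \<bar>P k t\<bar> \<le> R)))" for t0 r0 and e R :: real
  have "\<exists>eR. Q (fst z) (snd z) (fst eR) (snd eR)" if "z \<in> K" for z
  proof -
    have "(fst z, snd z) \<in> U" using that K(2) by auto
    from uniform_local_slopes[OF f U DC this] show ?thesis unfolding Q_def[symmetric] by auto
  qed
  then have "\<exists>eR. \<forall>z\<in>K. Q (fst z) (snd z) (fst (eR z)) (snd (eR z))" by (intro bchoice ballI)
  then obtain eR where Q: "\<And>z. z \<in> K \<Longrightarrow> Q (fst z) (snd z) (fst (eR z)) (snd (eR z))" by blast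
  define e where "e z = fst (eR z)" for z
  define R where "R z = snd (eR z)" for z
  note Q = Q[folded e_def R_def]
  define W where "W z = ball (fst z) (e z) \<times> ball (snd z) (e z)" for z
  have "K \<subseteq> (\<Union>z\<in>K. W z)"
  proof
    fix z assume "z \<in> K"
    then have "z \<in> W z" using Q by (auto simp: W_def Q_def mem_Times_iff)
    then show "z \<in> (\<Union>z\<in>K. W z)" using \<open>z \<in> K\<close> by blast
  qed
  then obtain Z where Z: "Z \<subseteq> K" "finite Z" "K \<subseteq> (\<Union>z\<in>Z. W z)"
    by (rule compactE_image[OF K(1), rotated]) (auto simp: W_def open_Times)
  obtain \<delta> where \<delta>: "0 < \<delta>" "\<And>y. y \<in> K \<Longrightarrow> \<exists>G\<in>W ` Z. ball y \<delta> \<subseteq> G"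
    by (rule Heine_Borel_lemma[OF K(1) Z(3)]) (auto simp: W_def open_Times)
  define C where "C = (\<Sum>z\<in>Z. R z)"
  have R0: "0 \<le> R z" if "z \<in> Z" for z using Q[of z] Z(1) that by (auto simp: Q_def)
  have RC: "R z \<le> C" if "z \<in> Z" for z unfolding C_def using that R0 Z(2) by (intro member_le_sum) auto
  show ?thesis
  proof (rule that[of "\<delta> / 2" C])
    show "0 < \<delta> / 2" using \<delta> by simp
    show "0 \<le> C" unfolding C_def by (intro sum_nonneg R0)
    fix s r assume "(s, r) \<in> K"
    then obtain z where z: "z \<in> Z" "ball (s, r) \<delta> \<subseteq> W z" using \<delta>(2) by blast
    have in_ball: "t \<in> ball (fst z) (e z) \<and> dist r (snd z) < e z" if "t \<in> {s..s + \<delta> / 2}" for t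
    proof -
      have "dist (s, r) (t, r) < \<delta>" using dist_Pair_le[of s r t r] that \<delta>(1) by (simp add: dist_real_def)
      then have "(t, r) \<in> W z" using z(2) by auto
      then show ?thesis by (simp add: W_def dist_commute)
    qed
    have "s \<in> {s..s + \<delta> / 2}" using \<delta>(1) by simp
    then have "dist r (snd z) < e z" using in_ball by blast
    then obtain J P where JP: "open J" "ball (fst z) (e z) \<subseteq> J" "\<forall>k\<le>d. convex_on J (P k)"
      "\<forall>j<d. \<forall>t\<in>ball (fst z) (e z). char_map f v (x (t, r)) ! j = P (d - Suc j) t - P (d - j) t"
      "\<forall>k\<le>d. \<forall>t\<in>ball (fst z) (e z). \<bar>right_slope J (P k) t\<bar> \<le> R z \<and> \<bar>P k t\<bar> \<le> R z"
    proof -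
      have "z \<in> K" using z(1) Z(1) by blast
      from Q[OF this, unfolded Q_def, THEN conjunct2, THEN conjunct2, THEN spec, THEN mp, OF \<open>dist r (snd z) < e z\<close>]
      show thesis by (elim exE conjE) (rule that)
    qed
    have "\<forall>k\<le>d. \<forall>t\<in>ball (fst z) (e z). \<bar>right_slope J (P k) t\<bar> \<le> C \<and> \<bar>P k t\<bar> \<le> C"
      using JP(5) RC[OF z(1)] by (meson order_trans)
    moreover have "{s..s + \<delta> / 2} \<subseteq> ball (fst z) (e z)" using in_ball by blast
    ultimately show "\<exists>I J P. {s..s + \<delta> / 2} \<subseteq> I \<and> open J \<and> I \<subseteq> J \<and> (\<forall>k\<le>d. convex_on J (P k)) \<and>
      (\<forall>j<d. \<forall>t\<in>I. char_map f v (x (t, r)) ! j = P (d - Suc j) t - P (d - j) t) \<and>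
      (\<forall>k\<le>d. \<forall>t\<in>I. \<bar>right_slope J (P k) t\<bar> \<le> C \<and> \<bar>P k t\<bar> \<le> C)"
      using JP(1-4) by (intro exI[of _ "ball (fst z) (e z)"] exI[of _ J] exI[of _ P] conjI)
  qed
qed

lemma abs_diff_le_double:
  fixes p q c :: real
  assumes "\<bar>p\<bar> \<le> c" "\<bar>q\<bar> \<le> c"
  shows "\<bar>p - q\<bar> \<le> 2 * c" "\<bar>p + q\<bar> \<le> 2 * c"
  using assms by linarith+

text \<open>A root or its derivative is a difference of two quantities bounded by \<open>R\<close>,
  hence \<open>2 * R\<close>. The dominating function adds two slopes for each of the
  \<open>CARD('d)\<close> indices; counting both end points gives the factor 4.\<close>

lemma root_derivative_bounds:
  fixes x :: "real \<Rightarrow> real ^ 'n::finite" and lam lam' :: "real \<Rightarrow> real ^ 'd::finite"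
  assumes J: "open J" "I \<subseteq> J" and P: "\<forall>k\<le>CARD('d). convex_on J (P k)"
    and rep: "\<forall>j<CARD('d). \<forall>t\<in>I. char_map f v (x t) ! j = P (CARD('d) - Suc j) t - P (CARD('d) - j) t"
    and R: "\<forall>k\<le>CARD('d). \<forall>t\<in>I. \<bar>right_slope J (P k) t\<bar> \<le> R \<and> \<bar>P k t\<bar> \<le> R"
    and st: "s \<le> t" "{s..t} \<subseteq> I"
    and lam: "\<And>u i. u \<in> {s..t} \<Longrightarrow> \<exists>j<CARD('d). lam u $ i = char_map f v (x u) ! j"
    and d: "\<And>u i. u \<in> {s<..<t} \<Longrightarrow> ((\<lambda>u. lam u $ i) has_real_derivative lam' u $ i) (at u)"
    and c: "continuous_on {s..t} lam'"
  shows "bounded_increments lam' s t (4 * of_nat CARD('d) * R)"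
    and "u \<in> {s..t} \<Longrightarrow> \<bar>lam u $ i\<bar> \<le> 2 * R"
    and "u \<in> {s<..<t} \<Longrightarrow> \<bar>lam' u $ i\<bar> \<le> 2 * R"
proof -
  let ?d = "CARD('d)"
  let ?S = "\<lambda>k. right_slope J (P k)"
  have sel: "\<exists>j<?d. lam u $ i = P (?d - Suc j) u - P (?d - j) u" if u: "u \<in> {s..t}" for u i
  proof -
    obtain j where "j < ?d" "lam u $ i = char_map f v (x u) ! j" using lam[OF u] by blast
    moreover have "u \<in> I" using u st(2) by blast
    ultimately show ?thesis using rep by auto
  qed
  have PR: "\<bar>?S k u\<bar> \<le> R" "\<bar>P k u\<bar> \<le> R" if "k \<le> ?d" "u \<in> {s..t}" for k u
    using R that st(2) by auto
  show "\<bar>lam u $ i\<bar> \<le> 2 * R" if u: "u \<in> {s..t}" for u i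
  proof -
    obtain j where j: "j < ?d" "lam u $ i = P (?d - Suc j) u - P (?d - j) u" using sel[OF u] by blast
    show ?thesis unfolding j(2) by (rule abs_diff_le_double(1)) (rule PR(2)[OF _ u], simp)+
  qed
  have stJ: "u \<in> J" if "s \<le> u" "u \<le> t" for u
  proof -
    have "u \<in> {s..t}" using that by simp
    then show ?thesis using st(2) J(2) by blast
  qed
  then have sub: "{s<..<t} \<subseteq> J" by (intro subsetI) simp
  have sel': "\<exists>j<?d. lam u $ i = P (?d - Suc j) u - P (?d - j) u" if "u \<in> {s<..<t}" for u i
    by (rule sel) (use that in auto)
  have P': "convex_on J (P k)" if "k \<le> ?d" for k using P that by blast
  have slope: "\<exists>j<?d. lam' u $ i = ?S (?d - Suc j) u - ?S (?d - j) u" if "u \<in> {s<..<t}" for u i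
    by (rule root_derivative_eq_slope[where g = "\<lambda>u. lam u $ i" and g' = "\<lambda>u. lam' u $ i",
          OF J(1) open_greaterThanLessThan sub _ _ _ that]) (rule P' d sel', assumption)+
  have incr: "\<bar>lam' w $ i - lam' u $ i\<bar> \<le> (\<Sum>j<?d. ?S (?d - Suc j) w + ?S (?d - j) w) - (\<Sum>j<?d. ?S (?d - Suc j) u + ?S (?d - j) u)"
    if "u \<le> w" "{u..w} \<subseteq> {s<..<t}" for u w i
    by (rule root_derivative_increment[where g = "\<lambda>u. lam u $ i" and g' = "\<lambda>u. lam' u $ i",
          OF J(1) open_greaterThanLessThan sub _ _ _ that]) (rule P' d sel', assumption)+
  show "\<bar>lam' u $ i\<bar> \<le> 2 * R" if u: "u \<in> {s<..<t}" for u i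
  proof -
    obtain j where j: "j < ?d" "lam' u $ i = ?S (?d - Suc j) u - ?S (?d - j) u" using slope[OF u] by blast
    have "u \<in> {s..t}" using u by auto
    then show ?thesis unfolding j(2) by (intro abs_diff_le_double(1) PR(1)) simp_all
  qed
  define \<Phi> where "\<Phi> u = (\<Sum>j<?d. ?S (?d - Suc j) u + ?S (?d - j) u)" for u
  have mono: "\<Phi> u \<le> \<Phi> w" if "s \<le> u" "u \<le> w" "w \<le> t" for u w
  proof -
    have "u \<in> J" "w \<in> J" using that by (auto intro: stJ)
    then show ?thesis
      unfolding \<Phi>_def using that(2) by (intro sum_mono add_mono right_slope_increment(3)[OF J(1) P']) auto
  qed
  have "\<bar>lam' w $ i - lam' u $ i\<bar> \<le> \<Phi> w - \<Phi> u" if uw: "s \<le> u" "u \<le> w" "w \<le> t" for u w i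
  proof (rule dominated_on_closed_interval[OF _ _ mono uw])
    show "continuous_on {s..t} (\<lambda>u. lam' u $ i)" by (intro continuous_intros c)
    fix u w assume "s < u" "u \<le> w" "w < t"
    then show "\<bar>lam' w $ i - lam' u $ i\<bar> \<le> \<Phi> w - \<Phi> u"
      unfolding \<Phi>_def by (intro incr) auto
  qed
  moreover have "\<Phi> t - \<Phi> s \<le> 4 * of_nat ?d * R"
  proof -
    have "\<bar>\<Phi> u\<bar> \<le> of_nat ?d * (2 * R)" if u: "u \<in> {s..t}" for u
    proof -
      have "\<bar>\<Phi> u\<bar> \<le> (\<Sum>j<?d. \<bar>?S (?d - Suc j) u + ?S (?d - j) u\<bar>)" unfolding \<Phi>_def by (rule sum_abs)
      also have "\<dots> \<le> (\<Sum>j<?d. 2 * R)"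
      proof (rule sum_mono)
        fix j
        show "\<bar>?S (?d - Suc j) u + ?S (?d - j) u\<bar> \<le> 2 * R"
          by (rule abs_diff_le_double(2)) (rule PR(1)[OF _ u], simp)+
      qed
      finally show ?thesis by simp
    qed
    then have "\<bar>\<Phi> t - \<Phi> s\<bar> \<le> 2 * (of_nat ?d * (2 * R))" using st(1) by (intro abs_diff_le_double(1)) auto
    then show ?thesis by simp
  qed
  ultimately show "bounded_increments lam' s t (4 * of_nat ?d * R)"
    unfolding bounded_increments_def by blast
qed

lemma cube_box: "cube {a..b} = cbox (\<chi> i. a) (\<chi> i. b)" "cube {a<..<b} = box (\<chi> i. a) (\<chi> i. b)"
  by (auto simp: cube_def mem_box_cart)

lemma closure_interval_cube:
  fixes a b :: real
  assumes "a < b"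
  shows "closure ({a<..<b} \<times> cube {a<..<b}) = {a..b} \<times> (cube {a..b} :: (real ^ 'k::finite) set)"
proof -
  have "(\<chi> i. (a + b) / 2) \<in> (box (\<chi> i. a) (\<chi> i. b) :: (real ^ 'k) set)"
    using assms by (simp add: mem_box_cart)
  then have "box (\<chi> i. a) (\<chi> i. b) \<noteq> ({} :: (real ^ 'k) set)" by blast
  then show ?thesis using assms by (simp add: closure_Times cube_box closure_box)
qed

lemma norm_le_of_components:
  fixes y :: "real ^ 'd::finite"
  assumes "\<And>i. \<bar>y $ i\<bar> \<le> c"
  shows "norm y \<le> of_nat CARD('d) * c"
proof -
  have "norm y \<le> (\<Sum>i\<in>UNIV. \<bar>y $ i\<bar>)" by (rule norm_le_l1_cart)
  also have "\<dots> \<le> (\<Sum>i\<in>(UNIV :: 'd set). c)" by (intro sum_mono assms)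
  finally show ?thesis by simp
qed

text \<open>All constants depend on the step length, on the slope bound \<open>R\<close> and on the
  interval. Since these come from compactness of the whole set of times and parameters, nothing
  depends on \<open>r\<close> or on the chosen systems.\<close>

lemma uniform_root_bounds:
  fixes x :: "real \<times> (real ^ 'k::finite) \<Rightarrow> real ^ 'n::finite" and lam :: "real \<Rightarrow> real ^ 'k \<Rightarrow> real ^ 'd::finite"
  assumes f: "f \<in> Hyp CARD('d) v" and ab: "a < b" and U: "open U" "closure ({a<..<b} \<times> cube {a<..<b}) \<subseteq> U"
    and DC: "locally_DC_on U x"
    and x: "\<And>r. r \<in> cube {a..b} \<Longrightarrow> C1_on {a..b} (\<lambda>t. x (t, r)) \<and> W21 {a<..<b} (\<lambda>t. x (t, r))"
    and lam: "\<And>r. r \<in> cube {a..b} \<Longrightarrow> root_system f v {a..b} (\<lambda>t. x (t, r)) (\<lambda>t. lam t r) \<and> C1_on {a..b} (\<lambda>t. lam t r)"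
  obtains A B where "0 \<le> B" "\<And>r. r \<in> cube {a..b} \<Longrightarrow> C1_norm {a..b} (\<lambda>t. lam t r) \<le> A"
    "\<And>r. r \<in> cube {a..b} \<Longrightarrow> W21 {a<..<b} (\<lambda>t. lam t r) \<and> W21_norm {a<..<b} (\<lambda>t. lam t r) \<le> B"
proof -
  let ?d = "CARD('d)"
  let ?K = "{a..b} \<times> (cube {a..b} :: (real ^ 'k) set)"
  have K: "compact ?K" "?K \<subseteq> U"
    by (simp add: cube_box compact_Times compact_cbox) (use U(2) in \<open>simp only: closure_interval_cube[OF ab]\<close>)
  obtain \<delta> R where \<delta>: "0 < \<delta>" and R: "0 \<le> R"
    and loc: "\<And>s r. (s, r) \<in> ?K \<Longrightarrow> \<exists>I J P. {s..s + \<delta>} \<subseteq> I \<and> open J \<and> I \<subseteq> J \<and> (\<forall>k\<le>?d. convex_on J (P k)) \<and>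
      (\<forall>j<?d. \<forall>t\<in>I. char_map f v (x (t, r)) ! j = P (?d - Suc j) t - P (?d - j) t) \<and>
      (\<forall>k\<le>?d. \<forall>t\<in>I. \<bar>right_slope J (P k) t\<bar> \<le> R \<and> \<bar>P k t\<bar> \<le> R)"
    by (rule uniform_slopes[OF f U(1) DC K]) (rule that)
  obtain n :: nat where n: "(b - a) / \<delta> \<le> real n" using real_arch_simple by blast
  define C where "C = real (Suc n) * (4 * of_nat ?d * R)"
  define B0 where "B0 = of_nat ?d * (2 * R)"
  define B1 where "B1 = of_nat ?d * (2 * R + C)"
  have C: "0 \<le> C" using R by (simp add: C_def)
  have *: "C1_norm {a..b} (\<lambda>t. lam t r) \<le> B0 + B1 \<and> W21 {a<..<b} (\<lambda>t. lam t r) \<and>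
    W21_norm {a<..<b} (\<lambda>t. lam t r) \<le> (b - a) * B0 + (b - a) * B1 + of_nat ?d * (6 * C)" if r: "r \<in> cube {a..b}" for r
  proof -
    define l where "l t = lam t r" for t
    have sys: "root_system f v {a..b} (\<lambda>t. x (t, r)) l" and C1: "C1_on {a..b} l"
      using lam[OF r] by (simp_all add: l_def[abs_def])
    obtain l' where l': "\<And>t. t \<in> {a..b} \<Longrightarrow> (l has_vector_derivative l' t) (at t within {a..b})" "continuous_on {a..b} l'"
      using C1 unfolding C1_on_def by (elim exE conjE) (rule that, rule bspec)
    have d: "((\<lambda>t. l t $ i) has_real_derivative l' t $ i) (at t within {a..b})" if "t \<in> {a..b}" for t i
      by (rule has_real_derivative_component[OF l'(1)[OF that]])
    have loc': "bounded_increments l' s t (4 * of_nat ?d * R) \<and> (\<forall>u\<in>{s..t}. \<forall>i. \<bar>l u $ i\<bar> \<le> 2 * R) \<and>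
        (\<forall>u\<in>{s<..<t}. \<forall>i. \<bar>l' u $ i\<bar> \<le> 2 * R)"
      if st: "a \<le> s" "s \<le> t" "t \<le> b" "t \<le> s + \<delta>" for s t
    proof -
      have "(s, r) \<in> ?K" using st r by simp
      from loc[OF this] obtain I J P where JP: "{s..s + \<delta>} \<subseteq> I" "open J" "I \<subseteq> J" "\<forall>k\<le>?d. convex_on J (P k)"
        "\<forall>j<?d. \<forall>t\<in>I. char_map f v (x (t, r)) ! j = P (?d - Suc j) t - P (?d - j) t"
        "\<forall>k\<le>?d. \<forall>t\<in>I. \<bar>right_slope J (P k) t\<bar> \<le> R \<and> \<bar>P k t\<bar> \<le> R"
        by (elim exE conjE) (rule that)
      have sub: "{s..t} \<subseteq> I" "{s..t} \<subseteq> {a..b}" using JP(1) st by auto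
      have nth: "\<exists>j<?d. l u $ i = char_map f v (x (u, r)) ! j" if "u \<in> {s..t}" for u i
        by (rule root_system_nth[OF f sys]) (use that sub in blast)
      have di: "((\<lambda>u. l u $ i) has_real_derivative l' u $ i) (at u)" if "u \<in> {s<..<t}" for u i
      proof -
        have "u \<in> {a..b}" "a < u" "u < b" using that st by auto
        then show ?thesis using d[of u i] by (simp add: at_within_Icc_at)
      qed
      note b = root_derivative_bounds[where x = "\<lambda>t. x (t, r)" and lam = l and lam' = l' and v = v,
          OF JP(2,3,4,5,6) st(2) sub(1) nth di continuous_on_subset[OF l'(2) sub(2)]]
      show ?thesis using b by blast
    qed
    have lb: "norm (l t) \<le> B0" if "t \<in> {a..b}" for t
      unfolding B0_def using loc'[of t t] that \<delta> by (intro norm_le_of_components) auto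
    \<comment> \<open>A window of length at most \<open>\<delta>\<close> with \<open>u\<close> in
      its interior, cut off at the ends of \<open>[a, b]\<close>.\<close>
    have l'i: "\<bar>l' u $ i\<bar> \<le> 2 * R" if u: "u \<in> {a<..<b}" for u i
      using loc'[of "max a (u - \<delta> / 2)" "min b (u + \<delta> / 2)"] u \<delta> by auto
    have "b \<le> a + real n * \<delta>" using n \<delta> by (simp add: pos_divide_le_eq)
    then have "bounded_increments l' a b C"
      unfolding C_def using loc' R ab by (intro bounded_increments_chain[OF \<delta>]) auto
    then obtain \<Phi> where \<Phi>: "\<And>u w j. a \<le> u \<Longrightarrow> u \<le> w \<Longrightarrow> w \<le> b \<Longrightarrow> \<bar>l' w $ j - l' u $ j\<bar> \<le> \<Phi> w - \<Phi> u" "\<Phi> b - \<Phi> a \<le> C"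
      unfolding bounded_increments_def by blast
    have l'b: "norm (l' t) \<le> B1" if t: "t \<in> {a..b}" for t
      unfolding B1_def
    proof (rule norm_le_of_components)
      fix i
      \<comment> \<open>The pointwise bound \<open>2 * R\<close> holds at interior points. Comparing
        with the midpoint through the total increment \<open>C\<close> includes the end
        points.\<close>
      let ?m = "(a + b) / 2"
      have mono: "\<Phi> u \<le> \<Phi> w" if "a \<le> u" "u \<le> w" "w \<le> b" for u w
        using \<Phi>(1)[OF that, of i] by linarith
      have m: "\<bar>l' ?m $ i\<bar> \<le> 2 * R" using ab by (intro l'i) auto
      have "\<bar>l' t $ i - l' ?m $ i\<bar> \<le> \<Phi> b - \<Phi> a"
      proof (cases "t \<le> ?m")
        case True
        then show ?thesis using \<Phi>(1)[of t ?m i] mono[of a t] mono[of ?m b] t ab by (simp add: abs_minus_commute)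
      next
        case False
        then show ?thesis using \<Phi>(1)[of ?m t i] mono[of a ?m] mono[of t b] t ab by simp
      qed
      then show "\<bar>l' t $ i\<bar> \<le> 2 * R + C" using m \<Phi>(2) by linarith
    qed
    have null: "negligible ((\<lambda>t. l' t $ j) ` N)" if "negligible N" "N \<subseteq> {a..b}" for N j
    proof (rule root_system_derivative_negligible_image[OF f ab _ _ sys d l'(2) that])
      have "C1_on {a..b} (\<lambda>t. x (t, r))" using x[OF r] by (rule conjunct1)
      then obtain x' where x': "\<forall>t\<in>{a..b}. ((\<lambda>t. x (t, r)) has_vector_derivative x' t) (at t within {a..b})"
        unfolding C1_on_def by (elim exE conjE) (rule that)
      have "continuous_on {a..b} (\<lambda>t. x (t, r))" by (rule continuous_on_vector_derivative[OF bspec[OF x']])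
      then show "continuous_on {a<..<b} (\<lambda>t. x (t, r))" by (rule continuous_on_subset) auto
      show "W21 {a<..<b} (\<lambda>t. x (t, r))" using x[OF r] by blast
    qed
    have W: "W21 {a<..<b} l" by (rule W21_of_dominated_derivative(1)[OF ab d l'(2) \<Phi>(1) null]) auto
    have "W21_norm {a<..<b} l \<le> (b - a) * B0 + (b - a) * B1 + of_nat ?d * (6 * (\<Phi> b - \<Phi> a))"
      by (rule W21_of_dominated_derivative(2)[OF ab d l'(2) \<Phi>(1) null]) (auto intro: lb l'b)
    also have "\<dots> \<le> (b - a) * B0 + (b - a) * B1 + of_nat ?d * (6 * C)"
      using \<Phi>(2) by (intro add_left_mono mult_left_mono) auto
    finally have Wn: "W21_norm {a<..<b} l \<le> (b - a) * B0 + (b - a) * B1 + of_nat ?d * (6 * C)" .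
    have "C1_norm {a..b} l \<le> B0 + B1"
      unfolding C1_norm_def
    proof (rule add_mono)
      show "(SUP t\<in>{a..b}. norm (l t)) \<le> B0" using ab by (intro cSUP_least lb) auto
      show "(SUP t\<in>{a..b}. norm (vector_derivative l (at t within {a..b}))) \<le> B1"
      proof (rule cSUP_least)
        fix t assume t: "t \<in> {a..b}"
        have "vector_derivative l (at t within {a..b}) = l' t"
          by (rule vector_derivative_within_closed_interval[OF ab t l'(1)[OF t]])
        then show "norm (vector_derivative l (at t within {a..b})) \<le> B1" using l'b[OF t] by simp
      qed (use ab in simp)
    qed
    then show ?thesis using W Wn by (simp add: l_def[abs_def])
  qed
  show ?thesis
  proof (rule that[of "(b - a) * B0 + (b - a) * B1 + of_nat ?d * (6 * C)" "B0 + B1"])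
    show "0 \<le> (b - a) * B0 + (b - a) * B1 + of_nat ?d * (6 * C)"
      using ab C R by (simp add: B0_def B1_def)
  qed (use * in blast)+
qed

theorem theorem0p4p6:
  fixes f :: "'n::finite rpoly" and v :: "real ^ 'n"
  assumes "f \<in> Hyp CARD('d::finite) v"
  shows
    "(\<forall>x :: real \<Rightarrow> real ^ 'n. C11 x \<longrightarrow> DC_on UNIV x \<and> W21_loc UNIV x)
     \<and>
     (\<forall>x :: real \<Rightarrow> real ^ 'n. DC_on UNIV x \<and> W21_loc UNIV x \<longrightarrow>
        (\<forall>lam :: real \<Rightarrow> real ^ 'd.
           root_system f v UNIV x lam \<and> lam differentiable_on UNIV \<longrightarrow>
           C1_on UNIV lam \<and> DC_on UNIV lam \<and> W21_loc UNIV lam)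
        \<and>
        (C1_on UNIV x \<longrightarrow>
           (\<exists>lam :: real \<Rightarrow> real ^ 'd.
              root_system f v UNIV x lam \<and> lam differentiable_on UNIV \<and> C1_on UNIV lam)))
     \<and>
     (\<forall>(a::real) b (U :: (real \<times> (real ^ 'k::finite)) set) (x :: real \<times> (real ^ 'k) \<Rightarrow> real ^ 'n)
        (lam :: real \<Rightarrow> real ^ 'k \<Rightarrow> real ^ 'd).
        a < b \<and> open U \<and> closure ({a<..<b} \<times> cube {a<..<b}) \<subseteq> U \<and>
        locally_DC_on U x \<and>
        (\<forall>r\<in>cube {a..b}. C1_on {a..b} (\<lambda>t. x (t, r)) \<and> W21 {a<..<b} (\<lambda>t. x (t, r))) \<and>
        (\<forall>r\<in>cube {a..b}. root_system f v {a..b} (\<lambda>t. x (t, r)) (\<lambda>t. lam t r) \<and>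
                          C1_on {a..b} (\<lambda>t. lam t r)) \<longrightarrow>
        (\<exists>C. \<forall>r\<in>cube {a..b}. C1_norm {a..b} (\<lambda>t. lam t r) \<le> C) \<and>
        (\<exists>m :: real ^ 'k \<Rightarrow> real.
           m absolutely_integrable_on cube {a<..<b} \<and>
           (\<forall>r\<in>cube {a<..<b}. 0 \<le> m r) \<and>
           (AE r in lebesgue. r \<in> cube {a<..<b} \<longrightarrow>
              W21 {a<..<b} (\<lambda>t. lam t r) \<and> W21_norm {a<..<b} (\<lambda>t. lam t r) \<le> m r)))"
proof (intro conjI allI impI)
  fix x :: "real \<Rightarrow> real ^ 'n" assume "C11 x"
  then show "DC_on UNIV x" "W21_loc UNIV x" by (rule C11_imp_DC_W21_loc)+
next
  fix x :: "real \<Rightarrow> real ^ 'n" and lam :: "real \<Rightarrow> real ^ 'd"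
  assume x: "DC_on UNIV x \<and> W21_loc UNIV x" and lam: "root_system f v UNIV x lam \<and> lam differentiable_on UNIV"
  show "C1_on UNIV lam" "DC_on UNIV lam" "W21_loc UNIV lam"
    using differentiable_root_system_regular[OF assms, of x lam] x lam by blast+
next
  fix x :: "real \<Rightarrow> real ^ 'n"
  assume x: "DC_on UNIV x \<and> W21_loc UNIV x" "C1_on UNIV x"
  obtain lam :: "real \<Rightarrow> real ^ 'd" where lam: "root_system f v UNIV x lam" "lam differentiable_on UNIV"
    by (rule exists_differentiable_root_system[OF assms conjunct1[OF x(1)] x(2)]) (rule that)
  have "C1_on UNIV lam" using differentiable_root_system_regular(1)[OF assms _ _ lam] x(1) by blast
  then show "\<exists>lam :: real \<Rightarrow> real ^ 'd. root_system f v UNIV x lam \<and> lam differentiable_on UNIV \<and> C1_on UNIV lam"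
    using lam by blast
next
  fix a b :: real and U :: "(real \<times> (real ^ 'k)) set" and x :: "real \<times> (real ^ 'k) \<Rightarrow> real ^ 'n"
    and lam :: "real \<Rightarrow> real ^ 'k \<Rightarrow> real ^ 'd"
  assume *: "a < b \<and> open U \<and> closure ({a<..<b} \<times> cube {a<..<b}) \<subseteq> U \<and>
        locally_DC_on U x \<and>
        (\<forall>r\<in>cube {a..b}. C1_on {a..b} (\<lambda>t. x (t, r)) \<and> W21 {a<..<b} (\<lambda>t. x (t, r))) \<and>
        (\<forall>r\<in>cube {a..b}. root_system f v {a..b} (\<lambda>t. x (t, r)) (\<lambda>t. lam t r) \<and>
                          C1_on {a..b} (\<lambda>t. lam t r))"
  have h: "a < b" "open U" "closure ({a<..<b} \<times> cube {a<..<b}) \<subseteq> U" "locally_DC_on U x"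
    "\<And>r. r \<in> cube {a..b} \<Longrightarrow> C1_on {a..b} (\<lambda>t. x (t, r)) \<and> W21 {a<..<b} (\<lambda>t. x (t, r))"
    "\<And>r. r \<in> cube {a..b} \<Longrightarrow> root_system f v {a..b} (\<lambda>t. x (t, r)) (\<lambda>t. lam t r) \<and> C1_on {a..b} (\<lambda>t. lam t r)"
    using * by blast+
  obtain A B where B: "0 \<le> B" and A: "\<And>r. r \<in> cube {a..b} \<Longrightarrow> C1_norm {a..b} (\<lambda>t. lam t r) \<le> A"
    and W: "\<And>r. r \<in> cube {a..b} \<Longrightarrow> W21 {a<..<b} (\<lambda>t. lam t r) \<and> W21_norm {a<..<b} (\<lambda>t. lam t r) \<le> B"
    by (rule uniform_root_bounds[OF assms h]) (assumption, assumption, rule that)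
  show "\<exists>C. \<forall>r\<in>cube {a..b}. C1_norm {a..b} (\<lambda>t. lam t r) \<le> C" using A by blast
  have sub: "cube {a<..<b} \<subseteq> (cube {a..b} :: (real ^ 'k) set)" by (auto simp: cube_def less_imp_le)
  show "\<exists>m :: real ^ 'k \<Rightarrow> real.
           m absolutely_integrable_on cube {a<..<b} \<and>
           (\<forall>r\<in>cube {a<..<b}. 0 \<le> m r) \<and>
           (AE r in lebesgue. r \<in> cube {a<..<b} \<longrightarrow>
              W21 {a<..<b} (\<lambda>t. lam t r) \<and> W21_norm {a<..<b} (\<lambda>t. lam t r) \<le> m r)"
  proof (intro exI[of _ "\<lambda>_. B"] conjI ballI AE_I2 impI B)
    show "(\<lambda>_. B) absolutely_integrable_on (cube {a<..<b} :: (real ^ 'k) set)"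
      unfolding cube_box by (rule absolutely_integrable_on_const) simp
  qed (use W sub in blast)+
qed

end
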